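(* Let $s>-\frac34$ and $u_0\in H^s(\mathbb R^2)$. Then there exist $b>\frac12$ and $\delta=\delta(\|u_0\|_{H^s})>0$ such that the initial value problem \[ \partial_t u+(\partial_x^3-3\partial_x\partial_y^2)u=N(u),\qquad u(x,y,0)=u_0(x,y), \] has a unique solution $u\in X^{\delta}_{s,b}$. Moreover, for every $R>0$ the solution operator \[ S_R: \{u_0\in H^s(\mathbb R^2):\|u_0\|_{H^s}<R\}\to X^{\delta(R)}_{s,b},\qquad u_0\mapsto u, \] is Lipschitz continuous.
   Context: Functions are complex valued. For $f$ on $\mathbb R^2$ (or $\mathbb R^3$) $\widehat f$ denotes the Fourier transform in the space variables $(x,y)\mapsto(\xi,\eta)$ (resp. in all variables $(x,y,t)\mapsto(\xi,\eta,\tau)$). Let $R_1$ and $R_2$ be the Fourier multipliers in the space variables with symbols $\frac{\xi^2-\eta^2}{\xi^2+\eta^2}$ and $\frac{2\xi\eta}{\xi^2+\eta^2}$ respectively (written $\frac{\partial_x^2-\partial_y^2}{\Delta}$ and $\frac{2\partial_x\partial_y}{\Delta}$). The nonlinearity is $N(u)=\partial_x(u\,R_1u)-\partial_y(u\,R_2u)$; this equation is (after rescaling time and ignoring constant factors) the zero energy Novikov–Veselov equation $\partial_tu+(\partial^3+\overline\partial^3)u+3(\partial(u\overline\partial^{-1}\partial u)+\overline\partial(u\partial^{-1}\overline\partial u))=0$ written in real coordinates. Let $\varphi(\xi,\eta)=\xi^3-3\xi\eta^2$ and $\langle x\rangle=(1+|x|^2)^{1/2}$. The Bourgain space $X_{s,b}$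 consists of $f\in\mathcal S'(\mathbb R^3)$ with \[ \|f\|_{X_{s,b}}^2=\int_{\mathbb R^3}\langle\tau-\varphi(\xi,\eta)\rangle^{2b}\langle(\xi,\eta)\rangle^{2s}|\widehat f(\xi,\eta,\tau)|^2\,d\tau\,d\xi\,d\eta<\infty, \] and the time-restricted space $X^\delta_{s,b}$ has norm $\|f\|_{X^\delta_{s,b}}=\inf\{\|\tilde f\|_{X_{s,b}}:\tilde f\in X_{s,b},\ \tilde f|_{\mathbb R^2\times(-\delta,\delta)}=f\}$. For $b>\frac12$, $X^\delta_{s,b}\hookrightarrow C([-\delta,\delta],H^s(\mathbb R^2))$. Solutions are understood in the sense of the Fourier restriction norm method, i.e. as solutions on $[-\delta,\delta]$ of the associated Duhamel integral equation. *)

theory Defs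
  imports "HOL-Analysis.Analysis"
begin

definition jbr :: "'a::real_normed_vector \<Rightarrow> real" where
  "jbr x = sqrt (1 + (norm x)^2)"

definition phi :: "real \<times> real \<Rightarrow> real" where
  "phi z = (fst z)^3 - 3 * fst z * (snd z)^2"

(* Fourier convention: hat f(zeta) = int exp(-i x.zeta) f(x) dx.
   Elements of H^s(R^2) are represented by their (spatial) Fourier transforms. *)
definition Hs_norm2 :: "real \<Rightarrow> (real \<times> real \<Rightarrow> complex) \<Rightarrow> ennreal" where
  "Hs_norm2 s f = (\<integral>\<^sup>+ z. ennreal (jbr z powr (2 * s) * (cmod (f z))^2) \<partial>lborel)"

definition Hs :: "real \<Rightarrow> (real \<times> real \<Rightarrow> complex) set" where
  "Hs s = {f. f \<in> borel_measurable lborel \<and> Hs_norm2 s f < \<infinity>}"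

definition Hs_norm :: "real \<Rightarrow> (real \<times> real \<Rightarrow> complex) \<Rightarrow> real" where
  "Hs_norm s f = sqrt (enn2real (Hs_norm2 s f))"

(* Elements of X_{s,b} are represented by their space-time Fourier transforms
   U(xi,eta,tau). *)
definition Xsb_weight :: "real \<Rightarrow> real \<Rightarrow> real \<times> real \<times> real \<Rightarrow> real" where
  "Xsb_weight s b z = jbr (snd (snd z) - phi (fst z, fst (snd z))) powr (2 * b)
                      * jbr (fst z, fst (snd z)) powr (2 * s)"

definition Xsb_norm2 :: "real \<Rightarrow> real \<Rightarrow> (real \<times> real \<times> real \<Rightarrow> complex) \<Rightarrow> ennreal" where
  "Xsb_norm2 s b U = (\<integral>\<^sup>+ z. ennreal (Xsb_weight s b z * (cmod (U z))^2) \<partial>lborel)"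

definition Xsb :: "real \<Rightarrow> real \<Rightarrow> (real \<times> real \<times> real \<Rightarrow> complex) set" where
  "Xsb s b = {U. U \<in> borel_measurable lborel \<and> Xsb_norm2 s b U < \<infinity>}"

definition Xsb_norm :: "real \<Rightarrow> real \<Rightarrow> (real \<times> real \<times> real \<Rightarrow> complex) \<Rightarrow> real" where
  "Xsb_norm s b U = sqrt (enn2real (Xsb_norm2 s b U))"

fun Ck :: "nat \<Rightarrow> ('a::real_normed_vector \<Rightarrow> 'b::real_normed_vector) set" where
  "Ck 0 = {f. continuous_on UNIV f}"
| "Ck (Suc n) = {f. (\<forall>x. f differentiable (at x)) \<and>
                    (\<forall>v. (\<lambda>x. frechet_derivative f (at x) v) \<in> Ck n)}"

definition smooth_fun :: "('a::real_normed_vector \<Rightarrow> 'b::real_normed_vector) \<Rightarrow> bool" where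
  "smooth_fun f \<longleftrightarrow> (\<forall>n. f \<in> Ck n)"

definition test_fun_strip :: "real \<Rightarrow> (real \<times> real \<times> real \<Rightarrow> complex) \<Rightarrow> bool" where
  "test_fun_strip \<delta> \<psi> \<longleftrightarrow> smooth_fun \<psi> \<and>
     (\<exists>K. compact K \<and> K \<subseteq> {z. - \<delta> < snd (snd z) \<and> snd (snd z) < \<delta>} \<and>
          (\<forall>z. z \<notin> K \<longrightarrow> \<psi> z = 0))"

definition FT3 :: "(real \<times> real \<times> real \<Rightarrow> complex) \<Rightarrow> real \<times> real \<times> real \<Rightarrow> complex" where
  "FT3 \<psi> \<zeta> = (\<integral>x. exp (- \<i> * complex_of_real (x \<bullet> \<zeta>)) * \<psi> x \<partial>lborel)"

(* The distributions with Fourier transforms U and V coincide on R^2 x (-delta,delta):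
   <f,psi> = (2 pi)^-3 int hat f(zeta) hat psi(-zeta) d zeta *)
definition agree_on_strip :: "real \<Rightarrow> (real \<times> real \<times> real \<Rightarrow> complex) \<Rightarrow>
                              (real \<times> real \<times> real \<Rightarrow> complex) \<Rightarrow> bool" where
  "agree_on_strip \<delta> U V \<longleftrightarrow> (\<forall>\<psi>. test_fun_strip \<delta> \<psi> \<longrightarrow>
      (\<integral>\<zeta>. (U \<zeta> - V \<zeta>) * FT3 \<psi> (- \<zeta>) \<partial>lborel) = 0)"

definition Xdelta_norm :: "real \<Rightarrow> real \<Rightarrow> real \<Rightarrow> (real \<times> real \<times> real \<Rightarrow> complex) \<Rightarrow> real" where
  "Xdelta_norm s b \<delta> U = Inf {Xsb_norm s b W | W. W \<in> Xsb s b \<and> agree_on_strip \<delta> W U}"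

(* spatial Fourier transform of u(t), recovered from the space-time transform *)
definition time_rep :: "(real \<times> real \<times> real \<Rightarrow> complex) \<Rightarrow> real \<times> real \<Rightarrow> real \<Rightarrow> complex" where
  "time_rep U z t = (1 / (2 * pi)) * (\<integral>\<tau>. exp (\<i> * complex_of_real (t * \<tau>)) * U (fst z, snd z, \<tau>) \<partial>lborel)"

definition m1 :: "real \<times> real \<Rightarrow> real" where
  "m1 z = ((fst z)^2 - (snd z)^2) / ((fst z)^2 + (snd z)^2)"
definition m2 :: "real \<times> real \<Rightarrow> real" where
  "m2 z = (2 * fst z * snd z) / ((fst z)^2 + (snd z)^2)"

(* symmetrised symbol of N(u) = d_x(u R_1 u) - d_y(u R_2 u) *)
definition N_symb :: "real \<times> real \<times> real \<Rightarrow> real \<times> real \<times> real \<Rightarrow> complex" where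
  "N_symb \<zeta> \<zeta>1 = (let \<zeta>2 = \<zeta> - \<zeta>1;
       p1 = (fst \<zeta>1, fst (snd \<zeta>1)); p2 = (fst \<zeta>2, fst (snd \<zeta>2)) in
     (\<i> / 2) * complex_of_real (fst \<zeta> * (m1 p1 + m1 p2) - fst (snd \<zeta>) * (m2 p1 + m2 p2)))"

(* space-time Fourier transform of N(u):  (fg)^ = (2 pi)^-3 hat f * hat g *)
definition NL :: "(real \<times> real \<times> real \<Rightarrow> complex) \<Rightarrow> real \<times> real \<times> real \<Rightarrow> complex" where
  "NL U \<zeta> = (1 / (2 * pi)^3) * (\<integral>\<zeta>1. N_symb \<zeta> \<zeta>1 * U (\<zeta> - \<zeta>1) * U \<zeta>1 \<partial>lborel)"

(* int_0^t exp(i(t-t')p) exp(i t' tau) dt' *)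
definition duh_kernel :: "real \<Rightarrow> real \<Rightarrow> real \<Rightarrow> complex" where
  "duh_kernel t \<tau> p = (if \<tau> = p then complex_of_real t * exp (\<i> * complex_of_real (t * p))
     else (exp (\<i> * complex_of_real (t * \<tau>)) - exp (\<i> * complex_of_real (t * p)))
          / (\<i> * complex_of_real (\<tau> - p)))"

(* spatial Fourier transform at time t of  int_0^t W(t-t') N(u)(t') dt',  W(t) = exp(-t(d_x^3 - 3 d_x d_y^2)) *)
definition duhamel :: "(real \<times> real \<times> real \<Rightarrow> complex) \<Rightarrow> real \<times> real \<Rightarrow> real \<Rightarrow> complex" where
  "duhamel U z t = (1 / (2 * pi)) *
     (\<integral>\<tau>. NL U (fst z, snd z, \<tau>) * duh_kernel t \<tau> (phi z) \<partial>lborel)"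

(* U (an element of X_{s,b}, representing u in X^delta_{s,b}) solves the Duhamel equation
   u(t) = W(t) u0 + int_0^t W(t-t') N(u)(t') dt'  on [-delta,delta] *)
definition solves_NV :: "real \<Rightarrow> real \<Rightarrow> real \<Rightarrow> (real \<times> real \<Rightarrow> complex) \<Rightarrow>
                          (real \<times> real \<times> real \<Rightarrow> complex) \<Rightarrow> bool" where
  "solves_NV s b \<delta> u0 U \<longleftrightarrow> U \<in> Xsb s b \<and>
     (\<forall>t \<in> {-\<delta>..\<delta>}. AE z in lborel.
        time_rep U z t = exp (\<i> * complex_of_real (t * phi z)) * u0 z + duhamel U z t)"

end

theory Submission
  imports Defs
begin

text \<open>Write \<open>z = \<xi> + \<i> \<eta>\<close>, so that \<open>phi = Re z\<^sup>3\<close> and the resonance function of \<open>z = z1 + z2\<close> is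
  \<open>H = 3 Re (z z1 z2)\<close>. The symmetrised symbol of the nonlinearity has modulus
  \<open>\<bar>Re (z1 cnj z2)\<bar> \<bar>H\<bar> / (3 \<bar>z1\<bar>\<^sup>2 \<bar>z2\<bar>\<^sup>2)\<close>, hence it is at most \<open>\<bar>H\<bar> / (3 \<bar>z1\<bar> \<bar>z2\<bar>)\<close> as well as at most \<open>\<bar>z\<bar>\<close>.
  Since \<open>H\<close> is bounded by three times the largest modulation, interpolating between the two bounds trades
  the loss of derivatives for the weight in the largest modulation. What remains after Cauchy-Schwarz is the measure of the set where
  \<open>phi y + phi (z - y)\<close> is close to a given number, and on coordinate lines this phase is a quadratic polynomial.
  The resulting bilinear estimate holds for \<open>s > -3/4\<close> with a small power of the existence time to spare,
  so the Duhamel map is a contraction.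

  For uniqueness the estimate is iterated without a time restriction norm: the difference \<open>D\<close> of two
  solutions coincides on a short interval with \<open>W n\<close>, where \<open>W 0 = D\<close> and \<open>W (n + 1)\<close> is the cut-off Duhamel term of \<open>W n\<close>,
  because the Duhamel integral up to time \<open>t\<close> only sees times between \<open>0\<close> and \<open>t\<close>. The norms of \<open>W n\<close> decay geometrically,
  so \<open>D\<close> vanishes there, and translation in time (multiplication by \<open>exp (\<i> T \<tau>)\<close>) covers the whole interval.\<close>

section \<open>Trilinear forms on square-integrable functions\<close>

text \<open>The threshold can be read off the exponents. Interpolation uses the resonance to the
  power \<open>th\<close>, close to 1/2, so an input of frequency N costs N^\<open>\<rho>\<close>
  from its Sobolev weight and gains N^(-\<open>th\<close>): the net loss is N^\<open>aa\<close> with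
  \<open>aa\<close> close to \<open>\<rho>\<close> - 1/2. In the squared kernel two high inputs cost
  N^(4 \<open>aa\<close>), while the gradient of the phase, of modulus 3 |z| |2y - z|, returns one
  power of N. Hence 4 (\<open>\<rho>\<close> - 1/2) < 1, that is \<open>\<rho>\<close> < 3/4. A
  derivative of the phase controls one direction only, and the other direction contributes the side
  length of the region. If the frequency held fixed is the small one, the region must therefore be
  cut down to its size. If it is comparable with the largest, the degenerate point y = z/2 of the
  gradient has to be excised, at the price of a logarithm. The obstacle in the uniqueness proof is
  that a solution is given by an arbitrary extension: only its values up to time
  \<open>\<delta>\<close> satisfy an equation, and its global norm carries no smallness. It does not
  solve the cut-off equation, so the comparison has to be made at single times.\<close>

lemma nn_integral_lborel_translate:
  fixes f :: "'a::euclidean_space \<Rightarrow> ennreal"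
  assumes [measurable]: "f \<in> borel_measurable borel"
  shows "(\<integral>\<^sup>+x. f (c + x) \<partial>lborel) = (\<integral>\<^sup>+x. f x \<partial>lborel)"
  by (subst lborel_distr_plus[symmetric, of c], subst nn_integral_distr) auto

lemma nn_integral_lborel_reflect:
  fixes f :: "'a::euclidean_space \<Rightarrow> ennreal"
  assumes [measurable]: "f \<in> borel_measurable borel"
  shows "(\<integral>\<^sup>+x. f (c - x) \<partial>lborel) = (\<integral>\<^sup>+x. f x \<partial>lborel)"
proof -
  have "(lborel::'a measure) = distr lborel borel (\<lambda>x. c + (-1) *\<^sub>R x)"
    using lborel_affine[of "-1" c] by (simp add: density_1)
  then have "(\<integral>\<^sup>+x. f x \<partial>lborel) = (\<integral>\<^sup>+x. f x \<partial>distr lborel borel (\<lambda>x. c + (-1) *\<^sub>R x))"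
    by simp
  also have "\<dots> = (\<integral>\<^sup>+x. f (c - x) \<partial>lborel)"
    by (subst nn_integral_distr) auto
  finally show ?thesis by simp
qed

lemma nn_integral_lborel_swap:
  fixes f :: "'a::euclidean_space \<Rightarrow> 'b::euclidean_space \<Rightarrow> ennreal"
  assumes [measurable]: "case_prod f \<in> borel_measurable (borel \<Otimes>\<^sub>M borel)"
  shows "(\<integral>\<^sup>+x. \<integral>\<^sup>+y. f x y \<partial>lborel \<partial>lborel) = (\<integral>\<^sup>+y. \<integral>\<^sup>+x. f x y \<partial>lborel \<partial>lborel)"
proof -
  show ?thesis
    by (rule lborel_pair.Fubini'[symmetric]) simp
qed

lemma nn_integral_lborel_pair:
  fixes f :: "'a::euclidean_space \<Rightarrow> 'b::euclidean_space \<Rightarrow> ennreal"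
  assumes [measurable]: "case_prod f \<in> borel_measurable (borel \<Otimes>\<^sub>M borel)"
  shows "(\<integral>\<^sup>+z. case_prod f z \<partial>lborel) = (\<integral>\<^sup>+x. \<integral>\<^sup>+y. f x y \<partial>lborel \<partial>lborel)"
proof -
  have "(\<integral>\<^sup>+x. \<integral>\<^sup>+y. case_prod f (x, y) \<partial>lborel \<partial>lborel) = (\<integral>\<^sup>+z. case_prod f z \<partial>(lborel \<Otimes>\<^sub>M lborel))"
    by (rule lborel.nn_integral_fst) simp
  then show ?thesis by (simp add: lborel_prod)
qed

text \<open>Replaces square roots in the Cauchy-Schwarz arguments: the free weight \<open>c\<close>
  is chosen afterwards to balance the two terms. With \<open>inverse 0 = top\<close> and
  \<open>inverse top = 0\<close>, an extreme weight makes the right side infinite unless the left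
  side is zero.\<close>

lemma ennreal_amgm:
  fixes a b c :: ennreal
  shows "2 * (a * b) \<le> inverse c * a\<^sup>2 + c * b\<^sup>2"
proof -
  have real: "2 * (x * y) \<le> inverse z * x\<^sup>2 + z * y\<^sup>2" if "z > 0" for x y z :: real
  proof -
    have "0 \<le> z * (x / z - y)\<^sup>2" using that by simp
    also have "z * (x / z - y)\<^sup>2 = inverse z * x\<^sup>2 + z * y\<^sup>2 - 2 * (x * y)"
      using that by (simp add: power2_eq_square field_simps)
    finally show ?thesis by simp
  qed
  consider "a = 0 \<or> b = 0" | "a \<noteq> 0" "b \<noteq> 0" "c = 0" | "a \<noteq> 0" "b \<noteq> 0" "c = top" 
    | "a \<noteq> 0" "b \<noteq> 0" "c \<noteq> 0" "c \<noteq> top" "a = top \<or> b = top"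
    | "a \<noteq> top" "b \<noteq> top" "c \<noteq> 0" "c \<noteq> top" by blast
  then show ?thesis
  proof cases
    case 1 then show ?thesis by auto
  next
    case 2 then show ?thesis by (simp add: ennreal_top_mult)
  next
    case 3 then show ?thesis by (simp add: ennreal_top_mult)
  next
    case 4
    then have "inverse c \<noteq> 0" by (simp add: ennreal_inverse_eq_0_iff top.not_eq_extremum)
    with 4 have "inverse c * a\<^sup>2 + c * b\<^sup>2 = top"
      by (auto simp: power2_eq_square ennreal_mult_eq_top_iff ennreal_top_mult ennreal_mult_top)
    then show ?thesis by (metis top_greatest)
  next
    case 5
    obtain x y z where "a = ennreal x" "b = ennreal y" "c = ennreal z" "x \<ge> 0" "y \<ge> 0" "z > 0"
      using 5 by (metis ennreal_cases ennreal_0 order_le_less)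
    then show ?thesis using real[of z x y]
      by (simp add: inverse_ennreal ennreal_power ennreal_mult[symmetric] ennreal_plus[symmetric]
           ennreal_numeral[symmetric] del: ennreal_plus ennreal_numeral)
  qed
qed

text \<open>Dual form of a bilinear estimate: \<open>f\<close> tests the output at frequency
  \<open>x\<close>, while \<open>g\<close> and \<open>h\<close> are the inputs at \<open>y\<close>
  and \<open>x - y\<close>. The kernel \<open>k\<close> absorbs the symbol and all weights, so the
  three functions range over the plain unit ball of L^2.\<close>

definition tri :: "('a::euclidean_space \<Rightarrow> 'a \<Rightarrow> ennreal) \<Rightarrow> ('a \<Rightarrow> ennreal) \<Rightarrow> ('a \<Rightarrow> ennreal) \<Rightarrow> ('a \<Rightarrow> ennreal) \<Rightarrow> ennreal"
  where "tri k f g h = (\<integral>\<^sup>+x. \<integral>\<^sup>+y. k x y * f x * g y * h (x - y) \<partial>lborel \<partial>lborel)"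

definition sub_unit :: "('a::euclidean_space \<Rightarrow> ennreal) \<Rightarrow> bool"
  where "sub_unit f \<longleftrightarrow> f \<in> borel_measurable borel \<and> (\<integral>\<^sup>+x. (f x)\<^sup>2 \<partial>lborel) \<le> 1"

definition tri_bdd :: "('a::euclidean_space \<Rightarrow> 'a \<Rightarrow> ennreal) \<Rightarrow> ennreal \<Rightarrow> bool"
  where "tri_bdd k C \<longleftrightarrow> (\<forall>f g h. sub_unit f \<longrightarrow> sub_unit g \<longrightarrow> sub_unit h \<longrightarrow> tri k f g h \<le> C)"

abbreviation kmeas :: "('a::euclidean_space \<Rightarrow> 'a \<Rightarrow> ennreal) \<Rightarrow> bool"
  where "kmeas k \<equiv> case_prod k \<in> borel_measurable (borel \<Otimes>\<^sub>M borel)"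

lemma kmeas_comp:
  fixes k :: "'a::euclidean_space \<Rightarrow> 'a \<Rightarrow> ennreal"
  assumes "kmeas k" "u \<in> borel_measurable M" "v \<in> borel_measurable M"
  shows "(\<lambda>x. k (u x) (v x)) \<in> borel_measurable M"
proof -
  have "case_prod k \<in> borel_measurable (borel \<Otimes>\<^sub>M borel)" using assms(1) .
  from measurable_compose[OF measurable_Pair[OF assms(2,3)] this] show ?thesis by simp
qed

lemma tri_bdd_mono:
  assumes "tri_bdd k C" "\<And>x y. k' x y \<le> k x y"
  shows "tri_bdd k' C"
  unfolding tri_bdd_def
proof (intro allI impI)
  fix f g h :: "'a \<Rightarrow> ennreal" assume "sub_unit f" "sub_unit g" "sub_unit h"
  then have "tri k f g h \<le> C" using assms(1) by (auto simp: tri_bdd_def)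
  moreover have "tri k' f g h \<le> tri k f g h"
    unfolding tri_def by (intro nn_integral_mono mult_right_mono assms) auto
  ultimately show "tri k' f g h \<le> C" by simp
qed

lemma tri_bdd_add:
  assumes "kmeas k" "kmeas l" and "tri_bdd k C" "tri_bdd l D"
  shows "tri_bdd (\<lambda>x y. k x y + l x y) (C + D)"
  unfolding tri_bdd_def
proof (intro allI impI)
  note [measurable] = kmeas_comp[OF assms(1)] kmeas_comp[OF assms(2)]
  fix f g h :: "'a \<Rightarrow> ennreal" assume *: "sub_unit f" "sub_unit g" "sub_unit h"
  then have [measurable]: "f \<in> borel_measurable borel" "g \<in> borel_measurable borel" "h \<in> borel_measurable borel"
    by (auto simp: sub_unit_def)
  have "tri (\<lambda>x y. k x y + l x y) f g h = tri k f g h + tri l f g h"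
    unfolding tri_def distrib_right by (subst nn_integral_add[symmetric]) (auto simp: nn_integral_add)
  also have "\<dots> \<le> C + D" using assms * by (intro add_mono) (auto simp: tri_bdd_def)
  finally show "tri (\<lambda>x y. k x y + l x y) f g h \<le> C + D" .
qed

lemma tri_bdd_suminf:
  assumes "\<And>i::nat. kmeas (k i)" and "\<And>i. tri_bdd (k i) (C i)"
  shows "tri_bdd (\<lambda>x y. \<Sum>i. k i x y) (\<Sum>i. C i)"
  unfolding tri_bdd_def
proof (intro allI impI)
  note [measurable] = kmeas_comp[OF assms(1)]
  fix f g h :: "'a \<Rightarrow> ennreal" assume *: "sub_unit f" "sub_unit g" "sub_unit h"
  then have [measurable]: "f \<in> borel_measurable borel" "g \<in> borel_measurable borel" "h \<in> borel_measurable borel"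
    by (auto simp: sub_unit_def)
  have "tri (\<lambda>x y. \<Sum>i. k i x y) f g h = (\<integral>\<^sup>+x. \<integral>\<^sup>+y. (\<Sum>i. k i x y * (f x * g y * h (x - y))) \<partial>lborel \<partial>lborel)"
    unfolding tri_def ennreal_suminf_multc by (simp add: mult.assoc)
  also have "\<dots> = (\<integral>\<^sup>+x. (\<Sum>i. \<integral>\<^sup>+y. k i x y * (f x * g y * h (x - y)) \<partial>lborel) \<partial>lborel)"
    by (intro nn_integral_cong nn_integral_suminf) measurable
  also have "\<dots> = (\<Sum>i. \<integral>\<^sup>+x. \<integral>\<^sup>+y. k i x y * (f x * g y * h (x - y)) \<partial>lborel \<partial>lborel)"
    by (intro nn_integral_suminf) measurable
  also have "\<dots> = (\<Sum>i. tri (k i) f g h)"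
    unfolding tri_def by (simp add: mult.assoc)
  also have "\<dots> \<le> (\<Sum>i. C i)" using assms * by (intro suminf_le) (auto simp: tri_bdd_def)
  finally show "tri (\<lambda>x y. \<Sum>i. k i x y) f g h \<le> (\<Sum>i. C i)" .
qed

lemma sub_unit_minus: "sub_unit h \<Longrightarrow> sub_unit (\<lambda>x. h (- x))"
  using nn_integral_lborel_reflect[of "\<lambda>x. (h x)\<^sup>2" 0] by (auto simp: sub_unit_def)

text \<open>Exchanges the output with the first input; the third function is only reflected, which
  preserves its norm. This moves the variable with the dominant modulation into the outer position,
  over which \<open>tri_Schur\<close> takes a supremum.\<close>

lemma tri_bdd_swap:
  assumes "kmeas k" and "tri_bdd (\<lambda>x y. k y x) C"
  shows "tri_bdd k C"
  unfolding tri_bdd_def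
proof (intro allI impI)
  note [measurable] = kmeas_comp[OF assms(1)]
  fix f g h :: "'a \<Rightarrow> ennreal" assume *: "sub_unit f" "sub_unit g" "sub_unit h"
  then have [measurable]: "f \<in> borel_measurable borel" "g \<in> borel_measurable borel" "h \<in> borel_measurable borel"
    by (auto simp: sub_unit_def)
  have "tri k f g h = (\<integral>\<^sup>+y. \<integral>\<^sup>+x. k x y * f x * g y * h (x - y) \<partial>lborel \<partial>lborel)"
    unfolding tri_def by (rule nn_integral_lborel_swap) measurable
  also have "\<dots> = tri (\<lambda>x y. k y x) g f (\<lambda>x. h (- x))"
    unfolding tri_def by (simp add: mult_ac)
  also have "\<dots> \<le> C" using assms(2) * sub_unit_minus[OF *(3)] by (auto simp: tri_bdd_def)
  finally show "tri k f g h \<le> C" .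
qed

text \<open>The substitution of \<open>x - y\<close> for \<open>y\<close> exchanges the two inputs,
  so only one of two symmetric cases has to be estimated.\<close>

lemma tri_bdd_refl:
  assumes "kmeas k" and "tri_bdd (\<lambda>x y. k x (x - y)) C"
  shows "tri_bdd k C"
  unfolding tri_bdd_def
proof (intro allI impI)
  note [measurable] = kmeas_comp[OF assms(1)]
  fix f g h :: "'a \<Rightarrow> ennreal" assume *: "sub_unit f" "sub_unit g" "sub_unit h"
  then have [measurable]: "f \<in> borel_measurable borel" "g \<in> borel_measurable borel" "h \<in> borel_measurable borel"
    by (auto simp: sub_unit_def)
  have "tri k f g h = tri (\<lambda>x y. k x (x - y)) f h g"
    unfolding tri_def
  proof (rule nn_integral_cong)
    fix x :: 'a
    have "(\<integral>\<^sup>+ y. k x y * f x * g y * h (x - y) \<partial>lborel) = (\<integral>\<^sup>+ y. k x (x - y) * f x * g (x - y) * h (x - (x - y)) \<partial>lborel)"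
      by (rule nn_integral_lborel_reflect[symmetric]) measurable
    then show "(\<integral>\<^sup>+ y. k x y * f x * g y * h (x - y) \<partial>lborel) = (\<integral>\<^sup>+ y. k x (x - y) * f x * h y * g (x - y) \<partial>lborel)"
      by (simp add: mult_ac)
  qed
  also have "\<dots> \<le> C" using assms(2) * by (auto simp: tri_bdd_def)
  finally show "tri k f g h \<le> C" .
qed

text \<open>Cauchy-Schwarz applied to \<open>g y * h (x - y)\<close> and \<open>k x y * f x\<close>.
  The square integral of the first factor is computed exactly by Tonelli and translation. The
  support of \<open>g\<close> is kept in the hypothesis \<open>K\<close> because the localisation to
  boxes cuts \<open>g\<close>.\<close>

lemma tri_Schur:
  fixes f g h :: "'a::euclidean_space \<Rightarrow> ennreal"
  assumes "kmeas k" and [measurable]: "f \<in> borel_measurable borel" "g \<in> borel_measurable borel" "h \<in> borel_measurable borel"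
    and K: "\<And>x. (\<integral>\<^sup>+y. (k x y)\<^sup>2 * indicator {y. g y \<noteq> 0} y \<partial>lborel) \<le> K"
    and F: "(\<integral>\<^sup>+x. (f x)\<^sup>2 \<partial>lborel) \<le> 1"
  shows "2 * tri k f g h \<le> inverse c * ((\<integral>\<^sup>+x. (g x)\<^sup>2 \<partial>lborel) * (\<integral>\<^sup>+x. (h x)\<^sup>2 \<partial>lborel)) + c * K"
proof -
  note [measurable] = kmeas_comp[OF assms(1)]
  let ?I = "\<lambda>y. indicator {y. g y \<noteq> 0} y :: ennreal"
  have "2 * tri k f g h = (\<integral>\<^sup>+x. \<integral>\<^sup>+y. 2 * ((g y * h (x - y)) * (k x y * f x * ?I y)) \<partial>lborel \<partial>lborel)"
    unfolding tri_def
    by (subst nn_integral_cmult[symmetric], measurable, intro nn_integral_cong, subst nn_integral_cmult[symmetric], measurable)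
       (auto intro!: nn_integral_cong simp: mult_ac split: split_indicator)
  also have "\<dots> \<le> (\<integral>\<^sup>+x. \<integral>\<^sup>+y. inverse c * (g y * h (x - y))\<^sup>2 + c * (k x y * f x * ?I y)\<^sup>2 \<partial>lborel \<partial>lborel)"
    by (intro nn_integral_mono ennreal_amgm)
  also have "\<dots> = inverse c * (\<integral>\<^sup>+x. \<integral>\<^sup>+y. (g y)\<^sup>2 * (h (x - y))\<^sup>2 \<partial>lborel \<partial>lborel)
                  + c * (\<integral>\<^sup>+x. (f x)\<^sup>2 * (\<integral>\<^sup>+y. (k x y)\<^sup>2 * ?I y \<partial>lborel) \<partial>lborel)"
  proof -
    have I: "(\<integral>\<^sup>+y. inverse c * (g y * h (x - y))\<^sup>2 + c * (k x y * f x * ?I y)\<^sup>2 \<partial>lborel)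
        = inverse c * (\<integral>\<^sup>+y. (g y)\<^sup>2 * (h (x - y))\<^sup>2 \<partial>lborel) + c * ((f x)\<^sup>2 * (\<integral>\<^sup>+y. (k x y)\<^sup>2 * ?I y \<partial>lborel))" for x
    proof -
      have "c * ((f x)\<^sup>2 * (\<integral>\<^sup>+y. (k x y)\<^sup>2 * ?I y \<partial>lborel)) = (\<integral>\<^sup>+y. c * (k x y * f x * ?I y)\<^sup>2 \<partial>lborel)"
        by (simp add: nn_integral_cmult[symmetric], intro nn_integral_cong)
           (simp add: power2_eq_square mult_ac split: split_indicator)
      moreover have "inverse c * (\<integral>\<^sup>+y. (g y)\<^sup>2 * (h (x - y))\<^sup>2 \<partial>lborel) = (\<integral>\<^sup>+y. inverse c * (g y * h (x - y))\<^sup>2 \<partial>lborel)"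
        by (simp add: nn_integral_cmult[symmetric] power_mult_distrib)
      ultimately show ?thesis by (simp add: nn_integral_add)
    qed
    show ?thesis unfolding I by (simp add: nn_integral_add nn_integral_cmult)
  qed
  also have "(\<integral>\<^sup>+x. \<integral>\<^sup>+y. (g y)\<^sup>2 * (h (x - y))\<^sup>2 \<partial>lborel \<partial>lborel) = (\<integral>\<^sup>+y. \<integral>\<^sup>+x. (g y)\<^sup>2 * (h (x - y))\<^sup>2 \<partial>lborel \<partial>lborel)"
    by (rule nn_integral_lborel_swap) measurable
  also have "\<dots> = (\<integral>\<^sup>+y. (g y)\<^sup>2 * (\<integral>\<^sup>+x. (h x)\<^sup>2 \<partial>lborel) \<partial>lborel)"
  proof (intro nn_integral_cong)
    fix y
    have "(\<integral>\<^sup>+x. (h (- y + x))\<^sup>2 \<partial>lborel) = (\<integral>\<^sup>+x. (h x)\<^sup>2 \<partial>lborel)"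
      by (rule nn_integral_lborel_translate) measurable
    then show "(\<integral>\<^sup>+x. (g y)\<^sup>2 * (h (x - y))\<^sup>2 \<partial>lborel) = (g y)\<^sup>2 * (\<integral>\<^sup>+x. (h x)\<^sup>2 \<partial>lborel)"
      by (simp add: nn_integral_cmult)
  qed
  also have "\<dots> = (\<integral>\<^sup>+x. (g x)\<^sup>2 \<partial>lborel) * (\<integral>\<^sup>+x. (h x)\<^sup>2 \<partial>lborel)"
    by (simp add: nn_integral_multc)
  also have "(\<integral>\<^sup>+x. (f x)\<^sup>2 * (\<integral>\<^sup>+y. (k x y)\<^sup>2 * ?I y \<partial>lborel) \<partial>lborel) \<le> (\<integral>\<^sup>+x. (f x)\<^sup>2 * K \<partial>lborel)"
    by (intro nn_integral_mono mult_left_mono K) auto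
  also have "\<dots> = (\<integral>\<^sup>+x. (f x)\<^sup>2 \<partial>lborel) * K" by (simp add: nn_integral_multc)
  also have "\<dots> \<le> 1 * K" by (intro mult_right_mono F) auto
  finally show ?thesis by (simp add: mult_left_mono add_left_mono)
qed

lemma tri_bdd_sup:
  assumes "kmeas k" and C: "0 < C"
    and K: "\<And>x. (\<integral>\<^sup>+y. (k x y)\<^sup>2 \<partial>lborel) \<le> ennreal (C\<^sup>2)"
  shows "tri_bdd k (ennreal C)"
  unfolding tri_bdd_def
proof (intro allI impI)
  note [measurable] = kmeas_comp[OF assms(1)]
  fix f g h :: "'a \<Rightarrow> ennreal" assume *: "sub_unit f" "sub_unit g" "sub_unit h"
  then have [measurable]: "f \<in> borel_measurable borel" "g \<in> borel_measurable borel" "h \<in> borel_measurable borel"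
    and le: "(\<integral>\<^sup>+x. (f x)\<^sup>2 \<partial>lborel) \<le> 1" "(\<integral>\<^sup>+x. (g x)\<^sup>2 \<partial>lborel) \<le> 1" "(\<integral>\<^sup>+x. (h x)\<^sup>2 \<partial>lborel) \<le> 1"
    by (auto simp: sub_unit_def)
  \<comment> \<open>The weight \<open>1 / C\<close> makes both terms equal to
    \<open>C\<close>.\<close>
  have "2 * tri k f g h \<le> inverse (ennreal (1 / C)) * ((\<integral>\<^sup>+x. (g x)\<^sup>2 \<partial>lborel) * (\<integral>\<^sup>+x. (h x)\<^sup>2 \<partial>lborel)) + ennreal (1 / C)
    * ennreal (C\<^sup>2)"
    using le by (intro tri_Schur assms(1)) (auto intro!: order_trans[OF nn_integral_mono K] split: split_indicator)
  also have "\<dots> \<le> inverse (ennreal (1 / C)) * (1 * 1) + ennreal (1 / C) * ennreal (C\<^sup>2)"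
    by (intro add_right_mono mult_left_mono mult_mono le) auto
  also have "\<dots> = 2 * ennreal C"
    using C by (simp add: inverse_ennreal ennreal_mult[symmetric] power2_eq_square mult_2)
  finally show "tri k f g h \<le> ennreal C"
    by (simp add: ennreal_mult_le_mult_iff)
qed

section \<open>Localisation in the spatial frequency\<close>

type_synonym pt = "real \<times> real \<times> real"

lemma borel_fst [measurable]: "(fst :: 'a::second_countable_topology \<times> 'b::second_countable_topology \<Rightarrow> 'a) \<in> borel_measurable borel"
  by (intro borel_measurable_continuous_onI continuous_intros)

lemma borel_snd [measurable]: "(snd :: 'a::second_countable_topology \<times> 'b::second_countable_topology \<Rightarrow> 'b) \<in> borel_measurable borel"
  by (intro borel_measurable_continuous_onI continuous_intros)

text \<open>The spatial frequency and the modulation \<open>\<tau> - phi (\<xi>, \<eta>)\<close> of a space-time frequency.\<close>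

definition sp :: "pt \<Rightarrow> real \<times> real" where "sp \<zeta> = (fst \<zeta>, fst (snd \<zeta>))"
definition md :: "pt \<Rightarrow> real" where "md \<zeta> = snd (snd \<zeta>) - phi (sp \<zeta>)"

lemma sp_measurable [measurable]: "sp \<in> borel_measurable borel"
  unfolding sp_def by (intro borel_measurable_continuous_onI continuous_intros)

lemma phi_measurable [measurable]: "phi \<in> borel_measurable borel"
  unfolding phi_def by (intro borel_measurable_continuous_onI continuous_intros)

lemma md_measurable [measurable]: "md \<in> borel_measurable borel"
  unfolding md_def sp_def phi_def by (intro borel_measurable_continuous_onI continuous_intros)

lemma jbr_measurable [measurable]: "(jbr :: 'a::euclidean_space \<Rightarrow> real) \<in> borel_measurable borel"
  unfolding jbr_def by (intro borel_measurable_continuous_onI continuous_intros)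

lemma jbr_ge_1: "jbr x \<ge> 1" unfolding jbr_def by simp
lemma jbr_pos: "jbr x > 0" using jbr_ge_1[of x] by linarith
lemma jbr_minus [simp]: "jbr (- x) = jbr x" unfolding jbr_def by simp
lemma jbr_minus_commute: "jbr (x - y) = jbr (y - x)" unfolding jbr_def by (simp add: norm_minus_commute)
lemma norm_le_jbr: "norm x \<le> jbr x" unfolding jbr_def by (rule real_le_rsqrt) simp

lemma sp_diff: "sp (x - y) = sp x - sp y" by (simp add: sp_def)

lemma nn_integral_pt:
  fixes f :: "pt \<Rightarrow> ennreal"
  assumes [measurable]: "f \<in> borel_measurable borel"
  shows "(\<integral>\<^sup>+\<zeta>. f \<zeta> \<partial>lborel) = (\<integral>\<^sup>+z. \<integral>\<^sup>+\<tau>. f (fst z, snd z, \<tau>) \<partial>lborel \<partial>lborel)"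
proof -
  have "(\<integral>\<^sup>+\<zeta>. f \<zeta> \<partial>lborel) = (\<integral>\<^sup>+\<zeta>. case_prod (\<lambda>\<xi> y. f (\<xi>, y)) \<zeta> \<partial>lborel)" by simp
  also have "\<dots> = (\<integral>\<^sup>+\<xi>. \<integral>\<^sup>+y. f (\<xi>, y) \<partial>lborel \<partial>lborel)"
    by (rule nn_integral_lborel_pair) (simp add: borel_prod)
  also have "\<dots> = (\<integral>\<^sup>+\<xi>. \<integral>\<^sup>+y. case_prod (\<lambda>\<eta> \<tau>. f (\<xi>, \<eta>, \<tau>)) y \<partial>lborel \<partial>lborel)" by simp
  also have "\<dots> = (\<integral>\<^sup>+\<xi>. \<integral>\<^sup>+\<eta>. \<integral>\<^sup>+\<tau>. f (\<xi>, \<eta>, \<tau>) \<partial>lborel \<partial>lborel \<partial>lborel)"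
    by (intro nn_integral_cong nn_integral_lborel_pair) (simp add: borel_prod)
  also have "\<dots> = (\<integral>\<^sup>+z. case_prod (\<lambda>\<xi> \<eta>. \<integral>\<^sup>+\<tau>. f (\<xi>, \<eta>, \<tau>) \<partial>lborel) z \<partial>lborel)"
    by (rule nn_integral_lborel_pair[symmetric]) (simp add: borel_prod)
  finally show ?thesis by (simp add: case_prod_beta')
qed

lemma nn_integral_box:
  fixes u v r :: real
  assumes "r > 0"
  shows "(\<integral>\<^sup>+q. indicator {q. \<bar>u - fst q\<bar> < r \<and> \<bar>v - snd q\<bar> < r} q \<partial>lborel) = ennreal (4 * r\<^sup>2)"
proof -
  have "{q. \<bar>u - fst q\<bar> < r \<and> \<bar>v - snd q\<bar> < r} = {u - r<..<u + r} \<times> {v - r<..<v + r}" by auto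
  then have "(\<integral>\<^sup>+q. indicator {q. \<bar>u - fst q\<bar> < r \<and> \<bar>v - snd q\<bar> < r} q \<partial>lborel)
      = emeasure (lborel \<Otimes>\<^sub>M lborel) ({u - r<..<u + r} \<times> {v - r<..<v + r})"
    by (simp add: lborel_prod[symmetric])
  also have "\<dots> = ennreal (4 * r\<^sup>2)"
    using assms by (subst lborel.emeasure_pair_measure_Times) (auto simp: ennreal_mult[symmetric] power2_eq_square)
  finally show ?thesis .
qed

text \<open>In \<open>tri_bdd_local\<close> the weight is proportional to \<open>a q + b q\<close>,
  which may vanish, so \<open>c\<close> must not be assumed invertible.\<close>

lemma ennreal_inverse_mult_le: "inverse c * (c * x) \<le> (x::ennreal)"
proof (cases "c = 0 \<or> c = top")
  case True then show ?thesis by auto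
next
  case False
  then have "c \<noteq> 0" "c < top" by (auto simp: less_top)
  then have "inverse c * c = 1" using ennreal_divide_self[of c] by (simp add: divide_ennreal_def mult.commute)
  then show ?thesis by (simp add: mult.assoc[symmetric])
qed

abbreviation bx :: "real \<Rightarrow> real \<Rightarrow> real \<Rightarrow> pt set"
  where "bx r u v \<equiv> {y. \<bar>fst y - u\<bar> < r \<and> \<bar>fst (snd y) - v\<bar> < r}"

text \<open>If \<^term>\<open>x\<close> has spatial frequency at most \<^term>\<open>r\<close>, then \<^term>\<open>y\<close> and \<^term>\<open>y - x\<close> lie in
  comparable boxes, so averaging over the position of the box loses nothing.\<close>

lemma tri_bdd_local:
  fixes k :: "pt \<Rightarrow> pt \<Rightarrow> ennreal"
  assumes "kmeas k" and C: "0 < C" and r: "0 < r"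
    and supp: "\<And>x y. k x y \<noteq> 0 \<Longrightarrow> \<bar>fst x\<bar> \<le> r \<and> \<bar>fst (snd x)\<bar> \<le> r"
    and K: "\<And>x u v. (\<integral>\<^sup>+y. (k x y)\<^sup>2 * indicator (bx r u v) y \<partial>lborel) \<le> ennreal (C\<^sup>2)"
  shows "tri_bdd k (ennreal (3 * C))"
  unfolding tri_bdd_def
proof (intro allI impI)
  note [measurable] = kmeas_comp[OF assms(1)]
  fix f g h :: "pt \<Rightarrow> ennreal" assume *: "sub_unit f" "sub_unit g" "sub_unit h"
  then have [measurable]: "f \<in> borel_measurable borel" "g \<in> borel_measurable borel" "h \<in> borel_measurable borel"
    and le: "(\<integral>\<^sup>+x. (f x)\<^sup>2 \<partial>lborel) \<le> 1" "(\<integral>\<^sup>+x. (g x)\<^sup>2 \<partial>lborel) \<le> 1" "(\<integral>\<^sup>+x. (h x)\<^sup>2 \<partial>lborel) \<le> 1"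
    by (auto simp: sub_unit_def)
  \<comment> \<open>\<open>h\<close> is evaluated at \<open>x - y\<close>, so its box is centred at
    \<open>- q\<close>; the doubled side accounts for the displacement by \<open>x\<close>.\<close>
  define G where "G q y = g y * indicator {q. \<bar>fst y - fst q\<bar> < r \<and> \<bar>fst (snd y) - snd q\<bar> < r} q" for q :: "real \<times> real" and y :: pt
  define H where "H q y = h y * indicator {q. \<bar>- fst y - fst q\<bar> < 2 * r \<and> \<bar>- fst (snd y) - snd q\<bar> < 2 * r} q" for q :: "real \<times> real"
    and y :: pt
  have G_m[measurable]: "(\<lambda>x. G (u x) (v x)) \<in> borel_measurable M"
    if [measurable]: "u \<in> borel_measurable M" "v \<in> borel_measurable M" for u v and M :: "'b measure"
    unfolding G_def indicator_def by measurable
  have H_m[measurable]: "(\<lambda>x. H (u x) (v x)) \<in> borel_measurable M"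
    if [measurable]: "u \<in> borel_measurable M" "v \<in> borel_measurable M" for u v and M :: "'b measure"
    unfolding H_def indicator_def by measurable
  define a where "a q = (\<integral>\<^sup>+y. (G q y)\<^sup>2 \<partial>lborel)" for q
  define b where "b q = (\<integral>\<^sup>+y. (H q y)\<^sup>2 \<partial>lborel)" for q
  have ab_m[measurable]: "a \<in> borel_measurable borel" "b \<in> borel_measurable borel"
    unfolding a_def b_def by measurable
  have ab_le: "a q \<le> 1" "b q \<le> 1" for q
    unfolding a_def b_def G_def H_def
    by (rule order_trans[OF nn_integral_mono le(2)] order_trans[OF nn_integral_mono le(3)]; auto split: split_indicator)+
  have aI: "(\<integral>\<^sup>+q. a q \<partial>lborel) \<le> ennreal (4 * r\<^sup>2)"
  proof -
    have "(\<integral>\<^sup>+q. a q \<partial>lborel) = (\<integral>\<^sup>+y. \<integral>\<^sup>+q. (G q y)\<^sup>2 \<partial>lborel \<partial>lborel)"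
      unfolding a_def by (rule nn_integral_lborel_swap) measurable
    also have "\<dots> = (\<integral>\<^sup>+y. (g y)\<^sup>2 * ennreal (4 * r\<^sup>2) \<partial>lborel)"
    proof (rule nn_integral_cong)
      fix y
      have "(\<integral>\<^sup>+q. (G q y)\<^sup>2 \<partial>lborel) = (\<integral>\<^sup>+q. (g y)\<^sup>2 * indicator {q. \<bar>fst y - fst q\<bar> < r \<and> \<bar>fst (snd y) - snd q\<bar> < r} q \<partial>lborel)"
        unfolding G_def by (intro nn_integral_cong) (auto split: split_indicator)
      also have "\<dots> = (g y)\<^sup>2 * (\<integral>\<^sup>+q. indicator {q. \<bar>fst y - fst q\<bar> < r \<and> \<bar>fst (snd y) - snd q\<bar> < r} q \<partial>lborel)"
        by (rule nn_integral_cmult) measurable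
      also have "\<dots> = (g y)\<^sup>2 * ennreal (4 * r\<^sup>2)" using nn_integral_box[OF r] by simp
      finally show "(\<integral>\<^sup>+q. (G q y)\<^sup>2 \<partial>lborel) = (g y)\<^sup>2 * ennreal (4 * r\<^sup>2)" .
    qed
    also have "\<dots> = (\<integral>\<^sup>+y. (g y)\<^sup>2 \<partial>lborel) * ennreal (4 * r\<^sup>2)" by (rule nn_integral_multc) measurable
    also have "\<dots> \<le> 1 * ennreal (4 * r\<^sup>2)" by (intro mult_right_mono le) auto
    finally show ?thesis by simp
  qed
  have bI: "(\<integral>\<^sup>+q. b q \<partial>lborel) \<le> ennreal (16 * r\<^sup>2)"
  proof -
    have "(\<integral>\<^sup>+q. b q \<partial>lborel) = (\<integral>\<^sup>+y. \<integral>\<^sup>+q. (H q y)\<^sup>2 \<partial>lborel \<partial>lborel)"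
      unfolding b_def by (rule nn_integral_lborel_swap) measurable
    also have "\<dots> = (\<integral>\<^sup>+y. (h y)\<^sup>2 * ennreal (16 * r\<^sup>2) \<partial>lborel)"
    proof (rule nn_integral_cong)
      fix y
      have "(\<integral>\<^sup>+q. (H q y)\<^sup>2 \<partial>lborel) = (\<integral>\<^sup>+q. (h y)\<^sup>2 * indicator {q. \<bar>- fst y - fst q\<bar> < 2 * r \<and> \<bar>- fst (snd y) - snd q\<bar>
        < 2 * r} q \<partial>lborel)"
        unfolding H_def by (intro nn_integral_cong) (auto split: split_indicator)
      also have "\<dots> = (h y)\<^sup>2 * (\<integral>\<^sup>+q. indicator {q. \<bar>- fst y - fst q\<bar> < 2 * r \<and> \<bar>- fst (snd y) - snd q\<bar> < 2 * r} q \<partial>lborel)"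
        by (rule nn_integral_cmult) measurable
      also have "\<dots> = (h y)\<^sup>2 * ennreal (16 * r\<^sup>2)" using nn_integral_box[of "2 * r" "- fst y" "- fst (snd y)"] r
        by (simp add: power_mult_distrib)
      finally show "(\<integral>\<^sup>+q. (H q y)\<^sup>2 \<partial>lborel) = (h y)\<^sup>2 * ennreal (16 * r\<^sup>2)" .
    qed
    also have "\<dots> = (\<integral>\<^sup>+y. (h y)\<^sup>2 \<partial>lborel) * ennreal (16 * r\<^sup>2)" by (rule nn_integral_multc) measurable
    also have "\<dots> \<le> 1 * ennreal (16 * r\<^sup>2)" by (intro mult_right_mono le) auto
    finally show ?thesis by simp
  qed
  have T: "2 * tri k f (G q) (H q) \<le> ennreal C * (a q + b q)" for q
  proof -
    \<comment> \<open>With this weight the second term is \<open>C * (a q + b q) / 2\<close>, and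
      the first is no larger because
      \<open>4 * (a q * b q) \<le> (a q + b q)\<^sup>2\<close>.\<close>
    define c where "c = ennreal (1 / (2 * C)) * (a q + b q)"
    have "2 * tri k f (G q) (H q) \<le> inverse c * ((\<integral>\<^sup>+x. (G q x)\<^sup>2 \<partial>lborel) * (\<integral>\<^sup>+x. (H q x)\<^sup>2 \<partial>lborel)) + c * ennreal (C\<^sup>2)"
    proof (rule tri_Schur[OF assms(1)])
      fix x
      have "(\<integral>\<^sup>+y. (k x y)\<^sup>2 * indicator {y. G q y \<noteq> 0} y \<partial>lborel) \<le> (\<integral>\<^sup>+y. (k x y)\<^sup>2 * indicator (bx r (fst q) (snd q)) y \<partial>lborel)"
        by (intro nn_integral_mono mult_left_mono) (auto simp: G_def split: split_indicator)
      also have "\<dots> \<le> ennreal (C\<^sup>2)" by (rule K)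
      finally show "(\<integral>\<^sup>+y. (k x y)\<^sup>2 * indicator {y. G q y \<noteq> 0} y \<partial>lborel) \<le> ennreal (C\<^sup>2)" .
    qed (use le in \<open>auto\<close>)
    also have "\<dots> = inverse c * (a q * b q) + c * ennreal (C\<^sup>2)" by (simp add: a_def b_def)
    also have "a q * b q \<le> c * (c * ennreal (C\<^sup>2))"
    proof -
      have "4 * (a q * b q) \<le> (a q + b q)\<^sup>2"
      proof -
        have "4 * (a q * b q) = 2 * (a q * b q) + 2 * (a q * b q)" 
          by (simp add: distrib_right[symmetric])
        also have "\<dots> \<le> (a q)\<^sup>2 + (b q)\<^sup>2 + 2 * (a q * b q)"
          using ennreal_amgm[of "a q" "b q" 1] by (intro add_right_mono) simp
        also have "\<dots> = (a q + b q)\<^sup>2"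
          unfolding power2_eq_square mult_2 by (simp add: distrib_left distrib_right mult_ac add_ac)
        finally show ?thesis .
      qed
      moreover have "ennreal 4 * (c * (c * ennreal (C\<^sup>2))) = (a q + b q)\<^sup>2"
      proof -
        have "ennreal 4 * (c * (c * ennreal (C\<^sup>2))) = (ennreal 4 * (ennreal (1 / (2 * C)) * (ennreal (1 / (2 * C))
          * ennreal (C\<^sup>2)))) * (a q + b q)\<^sup>2"
          unfolding c_def by (simp add: power2_eq_square mult_ac del: ennreal_numeral)
        also have "ennreal 4 * (ennreal (1 / (2 * C)) * (ennreal (1 / (2 * C)) * ennreal (C\<^sup>2)))
          = ennreal (4 * (1 / (2 * C) * (1 / (2 * C) * C\<^sup>2)))"
          using C by (simp add: ennreal_mult[symmetric] del: ennreal_numeral)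
        also have "4 * (1 / (2 * C) * (1 / (2 * C) * C\<^sup>2)) = 1" using C by (simp add: power2_eq_square)
        finally show ?thesis by simp
      qed
      ultimately have "4 * (a q * b q) \<le> 4 * (c * (c * ennreal (C\<^sup>2)))" by simp
      then show ?thesis by (subst (asm) ennreal_mult_le_mult_iff) auto
    qed
    then have "inverse c * (a q * b q) \<le> c * ennreal (C\<^sup>2)"
      by (rule order_trans[OF mult_left_mono ennreal_inverse_mult_le]) auto
    then have "inverse c * (a q * b q) + c * ennreal (C\<^sup>2) \<le> c * ennreal (C\<^sup>2) + c * ennreal (C\<^sup>2)"
      by (rule add_right_mono)
    also have "\<dots> = (a q + b q) * (ennreal (1 / (2 * C)) * ennreal (C\<^sup>2) + ennreal (1 / (2 * C)) * ennreal (C\<^sup>2))"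
      unfolding c_def by (simp add: algebra_simps)
    also have "ennreal (1 / (2 * C)) * ennreal (C\<^sup>2) + ennreal (1 / (2 * C)) * ennreal (C\<^sup>2) = ennreal C"
      using C by (simp add: ennreal_mult[symmetric] ennreal_plus[symmetric] power2_eq_square del: ennreal_plus)
    finally show ?thesis by (simp add: mult.commute)
  qed
  \<comment> \<open>Integration over the centre \<open>q\<close> returns the original integrand
    times the area \<open>4 * r\<^sup>2\<close>: wherever the indicator in \<open>G\<close> is 1,
    the support condition on \<open>x\<close> forces the one in \<open>H\<close> to be 1.\<close>
  have pt: "(\<integral>\<^sup>+q. k x y * f x * G q y * H q (x - y) \<partial>lborel) = ennreal (4 * r\<^sup>2) * (k x y * f x * g y * h (x - y))" for x y
  proof (cases "k x y = 0")
    case True then show ?thesis by simp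
  next
    case False
    note s = supp[OF False]
    have "(\<integral>\<^sup>+q. k x y * f x * G q y * H q (x - y) \<partial>lborel) =
      (\<integral>\<^sup>+q. (k x y * f x * g y * h (x - y)) * indicator {q. \<bar>fst y - fst q\<bar> < r \<and> \<bar>fst (snd y) - snd q\<bar> < r} q \<partial>lborel)"
      using s r by (intro nn_integral_cong) (auto simp: G_def H_def split: split_indicator)
    also have "\<dots> = (k x y * f x * g y * h (x - y)) * (\<integral>\<^sup>+q. indicator {q. \<bar>fst y - fst q\<bar> < r \<and> \<bar>fst (snd y) - snd q\<bar>
      < r} q \<partial>lborel)"
      by (rule nn_integral_cmult) measurable
    also have "\<dots> = ennreal (4 * r\<^sup>2) * (k x y * f x * g y * h (x - y))"
      using nn_integral_box[OF r] by (simp add: mult.commute)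
    finally show ?thesis .
  qed
  have "ennreal (4 * r\<^sup>2) * tri k f g h = (\<integral>\<^sup>+x. \<integral>\<^sup>+y. \<integral>\<^sup>+q. k x y * f x * G q y * H q (x - y) \<partial>lborel \<partial>lborel \<partial>lborel)"
    unfolding tri_def pt by (simp add: nn_integral_cmult)
  also have "\<dots> = (\<integral>\<^sup>+x. \<integral>\<^sup>+q. \<integral>\<^sup>+y. k x y * f x * G q y * H q (x - y) \<partial>lborel \<partial>lborel \<partial>lborel)"
    by (intro nn_integral_cong nn_integral_lborel_swap) measurable
  also have "\<dots> = (\<integral>\<^sup>+q. tri k f (G q) (H q) \<partial>lborel)"
    unfolding tri_def by (rule nn_integral_lborel_swap) measurable
  finally have "2 * (ennreal (4 * r\<^sup>2) * tri k f g h) = (\<integral>\<^sup>+q. 2 * tri k f (G q) (H q) \<partial>lborel)"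
    unfolding tri_def by (simp add: nn_integral_cmult)
  also have "\<dots> \<le> (\<integral>\<^sup>+q. ennreal C * (a q + b q) \<partial>lborel)"
    by (intro nn_integral_mono T)
  also have "\<dots> = ennreal C * ((\<integral>\<^sup>+q. a q \<partial>lborel) + (\<integral>\<^sup>+q. b q \<partial>lborel))"
    by (simp add: nn_integral_cmult nn_integral_add)
  also have "\<dots> \<le> ennreal C * (ennreal (4 * r\<^sup>2) + ennreal (16 * r\<^sup>2))"
    by (intro mult_left_mono add_mono aI bI) auto
  also have "\<dots> = ennreal (20 * C * r\<^sup>2)"
    using C by (simp add: ennreal_mult[symmetric] ennreal_plus[symmetric] del: ennreal_plus)
  \<comment> \<open>The areas \<open>4 * r\<^sup>2\<close> and \<open>16 * r\<^sup>2\<close> lead to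
    the factor 5/2, rounded up to 3.\<close>
  also have "\<dots> \<le> ennreal (2 * (4 * r\<^sup>2 * (3 * C)))" using C by (intro ennreal_leI) auto
  also have "\<dots> = ennreal 2 * (ennreal (4 * r\<^sup>2) * ennreal (3 * C))"
    using C by (simp only: ennreal_mult[symmetric] zero_le_numeral zero_le_power2 mult_nonneg_nonneg less_imp_le)
  also have "ennreal 2 = 2" by simp
  finally have "ennreal (4 * r\<^sup>2) * tri k f g h \<le> ennreal (4 * r\<^sup>2) * ennreal (3 * C)"
    by (subst (asm) ennreal_mult_le_mult_iff) auto
  then show "tri k f g h \<le> ennreal (3 * C)"
    using r by (subst (asm) ennreal_mult_le_mult_iff) auto
qed

text \<open>Each dyadic shell of the outer frequency is handled by \<open>tri_bdd_local\<close>, the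
  box side being the outer radius of the shell. The decay \<open>r powr (- c)\<close> turns the
  constants of the shells into a geometric series.\<close>

lemma tri_bdd_dyadic:
  fixes k :: "pt \<Rightarrow> pt \<Rightarrow> ennreal"
  assumes km: "kmeas k" and C: "0 < C" and c: "0 < c"
    and K: "\<And>r x u v. \<lbrakk>1 \<le> r; norm (sp x) \<le> r; r \<le> 2 * max 1 (norm (sp x))\<rbrakk> \<Longrightarrow>
       (\<integral>\<^sup>+y. (k x y)\<^sup>2 * indicator (bx r u v) y \<partial>lborel) \<le> ennreal ((C * r powr (- c))\<^sup>2)"
  shows "\<exists>D\<ge>0. tri_bdd k (ennreal D)"
proof -
  note [measurable] = kmeas_comp[OF km]
  \<comment> \<open>\<open>A 0\<close> is the whole unit ball, which is why the hypothesis
    \<open>K\<close> compares \<open>r\<close> with \<open>max 1 (norm (sp x))\<close>.\<close>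
  define A :: "nat \<Rightarrow> pt set" where "A j = {x. norm (sp x) \<le> 2 ^ j \<and> (j = 0 \<or> 2 ^ (j - 1) < norm (sp x))}" for j
  define kk where "kk j x y = k x y * indicator (A j) x" for j x y
  have A_m[measurable]: "A j \<in> sets borel" for j unfolding A_def by measurable
  have kkm: "kmeas (kk j)" for j unfolding kk_def by measurable
  define q where "q = (2::real) powr (- c)"
  have q: "0 < q" "q < 1" using c by (auto simp: q_def powr_less_one)
  have pw: "(2 ^ j) powr (- c) = q ^ j" for j
    by (simp add: q_def powr_realpow[symmetric] powr_powr mult.commute)
  have "tri_bdd (kk j) (ennreal (3 * (C * q ^ j)))" for j
  proof (rule tri_bdd_local[OF kkm, where r = "2 ^ j"])
    show "0 < C * q ^ j" using C q by simp
    show "(0::real) < 2 ^ j" by simp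
    fix x y :: pt assume "kk j x y \<noteq> 0"
    then have "norm (sp x) \<le> 2 ^ j" by (auto simp: kk_def A_def split: split_indicator_asm)
    then show "\<bar>fst x\<bar> \<le> 2 ^ j \<and> \<bar>fst (snd x)\<bar> \<le> 2 ^ j"
      using norm_fst_le[of "fst x" "fst (snd x)"] norm_snd_le[of "fst (snd x)" "fst x"] by (auto simp: sp_def intro: order_trans)
  next
    fix x u v
    show "(\<integral>\<^sup>+y. (kk j x y)\<^sup>2 * indicator (bx (2 ^ j) u v) y \<partial>lborel) \<le> ennreal ((C * q ^ j)\<^sup>2)"
    proof (cases "x \<in> A j")
      case False then show ?thesis by (simp add: kk_def)
    next
      case True
      have "(2::real) ^ j \<le> 2 * max 1 (norm (sp x))"
        using True by (cases j) (auto simp: A_def)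
      moreover have "norm (sp x) \<le> 2 ^ j" using True by (auto simp: A_def)
      ultimately show ?thesis using K[of "2 ^ j" x u v] True by (simp add: kk_def pw)
    qed
  qed
  from tri_bdd_suminf[of kk, OF kkm this]
  have 1: "tri_bdd (\<lambda>x y. \<Sum>j. kk j x y) (\<Sum>j. ennreal (3 * (C * q ^ j)))" .
  have 2: "(\<Sum>j. ennreal (3 * (C * q ^ j))) = ennreal (3 * C * (1 / (1 - q)))"
  proof (rule suminf_ennreal_eq)
    show "0 \<le> 3 * (C * q ^ j)" for j using C q by simp
    show "(\<lambda>j. 3 * (C * q ^ j)) sums (3 * C * (1 / (1 - q)))"
      using sums_mult[OF geometric_sums[of q], of "3 * C"] q by (simp add: mult.assoc)
  qed
  have 3: "k x y \<le> (\<Sum>j. kk j x y)" for x y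
  proof -
    have ex: "\<exists>j::nat. norm (sp x) \<le> 2 ^ j" 
      using real_arch_pow[of 2 "norm (sp x)"] by (auto intro: less_imp_le)
    define j where "j = (LEAST j::nat. norm (sp x) \<le> 2 ^ j)"
    have "x \<in> A j"
      using LeastI_ex[OF ex] not_less_Least[of "j - 1" "\<lambda>j. norm (sp x) \<le> 2 ^ j"]
      unfolding A_def j_def[symmetric] by (cases "j = 0") auto
    then have "k x y = kk j x y" by (simp add: kk_def)
    also have "\<dots> = (\<Sum>i\<in>{j}. kk i x y)" by simp
    also have "\<dots> \<le> (\<Sum>j. kk j x y)" by (rule sum_le_suminf) auto
    finally show ?thesis .
  qed
  show ?thesis
    using tri_bdd_mono[OF 1, of k] 2 3 C q by (intro exI[of _ "3 * C * (1 / (1 - q))"]) auto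
qed

lemma wt_measurable [measurable]: "(\<lambda>x. jbr (x::real) powr a) \<in> borel_measurable borel"
  by measurable

text \<open>The substitution \<open>x = \<tau>1 - phi z1\<close> makes the first weight independent
  of \<open>z1\<close>; for fixed \<open>x\<close> the second is a function of the phase
  \<open>phi z1 + phi (sp \<zeta> - z1)\<close> alone. The two-dimensional bound \<open>K\<close> is
  then integrated against the first weight.\<close>

lemma nn_integral_pair_weights:
  fixes m :: "real \<times> real \<Rightarrow> ennreal"
  assumes [measurable]: "m \<in> borel_measurable borel"
    and K: "\<And>A. (\<integral>\<^sup>+z1. m z1 * ennreal (jbr (A - phi z1 - phi (sp \<zeta> - z1)) powr (- \<beta>)) \<partial>lborel) \<le> K"
  shows "(\<integral>\<^sup>+\<zeta>1. m (sp \<zeta>1) * ennreal (jbr (md \<zeta>1) powr (- \<beta>)) * ennreal (jbr (md (\<zeta> - \<zeta>1)) powr (- \<beta>)) \<partial>lborel)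
     \<le> (\<integral>\<^sup>+x. ennreal (jbr (x::real) powr (- \<beta>)) \<partial>lborel) * K"
proof -
  let ?w = "\<lambda>x::real. ennreal (jbr x powr (- \<beta>))"
  define \<tau> where "\<tau> = snd (snd \<zeta>)"
  have "(\<integral>\<^sup>+\<zeta>1. m (sp \<zeta>1) * ?w (md \<zeta>1) * ?w (md (\<zeta> - \<zeta>1)) \<partial>lborel)
     = (\<integral>\<^sup>+z1. \<integral>\<^sup>+\<tau>1. m z1 * ?w (\<tau>1 - phi z1) * ?w (\<tau> - \<tau>1 - phi (sp \<zeta> - z1)) \<partial>lborel \<partial>lborel)"
    by (subst nn_integral_pt) (auto simp: md_def sp_diff \<tau>_def, simp add: sp_def)
  also have "\<dots> = (\<integral>\<^sup>+z1. \<integral>\<^sup>+x. m z1 * ?w x * ?w (\<tau> - x - phi z1 - phi (sp \<zeta> - z1)) \<partial>lborel \<partial>lborel)"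
  proof (rule nn_integral_cong)
    fix z1
    have "(\<integral>\<^sup>+\<tau>1. m z1 * ?w (\<tau>1 - phi z1) * ?w (\<tau> - \<tau>1 - phi (sp \<zeta> - z1)) \<partial>lborel)
       = (\<integral>\<^sup>+x. m z1 * ?w ((phi z1 + x) - phi z1) * ?w (\<tau> - (phi z1 + x) - phi (sp \<zeta> - z1)) \<partial>lborel)"
      by (rule nn_integral_lborel_translate[symmetric]) measurable
    then show "(\<integral>\<^sup>+\<tau>1. m z1 * ?w (\<tau>1 - phi z1) * ?w (\<tau> - \<tau>1 - phi (sp \<zeta> - z1)) \<partial>lborel)
       = (\<integral>\<^sup>+x. m z1 * ?w x * ?w (\<tau> - x - phi z1 - phi (sp \<zeta> - z1)) \<partial>lborel)"
      by (simp add: algebra_simps)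
  qed
  also have "\<dots> = (\<integral>\<^sup>+x. \<integral>\<^sup>+z1. m z1 * ?w x * ?w (\<tau> - x - phi z1 - phi (sp \<zeta> - z1)) \<partial>lborel \<partial>lborel)"
    by (rule nn_integral_lborel_swap) measurable
  also have "\<dots> = (\<integral>\<^sup>+x. ?w x * (\<integral>\<^sup>+z1. m z1 * ?w ((\<tau> - x) - phi z1 - phi (sp \<zeta> - z1)) \<partial>lborel) \<partial>lborel)"
    by (intro nn_integral_cong) (simp add: nn_integral_cmult[symmetric] mult_ac)
  also have "\<dots> \<le> (\<integral>\<^sup>+x. ?w x * K \<partial>lborel)"
    by (intro nn_integral_mono mult_left_mono K) auto
  also have "\<dots> = (\<integral>\<^sup>+x. ?w x \<partial>lborel) * K" by (rule nn_integral_multc) measurable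
  finally show ?thesis .
qed

section \<open>Level sets of the phase\<close>

lemma nn_integral_le_bounded_intervals:
  fixes f :: "real \<Rightarrow> ennreal"
  assumes [measurable]: "f \<in> borel_measurable borel"
    and C: "\<And>n::nat. (\<integral>\<^sup>+x. f x * indicator {- real n..real n} x \<partial>lborel) \<le> C"
  shows "(\<integral>\<^sup>+x. f x \<partial>lborel) \<le> C"
proof -
  have "(\<lambda>n. \<integral>\<^sup>+x. f x * indicator {- real n..real n} x \<partial>lborel) \<longlonglongrightarrow> (\<integral>\<^sup>+x. f x \<partial>lborel)"
  proof (rule nn_integral_LIMSEQ)
    show "incseq (\<lambda>n x. f x * indicator {- real n..real n} x)"
      by (auto simp: incseq_def le_fun_def intro!: mult_left_mono split: split_indicator)
    show "(\<lambda>n. f x * indicator {- real n..real n} x) \<longlonglongrightarrow> f x" for x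
    proof (rule tendsto_eventually)
      obtain N :: nat where "\<bar>x\<bar> \<le> real N" using real_arch_simple by blast
      then show "\<forall>\<^sub>F n in sequentially. f x * indicator {- real n..real n} x = f x"
        by (intro eventually_sequentiallyI[of N]) (auto split: split_indicator)
    qed
  qed measurable
  then show ?thesis by (rule LIMSEQ_le_const2) (use C in auto)
qed

text \<open>Truncation to a compact interval on which the quadratic is monotone gives access to the
  substitution rule. The image interval is then enlarged to the whole line, so the bound depends
  neither on the coefficients nor on the truncation.\<close>

lemma nn_integral_quadratic_subst_pos:
  fixes w :: "real \<Rightarrow> real"
  assumes [measurable]: "w \<in> borel_measurable borel" and w: "\<And>x. 0 \<le> w x"
  shows "(\<integral>\<^sup>+u. ennreal (w (a * u\<^sup>2 + b * u + c) * (2 * a * u + b)) * indicator {u. 0 \<le> 2 * a * u + b} u \<partial>lborel)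
     \<le> (\<integral>\<^sup>+x. ennreal (w x) \<partial>lborel)"
proof (rule nn_integral_le_bounded_intervals)
  fix n :: nat
  define S where "S = {u. 0 \<le> 2 * a * u + b} \<inter> {- real n..real n}"
  have "convex {u. 0 \<le> 2 * a * u + b}"
  proof -
    have "{u. 0 \<le> 2 * a * u + b} = {u. inner (- 2 * a) u \<le> b}" by (auto simp: inner_real_def)
    then show ?thesis using convex_halfspace_le[of "- 2 * a" b] by simp
  qed
  then have "connected S" unfolding S_def by (intro convex_connected convex_Int) auto
  moreover have "compact S" unfolding S_def
    by (intro closed_Int_compact closed_Collect_le continuous_intros) auto
  ultimately obtain l r where S: "S = {l..r}" using connected_compact_interval_1[of S] by (auto simp: box_real)
  have "(\<integral>\<^sup>+u. ennreal (w (a * u\<^sup>2 + b * u + c) * (2 * a * u + b)) * indicator {u. 0 \<le> 2 * a * u + b} u * indicator {- real n..real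
    n} u \<partial>lborel)
     = (\<integral>\<^sup>+u. ennreal (w (a * u\<^sup>2 + b * u + c) * (2 * a * u + b)) * indicator {l..r} u \<partial>lborel)"
    unfolding S[symmetric] S_def by (intro nn_integral_cong) (auto split: split_indicator)
  also have "\<dots> \<le> (\<integral>\<^sup>+x. ennreal (w x) \<partial>lborel)"
  proof (cases "l \<le> r")
    case False then show ?thesis by simp
  next
    case True
    let ?g = "\<lambda>u. a * u\<^sup>2 + b * u + c"
    have "(\<integral>\<^sup>+x. ennreal (w x * indicator {?g l..?g r} x) \<partial>lborel) = (\<integral>\<^sup>+u. ennreal (w (?g u) * (2 * a * u + b) * indicator {l..r}
      u) \<partial>lborel)"
    proof (rule nn_integral_substitution)
      show "set_borel_measurable borel {?g l..?g r} w" unfolding set_borel_measurable_def by measurable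
      show "(?g has_real_derivative 2 * a * u + b) (at u)" for u
        by (auto intro!: derivative_eq_intros)
      show "continuous_on {l..r} (\<lambda>u. 2 * a * u + b)" by (intro continuous_intros)
      show "0 \<le> 2 * a * u + b" if "u \<in> {l..r}" for u using that unfolding S[symmetric] S_def by auto
    qed fact
    moreover have "(\<integral>\<^sup>+u. ennreal (w (?g u) * (2 * a * u + b)) * indicator {l..r} u \<partial>lborel) = (\<integral>\<^sup>+u. ennreal (w (?g u) * (2 * a * u
      + b) * indicator {l..r} u) \<partial>lborel)"
      by (intro nn_integral_cong) (auto split: split_indicator)
    moreover have "(\<integral>\<^sup>+x. ennreal (w x * indicator {?g l..?g r} x) \<partial>lborel) \<le> (\<integral>\<^sup>+x. ennreal (w x) \<partial>lborel)"
      using w by (intro nn_integral_mono ennreal_leI) (auto split: split_indicator)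
    ultimately show ?thesis by simp
  qed
  finally show "(\<integral>\<^sup>+u. ennreal (w (a * u\<^sup>2 + b * u + c) * (2 * a * u + b)) * indicator {u. 0
    \<le> 2 * a * u + b} u * indicator {- real n..real n} u \<partial>lborel) \<le> (\<integral>\<^sup>+x. ennreal (w x) \<partial>lborel)" .
qed measurable

text \<open>The factor 2 counts the two monotone branches. On the decreasing one the quadratic is
  negated and \<open>w\<close> reflected, which is the increasing case again.\<close>

lemma nn_integral_quadratic_subst:
  fixes w :: "real \<Rightarrow> real"
  assumes [measurable]: "w \<in> borel_measurable borel" and w: "\<And>x. 0 \<le> w x"
  shows "(\<integral>\<^sup>+u. ennreal (w (a * u\<^sup>2 + b * u + c) * \<bar>2 * a * u + b\<bar>) \<partial>lborel) \<le> 2 * (\<integral>\<^sup>+x. ennreal (w x) \<partial>lborel)"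
proof -
  let ?f = "\<lambda>u. ennreal (w (a * u\<^sup>2 + b * u + c) * (2 * a * u + b)) * indicator {u. 0 \<le> 2 * a * u + b} u"
  let ?g = "\<lambda>u. ennreal (w (- ((- a) * u\<^sup>2 + (- b) * u + (- c))) * (2 * (- a) * u + (- b))) * indicator {u. 0
    \<le> 2 * (- a) * u + (- b)} u"
  have 1: "(\<integral>\<^sup>+u. ennreal (w (a * u\<^sup>2 + b * u + c) * \<bar>2 * a * u + b\<bar>) \<partial>lborel) \<le> (\<integral>\<^sup>+u. ?f u + ?g u \<partial>lborel)"
    by (intro nn_integral_mono) (auto simp: algebra_simps abs_if split: split_indicator)
  have 2: "(\<integral>\<^sup>+u. ?f u + ?g u \<partial>lborel) = (\<integral>\<^sup>+u. ?f u \<partial>lborel) + (\<integral>\<^sup>+u. ?g u \<partial>lborel)"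
    by (rule nn_integral_add) measurable
  have 3: "(\<integral>\<^sup>+u. ?f u \<partial>lborel) \<le> (\<integral>\<^sup>+x. ennreal (w x) \<partial>lborel)"
    using w by (intro nn_integral_quadratic_subst_pos) auto
  have "(\<integral>\<^sup>+u. ?g u \<partial>lborel) \<le> (\<integral>\<^sup>+x. ennreal (w (- x)) \<partial>lborel)"
    using w by (intro nn_integral_quadratic_subst_pos[where w = "\<lambda>x. w (- x)"]) auto
  also have "\<dots> = (\<integral>\<^sup>+x. ennreal (w x) \<partial>lborel)"
    using nn_integral_lborel_reflect[of "\<lambda>x. ennreal (w x)" 0] by simp
  finally have 4: "(\<integral>\<^sup>+u. ?g u \<partial>lborel) \<le> (\<integral>\<^sup>+x. ennreal (w x) \<partial>lborel)" .
  show ?thesis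
    by (rule order_trans[OF 1]) (simp only: 2 mult_2[of "\<integral>\<^sup>+x. ennreal (w x) \<partial>lborel"] add_mono 3 4)
qed

text \<open>The partial derivatives of \<open>y \<mapsto> phi y + phi (z - y)\<close>. Along each coordinate line the phase is quadratic,
  which makes the substitution explicit.\<close>

definition G1 :: "real \<times> real \<Rightarrow> real \<times> real \<Rightarrow> real"
  where "G1 z y = 2 * (3 * fst z) * fst y + 3 * ((snd z - snd y)\<^sup>2 - (snd y)\<^sup>2 - (fst z)\<^sup>2)"

definition G2 :: "real \<times> real \<Rightarrow> real \<times> real \<Rightarrow> real"
  where "G2 z y = 2 * (- 3 * fst z) * snd y + 6 * snd z * (fst z - fst y)"

lemma G_measurable [measurable]: "G1 z \<in> borel_measurable borel" "G2 z \<in> borel_measurable borel"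
  unfolding G1_def G2_def by (intro borel_measurable_continuous_onI continuous_intros)+

lemma norm_pair_sq: "(norm (z::real \<times> real))\<^sup>2 = (fst z)\<^sup>2 + (snd z)\<^sup>2"
  by (cases z) (simp add: norm_Pair)

text \<open>In complex notation the gradient of Re (y^3 + (z - y)^3) has the modulus of 3 (y^2 - (z
  - y)^2) = 3 z (2y - z).\<close>

lemma G_norm: "(G1 z y)\<^sup>2 + (G2 z y)\<^sup>2 = (3 * (norm z * norm (2 *\<^sub>R y - z)))\<^sup>2"
  unfolding power_mult_distrib norm_pair_sq G1_def G2_def by (simp add: power2_eq_square algebra_simps)

lemma G_lower: "3 * (norm z * norm (2 *\<^sub>R y - z)) \<le> \<bar>G1 z y\<bar> + \<bar>G2 z y\<bar>"
proof (rule power2_le_imp_le)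
  have "(3 * (norm z * norm (2 *\<^sub>R y - z)))\<^sup>2 = \<bar>G1 z y\<bar>\<^sup>2 + \<bar>G2 z y\<bar>\<^sup>2" by (simp add: G_norm)
  also have "\<dots> \<le> (\<bar>G1 z y\<bar> + \<bar>G2 z y\<bar>)\<^sup>2" unfolding power2_sum by simp
  finally show "(3 * (norm z * norm (2 *\<^sub>R y - z)))\<^sup>2 \<le> (\<bar>G1 z y\<bar> + \<bar>G2 z y\<bar>)\<^sup>2" .
qed simp

text \<open>The weight enters through its integral only, and in \<open>int_ball\<close> also through
  an upper bound by 1. The instance is \<open>wt\<close>, the square of a modulation weight.\<close>

locale pair_phase =
  fixes w :: "real \<Rightarrow> real" and c :: real
  assumes w_meas [measurable]: "w \<in> borel_measurable borel" and w_nonneg: "\<And>x. 0 \<le> w x"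
    and w_int: "(\<integral>\<^sup>+x. ennreal (w x) \<partial>lborel) \<le> ennreal c" and c_nonneg: "0 \<le> c"
begin

text \<open>\<open>A\<close> collects the output time frequency and the modulation of the first
  input, so the argument of \<open>w\<close> is the modulation of the second input.\<close>

definition Wt :: "real \<Rightarrow> real \<times> real \<Rightarrow> real \<times> real \<Rightarrow> real"
  where "Wt A z y = w (A - phi y - phi (z - y))"

lemma Wt_measurable [measurable]: "Wt A z \<in> borel_measurable borel"
  unfolding Wt_def by measurable

lemma Wt_nonneg: "0 \<le> Wt A z y" unfolding Wt_def by (rule w_nonneg)

text \<open>On a horizontal line the phase is a quadratic polynomial with derivative
  \<open>G1\<close>. This factor is therefore exactly the Jacobian of the substitution, and the
  bound is uniform in the line, in \<open>A\<close> and in \<open>z\<close>.\<close>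

lemma int_G1: "(\<integral>\<^sup>+\<xi>. ennreal (Wt A z (\<xi>, \<eta>) * \<bar>G1 z (\<xi>, \<eta>)\<bar>) \<partial>lborel) \<le> ennreal (2 * c)"
proof -
  let ?a = "3 * fst z" and ?b = "3 * ((snd z - \<eta>)\<^sup>2 - \<eta>\<^sup>2 - (fst z)\<^sup>2)" and ?d = "(fst z)^3 - 3 * fst z * (snd z - \<eta>)\<^sup>2"
  have eq: "phi (\<xi>, \<eta>) + phi (z - (\<xi>, \<eta>)) = ?a * \<xi>\<^sup>2 + ?b * \<xi> + ?d" for \<xi>
    by (cases z) (simp add: phi_def power2_eq_square power3_eq_cube algebra_simps)
  have "(\<integral>\<^sup>+\<xi>. ennreal (Wt A z (\<xi>, \<eta>) * \<bar>G1 z (\<xi>, \<eta>)\<bar>) \<partial>lborel)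
      = (\<integral>\<^sup>+\<xi>. ennreal (w (A - (?a * \<xi>\<^sup>2 + ?b * \<xi> + ?d)) * \<bar>2 * ?a * \<xi> + ?b\<bar>) \<partial>lborel)"
    unfolding Wt_def G1_def eq[symmetric] by (simp add: algebra_simps)
  also have "\<dots> \<le> 2 * (\<integral>\<^sup>+x. ennreal (w (A - x)) \<partial>lborel)"
    using w_nonneg by (intro nn_integral_quadratic_subst[where w = "\<lambda>x. w (A - x)"]) auto
  also have "(\<integral>\<^sup>+x. ennreal (w (A - x)) \<partial>lborel) = (\<integral>\<^sup>+x. ennreal (w x) \<partial>lborel)"
    by (rule nn_integral_lborel_reflect[of "\<lambda>x. ennreal (w x)"]) measurable
  also have "2 * \<dots> \<le> 2 * ennreal c" by (intro mult_left_mono w_int) auto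
  finally show ?thesis using c_nonneg by (simp add: ennreal_mult)
qed

lemma int_G2: "(\<integral>\<^sup>+\<eta>. ennreal (Wt A z (\<xi>, \<eta>) * \<bar>G2 z (\<xi>, \<eta>)\<bar>) \<partial>lborel) \<le> ennreal (2 * c)"
proof -
  let ?a = "- 3 * fst z" and ?b = "6 * snd z * (fst z - \<xi>)" and ?d = "\<xi>^3 + (fst z - \<xi>)^3 - 3 * (fst z - \<xi>) * (snd z)\<^sup>2"
  have eq: "phi (\<xi>, \<eta>) + phi (z - (\<xi>, \<eta>)) = ?a * \<eta>\<^sup>2 + ?b * \<eta> + ?d" for \<eta>
    by (cases z) (simp add: phi_def power2_eq_square power3_eq_cube algebra_simps)
  have "(\<integral>\<^sup>+\<eta>. ennreal (Wt A z (\<xi>, \<eta>) * \<bar>G2 z (\<xi>, \<eta>)\<bar>) \<partial>lborel)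
      = (\<integral>\<^sup>+\<eta>. ennreal (w (A - (?a * \<eta>\<^sup>2 + ?b * \<eta> + ?d)) * \<bar>2 * ?a * \<eta> + ?b\<bar>) \<partial>lborel)"
    unfolding Wt_def G2_def eq[symmetric] by (simp add: algebra_simps)
  also have "\<dots> \<le> 2 * (\<integral>\<^sup>+x. ennreal (w (A - x)) \<partial>lborel)"
    using w_nonneg by (intro nn_integral_quadratic_subst[where w = "\<lambda>x. w (A - x)"]) auto
  also have "(\<integral>\<^sup>+x. ennreal (w (A - x)) \<partial>lborel) = (\<integral>\<^sup>+x. ennreal (w x) \<partial>lborel)"
    by (rule nn_integral_lborel_reflect[of "\<lambda>x. ennreal (w x)"]) measurable
  also have "2 * \<dots> \<le> 2 * ennreal c" by (intro mult_left_mono w_int) auto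
  finally show ?thesis using c_nonneg by (simp add: ennreal_mult)
qed

text \<open>Each partial derivative pays for the integration in its own direction. The auxiliary
  weight next to it may depend on the other coordinate only, whose integral it makes finite.\<close>

lemma int_weighted:
  fixes h1 h2 :: "real \<Rightarrow> ennreal"
  assumes [measurable]: "h1 \<in> borel_measurable borel" "h2 \<in> borel_measurable borel"
    and h: "(\<integral>\<^sup>+x. h1 x \<partial>lborel) \<le> ennreal d" "(\<integral>\<^sup>+x. h2 x \<partial>lborel) \<le> ennreal d" and d: "0 \<le> d"
  shows "(\<integral>\<^sup>+y. ennreal (Wt A z y * \<bar>G1 z y\<bar>) * h1 (snd y) + ennreal (Wt A z y * \<bar>G2 z y\<bar>) * h2 (fst y) \<partial>lborel)
    \<le> ennreal (4 * c * d)"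
proof -
  have 1: "(\<integral>\<^sup>+y. ennreal (Wt A z y * \<bar>G1 z y\<bar>) * h1 (snd y) \<partial>lborel) \<le> ennreal (2 * c * d)"
  proof -
    have "(\<integral>\<^sup>+y. ennreal (Wt A z y * \<bar>G1 z y\<bar>) * h1 (snd y) \<partial>lborel)
        = (\<integral>\<^sup>+y. case_prod (\<lambda>\<xi> \<eta>. ennreal (Wt A z (\<xi>, \<eta>) * \<bar>G1 z (\<xi>, \<eta>)\<bar>) * h1 \<eta>) y \<partial>lborel)"
      by (intro nn_integral_cong) (auto split: prod.split)
    also have "\<dots> = (\<integral>\<^sup>+\<xi>. \<integral>\<^sup>+\<eta>. ennreal (Wt A z (\<xi>, \<eta>) * \<bar>G1 z (\<xi>, \<eta>)\<bar>) * h1 \<eta> \<partial>lborel \<partial>lborel)"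
      by (rule nn_integral_lborel_pair) (simp add: borel_prod case_prod_beta')
    also have "\<dots> = (\<integral>\<^sup>+\<eta>. \<integral>\<^sup>+\<xi>. ennreal (Wt A z (\<xi>, \<eta>) * \<bar>G1 z (\<xi>, \<eta>)\<bar>) * h1 \<eta> \<partial>lborel \<partial>lborel)"
      by (rule nn_integral_lborel_swap) (simp add: borel_prod case_prod_beta')
    also have "\<dots> = (\<integral>\<^sup>+\<eta>. (\<integral>\<^sup>+\<xi>. ennreal (Wt A z (\<xi>, \<eta>) * \<bar>G1 z (\<xi>, \<eta>)\<bar>) \<partial>lborel) * h1 \<eta> \<partial>lborel)"
      by (intro nn_integral_cong nn_integral_multc) measurable
    also have "\<dots> \<le> (\<integral>\<^sup>+\<eta>. ennreal (2 * c) * h1 \<eta> \<partial>lborel)"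
      by (intro nn_integral_mono mult_right_mono int_G1) auto
    also have "\<dots> = ennreal (2 * c) * (\<integral>\<^sup>+\<eta>. h1 \<eta> \<partial>lborel)" by (rule nn_integral_cmult) measurable
    also have "\<dots> \<le> ennreal (2 * c) * ennreal d" by (intro mult_left_mono h) auto
    finally show ?thesis using c_nonneg d by (simp add: ennreal_mult)
  qed
  have 2: "(\<integral>\<^sup>+y. ennreal (Wt A z y * \<bar>G2 z y\<bar>) * h2 (fst y) \<partial>lborel) \<le> ennreal (2 * c * d)"
  proof -
    have "(\<integral>\<^sup>+y. ennreal (Wt A z y * \<bar>G2 z y\<bar>) * h2 (fst y) \<partial>lborel)
        = (\<integral>\<^sup>+y. case_prod (\<lambda>\<xi> \<eta>. ennreal (Wt A z (\<xi>, \<eta>) * \<bar>G2 z (\<xi>, \<eta>)\<bar>) * h2 \<xi>) y \<partial>lborel)"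
      by (intro nn_integral_cong) (auto split: prod.split)
    also have "\<dots> = (\<integral>\<^sup>+\<xi>. \<integral>\<^sup>+\<eta>. ennreal (Wt A z (\<xi>, \<eta>) * \<bar>G2 z (\<xi>, \<eta>)\<bar>) * h2 \<xi> \<partial>lborel \<partial>lborel)"
      by (rule nn_integral_lborel_pair) (simp add: borel_prod case_prod_beta')
    also have "\<dots> = (\<integral>\<^sup>+\<xi>. (\<integral>\<^sup>+\<eta>. ennreal (Wt A z (\<xi>, \<eta>) * \<bar>G2 z (\<xi>, \<eta>)\<bar>) \<partial>lborel) * h2 \<xi> \<partial>lborel)"
      by (intro nn_integral_cong nn_integral_multc) measurable
    also have "\<dots> \<le> (\<integral>\<^sup>+\<xi>. ennreal (2 * c) * h2 \<xi> \<partial>lborel)"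
      by (intro nn_integral_mono mult_right_mono int_G2) auto
    also have "\<dots> = ennreal (2 * c) * (\<integral>\<^sup>+\<xi>. h2 \<xi> \<partial>lborel)" by (rule nn_integral_cmult) measurable
    also have "\<dots> \<le> ennreal (2 * c) * ennreal d" by (intro mult_left_mono h) auto
    finally show ?thesis using c_nonneg d by (simp add: ennreal_mult)
  qed
  have "(\<integral>\<^sup>+y. ennreal (Wt A z y * \<bar>G1 z y\<bar>) * h1 (snd y) + ennreal (Wt A z y * \<bar>G2 z y\<bar>) * h2 (fst y) \<partial>lborel)
     = (\<integral>\<^sup>+y. ennreal (Wt A z y * \<bar>G1 z y\<bar>) * h1 (snd y) \<partial>lborel) + (\<integral>\<^sup>+y. ennreal (Wt A z y * \<bar>G2 z y\<bar>) * h2 (fst y) \<partial>lborel)"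
    by (rule nn_integral_add) measurable
  also have "\<dots> \<le> ennreal (2 * c * d) + ennreal (2 * c * d)" by (intro add_mono 1 2)
  also have "\<dots> = ennreal (4 * c * d)" using c_nonneg d by (simp add: ennreal_plus[symmetric] del: ennreal_plus)
  finally show ?thesis .
qed

text \<open>The multiplier is at most \<open>K / 3\<close> times the sum of the two partial
  derivatives. One direction is absorbed by the substitution and only the other contributes the side
  \<open>2 * r\<close>, so the bound grows like \<open>r\<close> and not like the area.\<close>

lemma int_box:
  fixes m :: "real \<times> real \<Rightarrow> real"
  assumes r: "0 \<le> r" and K: "0 \<le> K"
    and m: "\<And>y. \<lbrakk>\<bar>fst y - u\<bar> < r; \<bar>snd y - v\<bar> < r\<rbrakk> \<Longrightarrow> m y \<le> K * (norm z * norm (2 *\<^sub>R y - z))"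
  shows "(\<integral>\<^sup>+y. ennreal (m y) * ennreal (Wt A z y) * indicator {y. \<bar>fst y - u\<bar> < r \<and> \<bar>snd y - v\<bar> < r} y \<partial>lborel)
    \<le> ennreal (3 * c * K * r)"
proof -
  have I: "(\<integral>\<^sup>+x. ennreal (K / 3) * indicator {a - r<..<a + r} x \<partial>lborel) \<le> ennreal (2 * r * K / 3)" for a
    using r K by (simp add: nn_integral_cmult_indicator ennreal_mult[symmetric])
  have "(\<integral>\<^sup>+y. ennreal (m y) * ennreal (Wt A z y) * indicator {y. \<bar>fst y - u\<bar> < r \<and> \<bar>snd y - v\<bar> < r} y \<partial>lborel)
     \<le> (\<integral>\<^sup>+y. ennreal (Wt A z y * \<bar>G1 z y\<bar>) * (ennreal (K / 3) * indicator {v - r<..<v + r} (snd y))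
            + ennreal (Wt A z y * \<bar>G2 z y\<bar>) * (ennreal (K / 3) * indicator {u - r<..<u + r} (fst y)) \<partial>lborel)"
  proof (rule nn_integral_mono)
    fix y
    show "ennreal (m y) * ennreal (Wt A z y) * indicator {y. \<bar>fst y - u\<bar> < r \<and> \<bar>snd y - v\<bar> < r} y
      \<le> ennreal (Wt A z y * \<bar>G1 z y\<bar>) * (ennreal (K / 3) * indicator {v - r<..<v + r} (snd y))
            + ennreal (Wt A z y * \<bar>G2 z y\<bar>) * (ennreal (K / 3) * indicator {u - r<..<u + r} (fst y))"
    proof (cases "\<bar>fst y - u\<bar> < r \<and> \<bar>snd y - v\<bar> < r")
      case False then show ?thesis by simp
    next
      case True
      have "m y \<le> (K / 3) * (\<bar>G1 z y\<bar> + \<bar>G2 z y\<bar>)"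
        using m[of y] True mult_left_mono[OF G_lower[of z y], of "K / 3"] K by simp
      then have "m y * Wt A z y \<le> (K / 3) * (\<bar>G1 z y\<bar> + \<bar>G2 z y\<bar>) * Wt A z y"
        by (rule mult_right_mono[OF _ Wt_nonneg])
      also have "\<dots> = Wt A z y * \<bar>G1 z y\<bar> * (K / 3) + Wt A z y * \<bar>G2 z y\<bar> * (K / 3)"
        by (simp add: algebra_simps)
      finally have "ennreal (m y * Wt A z y) \<le> ennreal (Wt A z y * \<bar>G1 z y\<bar> * (K / 3) + Wt A z y * \<bar>G2 z y\<bar> * (K / 3))"
        by (rule ennreal_leI)
      moreover have "snd y \<in> {v - r<..<v + r}" "fst y \<in> {u - r<..<u + r}" using True by auto
      ultimately show ?thesis
        using Wt_nonneg[of A z y] K True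
          by (simp add: ennreal_mult'[symmetric] ennreal_mult''[symmetric] ennreal_mult[symmetric] ennreal_plus[symmetric] del:
            ennreal_plus)
    qed
  qed
  also have "\<dots> \<le> ennreal (4 * c * (2 * r * K / 3))"
    using r K by (intro int_weighted I) auto
  also have "\<dots> \<le> ennreal (3 * c * K * r)"
    using r K c_nonneg by (intro ennreal_leI) (simp add: mult_ac mult_left_mono)
  finally show ?thesis .
qed

lemma int_log_weight:
  fixes r R a :: real
  assumes "0 < r" "0 \<le> R"
  shows "(\<integral>\<^sup>+x. ennreal (2 / (r + \<bar>2 * x - a\<bar>)) * indicator {x. \<bar>2 * x - a\<bar> \<le> R} x \<partial>lborel) \<le> ennreal (2 * ln (1 + R / r))"
proof -
  have half: "(\<integral>\<^sup>+x. ennreal (2 / (r + x)) * indicator {0..R} x \<partial>lborel) = ennreal (2 * ln (1 + R / r))"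
  proof -
    have "(\<integral>\<^sup>+x. ennreal (2 / (r + x)) * indicator {0..R} x \<partial>lborel) = ennreal (2 * ln (r + R) - 2 * ln (r + 0))"
      using assms by (intro nn_integral_FTC_Icc) (auto intro!: derivative_eq_intros simp: add_pos_nonneg)
    also have "2 * ln (r + R) - 2 * ln (r + 0) = 2 * ln (1 + R / r)"
    proof -
      have "1 + R / r = (r + R) / r" using assms by (simp add: field_simps)
      then show ?thesis using assms by (simp add: ln_div)
    qed
    finally show ?thesis .
  qed
  let ?h = "\<lambda>x. ennreal (2 / (r + \<bar>x\<bar>)) * indicator {x. \<bar>x\<bar> \<le> R} x"
  have "(\<integral>\<^sup>+x. ?h x \<partial>lborel) = ennreal 2 * (\<integral>\<^sup>+x. ?h (- a + 2 * x) \<partial>lborel)"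
    using nn_integral_real_affine[of ?h 2 "- a"] by simp
  then have *: "2 * (\<integral>\<^sup>+x. ennreal (2 / (r + \<bar>2 * x - a\<bar>)) * indicator {x. \<bar>2 * x - a\<bar> \<le> R} x \<partial>lborel) = (\<integral>\<^sup>+x. ?h x \<partial>lborel)"
    by (simp add: algebra_simps indicator_def)
  let ?k = "\<lambda>x. ennreal (2 / (r + x)) * indicator {0..R} x"
  have "(\<integral>\<^sup>+x. ?h x \<partial>lborel) \<le> (\<integral>\<^sup>+x. ?k x + ?k (- x) \<partial>lborel)"
    by (intro nn_integral_mono) (auto split: split_indicator simp: abs_if)
  moreover have "(\<integral>\<^sup>+x. ?k x + ?k (- x) \<partial>lborel) = (\<integral>\<^sup>+x. ?k x \<partial>lborel) + (\<integral>\<^sup>+x. ?k (- x) \<partial>lborel)"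
    by (rule nn_integral_add) measurable
  moreover have "(\<integral>\<^sup>+x. ?k (- x) \<partial>lborel) = (\<integral>\<^sup>+x. ?k x \<partial>lborel)"
    using nn_integral_lborel_reflect[of ?k 0] by simp
  ultimately have "2 * (\<integral>\<^sup>+x. ennreal (2 / (r + \<bar>2 * x - a\<bar>)) * indicator {x. \<bar>2 * x - a\<bar> \<le> R} x \<partial>lborel)
    \<le> 2 * ennreal (2 * ln (1 + R / r))"
    unfolding * half mult_2[of "ennreal (2 * ln (1 + R / r))"] by metis
  then show ?thesis by (rule iffD1[OF ennreal_mult_le_mult_iff, rotated 2]) simp_all
qed

text \<open>The gradient degenerates at \<open>y = z / 2\<close>. Where
  \<open>norm (2 *\<^sub>R y - z)\<close> is below \<open>r\<close> the weight is bounded by 1.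
  Elsewhere one divides by the gradient and integrates the reciprocal distance along the
  coordinates, which costs a logarithm.\<close>

lemma int_ball:
  assumes z: "z \<noteq> 0" and R: "0 \<le> R" and w1: "\<And>x. w x \<le> 1"
  shows "(\<integral>\<^sup>+y. ennreal (Wt A z y) * indicator {y. norm (2 *\<^sub>R y - z) \<le> R} y \<partial>lborel)
     \<le> ennreal ((1 + 3 * c * ln (1 + R * sqrt (norm z))) / norm z)"
proof -
  \<comment> \<open>Balances the area of the excised disc with the factor \<open>1 / norm z\<close>
    gained from the gradient outside it.\<close>
  define r where "r = 1 / sqrt (norm z)"
  have r: "0 < r" using z by (simp add: r_def)
  have r2: "r\<^sup>2 = 1 / norm z" using z by (simp add: r_def power_divide)
  define K where "K = 1 / (3 * norm z)"
  have K: "0 \<le> K" by (simp add: K_def)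
  let ?h = "\<lambda>a x. ennreal K * (ennreal (2 / (r + \<bar>2 * x - a\<bar>)) * indicator {x. \<bar>2 * x - a\<bar> \<le> R} x)"
  have I: "(\<integral>\<^sup>+x. ?h a x \<partial>lborel) \<le> ennreal (K * (2 * ln (1 + R / r)))" for a
  proof -
    have "(\<integral>\<^sup>+x. ?h a x \<partial>lborel) = ennreal K * (\<integral>\<^sup>+x. (ennreal (2 / (r + \<bar>2 * x - a\<bar>)) * indicator {x. \<bar>2 * x - a\<bar> \<le> R} x) \<partial>lborel)"
      by (rule nn_integral_cmult) measurable
    also have "\<dots> \<le> ennreal K * ennreal (2 * ln (1 + R / r))"
      by (intro mult_left_mono int_log_weight r R) auto
    finally show ?thesis using K by (simp add: ennreal_mult')
  qed
  have "(\<integral>\<^sup>+y. ennreal (Wt A z y) * indicator {y. norm (2 *\<^sub>R y - z) \<le> R} y \<partial>lborel)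
     \<le> (\<integral>\<^sup>+y. indicator {y. \<bar>fst z / 2 - fst y\<bar> < r / 2 \<and> \<bar>snd z / 2 - snd y\<bar> < r / 2} y
          + (ennreal (Wt A z y * \<bar>G1 z y\<bar>) * ?h (snd z) (snd y) + ennreal (Wt A z y * \<bar>G2 z y\<bar>) * ?h (fst z) (fst y)) \<partial>lborel)"
  proof (rule nn_integral_mono)
    fix y :: "real \<times> real"
    define \<omega> where "\<omega> = 2 *\<^sub>R y - z"
    have f: "\<bar>2 * fst y - fst z\<bar> \<le> norm \<omega>" "\<bar>2 * snd y - snd z\<bar> \<le> norm \<omega>"
      using norm_fst_le[of "fst \<omega>" "snd \<omega>"] norm_snd_le[of "snd \<omega>" "fst \<omega>"]
      unfolding prod.collapse by (auto simp: \<omega>_def)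
    show "ennreal (Wt A z y) * indicator {y. norm (2 *\<^sub>R y - z) \<le> R} y
      \<le> indicator {y. \<bar>fst z / 2 - fst y\<bar> < r / 2 \<and> \<bar>snd z / 2 - snd y\<bar> < r / 2} y
          + (ennreal (Wt A z y * \<bar>G1 z y\<bar>) * ?h (snd z) (snd y) + ennreal (Wt A z y * \<bar>G2 z y\<bar>) * ?h (fst z) (fst y))"
    proof -
      consider "norm \<omega> > R" | "norm \<omega> < r" | "norm \<omega> \<le> R" "r \<le> norm \<omega>" by linarith
      then show ?thesis
      proof cases
        case 1 then show ?thesis by (simp add: \<omega>_def)
      next
        case 2
        then have i: "y \<in> {y. \<bar>fst z / 2 - fst y\<bar> < r / 2 \<and> \<bar>snd z / 2 - snd y\<bar> < r / 2}"
          using f by (auto simp: abs_if split: if_splits)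
        have "ennreal (Wt A z y) * indicator {y. norm (2 *\<^sub>R y - z) \<le> R} y \<le> 1"
          using w1 by (auto simp: Wt_def split: split_indicator)
        then show ?thesis unfolding indicator_simps(1)[OF i] by (rule order_trans) (rule add_increasing2, simp_all)
      next
        case 3
        have wpos: "0 < norm \<omega>" using 3 r by linarith
        \<comment> \<open>\<open>norm \<omega>\<close> dominates both \<open>r\<close> and
          \<open>t\<close>, hence half of \<open>r + t\<close>. This replaces the two-dimensional
          distance by a function of one coordinate, as \<open>int_weighted\<close> requires.\<close>
        have h: "1 / norm \<omega> \<le> 2 / (r + t)" if "t \<le> norm \<omega>" "0 \<le> t" for t
          using that 3 r wpos by (simp add: field_simps)
        have "1 = K * (3 * (norm z * norm \<omega>)) * (1 / norm \<omega>)" using wpos z by (simp add: K_def)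
        also have "\<dots> \<le> K * (\<bar>G1 z y\<bar> + \<bar>G2 z y\<bar>) * (1 / norm \<omega>)"
          using G_lower[of z y] K wpos by (intro mult_right_mono mult_left_mono) (auto simp: \<omega>_def)
        also have "\<dots> = K * \<bar>G1 z y\<bar> * (1 / norm \<omega>) + K * \<bar>G2 z y\<bar> * (1 / norm \<omega>)" by (simp add: algebra_simps)
        also have "\<dots> \<le> K * \<bar>G1 z y\<bar> * (2 / (r + \<bar>2 * snd y - snd z\<bar>)) + K * \<bar>G2 z y\<bar> * (2 / (r + \<bar>2 * fst y - fst z\<bar>))"
          using f K by (intro add_mono mult_left_mono h) auto
        finally have "Wt A z y * 1 \<le> Wt A z y * (K * \<bar>G1 z y\<bar> * (2 / (r + \<bar>2 * snd y - snd z\<bar>)) + K * \<bar>G2 z y\<bar> * (2 / (r + \<bar>2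
          * fst y - fst z\<bar>)))"
          by (rule mult_left_mono[OF _ Wt_nonneg])
        then have "ennreal (Wt A z y) \<le> ennreal (Wt A z y * \<bar>G1 z y\<bar> * (K * (2 / (r + \<bar>2 * snd y - snd z\<bar>))) + Wt A z y * \<bar>G2 z y\<bar>
          * (K * (2 / (r + \<bar>2 * fst y - fst z\<bar>))))"
          by (intro ennreal_leI) (simp add: algebra_simps)
        also have "\<dots> = ennreal (Wt A z y * \<bar>G1 z y\<bar> * (K * (2 / (r + \<bar>2 * snd y - snd z\<bar>)))) + ennreal (Wt A z y * \<bar>G2 z y\<bar> * (K
          * (2 / (r + \<bar>2 * fst y - fst z\<bar>))))"
          using r K Wt_nonneg[of A z y] by (intro ennreal_plus) auto
        also have "\<dots> = ennreal (Wt A z y * \<bar>G1 z y\<bar>) * ?h (snd z) (snd y) + ennreal (Wt A z y * \<bar>G2 z y\<bar>) * ?h (fst z) (fst y)"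
        proof -
          have e: "ennreal (a * (K * t)) = ennreal a * (ennreal K * ennreal t)" if "0 \<le> a" "0 \<le> t" for a t
            using that K by (simp add: ennreal_mult)
          have i: "indicator {x. \<bar>2 * x - snd z\<bar> \<le> R} (snd y) = (1::ennreal)" "indicator {x. \<bar>2 * x - fst z\<bar> \<le> R} (fst y)
            = (1::ennreal)"
            using f 3 by auto
          show ?thesis unfolding i using r Wt_nonneg[of A z y] by (simp only: mult_1_right) (subst (1 2) e, auto)
        qed
        finally show ?thesis using 3 by (simp add: \<omega>_def add_increasing)
      qed
    qed
  qed
  also have "\<dots> = (\<integral>\<^sup>+y. indicator {y. \<bar>fst z / 2 - fst y\<bar> < r / 2 \<and> \<bar>snd z / 2 - snd y\<bar> < r / 2} y \<partial>lborel)
      + (\<integral>\<^sup>+y. (ennreal (Wt A z y * \<bar>G1 z y\<bar>) * ?h (snd z) (snd y) + ennreal (Wt A z y * \<bar>G2 z y\<bar>) * ?h (fst z) (fst y)) \<partial>lborel)"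
    by (rule nn_integral_add) measurable
  also have "\<dots> \<le> ennreal (4 * (r / 2)\<^sup>2) + ennreal (4 * c * (K * (2 * ln (1 + R / r))))"
    using r R K by (intro add_mono int_weighted I, intro eq_refl nn_integral_box) auto
  also have "\<dots> = ennreal (1 / norm z + 4 * c * (K * (2 * ln (1 + R / r))))"
    using r R K c_nonneg by (simp add: r2 power_divide ennreal_plus[symmetric] del: ennreal_plus)
  also have "\<dots> \<le> ennreal ((1 + 3 * c * ln (1 + R * sqrt (norm z))) / norm z)"
  proof (rule ennreal_leI)
    have "R / r = R * sqrt (norm z)" by (simp add: r_def)
    moreover have "0 \<le> c * ln (1 + R * sqrt (norm z)) / norm z" using R c_nonneg by simp
    ultimately show "1 / norm z + 4 * c * (K * (2 * ln (1 + R / r))) \<le> (1 + 3 * c * ln (1 + R * sqrt (norm z))) / norm z"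
      using z R c_nonneg by (simp add: K_def field_simps)
  qed
  finally show ?thesis .
qed

end

section \<open>The symbol and the resonance function\<close>

lemma jbr_real_ge: "(1 + \<bar>x\<bar>) / 2 \<le> jbr (x::real)"
proof -
  have "(1 + \<bar>x\<bar>)\<^sup>2 \<le> 4 * (1 + x\<^sup>2)"
    using sum_squares_ge_zero[of "\<bar>x\<bar> - 1" "\<bar>x\<bar>"] by (simp add: power2_eq_square algebra_simps)
  then have "(1 + \<bar>x\<bar>) \<le> sqrt (4 * (1 + x\<^sup>2))" by (rule real_le_rsqrt)
  moreover have "sqrt (4 * (1 + x\<^sup>2)) = 2 * sqrt (1 + x\<^sup>2)" by (simp only: real_sqrt_mult real_sqrt_four)
  ultimately show ?thesis by (simp add: jbr_def)
qed

lemma nn_integral_affine_decay: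
  assumes "1 < a"
  shows "(\<integral>\<^sup>+x. ennreal ((1 + x) powr (- a)) * indicator {0..} x \<partial>lborel) = ennreal (1 / (a - 1))"
proof -
  have "((\<lambda>x. - ((1 + x) powr (1 - a) / (a - 1))) \<longlongrightarrow> 0) at_top"
  proof -
    have "((\<lambda>x. (1 + x) powr (1 - a)) \<longlongrightarrow> 0) at_top"
      by (rule tendsto_neg_powr) (use assms in \<open>auto intro: filterlim_tendsto_add_at_top filterlim_ident tendsto_const\<close>)
    from tendsto_minus[OF tendsto_divide[OF this tendsto_const[of "a - 1"]]] assms
    show ?thesis by simp
  qed
  then have "(\<integral>\<^sup>+x. ennreal ((1 + x) powr (- a)) * indicator {0..} x \<partial>lborel) = ennreal (0 - (- ((1 + 0) powr (1 - a) / (a - 1))))"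
  proof (rule nn_integral_FTC_atLeast[rotated 3])
    fix x :: real assume "0 \<le> x"
    then have "((\<lambda>x. (1 + x) powr (1 - a)) has_real_derivative (1 - a) * (1 + x) powr (1 - a - 1)) (at x)"
      by (auto intro!: derivative_eq_intros)
    then show "((\<lambda>x. - ((1 + x) powr (1 - a) / (a - 1))) has_real_derivative (1 + x) powr (- a)) (at x)"
    proof -
      have "- ((1 - a) * P / (a - 1)) = P" for P using assms by (simp add: field_simps)
      moreover have "1 - a - 1 = - a" by simp
      ultimately show ?thesis
        using DERIV_minus[OF DERIV_cdivide[OF \<open>((\<lambda>x. (1 + x) powr (1 - a)) has_real_derivative (1 - a) * (1 + x) powr (1 - a - 1))
          (at x)\<close>, of "a - 1"]] by simp
    qed
  qed auto
  then show ?thesis using assms by simp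
qed

lemma jbr_powr_integrable:
  assumes "1 < a"
  shows "\<exists>c\<ge>0. (\<integral>\<^sup>+x. ennreal (jbr (x::real) powr (- a)) \<partial>lborel) \<le> ennreal c"
proof -
  let ?k = "\<lambda>x. ennreal (2 powr a) * (ennreal ((1 + x) powr (- a)) * indicator {0..} x)"
  have "(\<integral>\<^sup>+x. ennreal (jbr (x::real) powr (- a)) \<partial>lborel) \<le> (\<integral>\<^sup>+x. ?k x + ?k (- x) \<partial>lborel)"
  proof (rule nn_integral_mono)
    fix x :: real
    have "jbr x powr (- a) \<le> ((1 + \<bar>x\<bar>) / 2) powr (- a)"
      using assms by (intro powr_mono2' jbr_real_ge) auto
    also have "\<dots> = 2 powr a * (1 + \<bar>x\<bar>) powr (- a)" by (simp add: powr_divide powr_minus field_simps)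
    finally have "ennreal (jbr x powr (- a)) \<le> ennreal (2 powr a) * ennreal ((1 + \<bar>x\<bar>) powr (- a))"
      by (simp add: ennreal_mult[symmetric])
    also have "\<dots> \<le> ?k x + ?k (- x)"
      by (cases "0 \<le> x") (auto simp: add_increasing add_increasing2 split: split_indicator)
    finally show "ennreal (jbr x powr (- a)) \<le> ?k x + ?k (- x)" .
  qed
  also have "\<dots> = (\<integral>\<^sup>+x. ?k x \<partial>lborel) + (\<integral>\<^sup>+x. ?k (- x) \<partial>lborel)" by (rule nn_integral_add) measurable
  also have "(\<integral>\<^sup>+x. ?k (- x) \<partial>lborel) = (\<integral>\<^sup>+x. ?k x \<partial>lborel)"
    using nn_integral_lborel_reflect[of ?k 0] by simp
  also have "(\<integral>\<^sup>+x. ?k x \<partial>lborel) = ennreal (2 powr a * (1 / (a - 1)))"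
    by (subst nn_integral_cmult) (use assms in \<open>auto simp: nn_integral_affine_decay ennreal_mult''[symmetric]\<close>)
  finally have F: "(\<integral>\<^sup>+x. ennreal (jbr (x::real) powr (- a)) \<partial>lborel) \<le> ennreal (2 powr a * (1 / (a - 1))) + ennreal (2 powr a
    * (1 / (a - 1)))" .
  have Q: "0 \<le> 2 powr a * (1 / (a - 1))" using assms by simp
  show ?thesis
    by (rule exI[of _ "2 powr a * (1 / (a - 1)) + 2 powr a * (1 / (a - 1))"])
      (simp only: ennreal_plus[OF Q Q] F add_nonneg_nonneg[OF Q Q] simp_thms)
qed

lemma jbr_Peetre: "jbr (x - y) \<le> sqrt 2 * (jbr x * jbr y)"
proof -
  have "(norm (x - y))\<^sup>2 \<le> (norm x + norm y)\<^sup>2" by (intro power_mono norm_triangle_ineq4) simp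
  also have "\<dots> \<le> 2 * (norm x)\<^sup>2 + 2 * (norm y)\<^sup>2"
    using sum_squares_bound[of "norm x" "norm y"] by (simp add: power2_sum)
  finally have "1 + (norm (x - y))\<^sup>2 \<le> 2 * ((1 + (norm x)\<^sup>2) * (1 + (norm y)\<^sup>2))"
    by (simp add: algebra_simps) (smt (verit) mult_nonneg_nonneg zero_le_power2)
  then show ?thesis unfolding jbr_def real_sqrt_mult[symmetric] by (rule real_sqrt_le_mono)
qed

lemma jbr_le_norm: "1 \<le> norm x \<Longrightarrow> jbr x \<le> 2 * norm x"
proof -
  assume "1 \<le> norm x"
  then have "1 \<le> (norm x)\<^sup>2" by (simp add: one_le_power)
  then have "jbr x \<le> sqrt (4 * (norm x)\<^sup>2)" unfolding jbr_def by (intro real_sqrt_le_mono) simp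
  then show ?thesis by (simp add: real_sqrt_mult)
qed

lemma inner2_bound: "\<bar>a * c + b * d\<bar> \<le> norm (a, b) * norm (c, d :: real)"
  using Cauchy_Schwarz_ineq2[of "(a, b)" "(c, d)"] by (simp add: inner_prod_def inner_real_def)

text \<open>Off the origin the vector is (cos 2a, sin 2a), where a is the polar angle; at the origin
  division by zero gives the zero vector.\<close>

lemma m_norm_le: "norm (m1 p, m2 p) \<le> 1"
proof -
  have *: "((fst p)\<^sup>2 - (snd p)\<^sup>2)\<^sup>2 + (2 * fst p * snd p)\<^sup>2 = ((fst p)\<^sup>2 + (snd p)\<^sup>2)\<^sup>2"
    by (simp add: power2_eq_square algebra_simps)
  have "(m1 p)\<^sup>2 + (m2 p)\<^sup>2 \<le> 1"
    unfolding m1_def m2_def power_divide add_divide_distrib[symmetric] * by simp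
  then show ?thesis by (simp add: norm_Pair)
qed

text \<open>Up to the factor \<open>\<i> / 2\<close> the symbol is the inner product of the
  reflected output frequency (xi, -eta) with a sum of two vectors of norm at most 1.\<close>

lemma N_symb_le_freq: "cmod (N_symb \<zeta> \<zeta>1) \<le> norm (sp \<zeta>)"
proof -
  define p1 where "p1 = sp \<zeta>1"
  define p2 where "p2 = sp (\<zeta> - \<zeta>1)"
  have "cmod (N_symb \<zeta> \<zeta>1) = \<bar>fst \<zeta> * (m1 p1 + m1 p2) - fst (snd \<zeta>) * (m2 p1 + m2 p2)\<bar> / 2"
    unfolding N_symb_def Let_def norm_mult norm_of_real p1_def p2_def sp_def by (simp add: norm_divide)
  also have "\<dots> \<le> (\<bar>fst \<zeta> * m1 p1 + (- fst (snd \<zeta>)) * m2 p1\<bar> + \<bar>fst \<zeta> * m1 p2 + (- fst (snd \<zeta>)) * m2 p2\<bar>) / 2"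
    by (simp add: algebra_simps)
  also have "\<dots> \<le> (norm (fst \<zeta>, - fst (snd \<zeta>)) * 1 + norm (fst \<zeta>, - fst (snd \<zeta>)) * 1) / 2"
    by (intro divide_right_mono add_mono order_trans[OF inner2_bound] mult_left_mono m_norm_le) auto
  also have "\<dots> = norm (sp \<zeta>)" by (simp add: sp_def norm_Pair)
  finally show ?thesis .
qed

definition resH :: "pt \<Rightarrow> pt \<Rightarrow> real"
  where "resH \<zeta> \<zeta>1 = phi (sp \<zeta>) - phi (sp \<zeta>1) - phi (sp (\<zeta> - \<zeta>1))"

text \<open>In complex notation the symmetrised symbol is
  \<open>Re (z1 cnj z2) Re (z z1 z2) / \<bar>z1 z2\<bar>\<^sup>2\<close>, and \<open>3 Re (z z1 z2)\<close> is the resonance function.\<close>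

lemma N_symb_le_res: "3 * (norm (sp \<zeta>1) * norm (sp (\<zeta> - \<zeta>1))) * cmod (N_symb \<zeta> \<zeta>1) \<le> \<bar>resH \<zeta> \<zeta>1\<bar>"
proof -
  obtain a b t where z1: "\<zeta>1 = (a, b, t)" by (cases \<zeta>1)
  obtain c d u where z2: "\<zeta> - \<zeta>1 = (c, d, u)" by (cases "\<zeta> - \<zeta>1")
  have s1: "sp \<zeta>1 = (a, b)" unfolding sp_def z1 by simp
  have s2: "sp (\<zeta> - \<zeta>1) = (c, d)" unfolding sp_def z2 by simp
  have z: "\<zeta> = (a + c, b + d, t + u)" using z1 z2 by (cases \<zeta>) auto
  define D where "D = (a + c) * (m1 (a, b) + m1 (c, d)) - (b + d) * (m2 (a, b) + m2 (c, d))"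
  define E where "E = (a + c) * (a * c - b * d) - (b + d) * (a * d + b * c)"
  have N: "cmod (N_symb \<zeta> \<zeta>1) = \<bar>D\<bar> / 2"
    unfolding N_symb_def Let_def norm_mult norm_of_real D_def by (simp add: z z1 norm_divide)
  have H: "resH \<zeta> \<zeta>1 = 3 * E"
    by (simp add: resH_def sp_def z z1 phi_def E_def power2_eq_square power3_eq_cube algebra_simps)
  show ?thesis
  proof (cases "(a, b) = 0 \<or> (c, d) = 0")
    case True
    then have "norm (sp \<zeta>1) * norm (sp (\<zeta> - \<zeta>1)) = 0" unfolding s1 s2 by auto
    then show ?thesis by (simp only: mult_zero_left mult_zero_right abs_ge_zero)
  next
    case False
    define A where "A = a\<^sup>2 + b\<^sup>2"
    define B where "B = c\<^sup>2 + d\<^sup>2"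
    have AB: "A > 0" "B > 0" using False by (auto simp: A_def B_def zero_prod_def sum_power2_gt_zero_iff)
    have nA: "norm (a, b) = sqrt A" "norm (c, d) = sqrt B" by (auto simp: A_def B_def norm_Pair)
    \<comment> \<open>Once denominators are cleared, \<open>E\<close> splits off as a factor. The
      cofactor is an inner product of the inputs, so Cauchy-Schwarz lets one of the two powers of
      \<open>sqrt A * sqrt B\<close> be cancelled.\<close>
    have "D * (A * B) = (a + c) * ((a\<^sup>2 - b\<^sup>2) * B + (c\<^sup>2 - d\<^sup>2) * A) - (b + d) * ((2 * a * b) * B + (2 * c * d) * A)"
      unfolding D_def m1_def m2_def using AB by (simp add: A_def[symmetric] B_def[symmetric] field_simps)
    also have "\<dots> = 2 * (a * c + b * d) * E"
      unfolding A_def B_def E_def by (simp add: power2_eq_square algebra_simps)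
    finally have "\<bar>D\<bar> * (A * B) = 2 * \<bar>a * c + b * d\<bar> * \<bar>E\<bar>"
      using AB by (metis abs_mult abs_numeral abs_of_pos mult_pos_pos)
    also have "\<dots> \<le> 2 * (sqrt A * sqrt B) * \<bar>E\<bar>"
      using inner2_bound[of a c b d] unfolding nA by (intro mult_right_mono mult_left_mono) auto
    finally have "(\<bar>D\<bar> / 2 * (sqrt A * sqrt B)) * (sqrt A * sqrt B) \<le> \<bar>E\<bar> * (sqrt A * sqrt B)"
      using AB by (simp add: mult_ac)
    then have "\<bar>D\<bar> / 2 * (sqrt A * sqrt B) \<le> \<bar>E\<bar>"
      using AB by (subst (asm) mult_le_cancel_right) auto
    then show ?thesis unfolding N H s1 s2 nA by (simp add: abs_mult mult_ac)
  qed
qed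

lemma md_minus [simp]: "md (- x) = - md x"
  by (simp add: md_def sp_def phi_def)

lemma resH_md: "resH \<zeta> \<zeta>1 = md \<zeta>1 + md (\<zeta> - \<zeta>1) - md \<zeta>"
  by (simp add: resH_def md_def)

lemma resH_bound: "\<bar>resH \<zeta> \<zeta>1\<bar> \<le> \<bar>md \<zeta>\<bar> + \<bar>md \<zeta>1\<bar> + \<bar>md (\<zeta> - \<zeta>1)\<bar>"
  unfolding resH_md by linarith

lemma powr_split: "0 \<le> x \<Longrightarrow> x powr (1 - a) * x powr a = (x::real)"
  by (cases "x = 0") (auto simp: powr_add[symmetric])

text \<open>The symbol is written as the product of its powers \<open>1 - \<theta>\<close> and
  \<open>\<theta>\<close>. The first gets the bound by the output frequency, the second the
  resonance bound, whose factor \<open>jbr \<sigma> powr \<theta>\<close> cancels against the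
  weight. For \<open>\<sigma>\<close> the largest modulation is inserted.\<close>

lemma N_symb_interp:
  assumes th: "0 < \<theta>" "\<theta> < 1" and n: "0 < norm (sp \<zeta>1)" "0 < norm (sp (\<zeta> - \<zeta>1))"
    and H: "\<bar>resH \<zeta> \<zeta>1\<bar> \<le> 3 * \<bar>\<sigma>\<bar>"
  shows "cmod (N_symb \<zeta> \<zeta>1) * jbr \<sigma> powr (- \<theta>)
    \<le> norm (sp \<zeta>) powr (1 - \<theta>) * (norm (sp \<zeta>1) * norm (sp (\<zeta> - \<zeta>1))) powr (- \<theta>)"
proof -
  let ?N = "cmod (N_symb \<zeta> \<zeta>1)" and ?p = "norm (sp \<zeta>1) * norm (sp (\<zeta> - \<zeta>1))"
  have p: "0 < ?p" using n by simp
  have "?p * ?N \<le> jbr \<sigma>"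
    using N_symb_le_res[of \<zeta>1 \<zeta>] H norm_le_jbr[of \<sigma>] by (simp add: mult.assoc)
  then have "?N \<le> jbr \<sigma> / ?p" using p by (simp add: field_simps)
  then have "?N powr \<theta> \<le> (jbr \<sigma> / ?p) powr \<theta>" using th by (intro powr_mono2) auto
  moreover have "?N powr (1 - \<theta>) \<le> norm (sp \<zeta>) powr (1 - \<theta>)" using th by (intro powr_mono2 N_symb_le_freq) auto
  ultimately have "?N powr (1 - \<theta>) * ?N powr \<theta> \<le> norm (sp \<zeta>) powr (1 - \<theta>) * (jbr \<sigma> / ?p) powr \<theta>"
    by (intro mult_mono) auto
  then have "?N \<le> norm (sp \<zeta>) powr (1 - \<theta>) * (jbr \<sigma> / ?p) powr \<theta>"
    by (simp add: powr_split)
  then have "?N * jbr \<sigma> powr (- \<theta>) \<le> norm (sp \<zeta>) powr (1 - \<theta>) * (jbr \<sigma> / ?p) powr \<theta> * jbr \<sigma> powr (- \<theta>)"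
    by (rule mult_right_mono) simp
  also have "\<dots> = norm (sp \<zeta>) powr (1 - \<theta>) * ?p powr (- \<theta>)"
    using p jbr_pos[of \<sigma>] by (simp add: powr_divide powr_minus field_simps)
  finally show ?thesis .
qed

text \<open>\<open>- \<rho>\<close> is the regularity at which the trilinear estimate is proved;
  larger regularities follow in \<open>bilinear_aux\<close>. The lower bound 5/8 gives
  \<open>\<epsilon> \<le> 1 / 80\<close> and makes the exponent
  \<open>4 * \<epsilon> - 2 * \<rho> + 1\<close> in \<open>mb_bound\<close> at most -1/5, so that
  the dyadic sum converges.\<close>

locale nv_params =
  fixes \<rho> \<epsilon> :: real
  assumes rho: "5 / 8 \<le> \<rho>" "\<rho> < 3 / 4" and eps_def: "\<epsilon> = (3 / 4 - \<rho>) / 10"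
begin

lemma eps: "0 < \<epsilon>" "\<epsilon> \<le> 1 / 80" "4 * \<rho> = 3 - 40 * \<epsilon>"
  using rho eps_def by (auto simp: field_simps)

text \<open>\<open>\<epsilon>\<close> is the regularity to spare. The nonlinearity is estimated with modulation exponent \<open>- th\<close>, where
  \<open>bb + th = 1 - \<epsilon> < 1\<close> leaves a positive power of the existence time in the Duhamel estimate.\<close>

definition bb :: real where "bb = 1 / 2 + \<epsilon>"
definition th :: real where "th = 1 / 2 - 2 * \<epsilon>"
definition wt :: "real \<Rightarrow> real" where "wt x = jbr x powr (- (2 * bb))"
text \<open>Chosen by \<open>SOME\<close> so that the constant has a name that later constants and
  definitions can refer to; \<open>KL\<close>, \<open>CB\<close>, \<open>CS\<close> and
  \<open>KC\<close> are fixed in the same way.\<close>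

definition cw :: real where "cw = (SOME c. c \<ge> 0 \<and> (\<integral>\<^sup>+x. ennreal (wt x) \<partial>lborel) \<le> ennreal c)"

lemma cw: "0 \<le> cw" "(\<integral>\<^sup>+x. ennreal (wt x) \<partial>lborel) \<le> ennreal cw"
proof -
  have "\<exists>c. c \<ge> 0 \<and> (\<integral>\<^sup>+x. ennreal (wt x) \<partial>lborel) \<le> ennreal c"
    unfolding wt_def using eps by (intro jbr_powr_integrable) (simp add: bb_def)
  from someI_ex[OF this] show "0 \<le> cw" "(\<integral>\<^sup>+x. ennreal (wt x) \<partial>lborel) \<le> ennreal cw"
    by (auto simp: cw_def)
qed

lemma wt_le_1: "wt x \<le> 1"
  unfolding wt_def using powr_mono2'[of "- (2 * bb)" 1 "jbr x"] jbr_ge_1[of x] eps by (simp add: bb_def)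

sublocale pair_phase wt cw
proof
  show "wt \<in> borel_measurable borel" unfolding wt_def by measurable
qed (use cw in \<open>auto simp: wt_def\<close>)

text \<open>\<open>m\<close> is what remains of the symbol and the spatial weights once the
  modulation of the outer variable is spent or discarded; only the weights of the other two
  modulations are left.\<close>

definition pairk :: "(real \<times> real \<Rightarrow> real \<times> real \<Rightarrow> real) \<Rightarrow> pt \<Rightarrow> pt \<Rightarrow> ennreal"
  where "pairk m \<zeta> \<zeta>1 = ennreal (m (sp \<zeta>) (sp \<zeta>1) * jbr (md \<zeta>1) powr (- bb) * jbr (md (\<zeta> - \<zeta>1)) powr (- bb))"

abbreviation mmeas :: "(real \<times> real \<Rightarrow> real \<times> real \<Rightarrow> real) \<Rightarrow> bool"
  where "mmeas m \<equiv> case_prod m \<in> borel_measurable (borel \<Otimes>\<^sub>M borel)"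

lemma mmeas_comp:
  assumes "mmeas m" "u \<in> borel_measurable M" "v \<in> borel_measurable M"
  shows "(\<lambda>x. m (u x) (v x)) \<in> borel_measurable M"
  using measurable_compose[OF measurable_Pair[OF assms(2,3)] assms(1)] by simp

lemma kmeas_pairk: "mmeas m \<Longrightarrow> kmeas (pairk m)"
proof -
  assume "mmeas m"
  note [measurable] = mmeas_comp[OF this]
  show ?thesis unfolding pairk_def by measurable
qed

lemma pairk_sq:
  assumes "mmeas m" and m0: "\<And>z y. 0 \<le> m z y"
    and S[measurable]: "Measurable.pred borel S"
    and K: "\<And>A. (\<integral>\<^sup>+y. ennreal ((m (sp \<zeta>) y)\<^sup>2) * ennreal (Wt A (sp \<zeta>) y) * indicator {y. S y} y \<partial>lborel) \<le> ennreal K"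
  shows "(\<integral>\<^sup>+\<zeta>1. (pairk m \<zeta> \<zeta>1)\<^sup>2 * indicator {\<zeta>1. S (sp \<zeta>1)} \<zeta>1 \<partial>lborel) \<le> ennreal (cw * K)"
proof -
  note [measurable] = mmeas_comp[OF assms(1)]
  have "(\<integral>\<^sup>+\<zeta>1. (pairk m \<zeta> \<zeta>1)\<^sup>2 * indicator {\<zeta>1. S (sp \<zeta>1)} \<zeta>1 \<partial>lborel)
    = (\<integral>\<^sup>+\<zeta>1. (\<lambda>y. ennreal ((m (sp \<zeta>) y)\<^sup>2) * indicator {y. S y} y) (sp \<zeta>1) * ennreal (jbr (md \<zeta>1) powr (- (2 * bb))) * ennreal (jbr
      (md (\<zeta> - \<zeta>1)) powr (- (2 * bb))) \<partial>lborel)"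
  proof (rule nn_integral_cong)
    fix \<zeta>1
    have sq: "(jbr x powr (- bb))\<^sup>2 = jbr x powr (- (2 * bb))" for x :: real
      by (simp add: power2_eq_square powr_add[symmetric])
    show "(pairk m \<zeta> \<zeta>1)\<^sup>2 * indicator {\<zeta>1. S (sp \<zeta>1)} \<zeta>1 = (\<lambda>y. ennreal ((m (sp \<zeta>) y)\<^sup>2) * indicator {y. S y} y) (sp \<zeta>1)
      * ennreal (jbr (md \<zeta>1) powr (- (2 * bb))) * ennreal (jbr (md (\<zeta> - \<zeta>1)) powr (- (2 * bb)))"
      unfolding pairk_def sq[symmetric]
      by (simp add: m0 ennreal_power power_mult_distrib ennreal_mult mult_ac split: split_indicator)
  qed
  also have "\<dots> \<le> (\<integral>\<^sup>+x. ennreal (jbr (x::real) powr (- (2 * bb))) \<partial>lborel) * ennreal K"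
    by (rule nn_integral_pair_weights) (use K in \<open>simp_all add: Wt_def wt_def mult_ac\<close>)
  also have "\<dots> \<le> ennreal cw * ennreal K" using cw(2) by (intro mult_right_mono) (auto simp: wt_def)
  finally show ?thesis using cw(1) by (simp add: ennreal_mult')
qed

lemma tri_bdd_pairk:
  assumes m: "mmeas m" and m0: "\<And>z y. 0 \<le> m z y" and K0: "0 \<le> K"
    and K: "\<And>A z. (\<integral>\<^sup>+y. ennreal ((m z y)\<^sup>2) * ennreal (Wt A z y) \<partial>lborel) \<le> ennreal K"
  shows "\<exists>D\<ge>0. tri_bdd (pairk m) (ennreal D)"
proof (intro exI conjI)
  \<comment> \<open>The summand 1 keeps the constant positive if \<open>cw * K\<close> is zero, as
    \<open>tri_bdd_sup\<close> demands.\<close>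
  show "tri_bdd (pairk m) (ennreal (sqrt (cw * K) + 1))"
  proof (rule tri_bdd_sup[OF kmeas_pairk[OF m]])
    show "0 < sqrt (cw * K) + 1" using cw(1) K0 by (simp add: add_nonneg_pos)
    fix \<zeta>
    have "(\<integral>\<^sup>+\<zeta>1. (pairk m \<zeta> \<zeta>1)\<^sup>2 \<partial>lborel) \<le> ennreal (cw * K)"
      using pairk_sq[OF m m0, of "\<lambda>_. True" \<zeta> K] K by simp
    also have "\<dots> \<le> ennreal ((sqrt (cw * K) + 1)\<^sup>2)"
      using cw(1) K0 by (intro ennreal_leI) (simp add: power2_sum)
    finally show "(\<integral>\<^sup>+\<zeta>1. (pairk m \<zeta> \<zeta>1)\<^sup>2 \<partial>lborel) \<le> ennreal ((sqrt (cw * K) + 1)\<^sup>2)" .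
  qed
  show "0 \<le> sqrt (cw * K) + 1" using cw(1) K0 by simp
qed

lemma tri_bdd_pairk_dyadic:
  assumes m: "mmeas m" and m0: "\<And>z y. 0 \<le> m z y" and K0: "0 \<le> K" and c: "0 < c"
    and K: "\<And>A z r u v. \<lbrakk>1 \<le> r; norm z \<le> r; r \<le> 2 * max 1 (norm z)\<rbrakk> \<Longrightarrow>
      (\<integral>\<^sup>+y. ennreal ((m z y)\<^sup>2) * ennreal (Wt A z y) * indicator {y. \<bar>fst y - u\<bar> < r \<and> \<bar>snd y - v\<bar> < r} y \<partial>lborel) \<le> ennreal
        (K * r powr (- (2 * c)))"
  shows "\<exists>D\<ge>0. tri_bdd (pairk m) (ennreal D)"
proof (rule tri_bdd_dyadic[OF kmeas_pairk[OF m]])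
  show "0 < sqrt (cw * K) + 1" using cw(1) K0 by (simp add: add_nonneg_pos)
  show "0 < c" by fact
  fix r u v :: real and \<zeta> :: pt
  assume r: "1 \<le> r" "norm (sp \<zeta>) \<le> r" "r \<le> 2 * max 1 (norm (sp \<zeta>))"
  have "(\<integral>\<^sup>+\<zeta>1. (pairk m \<zeta> \<zeta>1)\<^sup>2 * indicator {\<zeta>1. (\<lambda>y. \<bar>fst y - u\<bar> < r \<and> \<bar>snd y - v\<bar> < r) (sp \<zeta>1)} \<zeta>1 \<partial>lborel)
    \<le> ennreal (cw * (K * r powr (- (2 * c))))"
    by (rule pairk_sq[OF m m0]) (measurable, use K[OF r] in auto)
  also have "\<dots> \<le> ennreal (((sqrt (cw * K) + 1) * r powr (- c))\<^sup>2)"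
  proof (rule ennreal_leI)
    have "(cw * K) * r powr (- (2 * c)) \<le> (sqrt (cw * K) + 1)\<^sup>2 * r powr (- (2 * c))"
      using cw(1) K0 by (intro mult_right_mono) (auto simp: power2_sum)
    also have eq: "r powr (- (2 * c)) = (r powr (- c))\<^sup>2" by (simp add: power2_eq_square powr_add[symmetric])
    finally show "cw * (K * r powr (- (2 * c))) \<le> ((sqrt (cw * K) + 1) * r powr (- c))\<^sup>2"
      by (simp only: eq power_mult_distrib mult.assoc)
  qed
  finally show "(\<integral>\<^sup>+\<zeta>1. (pairk m \<zeta> \<zeta>1)\<^sup>2 * indicator (bx r u v) \<zeta>1 \<partial>lborel) \<le> ennreal (((sqrt (cw * K) + 1) * r powr (- c))\<^sup>2)"
    by (simp add: sp_def)
qed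

end

section \<open>The trilinear estimate\<close>

lemma N_symb_refl: "N_symb \<zeta> (\<zeta> - \<zeta>1) = N_symb \<zeta> \<zeta>1"
  by (simp add: N_symb_def Let_def algebra_simps)

lemma N_symb_measurable: "case_prod N_symb \<in> borel_measurable (borel \<Otimes>\<^sub>M borel)"
  unfolding N_symb_def Let_def m1_def m2_def by (simp add: case_prod_beta')

lemma N_symb_comp:
  "u \<in> borel_measurable M \<Longrightarrow> v \<in> borel_measurable M \<Longrightarrow> (\<lambda>x. N_symb (u x) (v x)) \<in> borel_measurable M"
  using measurable_compose[OF measurable_Pair N_symb_measurable] by simp

context nv_params
begin

text \<open>Net loss in powers of an input frequency: \<open>\<rho>\<close> from the Sobolev weight
  minus the gain \<open>th\<close> from the resonance. A squared kernel contains four such losses,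
  and \<open>4 * aa \<le> 1\<close> is one form in which the threshold enters.\<close>

definition aa :: real where "aa = \<rho> - th"

lemma aa: "0 < aa" "aa \<le> 1 / 4" "aa = \<rho> - 1 / 2 + 2 * \<epsilon>"
  using rho eps by (auto simp: aa_def th_def)

lemma th: "0 < th" "th < 1" using eps by (auto simp: th_def)

text \<open>Spatial part of the kernel after \<open>N_symb_interp\<close>: the bound for the symbol
  multiplied by the Sobolev weights, with \<open>z\<close> the output and \<open>y\<close>,
  \<open>z - y\<close> the inputs.\<close>

definition mu :: "real \<times> real \<Rightarrow> real \<times> real \<Rightarrow> real"
  where "mu z y = norm z powr (1 - th) * jbr z powr (- \<rho>) * (norm y * norm (z - y)) powr (- th) * (jbr y * jbr (z - y)) powr \<rho>"

lemma mu_nonneg: "0 \<le> mu z y" unfolding mu_def by simp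

lemma low_factor:
  assumes "1 \<le> norm y"
  shows "norm y powr (- th) * jbr y powr \<rho> \<le> 2 * norm (y::real \<times> real) powr aa"
proof -
  have "jbr y powr \<rho> \<le> (2 * norm y) powr \<rho>"
    using rho jbr_pos[of y] by (intro powr_mono2 jbr_le_norm assms) auto
  also have "\<dots> = 2 powr \<rho> * norm y powr \<rho>" by (simp add: powr_mult)
  also have "\<dots> \<le> 2 * norm y powr \<rho>"
    using rho powr_mono[of \<rho> 1 2] by (intro mult_right_mono) auto
  finally have "norm y powr (- th) * jbr y powr \<rho> \<le> norm y powr (- th) * (2 * norm y powr \<rho>)"
    by (rule mult_left_mono) simp
  also have "\<dots> = 2 * norm y powr aa"
    by (simp add: aa_def powr_diff powr_minus field_simps)
  finally show ?thesis .
qed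

lemma mu_le:
  assumes "1 \<le> norm y" "1 \<le> norm (z - y)"
  shows "mu z y \<le> 4 * (norm z powr (1 - th) * jbr z powr (- \<rho>)) * (norm y powr aa * norm (z - y) powr aa)"
proof -
  have "mu z y = (norm z powr (1 - th) * jbr z powr (- \<rho>)) * ((norm y powr (- th) * jbr y powr \<rho>) * (norm (z - y) powr (- th)
    * jbr (z - y) powr \<rho>))"
    using jbr_pos[of y] jbr_pos[of "z - y"] unfolding mu_def by (simp add: powr_mult mult_ac)
  also have "\<dots> \<le> (norm z powr (1 - th) * jbr z powr (- \<rho>)) * ((2 * norm y powr aa) * (2 * norm (z - y) powr aa))"
    by (intro mult_left_mono mult_mono low_factor assms) auto
  finally show ?thesis by (simp add: mult_ac)
qed

text \<open>If an input frequency is at most \<open>1\<close> (\<open>m0\<close>), the output modulation is not needed. Otherwise one of the three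
  modulations dominates the resonance function: \<open>ma\<close>, \<open>mb\<close> treat the output modulation and \<open>mc\<close>, \<open>me\<close> that of the first factor;
  in \<open>mb\<close> and \<open>me\<close> the frequency held fixed is much smaller than the other two, and one localises to boxes.\<close>

definition m0 :: "real \<times> real \<Rightarrow> real \<times> real \<Rightarrow> real"
  where "m0 z y = (if norm y \<le> 1 then 4 * norm z else 0)"
definition ma :: "real \<times> real \<Rightarrow> real \<times> real \<Rightarrow> real"
  where "ma z y = (if 1 \<le> norm y \<and> 1 \<le> norm (z - y) \<and> norm y \<le> 4 * norm z \<and> norm (z - y) \<le> 4 * norm z then mu z y else 0)"
definition mb :: "real \<times> real \<Rightarrow> real \<times> real \<Rightarrow> real"
  where "mb z y = (if 1 \<le> norm y \<and> 1 \<le> norm (z - y) \<and> (4 * norm z < norm y \<or> 4 * norm z < norm (z - y)) then mu z y else 0)"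
definition mc :: "real \<times> real \<Rightarrow> real \<times> real \<Rightarrow> real"
  where "mc z y = (if 1 \<le> norm z \<and> 1 \<le> norm (y - z) \<and> norm y \<le> 4 * norm z then mu y z else 0)"
definition me :: "real \<times> real \<Rightarrow> real \<times> real \<Rightarrow> real"
  where "me z y = (if 1 \<le> norm z \<and> 1 \<le> norm (y - z) \<and> 4 * norm z < norm y then mu y z else 0)"

lemma mmeas_all: "mmeas m0" "mmeas ma" "mmeas mb" "mmeas mc" "mmeas me"
  unfolding m0_def ma_def mb_def mc_def me_def mu_def by measurable

lemma m_nonneg: "0 \<le> m0 z y" "0 \<le> ma z y" "0 \<le> mb z y" "0 \<le> mc z y" "0 \<le> me z y"
  by (auto simp: m0_def ma_def mb_def mc_def me_def mu_nonneg)

text \<open>Absorbs the logarithm of \<open>int_ball\<close> into a small power. The radius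
  \<open>9 * n\<close> bounds \<open>norm (2 *\<^sub>R y - z)\<close> when
  \<open>norm y \<le> 4 * n\<close>, and 1/4 is the least output frequency that \<open>ma\<close>
  allows with inputs of size at least 1.\<close>

lemma log_bound: "\<exists>K\<ge>0. \<forall>n\<ge>1/4. 1 + 3 * cw * ln (1 + 9 * n * sqrt n) \<le> K * n powr (2 * \<epsilon>)"
proof (intro exI conjI allI impI)
  show "0 \<le> 4 + 3 * cw * (34 / \<epsilon>)" using cw eps by simp
  fix n :: real assume n: "1 / 4 \<le> n"
  let ?t = "1 + 9 * n * sqrt n"
  have "1 / 2 \<le> sqrt n" using n by (intro real_le_rsqrt) (simp add: power2_eq_square)
  then have "n * sqrt n * (1 / 2) \<le> n * sqrt n * sqrt n" using n by (intro mult_left_mono) auto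
  moreover have "n * sqrt n * sqrt n = n\<^sup>2" using n by (simp add: power2_eq_square mult.assoc)
  moreover have "(1 / 4)\<^sup>2 \<le> n\<^sup>2" using n by (intro power_mono) auto
  ultimately have t: "?t \<le> 34 * n\<^sup>2" by (simp add: power2_eq_square)
  have t1: "1 \<le> ?t" using n by simp
  have "ln ?t = (1 / \<epsilon>) * ln (?t powr \<epsilon>)" using t1 eps by (simp add: ln_powr)
  also have "\<dots> \<le> (1 / \<epsilon>) * ?t powr \<epsilon>"
    using eps t1 ln_bound[of "?t powr \<epsilon>"] by (intro mult_left_mono) auto
  also have "?t powr \<epsilon> \<le> (34 * n\<^sup>2) powr \<epsilon>" using t t1 eps by (intro powr_mono2) auto
  also have "\<dots> = 34 powr \<epsilon> * n powr (2 * \<epsilon>)"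
    using n powr_powr[of n 2 \<epsilon>] by (simp add: powr_mult)
  also have "34 powr \<epsilon> \<le> (34::real)" using powr_mono[of \<epsilon> 1 34] eps by simp
  finally have "ln ?t \<le> (34 / \<epsilon>) * n powr (2 * \<epsilon>)" using eps by (simp add: field_simps mult_right_mono)
  then have "3 * cw * ln ?t \<le> 3 * cw * ((34 / \<epsilon>) * n powr (2 * \<epsilon>))" using cw by (intro mult_left_mono) auto
  moreover have "1 \<le> 4 * n powr (2 * \<epsilon>)"
  proof -
    have "(1 / 4) powr 1 \<le> (1 / 4 :: real) powr (2 * \<epsilon>)" using eps by (intro powr_mono') auto
    also have "\<dots> \<le> n powr (2 * \<epsilon>)" using n eps by (intro powr_mono2) auto
    finally show ?thesis by simp
  qed
  ultimately show "1 + 3 * cw * ln ?t \<le> (4 + 3 * cw * (34 / \<epsilon>)) * n powr (2 * \<epsilon>)"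
    by (simp add: algebra_simps)
qed

definition KL :: real where "KL = (SOME K. 0 \<le> K \<and> (\<forall>n\<ge>1/4. 1 + 3 * cw * ln (1 + 9 * n * sqrt n) \<le> K * n powr (2 * \<epsilon>)))"

lemma KL: "0 \<le> KL" "\<And>n. 1 / 4 \<le> n \<Longrightarrow> 1 + 3 * cw * ln (1 + 9 * n * sqrt n) \<le> KL * n powr (2 * \<epsilon>)"
  using someI_ex[OF log_bound[unfolded Bex_def]] unfolding KL_def by auto

text \<open>For the cases in which the free frequency is at most comparable with the fixed one: it
  then ranges in a ball, and no further localisation is needed.\<close>

lemma sq_int_ball:
  assumes n: "1 / 4 \<le> norm z" and B: "0 \<le> B"
    and m: "\<And>y. (m y)\<^sup>2 \<le> B * indicator {y. norm (2 *\<^sub>R y - z) \<le> 9 * norm z} y"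
  shows "(\<integral>\<^sup>+y. ennreal ((m y)\<^sup>2) * ennreal (Wt A z y) \<partial>lborel) \<le> ennreal (B * KL * norm z powr (2 * \<epsilon> - 1))"
proof -
  have "(\<integral>\<^sup>+y. ennreal ((m y)\<^sup>2) * ennreal (Wt A z y) \<partial>lborel)
     \<le> (\<integral>\<^sup>+y. ennreal B * (ennreal (Wt A z y) * indicator {y. norm (2 *\<^sub>R y - z) \<le> 9 * norm z} y) \<partial>lborel)"
  proof (rule nn_integral_mono)
    fix y
    have "ennreal ((m y)\<^sup>2) \<le> ennreal (B * indicator {y. norm (2 *\<^sub>R y - z) \<le> 9 * norm z} y)"
      by (intro ennreal_leI m)
    also have "\<dots> = ennreal B * indicator {y. norm (2 *\<^sub>R y - z) \<le> 9 * norm z} y"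
      by (auto split: split_indicator)
    finally show "ennreal ((m y)\<^sup>2) * ennreal (Wt A z y) \<le> ennreal B * (ennreal (Wt A z y) * indicator {y. norm (2 *\<^sub>R y - z)
      \<le> 9 * norm z} y)"
      using mult_right_mono[of "ennreal ((m y)\<^sup>2)" "ennreal B * indicator {y. norm (2 *\<^sub>R y - z) \<le> 9 * norm z} y"
        "ennreal (Wt A z y)"]
      by (simp add: mult_ac)
  qed
  also have "\<dots> = ennreal B * (\<integral>\<^sup>+y. (ennreal (Wt A z y) * indicator {y. norm (2 *\<^sub>R y - z) \<le> 9 * norm z} y) \<partial>lborel)"
    by (rule nn_integral_cmult) measurable
  also have "\<dots> \<le> ennreal B * ennreal ((1 + 3 * cw * ln (1 + 9 * norm z * sqrt (norm z))) / norm z)"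
    using n by (intro mult_left_mono int_ball wt_le_1) auto
  also have "\<dots> \<le> ennreal B * ennreal (KL * norm z powr (2 * \<epsilon>) / norm z)"
    using n by (intro mult_left_mono ennreal_leI divide_right_mono KL) auto
  also have "\<dots> = ennreal (B * KL * norm z powr (2 * \<epsilon> - 1))"
    using n B KL(1) by (simp add: ennreal_mult[symmetric] powr_diff mult.assoc)
  finally show ?thesis .
qed

text \<open>Both inputs are at most comparable with the output \<open>n\<close>. The squared
  multiplier has exponent \<open>2 * q\<close>, and \<open>int_ball\<close> contributes
  \<open>2 * \<epsilon> - 1\<close>. The sum is \<open>- (1 / 2 + 6 * \<epsilon>)\<close>, far from
  critical.\<close>

lemma ma_bound: "\<exists>D\<ge>0. tri_bdd (pairk ma) (ennreal D)"
proof (rule tri_bdd_pairk[OF mmeas_all(2) m_nonneg(2)])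
  show "0 \<le> 4096 * KL * 4" using KL by simp
  fix A z
  show "(\<integral>\<^sup>+y. ennreal ((ma z y)\<^sup>2) * ennreal (Wt A z y) \<partial>lborel) \<le> ennreal (4096 * KL * 4)"
  proof (cases "1 / 4 \<le> norm z")
    case False
    then have "ma z y = 0" for y by (auto simp: ma_def)
    then show ?thesis by simp
  next
    case True
    define n where "n = norm z"
    have n: "1 / 4 \<le> n" using True by (simp add: n_def)
    define q where "q = \<rho> - 1 / 2 + 6 * \<epsilon>"
    have "(ma z y)\<^sup>2 \<le> (64 * n powr q)\<^sup>2 * indicator {y. norm (2 *\<^sub>R y - z) \<le> 9 * norm z} y" for y
    proof (cases "1 \<le> norm y \<and> 1 \<le> norm (z - y) \<and> norm y \<le> 4 * norm z \<and> norm (z - y) \<le> 4 * norm z")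
      case False
      then show ?thesis by (auto simp: ma_def split: split_indicator)
    next
      case t: True
      have "norm (2 *\<^sub>R y - z) \<le> norm (2 *\<^sub>R y) + norm z" by (rule norm_triangle_ineq4)
      then have i: "norm (2 *\<^sub>R y - z) \<le> 9 * norm z" using t by simp
      have p: "x powr aa \<le> 4 * n powr aa" if "0 \<le> x" "x \<le> 4 * n" for x
      proof -
        have "x powr aa \<le> (4 * n) powr aa" using that aa by (intro powr_mono2) auto
        also have "\<dots> = 4 powr aa * n powr aa" by (simp add: powr_mult)
        also have "\<dots> \<le> 4 * n powr aa" using powr_mono[of aa 1 4] aa by (intro mult_right_mono) auto
        finally show ?thesis .
      qed
      have "ma z y = mu z y" using t by (simp add: ma_def)
      also have "\<dots> \<le> 4 * (norm z powr (1 - th) * jbr z powr (- \<rho>)) * (norm y powr aa * norm (z - y) powr aa)"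
        using t by (intro mu_le) auto
      also have "\<dots> \<le> 4 * (n powr (1 - th) * n powr (- \<rho>)) * ((4 * n powr aa) * (4 * n powr aa))"
        using t n rho norm_le_jbr[of z] unfolding n_def
        by (intro mult_mono mult_left_mono p[unfolded n_def] powr_mono2') auto
      also have "\<dots> = 64 * (n powr (1 - th) * n powr (- \<rho>) * n powr aa * n powr aa)" by (simp add: mult_ac)
      also have "n powr (1 - th) * n powr (- \<rho>) * n powr aa * n powr aa = n powr q"
        unfolding powr_add[symmetric] by (rule arg_cong[where f = "\<lambda>x. n powr x"]) (simp add: q_def aa th_def)
      finally have "(ma z y)\<^sup>2 \<le> (64 * n powr q)\<^sup>2" by (rule power_mono[OF _ m_nonneg(2)])
      then show ?thesis using i by simp
    qed
    from sq_int_ball[OF True _ this]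
    have "(\<integral>\<^sup>+y. ennreal ((ma z y)\<^sup>2) * ennreal (Wt A z y) \<partial>lborel) \<le> ennreal ((64 * n powr q)\<^sup>2 * KL * n powr (2 * \<epsilon> - 1))"
      by (simp add: n_def)
    also have "\<dots> \<le> ennreal (4096 * KL * 4)"
    proof (rule ennreal_leI)
      have "(64 * n powr q)\<^sup>2 * KL * n powr (2 * \<epsilon> - 1) = 4096 * KL * (n powr q * n powr q * n powr (2 * \<epsilon> - 1))"
        by (simp add: power2_eq_square)
      also have "n powr q * n powr q * n powr (2 * \<epsilon> - 1) = n powr (- (1 / 2 + 6 * \<epsilon>))"
        unfolding powr_add[symmetric] using eps(3) by (intro arg_cong[where f = "\<lambda>x. n powr x"]) (simp add: q_def)
      \<comment> \<open>A negative power is largest at the smallest admissible \<open>n\<close>,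
        which is 1/4.\<close>
      also have "\<dots> \<le> (1 / 4) powr (- (1 / 2 + 6 * \<epsilon>))"
        using n eps by (intro powr_mono2') auto
      also have "\<dots> \<le> (1 / 4) powr (- 1)" using eps by (intro powr_mono') auto
      finally show "(64 * n powr q)\<^sup>2 * KL * n powr (2 * \<epsilon> - 1) \<le> 4096 * KL * 4"
        using KL(1) by (simp add: powr_minus mult_left_mono)
    qed
    finally show ?thesis .
  qed
qed

text \<open>The fixed frequency is now an input, and the output \<open>y\<close> may be much
  smaller. The powers of \<open>y\<close> combine to the exponent
  \<open>1 - th - \<rho> \<le> 0\<close> and are harmless. The inputs leave \<open>4 * aa\<close>
  against the gain \<open>2 * \<epsilon> - 1\<close>; the total \<open>- (30 * \<epsilon>)\<close>
  shows that this case is critical at 3/4.\<close>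

lemma mc_bound: "\<exists>D\<ge>0. tri_bdd (pairk mc) (ennreal D)"
proof (rule tri_bdd_pairk[OF mmeas_all(4) m_nonneg(4)])
  show "0 \<le> 4096 * KL" using KL by simp
  fix A z
  show "(\<integral>\<^sup>+y. ennreal ((mc z y)\<^sup>2) * ennreal (Wt A z y) \<partial>lborel) \<le> ennreal (4096 * KL)"
  proof (cases "1 \<le> norm z")
    case False
    then have "mc z y = 0" for y by (auto simp: mc_def)
    then show ?thesis by simp
  next
    case True
    define n where "n = norm z"
    have n: "1 \<le> n" using True by (simp add: n_def)
    have "(mc z y)\<^sup>2 \<le> (64 * n powr (2 * aa))\<^sup>2 * indicator {y. norm (2 *\<^sub>R y - z) \<le> 9 * norm z} y" for y
    proof (cases "1 \<le> norm z \<and> 1 \<le> norm (y - z) \<and> norm y \<le> 4 * norm z")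
      case False
      then show ?thesis by (auto simp: mc_def split: split_indicator)
    next
      case t: True
      have "norm (2 *\<^sub>R y - z) \<le> norm (2 *\<^sub>R y) + norm z" by (rule norm_triangle_ineq4)
      then have i: "norm (2 *\<^sub>R y - z) \<le> 9 * norm z" using t by simp
      have yz: "norm (y - z) \<le> 5 * n" using norm_triangle_ineq4[of y z] t by (simp add: n_def)
      have "norm (y - z) powr aa \<le> (5 * n) powr aa" using yz aa by (intro powr_mono2) auto
      also have "\<dots> = 5 powr aa * n powr aa" by (simp add: powr_mult)
      also have "\<dots> \<le> 5 * n powr aa" using powr_mono[of aa 1 5] aa by (intro mult_right_mono) auto
      finally have p: "norm (y - z) powr aa \<le> 5 * n powr aa" .
      have "norm y powr (1 - th) * jbr y powr (- \<rho>) \<le> jbr y powr (1 - th) * jbr y powr (- \<rho>)"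
        using th by (intro mult_right_mono powr_mono2 norm_le_jbr) auto
      also have "\<dots> = jbr y powr (1 - th - \<rho>)" by (simp add: powr_add[symmetric])
      also have "\<dots> \<le> jbr y powr 0" using jbr_ge_1[of y] rho eps by (intro powr_mono) (auto simp: th_def)
      finally have p2: "norm y powr (1 - th) * jbr y powr (- \<rho>) \<le> 1" using jbr_pos[of y] by simp
      have "mc z y = mu y z" using t by (simp add: mc_def)
      also have "\<dots> \<le> 4 * (norm y powr (1 - th) * jbr y powr (- \<rho>)) * (norm z powr aa * norm (y - z) powr aa)"
        using t by (intro mu_le) auto
      also have "\<dots> \<le> 4 * 1 * (n powr aa * (5 * n powr aa))"
        using p p2 unfolding n_def by (intro mult_mono mult_left_mono) auto
      also have "\<dots> = 20 * n powr (2 * aa)" by (simp add: powr_add[symmetric])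
      also have "\<dots> \<le> 64 * n powr (2 * aa)" by (intro mult_right_mono) auto
      finally have "(mc z y)\<^sup>2 \<le> (64 * n powr (2 * aa))\<^sup>2" by (rule power_mono[OF _ m_nonneg(4)])
      then show ?thesis using i by simp
    qed
    from sq_int_ball[OF _ _ this]
    have "(\<integral>\<^sup>+y. ennreal ((mc z y)\<^sup>2) * ennreal (Wt A z y) \<partial>lborel) \<le> ennreal ((64 * n powr (2 * aa))\<^sup>2 * KL * n powr (2 * \<epsilon> - 1))"
      using n by (simp add: n_def)
    also have "\<dots> \<le> ennreal (4096 * KL)"
    proof (rule ennreal_leI)
      have "(64 * n powr (2 * aa))\<^sup>2 * KL * n powr (2 * \<epsilon> - 1) = 4096 * KL * (n powr (2 * aa) * n powr (2 * aa) * n powr (2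
        * \<epsilon> - 1))"
        by (simp add: power2_eq_square)
      also have "n powr (2 * aa) * n powr (2 * aa) * n powr (2 * \<epsilon> - 1) = n powr (- (30 * \<epsilon>))"
        unfolding powr_add[symmetric] using eps(3) by (intro arg_cong[where f = "\<lambda>x. n powr x"]) (simp add: aa)
      also have "4096 * KL * n powr (- (30 * \<epsilon>)) \<le> 4096 * KL * n powr 0"
        using n eps KL(1) by (intro mult_left_mono powr_mono) auto
      finally show "(64 * n powr (2 * aa))\<^sup>2 * KL * n powr (2 * \<epsilon> - 1) \<le> 4096 * KL"
        using n by simp
    qed
    finally show ?thesis .
  qed
qed

section \<open>Interactions in which the frequency held fixed is small\<close>

lemma half_powr:
  fixes r x p :: real
  assumes "0 < r" "r / 2 \<le> x" "- 2 \<le> p" "p \<le> 0"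
  shows "x powr p \<le> 4 * r powr p"
proof -
  have "x powr p \<le> (r / 2) powr p" using assms by (intro powr_mono2') auto
  also have "\<dots> = (1 / 2) powr p * r powr p" using assms powr_mult[of "1 / 2" r p] by simp
  also have "\<dots> \<le> (1 / 2) powr (- 2) * r powr p" using assms by (intro mult_right_mono powr_mono') auto
  also have "(1 / 2) powr (- 2) = (4::real)" by (simp add: powr_minus powr_divide)
  finally show ?thesis .
qed

text \<open>Two high inputs produce a low output \<open>z\<close>. In the squared multiplier,
  \<open>norm y powr (4 * aa)\<close> is at most \<open>norm (2 *\<^sub>R y - z)\<close> because
  \<open>4 * aa \<le> 1\<close>, and the powers of \<open>norm z\<close> contain a full factor
  \<open>norm z\<close>. Together they form the gradient that \<open>int_box\<close> requires. The
  remaining power of \<open>jbr z\<close> beats the box side \<open>r\<close>, which uses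
  \<open>\<rho> \<ge> 5 / 8\<close>.\<close>

lemma mb_bound: "\<exists>D\<ge>0. tri_bdd (pairk mb) (ennreal D)"
proof (rule tri_bdd_pairk_dyadic[OF mmeas_all(3) m_nonneg(3)])
  show "0 \<le> 3 * cw * 1024" using cw by simp
  show "0 < (1 / 10 :: real)" by simp
  fix A :: real and z :: "real \<times> real" and r u v :: real
  assume r: "1 \<le> r" "norm z \<le> r" "r \<le> 2 * max 1 (norm z)"
  define K where "K = 256 * jbr z powr (4 * \<epsilon> - 2 * \<rho>)"
  have m: "(mb z y)\<^sup>2 \<le> K * (norm z * norm (2 *\<^sub>R y - z))" for y
  proof (cases "1 \<le> norm y \<and> 1 \<le> norm (z - y) \<and> (4 * norm z < norm y \<or> 4 * norm z < norm (z - y))")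
    case False
    then show ?thesis unfolding mb_def by (auto simp: K_def)
  next
    case t: True
    have tri: "norm (z - y) \<le> norm z + norm y" "norm y \<le> norm z + norm (z - y)" "2 * norm y \<le> norm (2 *\<^sub>R y - z) + norm z"
      using norm_triangle_ineq4[of z y] norm_triangle_ineq4[of z "z - y"] norm_triangle_ineq[of "2 *\<^sub>R y - z" z] by auto
    have zy: "norm (z - y) \<le> 2 * norm y" and y2: "norm y \<le> norm (2 *\<^sub>R y - z)" using t tri by auto
    have "norm (z - y) powr aa \<le> (2 * norm y) powr aa" using zy aa by (intro powr_mono2) auto
    also have "\<dots> = 2 powr aa * norm y powr aa" by (simp add: powr_mult)
    also have "\<dots> \<le> 2 * norm y powr aa" using powr_mono[of aa 1 2] aa by (intro mult_right_mono) auto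
    finally have p: "norm (z - y) powr aa \<le> 2 * norm y powr aa" .
    have "mb z y = mu z y" using t by (simp add: mb_def)
    also have "\<dots> \<le> 4 * (norm z powr (1 - th) * jbr z powr (- \<rho>)) * (norm y powr aa * norm (z - y) powr aa)"
      using t by (intro mu_le) auto
    also have "\<dots> \<le> 4 * (norm z powr (1 - th) * jbr z powr (- \<rho>)) * (norm y powr aa * (2 * norm y powr aa))"
      by (intro mult_left_mono p) auto
    finally have "(mb z y)\<^sup>2 \<le> (4 * (norm z powr (1 - th) * jbr z powr (- \<rho>)) * (norm y powr aa * (2 * norm y powr aa)))\<^sup>2"
      by (intro power_mono m_nonneg)
    also have "\<dots> = 64 * (norm z powr (1 - th) * norm z powr (1 - th)) * (jbr z powr (- \<rho>) * jbr z powr (- \<rho>)) * (norm y powr aa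
      * norm y powr aa * norm y powr aa * norm y powr aa)"
      by (simp add: power2_eq_square mult_ac)
    \<comment> \<open>Here \<open>2 * (1 - th) = 1 + 4 * \<epsilon>\<close>; the full power is set
      aside as a factor of the gradient.\<close>
    also have "norm z powr (1 - th) * norm z powr (1 - th) = norm z * norm z powr (4 * \<epsilon>)"
    proof (cases "z = 0")
      case False
      have "norm z * norm z powr (4 * \<epsilon>) = norm z powr 1 * norm z powr (4 * \<epsilon>)" using False by simp
      then show ?thesis unfolding powr_add[symmetric] by (simp add: th_def)
    qed simp
    also have "jbr z powr (- \<rho>) * jbr z powr (- \<rho>) = jbr z powr (- 2 * \<rho>)"
      unfolding powr_add[symmetric] by simp
    also have "norm y powr aa * norm y powr aa * norm y powr aa * norm y powr aa = norm y powr (4 * aa)"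
      unfolding powr_add[symmetric] by simp
    also have "norm y powr (4 * aa) \<le> norm y powr 1" using t aa by (intro powr_mono) auto
    also have "norm y powr 1 \<le> norm (2 *\<^sub>R y - z)" using y2 t by simp
    also have "norm z powr (4 * \<epsilon>) \<le> jbr z powr (4 * \<epsilon>)" using eps by (intro powr_mono2 norm_le_jbr) auto
    finally have "(mb z y)\<^sup>2 \<le> 64 * (norm z * jbr z powr (4 * \<epsilon>)) * jbr z powr (- 2 * \<rho>) * norm (2 *\<^sub>R y - z)"
      by (simp add: mult_left_mono mult_right_mono)
    also have "\<dots> = 64 * (jbr z powr (4 * \<epsilon>) * jbr z powr (- 2 * \<rho>)) * (norm z * norm (2 *\<^sub>R y - z))" by (simp add: mult_ac)
    also have "jbr z powr (4 * \<epsilon>) * jbr z powr (- 2 * \<rho>) = jbr z powr (4 * \<epsilon> - 2 * \<rho>)"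
      unfolding powr_add[symmetric] by simp
    also have "64 * jbr z powr (4 * \<epsilon> - 2 * \<rho>) * (norm z * norm (2 *\<^sub>R y - z)) \<le> K * (norm z * norm (2 *\<^sub>R y - z))"
      by (intro mult_right_mono) (auto simp: K_def)
    finally show ?thesis .
  qed
  have "(\<integral>\<^sup>+y. ennreal ((mb z y)\<^sup>2) * ennreal (Wt A z y) * indicator {y. \<bar>fst y - u\<bar> < r \<and> \<bar>snd y - v\<bar> < r} y \<partial>lborel)
    \<le> ennreal (3 * cw * K * r)"
    using r m by (intro int_box) (auto simp: K_def)
  also have "\<dots> \<le> ennreal (3 * cw * 1024 * r powr (- (2 * (1 / 10))))"
  proof (rule ennreal_leI)
    have "max 1 (norm z) \<le> jbr z" using jbr_ge_1[of z] norm_le_jbr[of z] by simp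
    then have "jbr z powr (4 * \<epsilon> - 2 * \<rho>) \<le> 4 * r powr (4 * \<epsilon> - 2 * \<rho>)"
      using r rho eps by (intro half_powr) auto
    then have "K * r \<le> 256 * (4 * r powr (4 * \<epsilon> - 2 * \<rho>)) * r powr 1"
      unfolding K_def using r by (intro mult_mono mult_left_mono) auto
    also have "\<dots> = 1024 * r powr (4 * \<epsilon> - 2 * \<rho> + 1)" by (simp add: powr_add)
    also have "r powr (4 * \<epsilon> - 2 * \<rho> + 1) \<le> r powr (- (2 * (1 / 10)))"
      using r rho eps by (intro powr_mono) auto
    finally have "K * r \<le> 1024 * r powr (- (2 * (1 / 10)))" by simp
    from mult_left_mono[OF this, of "3 * cw"] cw
    show "3 * cw * K * r \<le> 3 * cw * 1024 * r powr (- (2 * (1 / 10)))" by (simp add: mult.assoc)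
  qed
  finally show "(\<integral>\<^sup>+y. ennreal ((mb z y)\<^sup>2) * ennreal (Wt A z y) * indicator {y. \<bar>fst y - u\<bar> < r \<and> \<bar>snd y - v\<bar> < r} y \<partial>lborel)
      \<le> ennreal (3 * cw * 1024 * r powr (- (2 * (1 / 10))))" .
qed

text \<open>A low input \<open>z\<close> has the dominant modulation, while the output
  \<open>y\<close> and the other input are high. The powers of \<open>y\<close> nearly cancel and
  leave \<open>4 * \<epsilon>\<close>. A whole power of \<open>norm y\<close> can therefore be split
  off for the gradient, and the excess \<open>norm y powr (8 * \<epsilon> - 1)\<close> is bounded by
  the same negative power of the smaller \<open>norm z\<close>, which yields decay in
  \<open>r\<close>.\<close>

lemma me_bound: "\<exists>D\<ge>0. tri_bdd (pairk me) (ennreal D)"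
proof (rule tri_bdd_pairk_dyadic[OF mmeas_all(5) m_nonneg(5)])
  show "0 \<le> 3 * cw * 1024" using cw by simp
  show "0 < (1 / 10 :: real)" by simp
  fix A :: real and z :: "real \<times> real" and r u v :: real
  assume r: "1 \<le> r" "norm z \<le> r" "r \<le> 2 * max 1 (norm z)"
  show "(\<integral>\<^sup>+y. ennreal ((me z y)\<^sup>2) * ennreal (Wt A z y) * indicator {y. \<bar>fst y - u\<bar> < r \<and> \<bar>snd y - v\<bar> < r} y \<partial>lborel)
      \<le> ennreal (3 * cw * 1024 * r powr (- (2 * (1 / 10))))"
  proof (cases "1 \<le> norm z")
    case False
    then have "me z y = 0" for y by (auto simp: me_def)
    then show ?thesis by simp
  next
    case n: True
    define p where "p = 2 * aa - 2 + 8 * \<epsilon>"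
    define K where "K = 64 * norm z powr p"
    have m: "(me z y)\<^sup>2 \<le> K * (norm z * norm (2 *\<^sub>R y - z))" for y
    proof (cases "1 \<le> norm z \<and> 1 \<le> norm (y - z) \<and> 4 * norm z < norm y")
      case False
      then show ?thesis unfolding me_def by (auto simp: K_def)
    next
      case t: True
      have tri: "norm (y - z) \<le> norm y + norm z" "2 * norm y \<le> norm (2 *\<^sub>R y - z) + norm z"
        using norm_triangle_ineq4[of y z] norm_triangle_ineq[of "2 *\<^sub>R y - z" z] by auto
      have zy: "norm (y - z) \<le> 2 * norm y" and y2: "norm y \<le> norm (2 *\<^sub>R y - z)" using t tri by auto
      have y0: "0 < norm y" using t by (auto intro: le_less_trans[of 0 "4 * norm z"])
      have "norm (y - z) powr aa \<le> (2 * norm y) powr aa" using zy aa by (intro powr_mono2) auto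
      also have "\<dots> = 2 powr aa * norm y powr aa" by (simp add: powr_mult)
      also have "\<dots> \<le> 2 * norm y powr aa" using powr_mono[of aa 1 2] aa by (intro mult_right_mono) auto
      finally have p: "norm (y - z) powr aa \<le> 2 * norm y powr aa" .
      have "me z y = mu y z" using t by (simp add: me_def)
      also have "\<dots> \<le> 4 * (norm y powr (1 - th) * jbr y powr (- \<rho>)) * (norm z powr aa * norm (y - z) powr aa)"
        using t by (intro mu_le) auto
      also have "\<dots> \<le> 4 * (norm y powr (1 - th) * norm y powr (- \<rho>)) * (norm z powr aa * (2 * norm y powr aa))"
        using p y0 rho norm_le_jbr[of y] by (intro mult_mono mult_left_mono powr_mono2') auto
      also have "\<dots> = 8 * norm z powr aa * (norm y powr (1 - th) * norm y powr (- \<rho>) * norm y powr aa)" by (simp add: mult_ac)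
      also have "norm y powr (1 - th) * norm y powr (- \<rho>) * norm y powr aa = norm y powr (4 * \<epsilon>)"
        unfolding powr_add[symmetric] by (rule arg_cong[where f = "\<lambda>x. norm y powr x"]) (simp add: aa th_def)
      finally have "(me z y)\<^sup>2 \<le> (8 * norm z powr aa * norm y powr (4 * \<epsilon>))\<^sup>2"
        by (intro power_mono m_nonneg)
      also have "\<dots> = 64 * (norm z powr aa * norm z powr aa) * (norm y powr (4 * \<epsilon>) * norm y powr (4 * \<epsilon>))"
        by (simp add: power2_eq_square)
      also have "norm y powr (4 * \<epsilon>) * norm y powr (4 * \<epsilon>) = norm y powr 1 * norm y powr (8 * \<epsilon> - 1)"
        unfolding powr_add[symmetric] by simp
      also have "norm y powr 1 * norm y powr (8 * \<epsilon> - 1) \<le> norm (2 *\<^sub>R y - z) * norm z powr (8 * \<epsilon> - 1)"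
        using y2 y0 t n eps by (intro mult_mono powr_mono2') auto
      also have "64 * (norm z powr aa * norm z powr aa) * (norm (2 *\<^sub>R y - z) * norm z powr (8 * \<epsilon> - 1))
        = 64 * (norm z powr aa * norm z powr aa * norm z powr (8 * \<epsilon> - 1)) * norm (2 *\<^sub>R y - z)" by (simp add: mult_ac)
      also have "norm z powr aa * norm z powr aa * norm z powr (8 * \<epsilon> - 1) = norm z powr p * norm z powr 1"
        unfolding powr_add[symmetric] by (rule arg_cong[where f = "\<lambda>x. norm z powr x"]) (simp add: p_def)
      finally show ?thesis using n by (simp add: K_def mult_left_mono mult_right_mono mult_ac)
    qed
    have "(\<integral>\<^sup>+y. ennreal ((me z y)\<^sup>2) * ennreal (Wt A z y) * indicator {y. \<bar>fst y - u\<bar> < r \<and> \<bar>snd y - v\<bar> < r} y \<partial>lborel)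
      \<le> ennreal (3 * cw * K * r)"
      using r m by (intro int_box) (auto simp: K_def)
    also have "\<dots> \<le> ennreal (3 * cw * 1024 * r powr (- (2 * (1 / 10))))"
    proof (rule ennreal_leI)
      have "norm z powr p \<le> 4 * r powr p"
        using r n aa eps by (intro half_powr) (auto simp: p_def)
      then have "K * r \<le> 64 * (4 * r powr p) * r powr 1"
        unfolding K_def using r by (intro mult_mono mult_left_mono) auto
      also have "\<dots> = 256 * r powr (p + 1)" by (simp add: powr_add)
      also have "\<dots> \<le> 1024 * r powr (p + 1)" by (intro mult_right_mono) auto
      also have "r powr (p + 1) \<le> r powr (- (2 * (1 / 10)))"
        using r aa eps by (intro powr_mono) (auto simp: p_def)
      finally have "K * r \<le> 1024 * r powr (- (2 * (1 / 10)))" by simp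
      from mult_left_mono[OF this, of "3 * cw"] cw
      show "3 * cw * K * r \<le> 3 * cw * 1024 * r powr (- (2 * (1 / 10)))" by (simp add: mult.assoc)
    qed
    finally show ?thesis .
  qed
qed

text \<open>The low input stays in a fixed box, so no dyadic decomposition is involved. For a high
  output the gradient is at least of order \<open>(norm z)\<^sup>2\<close> and pays for the full
  derivative. For \<open>norm z < 4\<close> the squared multiplier is at most 256 and the area of
  the box is 16.\<close>

lemma m0_bound: "\<exists>D\<ge>0. tri_bdd (pairk m0) (ennreal D)"
proof (rule tri_bdd_pairk[OF mmeas_all(1) m_nonneg(1)])
  let ?K = "3 * cw * 32 * 2 + 4096"
  show "0 \<le> ?K" using cw by simp
  fix A z
  have ind: "ennreal ((m0 z y)\<^sup>2) * ennreal (Wt A z y) = ennreal ((m0 z y)\<^sup>2) * ennreal (Wt A z y) * indicator {y. \<bar>fst y - 0\<bar>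
    < 2 \<and> \<bar>snd y - 0\<bar> < 2} y" for y
  proof (cases "norm y \<le> 1")
    case True
    then have "\<bar>fst y\<bar> < 2" "\<bar>snd y\<bar> < 2"
      using norm_fst_le[of "fst y" "snd y"] norm_snd_le[of "snd y" "fst y"] unfolding prod.collapse by auto
    then show ?thesis by simp
  qed (simp add: m0_def)
  show "(\<integral>\<^sup>+y. ennreal ((m0 z y)\<^sup>2) * ennreal (Wt A z y) \<partial>lborel) \<le> ennreal ?K"
  proof (cases "4 \<le> norm z")
    case True
    have m: "(m0 z y)\<^sup>2 \<le> 32 * (norm z * norm (2 *\<^sub>R y - z))" for y
    proof (cases "norm y \<le> 1")
      case y: True
      have "norm z \<le> norm (2 *\<^sub>R y - z) + norm (2 *\<^sub>R y)"
        using norm_triangle_ineq4[of "2 *\<^sub>R y" "2 *\<^sub>R y - z"] by simp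
      then have "norm z \<le> 2 * norm (2 *\<^sub>R y - z)" using y True by simp
      from mult_left_mono[OF this, of "16 * norm z"] y show ?thesis
        by (simp add: m0_def power2_eq_square mult_ac)
    qed (simp add: m0_def)
    have "(\<integral>\<^sup>+y. ennreal ((m0 z y)\<^sup>2) * ennreal (Wt A z y) \<partial>lborel) \<le> ennreal (3 * cw * 32 * 2)"
      by (subst ind) (intro int_box m; simp)
    also have "\<dots> \<le> ennreal ?K" by (intro ennreal_leI) simp
    finally show ?thesis .
  next
    case False
    have "(\<integral>\<^sup>+y. ennreal ((m0 z y)\<^sup>2) * ennreal (Wt A z y) \<partial>lborel)
      \<le> (\<integral>\<^sup>+y. ennreal 256 * indicator {y :: real \<times> real. \<bar>0 - fst y\<bar> < 2 \<and> \<bar>0 - snd y\<bar> < 2} y \<partial>lborel)"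
    proof (subst ind, rule nn_integral_mono)
      fix y
      have "norm z ^ 2 \<le> 4 ^ 2" using False by (intro power_mono) auto
      then have "(m0 z y)\<^sup>2 \<le> 256" by (simp add: m0_def power_mult_distrib)
      then have "ennreal ((m0 z y)\<^sup>2) * ennreal (Wt A z y) \<le> ennreal 256 * 1"
        using wt_le_1 by (intro mult_mono ennreal_leI) (auto simp: Wt_def)
      then show "ennreal ((m0 z y)\<^sup>2) * ennreal (Wt A z y) * indicator {y. \<bar>fst y - 0\<bar> < 2 \<and> \<bar>snd y - 0\<bar> < 2} y
        \<le> ennreal 256 * indicator {y :: real \<times> real. \<bar>0 - fst y\<bar> < 2 \<and> \<bar>0 - snd y\<bar> < 2} y"
        by (auto split: split_indicator)
    qed
    also have "\<dots> = ennreal 256 * ennreal (4 * 2\<^sup>2)"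
      by (subst nn_integral_cmult) (measurable, rule arg_cong[where f = "\<lambda>x. ennreal 256 * x"], rule nn_integral_box, simp)
    also have "\<dots> \<le> ennreal ?K" using cw by (simp add: ennreal_mult[symmetric] del: ennreal_numeral) 
    finally show ?thesis .
  qed
qed

text \<open>Kernel of the trilinear form dual to the bilinear estimate at regularity
  \<open>- \<rho>\<close>: the output weight with modulation exponent \<open>- th\<close>, divided
  by the weights of the two inputs.\<close>

definition Mker :: "pt \<Rightarrow> pt \<Rightarrow> ennreal"
  where "Mker \<zeta> \<zeta>1 = ennreal (cmod (N_symb \<zeta> \<zeta>1) * jbr (sp \<zeta>) powr (- \<rho>) * (jbr (sp \<zeta>1) * jbr (sp (\<zeta> - \<zeta>1))) powr \<rho>
      * jbr (md \<zeta>) powr (- th) * jbr (md \<zeta>1) powr (- bb) * jbr (md (\<zeta> - \<zeta>1)) powr (- bb))"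

lemma Mker_refl: "Mker \<zeta> (\<zeta> - \<zeta>1) = Mker \<zeta> \<zeta>1"
  unfolding Mker_def N_symb_refl by (simp add: mult_ac)

text \<open>By Peetre's inequality the weight of the other input is controlled by that of the
  output, so the Sobolev weights cancel up to the factor 4. The symbol is bounded by the output
  frequency, and the weight of the output modulation by 1.\<close>

lemma Mker_low:
  assumes "norm (sp \<zeta>1) \<le> 1"
  shows "Mker \<zeta> \<zeta>1 \<le> pairk m0 \<zeta> \<zeta>1"
proof -
  let ?z = "sp \<zeta>" and ?y = "sp \<zeta>1" and ?x = "sp (\<zeta> - \<zeta>1)"
  have x: "jbr ?x \<le> sqrt 2 * (jbr ?z * jbr ?y)" unfolding sp_diff by (rule jbr_Peetre)
  have "(norm ?y)\<^sup>2 \<le> 1" using assms by (simp add: power_le_one)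
  then have y: "jbr ?y \<le> sqrt 2" by (simp add: jbr_def)
  have "jbr ?y * jbr ?x \<le> sqrt 2 * (sqrt 2 * (jbr ?z * sqrt 2))"
    using y jbr_pos[of ?x] jbr_pos[of ?z] jbr_pos[of ?y]
    by (intro mult_mono order_trans[OF x] mult_left_mono) auto
  also have "\<dots> = sqrt 8 * jbr ?z" by (simp add: real_sqrt_mult[of 4 2, simplified] mult_ac)
  also have "\<dots> \<le> 4 * jbr ?z" using jbr_pos[of ?z] by (intro mult_right_mono) (auto intro: real_le_lsqrt)
  finally have "(jbr ?y * jbr ?x) powr \<rho> \<le> (4 * jbr ?z) powr \<rho>"
    using jbr_pos[of ?x] jbr_pos[of ?y] rho by (intro powr_mono2) auto
  also have "\<dots> = 4 powr \<rho> * jbr ?z powr \<rho>" using jbr_pos[of ?z] by (simp add: powr_mult)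
  also have "\<dots> \<le> 4 * jbr ?z powr \<rho>" using powr_mono[of \<rho> 1 4] rho by (intro mult_right_mono) auto
  finally have "jbr ?z powr (- \<rho>) * (jbr ?y * jbr ?x) powr \<rho> \<le> jbr ?z powr (- \<rho>) * (4 * jbr ?z powr \<rho>)"
    by (rule mult_left_mono) simp
  also have "\<dots> = 4" using jbr_pos[of ?z] by (simp add: powr_minus)
  finally have w: "jbr ?z powr (- \<rho>) * (jbr ?y * jbr ?x) powr \<rho> \<le> 4" .
  have s: "jbr (md \<zeta>) powr (- th) \<le> 1" using powr_mono2'[of "- th" 1 "jbr (md \<zeta>)"] jbr_ge_1[of "md \<zeta>"] th by simp
  have "cmod (N_symb \<zeta> \<zeta>1) * (jbr ?z powr (- \<rho>) * (jbr ?y * jbr ?x) powr \<rho>) * jbr (md \<zeta>) powr (- th) \<le> norm ?z * 4 * 1"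
    by (intro mult_mono N_symb_le_freq w s) auto
  then have "cmod (N_symb \<zeta> \<zeta>1) * (jbr ?z powr (- \<rho>) * (jbr ?y * jbr ?x) powr \<rho>) * jbr (md \<zeta>) powr (- th) * (jbr (md \<zeta>1) powr (- bb)
    * jbr (md (\<zeta> - \<zeta>1)) powr (- bb))
    \<le> norm ?z * 4 * 1 * (jbr (md \<zeta>1) powr (- bb) * jbr (md (\<zeta> - \<zeta>1)) powr (- bb))"
    by (rule mult_right_mono) simp
  then show ?thesis
    unfolding Mker_def pairk_def m0_def using assms by (intro ennreal_leI) (simp add: mult_ac)
qed

lemma Mker_res0:
  assumes n: "1 \<le> norm (sp \<zeta>1)" "1 \<le> norm (sp (\<zeta> - \<zeta>1))"
    and s: "\<bar>md \<zeta>1\<bar> \<le> \<bar>md \<zeta>\<bar>" "\<bar>md (\<zeta> - \<zeta>1)\<bar> \<le> \<bar>md \<zeta>\<bar>"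
  shows "Mker \<zeta> \<zeta>1 \<le> pairk ma \<zeta> \<zeta>1 + pairk mb \<zeta> \<zeta>1"
proof -
  let ?z = "sp \<zeta>" and ?y = "sp \<zeta>1"
  have N: "cmod (N_symb \<zeta> \<zeta>1) * jbr (md \<zeta>) powr (- th) \<le> norm ?z powr (1 - th) * (norm ?y * norm (sp (\<zeta> - \<zeta>1))) powr (- th)"
    using th n s resH_bound[of \<zeta> \<zeta>1] by (intro N_symb_interp) auto
  have "Mker \<zeta> \<zeta>1 \<le> pairk mu \<zeta> \<zeta>1"
    unfolding Mker_def pairk_def
  proof (rule ennreal_leI)
    let ?c = "jbr ?z powr (- \<rho>) * (jbr ?y * jbr (sp (\<zeta> - \<zeta>1))) powr \<rho> * (jbr (md \<zeta>1) powr (- bb) * jbr (md (\<zeta> - \<zeta>1)) powr (- bb))"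
    from mult_right_mono[OF N, of ?c]
    show "cmod (N_symb \<zeta> \<zeta>1) * jbr ?z powr (- \<rho>) * (jbr ?y * jbr (sp (\<zeta> - \<zeta>1))) powr \<rho> * jbr (md \<zeta>) powr (- th) * jbr (md \<zeta>1) powr
      (- bb) * jbr (md (\<zeta> - \<zeta>1)) powr (- bb)
      \<le> mu ?z ?y * jbr (md \<zeta>1) powr (- bb) * jbr (md (\<zeta> - \<zeta>1)) powr (- bb)"
      by (simp add: mu_def sp_diff mult_ac)
  qed
  also have "pairk mu \<zeta> \<zeta>1 = pairk ma \<zeta> \<zeta>1 \<or> pairk mu \<zeta> \<zeta>1 = pairk mb \<zeta> \<zeta>1"
    using n unfolding pairk_def ma_def mb_def sp_diff by auto
  ultimately show ?thesis by (auto intro: add_increasing add_increasing2)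
qed

text \<open>The symbol consumes a weight of \<open>md \<zeta>1\<close> with exponent
  \<open>th\<close>, but \<open>Mker\<close> provides the exponent \<open>bb\<close> there and only
  \<open>th\<close> at the output. Since \<open>\<zeta>1\<close> has the larger modulation and
  \<open>th < bb\<close>, the exponents may be exchanged (\<open>swap\<close>). The result is a
  kernel of type \<open>pairk\<close> with \<open>\<zeta>1\<close> as the outer variable.\<close>

lemma Mker_res1:
  assumes n: "1 \<le> norm (sp \<zeta>1)" "1 \<le> norm (sp (\<zeta> - \<zeta>1))"
    and s: "\<bar>md \<zeta>\<bar> \<le> \<bar>md \<zeta>1\<bar>" "\<bar>md (\<zeta> - \<zeta>1)\<bar> \<le> \<bar>md \<zeta>1\<bar>"
  shows "Mker \<zeta> \<zeta>1 \<le> pairk mc \<zeta>1 \<zeta> + pairk me \<zeta>1 \<zeta>"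
proof -
  let ?z = "sp \<zeta>" and ?y = "sp \<zeta>1"
  have N: "cmod (N_symb \<zeta> \<zeta>1) * jbr (md \<zeta>1) powr (- th) \<le> norm ?z powr (1 - th) * (norm ?y * norm (sp (\<zeta> - \<zeta>1))) powr (- th)"
    using th n s resH_bound[of \<zeta> \<zeta>1] by (intro N_symb_interp) auto
  have j: "jbr (md \<zeta>) \<le> jbr (md \<zeta>1)"
    using s unfolding jbr_def by (intro real_sqrt_le_mono add_left_mono power_mono) auto
  have swap: "jbr (md \<zeta>) powr (- th) * jbr (md \<zeta>1) powr (- bb) \<le> jbr (md \<zeta>1) powr (- th) * jbr (md \<zeta>) powr (- bb)"
  proof -
    have "jbr (md \<zeta>) powr (bb - th) \<le> jbr (md \<zeta>1) powr (bb - th)"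
      using j jbr_pos[of "md \<zeta>"] eps by (intro powr_mono2) (auto simp: bb_def th_def)
    then have "jbr (md \<zeta>) powr (bb - th) * (jbr (md \<zeta>) powr (- bb) * jbr (md \<zeta>1) powr (- bb))
      \<le> jbr (md \<zeta>1) powr (bb - th) * (jbr (md \<zeta>) powr (- bb) * jbr (md \<zeta>1) powr (- bb))"
      by (rule mult_right_mono) simp
    moreover have "x powr (bb - th) * x powr (- bb) = x powr (- th)" for x :: real
      by (simp add: powr_add[symmetric])
    ultimately show ?thesis by (metis mult.assoc mult.commute)
  qed
  define M where "M = mu ?z ?y * jbr (md \<zeta>) powr (- bb) * jbr (md (\<zeta>1 - \<zeta>)) powr (- bb)"
  have mdc: "jbr (md (\<zeta>1 - \<zeta>)) = jbr (md (\<zeta> - \<zeta>1))"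
    by (metis jbr_minus md_minus minus_diff_eq)
  have "Mker \<zeta> \<zeta>1 \<le> ennreal M"
    unfolding Mker_def
  proof (rule ennreal_leI)
    let ?c = "jbr ?z powr (- \<rho>) * (jbr ?y * jbr (sp (\<zeta> - \<zeta>1))) powr \<rho> * (jbr (md \<zeta>) powr (- bb) * jbr (md (\<zeta> - \<zeta>1)) powr (- bb))"
    let ?d = "cmod (N_symb \<zeta> \<zeta>1) * jbr ?z powr (- \<rho>) * (jbr ?y * jbr (sp (\<zeta> - \<zeta>1))) powr \<rho> * jbr (md (\<zeta> - \<zeta>1)) powr (- bb)"
    have "?d * (jbr (md \<zeta>) powr (- th) * jbr (md \<zeta>1) powr (- bb)) \<le> ?d * (jbr (md \<zeta>1) powr (- th) * jbr (md \<zeta>) powr (- bb))"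
      by (intro mult_left_mono swap) auto
    also have "\<dots> = cmod (N_symb \<zeta> \<zeta>1) * jbr (md \<zeta>1) powr (- th) * ?c" by (simp add: mult_ac)
    also have "\<dots> \<le> norm ?z powr (1 - th) * (norm ?y * norm (sp (\<zeta> - \<zeta>1))) powr (- th) * ?c"
      by (intro mult_right_mono N) auto
    also have "\<dots> = M" unfolding M_def mu_def mdc by (simp add: sp_diff mult_ac)
    finally show "cmod (N_symb \<zeta> \<zeta>1) * jbr ?z powr (- \<rho>) * (jbr ?y * jbr (sp (\<zeta> - \<zeta>1))) powr \<rho> * jbr (md \<zeta>) powr (- th)
      * jbr (md \<zeta>1) powr (- bb) * jbr (md (\<zeta> - \<zeta>1)) powr (- bb) \<le> M"
      by (simp add: mult_ac)
  qed
  moreover have "ennreal M = pairk mc \<zeta>1 \<zeta> \<or> ennreal M = pairk me \<zeta>1 \<zeta>"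
    using n unfolding pairk_def mc_def me_def M_def sp_diff by auto
  ultimately show ?thesis by (auto intro: add_increasing add_increasing2)
qed

text \<open>\<open>kr\<close> and \<open>kl\<close> are the mirror images, under exchange of the
  inputs, of \<open>ks\<close> and of the low-frequency kernel, so the three pointwise estimates
  cover all five regions.\<close>

lemma Mker_bounded: "\<exists>D\<ge>0. tri_bdd Mker (ennreal D)"
proof -
  note km = mmeas_all[THEN kmeas_pairk]
  note [measurable] = km[THEN kmeas_comp]
  obtain D0 Da Db Dc De where D: "0 \<le> D0" "0 \<le> Da" "0 \<le> Db" "0 \<le> Dc" "0 \<le> De"
    and T: "tri_bdd (pairk m0) (ennreal D0)" "tri_bdd (pairk ma) (ennreal Da)" "tri_bdd (pairk mb) (ennreal Db)"
      "tri_bdd (pairk mc) (ennreal Dc)" "tri_bdd (pairk me) (ennreal De)"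
    using m0_bound ma_bound mb_bound mc_bound me_bound by metis
  define ks where "ks = (\<lambda>\<zeta> \<zeta>1. pairk mc \<zeta>1 \<zeta> + pairk me \<zeta>1 \<zeta>)"
  have ksm: "kmeas ks" unfolding ks_def by measurable
  note [measurable] = kmeas_comp[OF ksm]
  have ks: "tri_bdd ks (ennreal Dc + ennreal De)"
    by (rule tri_bdd_swap[OF ksm]) (unfold ks_def, intro tri_bdd_add km T)
  define kr where "kr = (\<lambda>\<zeta> \<zeta>1. ks \<zeta> (\<zeta> - \<zeta>1))"
  have krm: "kmeas kr" unfolding kr_def by measurable
  have kr: "tri_bdd kr (ennreal Dc + ennreal De)"
    by (rule tri_bdd_refl[OF krm]) (simp add: kr_def ks)
  define kl where "kl = (\<lambda>\<zeta> \<zeta>1. pairk m0 \<zeta> (\<zeta> - \<zeta>1))"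
  have klm: "kmeas kl" unfolding kl_def by measurable
  have kl: "tri_bdd kl (ennreal D0)"
    by (rule tri_bdd_refl[OF klm]) (simp add: kl_def T)
  let ?k1 = "\<lambda>\<zeta> \<zeta>1. ks \<zeta> \<zeta>1 + kr \<zeta> \<zeta>1" and ?k2 = "\<lambda>\<zeta> \<zeta>1. pairk m0 \<zeta> \<zeta>1 + kl \<zeta> \<zeta>1" and ?k3 = "\<lambda>\<zeta> \<zeta>1. pairk ma \<zeta> \<zeta>1 + pairk mb \<zeta> \<zeta>1"
  note [measurable] = kmeas_comp[OF krm] kmeas_comp[OF klm]
  have "tri_bdd (\<lambda>\<zeta> \<zeta>1. (?k1 \<zeta> \<zeta>1 + ?k2 \<zeta> \<zeta>1) + ?k3 \<zeta> \<zeta>1)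
      (((ennreal Dc + ennreal De) + (ennreal Dc + ennreal De)) + (ennreal D0 + ennreal D0) + (ennreal Da + ennreal Db))"
    by (intro tri_bdd_add km ksm krm klm ks kr kl T; measurable)
  moreover have "Mker \<zeta> \<zeta>1 \<le> (?k1 \<zeta> \<zeta>1 + ?k2 \<zeta> \<zeta>1) + ?k3 \<zeta> \<zeta>1" for \<zeta> \<zeta>1
  proof -
    consider "norm (sp \<zeta>1) \<le> 1" | "norm (sp (\<zeta> - \<zeta>1)) \<le> 1"
      | "1 \<le> norm (sp \<zeta>1)" "1 \<le> norm (sp (\<zeta> - \<zeta>1))" "\<bar>md \<zeta>1\<bar> \<le> \<bar>md \<zeta>\<bar>" "\<bar>md (\<zeta> - \<zeta>1)\<bar> \<le> \<bar>md \<zeta>\<bar>"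
      | "1 \<le> norm (sp \<zeta>1)" "1 \<le> norm (sp (\<zeta> - \<zeta>1))" "\<bar>md \<zeta>\<bar> \<le> \<bar>md \<zeta>1\<bar>" "\<bar>md (\<zeta> - \<zeta>1)\<bar> \<le> \<bar>md \<zeta>1\<bar>"
      | "1 \<le> norm (sp \<zeta>1)" "1 \<le> norm (sp (\<zeta> - \<zeta>1))" "\<bar>md \<zeta>\<bar> \<le> \<bar>md (\<zeta> - \<zeta>1)\<bar>" "\<bar>md \<zeta>1\<bar> \<le> \<bar>md (\<zeta> - \<zeta>1)\<bar>"
      by linarith
    then show ?thesis
    proof cases
      case 1
      from Mker_low[OF 1, of \<zeta>] show ?thesis by (rule order_trans) (auto intro: add_increasing add_increasing2)
    next
      case 2
      from Mker_low[OF 2, of \<zeta>] show ?thesis unfolding Mker_refl kl_def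
        by (rule order_trans) (auto intro: add_increasing add_increasing2)
    next
      case 3
      from Mker_res0[OF 3] show ?thesis by (rule order_trans) (auto intro: add_increasing add_increasing2)
    next
      case 4
      from Mker_res1[OF 4] show ?thesis unfolding ks_def by (rule order_trans) (auto intro: add_increasing add_increasing2)
    next
      case 5
      have "Mker \<zeta> (\<zeta> - \<zeta>1) \<le> pairk mc (\<zeta> - \<zeta>1) \<zeta> + pairk me (\<zeta> - \<zeta>1) \<zeta>"
        using 5 by (intro Mker_res1) auto
      then show ?thesis unfolding Mker_refl kr_def ks_def by (rule order_trans) (auto intro: add_increasing add_increasing2)
    qed
  qed
  ultimately have "tri_bdd Mker (((ennreal Dc + ennreal De) + (ennreal Dc + ennreal De)) + (ennreal D0 + ennreal D0) + (ennreal Da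
    + ennreal Db))"
    by (rule tri_bdd_mono)
  then show ?thesis
    using D by (intro exI[of _ "((Dc + De) + (Dc + De)) + (D0 + D0) + (Da + Db)"]) (simp add: ennreal_plus[symmetric] del:
      ennreal_plus)
qed

end

section \<open>The bilinear estimate\<close>

lemma power2_powr: "(x powr a)\<^sup>2 = x powr (2 * a)" for x :: real
  by (simp add: power2_eq_square powr_add[symmetric])

text \<open>\<open>bilinear_aux\<close> divides by the bounds on the norms and needs them to be
  positive; letting the excess tend to zero includes inputs of norm zero.\<close>

lemma ennreal_le_limitI:
  assumes "\<And>\<eta>::real. 0 < \<eta> \<Longrightarrow> x \<le> ennreal (C * (r + \<eta>) * (q + \<eta>))"
  shows "x \<le> ennreal (C * r * q)"
proof -
  have "(\<lambda>n. ennreal (C * (r + 1 / real (Suc n)) * (q + 1 / real (Suc n)))) \<longlonglongrightarrow> ennreal (C * (r + 0) * (q + 0))"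
    by (intro tendsto_ennrealI tendsto_mult tendsto_add tendsto_const LIMSEQ_Suc[OF lim_1_over_n])
  moreover have "\<exists>N. \<forall>n\<ge>N. x \<le> ennreal (C * (r + 1 / real (Suc n)) * (q + 1 / real (Suc n)))"
    using assms by auto
  ultimately have "x \<le> ennreal (C * (r + 0) * (q + 0))" by (rule LIMSEQ_le_const)
  then show ?thesis by simp
qed

text \<open>The natural test function is \<open>G\<close> divided by its norm, which may be infinite
  a priori. Truncation in height and in space makes it finite, and monotone convergence removes the
  truncation.\<close>

lemma nn_integral_sq_dual:
  fixes G :: "'a::euclidean_space \<Rightarrow> ennreal"
  assumes [measurable]: "G \<in> borel_measurable borel" and C: "0 \<le> C"
    and D: "\<And>f. sub_unit f \<Longrightarrow> (\<integral>\<^sup>+x. f x * G x \<partial>lborel) \<le> ennreal C"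
  shows "(\<integral>\<^sup>+x. (G x)\<^sup>2 \<partial>lborel) \<le> ennreal (C\<^sup>2)"
proof -
  define g where "g n x = min (G x) (of_nat n) * indicator (ball 0 (real n)) x" for n x
  have [measurable]: "ball (0::'a) r \<in> sets borel" for r by simp
  have g_m[measurable]: "g n \<in> borel_measurable borel" for n unfolding g_def by measurable
  have I: "(\<integral>\<^sup>+x. (g n x)\<^sup>2 \<partial>lborel) \<le> ennreal (C\<^sup>2)" for n
  proof -
    have "(\<integral>\<^sup>+x. (g n x)\<^sup>2 \<partial>lborel) \<le> (\<integral>\<^sup>+x. (of_nat n)\<^sup>2 * indicator (ball (0::'a) (real n)) x \<partial>lborel)"
      by (intro nn_integral_mono) (auto simp: g_def intro!: power_mono split: split_indicator)
    also have "\<dots> = (of_nat n)\<^sup>2 * emeasure lborel (ball (0::'a) (real n))"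
      by (rule nn_integral_cmult_indicator) simp
    also have "\<dots> < top"
      using emeasure_bounded_finite[of "ball (0::'a) (real n)"]
        by (simp add: ennreal_mult_less_top power_less_top_ennreal of_nat_less_top)
    finally obtain r where r: "(\<integral>\<^sup>+x. (g n x)\<^sup>2 \<partial>lborel) = ennreal r" "0 \<le> r"
      by (metis ennreal_cases less_irrefl)
    show ?thesis
    proof (cases "r = 0")
      case True then show ?thesis using r by simp
    next
      case False
      then have rp: "0 < r" using r by simp
      define f where "f x = ennreal (1 / sqrt r) * g n x" for x
      have [measurable]: "f \<in> borel_measurable borel" unfolding f_def by measurable
      have "sub_unit f"
      proof -
        have "(\<integral>\<^sup>+x. (f x)\<^sup>2 \<partial>lborel) = (ennreal (1 / sqrt r))\<^sup>2 * ennreal r"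
          unfolding f_def r(1)[symmetric] by (simp add: power_mult_distrib nn_integral_cmult)
        also have "\<dots> = 1" using rp by (simp add: ennreal_power ennreal_mult[symmetric] power_divide)
        finally show ?thesis by (simp add: sub_unit_def)
      qed
      from D[OF this] have "(\<integral>\<^sup>+x. f x * G x \<partial>lborel) \<le> ennreal C" .
      moreover have "(\<integral>\<^sup>+x. ennreal (1 / sqrt r) * (g n x)\<^sup>2 \<partial>lborel) \<le> (\<integral>\<^sup>+x. f x * G x \<partial>lborel)"
        by (intro nn_integral_mono) (auto simp: f_def g_def power2_eq_square mult.assoc intro!: mult_left_mono split:
          split_indicator)
      moreover have "(\<integral>\<^sup>+x. ennreal (1 / sqrt r) * (g n x)\<^sup>2 \<partial>lborel) = ennreal (1 / sqrt r) * ennreal r"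
        unfolding r(1)[symmetric] by (rule nn_integral_cmult) measurable
      moreover have "ennreal (1 / sqrt r) * ennreal r = ennreal (sqrt r)"
        using rp by (simp add: ennreal_mult[symmetric] real_div_sqrt)
      ultimately have "ennreal (sqrt r) \<le> ennreal C" by simp
      then have "sqrt r \<le> C" using C by simp
      then have "r \<le> C\<^sup>2" using r by (simp add: real_sqrt_le_iff sqrt_le_D)
      then show ?thesis unfolding r(1) by (rule ennreal_leI)
    qed
  qed
  have "(\<lambda>n. \<integral>\<^sup>+x. (g n x)\<^sup>2 \<partial>lborel) \<longlonglongrightarrow> (\<integral>\<^sup>+x. (G x)\<^sup>2 \<partial>lborel)"
  proof (rule nn_integral_LIMSEQ)
    show "incseq (\<lambda>n x. (g n x)\<^sup>2)"
      by (auto simp: incseq_def le_fun_def g_def min_def intro!: power_mono split: split_indicator)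
         (metis of_nat_le_iff order_trans)+
    show "(\<lambda>n. (g n x)\<^sup>2) \<longlonglongrightarrow> (G x)\<^sup>2" for x
    proof -
      obtain N :: nat where N: "norm x < real N" using reals_Archimedean2 by blast
      have "(\<lambda>n. min (G x) (of_nat n) ^ 2) \<longlonglongrightarrow> (min (G x) top)^2"
        unfolding power2_eq_square
        by (intro tendsto_mult_ennreal tendsto_min tendsto_const of_nat_tendsto_top_ennreal) (auto simp: min_def)
      then have "(\<lambda>n. min (G x) (of_nat n) ^ 2) \<longlonglongrightarrow> (G x)^2" by simp
      moreover have "\<forall>\<^sub>F n in sequentially. min (G x) (of_nat n) ^ 2 = (g n x)\<^sup>2"
        using N by (intro eventually_sequentiallyI[of N]) (auto simp: g_def)
      ultimately show ?thesis by (rule Lim_transform_eventually)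
    qed
  qed measurable
  then show ?thesis by (rule LIMSEQ_le_const2) (use I in auto)
qed

text \<open>With absolute values inside, the bilinear estimate applies without any convergence
  question. Its finiteness almost everywhere later justifies integrability, Fubini and linearity for
  \<open>Bil\<close>.\<close>

definition Babs :: "(pt \<Rightarrow> complex) \<Rightarrow> (pt \<Rightarrow> complex) \<Rightarrow> pt \<Rightarrow> ennreal"
  where "Babs U V \<zeta> = (\<integral>\<^sup>+\<zeta>1. ennreal (cmod (N_symb \<zeta> \<zeta>1) * cmod (U (\<zeta> - \<zeta>1)) * cmod (V \<zeta>1)) \<partial>lborel)"

lemma Babs_measurable [measurable]:
  assumes [measurable]: "U \<in> borel_measurable borel" "V \<in> borel_measurable borel"
  shows "Babs U V \<in> borel_measurable borel"
proof -
  note [measurable] = N_symb_comp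
  show ?thesis unfolding Babs_def by measurable
qed

lemma Xsb_weight_eq: "Xsb_weight s b \<zeta> = jbr (md \<zeta>) powr (2 * b) * jbr (sp \<zeta>) powr (2 * s)"
  by (simp add: Xsb_weight_def md_def sp_def)

lemma Xsb_weight_measurable [measurable]: "Xsb_weight s b \<in> borel_measurable borel"
  unfolding Xsb_weight_eq[abs_def] by measurable

lemma Xsb_weight_pos: "0 < Xsb_weight s b \<zeta>"
  using jbr_pos[of "md \<zeta>"] jbr_pos[of "sp \<zeta>"] by (simp add: Xsb_weight_eq)

locale nv = nv_params +
  fixes s :: real
  assumes s_rho: "- \<rho> \<le> s"
begin

lemma bilinear_aux:
  "\<exists>C\<ge>0. \<forall>U V a b. U \<in> borel_measurable borel \<longrightarrow> V \<in> borel_measurable borel \<longrightarrow> 0 < a \<longrightarrow> 0 < b \<longrightarrow>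
     Xsb_norm2 s bb U \<le> ennreal a \<longrightarrow> Xsb_norm2 s bb V \<le> ennreal b \<longrightarrow>
     (\<integral>\<^sup>+\<zeta>. ennreal (Xsb_weight s (- th) \<zeta>) * (Babs U V \<zeta>)\<^sup>2 \<partial>lborel) \<le> ennreal (C * a * b)"
proof -
  obtain D where D: "0 \<le> D" "tri_bdd Mker (ennreal D)" using Mker_bounded by blast
  define d where "d = s + \<rho>"
  have d: "0 \<le> d" using s_rho by (simp add: d_def)
  define C where "C = (sqrt 2 powr d * D)\<^sup>2"
  note [measurable] = N_symb_comp
  \<comment> \<open>The surplus regularity \<open>d = s + \<rho>\<close> is nonnegative, so Peetre's
    inequality moves it from the output to the inputs. This is how the estimate at
    \<open>- \<rho>\<close> gives all larger \<open>s\<close>.\<close>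
  have w: "jbr (sp \<zeta>) powr s \<le> sqrt 2 powr d * (jbr (sp \<zeta>) powr (- \<rho>) * (jbr (sp \<zeta>1) * jbr (sp (\<zeta> - \<zeta>1))) powr d)" for \<zeta> \<zeta>1
  proof -
    have "jbr (sp \<zeta>) \<le> sqrt 2 * (jbr (sp \<zeta>1) * jbr (sp (\<zeta> - \<zeta>1)))"
      using jbr_Peetre[of "sp \<zeta>1" "- sp (\<zeta> - \<zeta>1)"] jbr_minus_commute[of "sp \<zeta>1" "sp \<zeta>"] by (simp add: sp_diff)
    then have "jbr (sp \<zeta>) powr d \<le> (sqrt 2 * (jbr (sp \<zeta>1) * jbr (sp (\<zeta> - \<zeta>1)))) powr d"
      using d jbr_pos[of "sp \<zeta>"] by (intro powr_mono2) auto
    also have "\<dots> = sqrt 2 powr d * (jbr (sp \<zeta>1) * jbr (sp (\<zeta> - \<zeta>1))) powr d"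
      using jbr_pos[of "sp \<zeta>1"] jbr_pos[of "sp (\<zeta> - \<zeta>1)"] by (simp add: powr_mult)
    finally have "jbr (sp \<zeta>) powr (- \<rho>) * jbr (sp \<zeta>) powr d \<le> jbr (sp \<zeta>) powr (- \<rho>) * (sqrt 2 powr d * (jbr (sp \<zeta>1) * jbr (sp (\<zeta> -
      \<zeta>1))) powr d)"
      by (rule mult_left_mono) simp
    moreover have "jbr (sp \<zeta>) powr (- \<rho>) * jbr (sp \<zeta>) powr d = jbr (sp \<zeta>) powr s"
      by (simp add: powr_add[symmetric] d_def)
    ultimately show ?thesis by (simp add: mult_ac)
  qed
  show ?thesis
  proof (intro exI[of _ C] conjI allI impI)
    show "0 \<le> C" by (simp add: C_def)
    fix U V :: "pt \<Rightarrow> complex" and a b :: real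
    assume [measurable]: "U \<in> borel_measurable borel" "V \<in> borel_measurable borel" and ab: "0 < a" "0 < b"
      and NU: "Xsb_norm2 s bb U \<le> ennreal a" and NV: "Xsb_norm2 s bb V \<le> ennreal b"
    define w where "w \<zeta> = jbr (md \<zeta>) powr bb * jbr (sp \<zeta>) powr s" for \<zeta>
    define w' where "w' \<zeta> = jbr (md \<zeta>) powr (- th) * jbr (sp \<zeta>) powr s" for \<zeta>
    have [measurable]: "w \<in> borel_measurable borel" "w' \<in> borel_measurable borel"
      unfolding w_def w'_def by measurable
    have wpos: "0 < w \<zeta>" for \<zeta> using jbr_pos[of "md \<zeta>"] jbr_pos[of "sp \<zeta>"] by (simp add: w_def)
    have w'pos: "0 < w' \<zeta>" for \<zeta> using jbr_pos[of "md \<zeta>"] jbr_pos[of "sp \<zeta>"] by (simp add: w'_def)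
    have w2: "(w \<zeta>)\<^sup>2 = Xsb_weight s bb \<zeta>" for \<zeta>
      by (simp add: w_def Xsb_weight_eq power_mult_distrib power2_powr)
    have w'2: "(w' \<zeta>)\<^sup>2 = Xsb_weight s (- th) \<zeta>" for \<zeta>
      by (simp add: w'_def Xsb_weight_eq power_mult_distrib power2_powr)
    define g where "g \<zeta> = ennreal (w \<zeta> * cmod (V \<zeta>) / sqrt b)" for \<zeta>
    define h where "h \<zeta> = ennreal (w \<zeta> * cmod (U \<zeta>) / sqrt a)" for \<zeta>
    have unit: "sub_unit (\<lambda>\<zeta>. ennreal (w \<zeta> * cmod (F \<zeta>) / sqrt e))" if [measurable]: "F \<in> borel_measurable borel" and e: "0 < e"
      and N: "Xsb_norm2 s bb F \<le> ennreal e" for F :: "pt \<Rightarrow> complex" and e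
    proof -
      have "(\<integral>\<^sup>+\<zeta>. (ennreal (w \<zeta> * cmod (F \<zeta>) / sqrt e))\<^sup>2 \<partial>lborel) = (\<integral>\<^sup>+\<zeta>. ennreal (1 / e) * ennreal (Xsb_weight s bb \<zeta>
        * (cmod (F \<zeta>))\<^sup>2) \<partial>lborel)"
        using e wpos by (intro nn_integral_cong) (simp add: ennreal_power less_imp_le power_divide power_mult_distrib w2
          ennreal_mult'[symmetric])
      also have "\<dots> = ennreal (1 / e) * Xsb_norm2 s bb F"
        unfolding Xsb_norm2_def by (rule nn_integral_cmult) measurable
      also have "\<dots> \<le> ennreal (1 / e) * ennreal e" by (intro mult_left_mono N) simp
      also have "\<dots> = 1" using e by (simp add: ennreal_mult[symmetric])
      finally show ?thesis by (simp add: sub_unit_def)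
    qed
    have gu: "sub_unit g" "sub_unit h" unfolding g_def[abs_def] h_def[abs_def] using ab NU NV by (auto intro!: unit)
    have [measurable]: "g \<in> borel_measurable borel" "h \<in> borel_measurable borel" using gu by (auto simp: sub_unit_def)
    \<comment> \<open>The normalised output. Its square integral is bounded by duality, and pairing
      it with a test function produces \<open>tri Mker\<close>.\<close>
    define G where "G \<zeta> = ennreal (w' \<zeta> / sqrt (a * b)) * Babs U V \<zeta>" for \<zeta>
    have [measurable]: "G \<in> borel_measurable borel" unfolding G_def by measurable
    have pw: "ennreal (w' \<zeta> / sqrt (a * b)) * ennreal (cmod (N_symb \<zeta> \<zeta>1) * cmod (U (\<zeta> - \<zeta>1)) * cmod (V \<zeta>1))
        \<le> ennreal (sqrt 2 powr d) * (Mker \<zeta> \<zeta>1 * g \<zeta>1 * h (\<zeta> - \<zeta>1))" for \<zeta> \<zeta>1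
    proof -
      define A where "A = jbr (md \<zeta>1) powr bb * jbr (md (\<zeta> - \<zeta>1)) powr bb"
      define E where "E = (jbr (sp \<zeta>1) * jbr (sp (\<zeta> - \<zeta>1)))"
      have E: "0 < E" using jbr_pos[of "sp \<zeta>1"] jbr_pos[of "sp (\<zeta> - \<zeta>1)"] by (simp add: E_def)
      have A: "0 < A" using jbr_pos[of "md \<zeta>1"] jbr_pos[of "md (\<zeta> - \<zeta>1)"] by (simp add: A_def)
      have A': "jbr (md \<zeta>1) powr (- bb) * jbr (md (\<zeta> - \<zeta>1)) powr (- bb) = 1 / A"
        by (simp add: A_def powr_minus_divide)
      have ww: "w \<zeta>1 * w (\<zeta> - \<zeta>1) = A * E powr s"
        using jbr_pos[of "sp \<zeta>1"] jbr_pos[of "sp (\<zeta> - \<zeta>1)"] by (simp add: w_def A_def E_def powr_mult mult_ac)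
      have 1: "E powr d = E powr \<rho> * E powr s" by (simp add: d_def powr_add[symmetric] add.commute)
      define Q where "Q = cmod (N_symb \<zeta> \<zeta>1) * cmod (U (\<zeta> - \<zeta>1)) * cmod (V \<zeta>1) * jbr (md \<zeta>) powr (- th) / sqrt (a * b)"
      have Q: "0 \<le> Q" using ab by (simp add: Q_def)
      have "w' \<zeta> / sqrt (a * b) * (cmod (N_symb \<zeta> \<zeta>1) * cmod (U (\<zeta> - \<zeta>1)) * cmod (V \<zeta>1)) = jbr (sp \<zeta>) powr s * Q"
        by (simp add: w'_def Q_def mult_ac)
      also have "\<dots> \<le> sqrt 2 powr d * (jbr (sp \<zeta>) powr (- \<rho>) * E powr d) * Q"
        using w[of \<zeta> \<zeta>1] Q unfolding E_def by (rule mult_right_mono)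
      also have "\<dots> = sqrt 2 powr d * ((cmod (N_symb \<zeta> \<zeta>1) * jbr (sp \<zeta>) powr (- \<rho>) * E powr \<rho> * jbr (md \<zeta>) powr (- th) * (1 / A))
          * (w \<zeta>1 * cmod (V \<zeta>1) / sqrt b) * (w (\<zeta> - \<zeta>1) * cmod (U (\<zeta> - \<zeta>1)) / sqrt a))"
      proof -
        have "(w \<zeta>1 * cmod (V \<zeta>1) / sqrt b) * (w (\<zeta> - \<zeta>1) * cmod (U (\<zeta> - \<zeta>1)) / sqrt a)
          = (A * E powr s) * (cmod (V \<zeta>1) * cmod (U (\<zeta> - \<zeta>1)) / sqrt (a * b))"
          unfolding ww[symmetric] by (simp add: real_sqrt_mult mult_ac)
        then show ?thesis unfolding 1 Q_def mult.assoc using A by simp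
      qed
      finally have le: "ennreal (w' \<zeta> / sqrt (a * b) * (cmod (N_symb \<zeta> \<zeta>1) * cmod (U (\<zeta> - \<zeta>1)) * cmod (V \<zeta>1)))
         \<le> ennreal (sqrt 2 powr d * ((cmod (N_symb \<zeta> \<zeta>1) * jbr (sp \<zeta>) powr (- \<rho>) * E powr \<rho> * jbr (md \<zeta>) powr (- th) * (1 / A))
          * (w \<zeta>1 * cmod (V \<zeta>1) / sqrt b) * (w (\<zeta> - \<zeta>1) * cmod (U (\<zeta> - \<zeta>1)) / sqrt a)))"
        by (rule ennreal_leI)
      have M: "Mker \<zeta> \<zeta>1 = ennreal (cmod (N_symb \<zeta> \<zeta>1) * jbr (sp \<zeta>) powr (- \<rho>) * E powr \<rho> * jbr (md \<zeta>) powr (- th) * (1 / A))"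
        unfolding Mker_def E_def A'[symmetric] by (simp add: mult.assoc)
      show ?thesis
        using le ab A E wpos[of \<zeta>1] wpos[of "\<zeta> - \<zeta>1"] w'pos[of \<zeta>] unfolding M g_def h_def
        by (simp only: ennreal_mult[symmetric] mult_nonneg_nonneg divide_nonneg_nonneg less_imp_le norm_ge_zero powr_ge_zero
          real_sqrt_ge_zero zero_le_one)
    qed
    have "(\<integral>\<^sup>+\<zeta>. (G \<zeta>)\<^sup>2 \<partial>lborel) \<le> ennreal ((sqrt 2 powr d * D)\<^sup>2)"
    proof (rule nn_integral_sq_dual)
      show "0 \<le> sqrt 2 powr d * D" using D by simp
      fix f :: "pt \<Rightarrow> ennreal" assume f: "sub_unit f"
      then have [measurable]: "f \<in> borel_measurable borel" by (simp add: sub_unit_def)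
      have [measurable]: "kmeas Mker" unfolding Mker_def by measurable
      note [measurable] = kmeas_comp[OF this]
      have "(\<integral>\<^sup>+\<zeta>. f \<zeta> * G \<zeta> \<partial>lborel) = (\<integral>\<^sup>+\<zeta>. \<integral>\<^sup>+\<zeta>1. f \<zeta> * (ennreal (w' \<zeta> / sqrt (a * b)) * ennreal (cmod (N_symb \<zeta> \<zeta>1)
        * cmod (U (\<zeta> - \<zeta>1)) * cmod (V \<zeta>1))) \<partial>lborel \<partial>lborel)"
        unfolding G_def Babs_def by (simp add: nn_integral_cmult)
      also have "\<dots> \<le> (\<integral>\<^sup>+\<zeta>. \<integral>\<^sup>+\<zeta>1. f \<zeta> * (ennreal (sqrt 2 powr d) * (Mker \<zeta> \<zeta>1 * g \<zeta>1 * h (\<zeta> - \<zeta>1))) \<partial>lborel \<partial>lborel)"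
        by (intro nn_integral_mono mult_left_mono pw) auto
      also have "\<dots> = ennreal (sqrt 2 powr d) * tri Mker f g h"
        unfolding tri_def by (simp add: nn_integral_cmult[symmetric] mult_ac)
      also have "\<dots> \<le> ennreal (sqrt 2 powr d) * ennreal D"
        using D f gu by (intro mult_left_mono) (auto simp: tri_bdd_def)
      finally show "(\<integral>\<^sup>+\<zeta>. f \<zeta> * G \<zeta> \<partial>lborel) \<le> ennreal (sqrt 2 powr d * D)"
        using D by (simp add: ennreal_mult)
    qed measurable
    then have "ennreal (a * b) * (\<integral>\<^sup>+\<zeta>. (G \<zeta>)\<^sup>2 \<partial>lborel) \<le> ennreal (a * b) * ennreal C"
      unfolding C_def by (rule mult_left_mono) simp
    moreover have "ennreal (a * b) * (\<integral>\<^sup>+\<zeta>. (G \<zeta>)\<^sup>2 \<partial>lborel) = (\<integral>\<^sup>+\<zeta>. ennreal (Xsb_weight s (- th) \<zeta>) * (Babs U V \<zeta>)\<^sup>2 \<partial>lborel)"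
    proof -
      have "ennreal (a * b) * (G \<zeta>)\<^sup>2 = ennreal (Xsb_weight s (- th) \<zeta>) * (Babs U V \<zeta>)\<^sup>2" for \<zeta>
      proof -
        have "ennreal (a * b) * (ennreal (w' \<zeta> / sqrt (a * b)))\<^sup>2 = ennreal (Xsb_weight s (- th) \<zeta>)"
          using ab w'pos[of \<zeta>] Xsb_weight_pos[of s "- th" \<zeta>]
            by (simp add: ennreal_power ennreal_mult[symmetric] power_divide w'2 less_imp_le)
        then show ?thesis unfolding G_def power_mult_distrib by (simp add: mult.assoc[symmetric])
      qed
      then show ?thesis by (simp add: nn_integral_cmult[symmetric])
    qed
    moreover have "ennreal (a * b) * ennreal C = ennreal (C * a * b)"
      using ab by (simp add: ennreal_mult[symmetric] C_def mult_ac)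
    ultimately show "(\<integral>\<^sup>+\<zeta>. ennreal (Xsb_weight s (- th) \<zeta>) * (Babs U V \<zeta>)\<^sup>2 \<partial>lborel) \<le> ennreal (C * a * b)" by simp
  qed
qed

definition CB :: real where "CB = (SOME C. 0 \<le> C \<and> (\<forall>U V a b. U \<in> borel_measurable borel \<longrightarrow> V \<in> borel_measurable borel \<longrightarrow> 0 < a \<longrightarrow> 0
  < b \<longrightarrow>
     Xsb_norm2 s bb U \<le> ennreal a \<longrightarrow> Xsb_norm2 s bb V \<le> ennreal b \<longrightarrow>
     (\<integral>\<^sup>+\<zeta>. ennreal (Xsb_weight s (- th) \<zeta>) * (Babs U V \<zeta>)\<^sup>2 \<partial>lborel) \<le> ennreal (C * a * b)))"

lemma CB_nonneg: "0 \<le> CB"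
  and CB_bound: "\<lbrakk>U \<in> borel_measurable borel; V \<in> borel_measurable borel; 0 < a; 0 < b; 
     Xsb_norm2 s bb U \<le> ennreal a; Xsb_norm2 s bb V \<le> ennreal b\<rbrakk> \<Longrightarrow>
     (\<integral>\<^sup>+\<zeta>. ennreal (Xsb_weight s (- th) \<zeta>) * (Babs U V \<zeta>)\<^sup>2 \<partial>lborel) \<le> ennreal (CB * a * b)"
  using someI_ex[OF bilinear_aux] unfolding CB_def[symmetric] by auto

theorem bilinear:
  assumes U: "U \<in> Xsb s bb" and V: "V \<in> Xsb s bb"
  shows "(\<integral>\<^sup>+\<zeta>. ennreal (Xsb_weight s (- th) \<zeta>) * (Babs U V \<zeta>)\<^sup>2 \<partial>lborel) \<le> ennreal CB * Xsb_norm2 s bb U * Xsb_norm2 s bb V"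
proof -
  have [measurable]: "U \<in> borel_measurable borel" "V \<in> borel_measurable borel" using assms by (auto simp: Xsb_def)
  obtain r where r: "Xsb_norm2 s bb U = ennreal r" "0 \<le> r"
    using U by (cases "Xsb_norm2 s bb U") (auto simp: Xsb_def)
  obtain q where q: "Xsb_norm2 s bb V = ennreal q" "0 \<le> q"
    using V by (cases "Xsb_norm2 s bb V") (auto simp: Xsb_def)
  have "(\<integral>\<^sup>+\<zeta>. ennreal (Xsb_weight s (- th) \<zeta>) * (Babs U V \<zeta>)\<^sup>2 \<partial>lborel) \<le> ennreal (CB * r * q)"
    by (rule ennreal_le_limitI, rule CB_bound) (use r q in \<open>auto intro: ennreal_leI\<close>)
  also have "\<dots> = ennreal CB * ennreal r * ennreal q" using CB_nonneg r q by (simp add: ennreal_mult)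
  finally show ?thesis by (simp add: r q)
qed

end

section \<open>A time cutoff\<close>

definition snc :: "real \<Rightarrow> real" where "snc x = (if x = 0 then 1 else sin x / x)"

lemma snc_mult: "x * snc x = sin x" by (simp add: snc_def)

lemma snc_measurable [measurable]: "snc \<in> borel_measurable borel"
  unfolding snc_def by measurable

lemma snc_integral: "((\<lambda>u. cos (u * x)) has_integral snc x) {0..1}"
proof (cases "x = 0")
  case True then show ?thesis using has_integral_const_real[of 1 0 "1::real"] by (simp add: snc_def)
next
  case False
  have "((\<lambda>u. cos (u * x)) has_integral (sin (1 * x) / x - sin (0 * x) / x)) {0..1}"
    using False by (intro fundamental_theorem_of_calculus)
      (auto intro!: derivative_eq_intros simp: has_real_derivative_iff_has_vector_derivative[symmetric])
  then show ?thesis using False by (simp add: snc_def)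
qed

lemma cos_diff_le: "\<bar>cos a - cos b\<bar> \<le> \<bar>a - b :: real\<bar>"
proof -
  have "\<bar>cos a - cos b\<bar> = 2 * (\<bar>sin ((a + b) / 2)\<bar> * \<bar>sin ((b - a) / 2)\<bar>)"
    by (simp add: cos_diff_cos abs_mult)
  also have "\<dots> \<le> 2 * (1 * \<bar>(b - a) / 2\<bar>)"
    by (intro mult_left_mono mult_mono abs_sin_x_le_abs_x) auto
  finally show ?thesis by simp
qed

lemma sin_diff_le: "\<bar>sin a - sin b\<bar> \<le> \<bar>a - b :: real\<bar>"
proof -
  have "\<bar>sin a - sin b\<bar> = 2 * (\<bar>sin ((a - b) / 2)\<bar> * \<bar>cos ((a + b) / 2)\<bar>)"
    by (simp add: sin_diff_sin abs_mult)
  also have "\<dots> \<le> 2 * (\<bar>(a - b) / 2\<bar> * 1)"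
    by (intro mult_left_mono mult_mono abs_sin_x_le_abs_x) auto
  finally show ?thesis by simp
qed

text \<open>\<open>snc x\<close> is the average of \<open>cos (u * x)\<close> over \<open>u\<close>
  in [0, 1], so the Lipschitz bound for the cosine carries over.\<close>

lemma snc_lipschitz: "\<bar>snc a - snc b\<bar> \<le> \<bar>a - b\<bar>"
proof -
  have "((\<lambda>u. cos (u * a) - cos (u * b)) has_integral snc a - snc b) (cbox 0 1)"
    unfolding cbox_interval by (intro has_integral_diff snc_integral)
  then have "norm (snc a - snc b) \<le> \<bar>a - b\<bar> * measure lborel (cbox 0 (1::real))"
  proof (rule has_integral_bound[rotated])
    fix u :: real assume "u \<in> cbox 0 1"
    then have u: "0 \<le> u" "u \<le> 1" by auto
    have "\<bar>cos (u * a) - cos (u * b)\<bar> \<le> \<bar>u * a - u * b\<bar>" by (rule cos_diff_le)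
    also have "\<dots> = u * \<bar>a - b\<bar>" using u by (simp add: abs_mult right_diff_distrib[symmetric])
    also have "\<dots> \<le> 1 * \<bar>a - b\<bar>" using u by (intro mult_right_mono) auto
    finally show "norm (cos (u * a) - cos (u * b)) \<le> \<bar>a - b\<bar>" by simp
  qed auto
  then show ?thesis by simp
qed

lemma snc_le_1: "\<bar>snc x\<bar> \<le> 1"
  using abs_sin_x_le_abs_x[of x] by (auto simp: snc_def divide_le_eq_1)

lemma snc_bound: "\<bar>snc x\<bar> \<le> 2 / (1 + \<bar>x\<bar>)"
proof (cases "\<bar>x\<bar> \<le> 1")
  case True
  then have "1 \<le> 2 / (1 + \<bar>x\<bar>)" by (simp add: field_simps)
  then show ?thesis using snc_le_1[of x] by linarith
next
  case False
  have "\<bar>snc x\<bar> \<le> 1 / \<bar>x\<bar>" using False by (auto simp: snc_def intro!: divide_right_mono)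
  also have "\<dots> \<le> 2 / (1 + \<bar>x\<bar>)" using False by (simp add: field_simps)
  finally show ?thesis .
qed

text \<open>Improves \<open>snc_lipschitz\<close> by decay: \<open>b\<close> times the difference is
  computed from \<open>x * snc x = sin x\<close> by a discrete product rule, and the two bounds are
  added.\<close>

lemma snc_diff_bound: "\<bar>snc a - snc b\<bar> \<le> 3 * \<bar>a - b\<bar> / (1 + \<bar>b\<bar>)"
proof -
  have "b * (snc a - snc b) = (sin a - sin b) - (a - b) * snc a"
    using snc_mult[of a] snc_mult[of b] by (simp add: algebra_simps)
  then have "\<bar>b\<bar> * \<bar>snc a - snc b\<bar> = \<bar>(sin a - sin b) - (a - b) * snc a\<bar>" by (simp add: abs_mult[symmetric])
  also have "\<dots> \<le> \<bar>sin a - sin b\<bar> + \<bar>a - b\<bar> * \<bar>snc a\<bar>" by (simp add: abs_mult[symmetric])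
  also have "\<dots> \<le> \<bar>a - b\<bar> + \<bar>a - b\<bar> * 1" by (intro add_mono sin_diff_le mult_left_mono snc_le_1) auto
  finally have "(1 + \<bar>b\<bar>) * \<bar>snc a - snc b\<bar> \<le> 3 * \<bar>a - b\<bar>"
    using snc_lipschitz[of a b] by (simp add: algebra_simps)
  then show ?thesis by (simp add: field_simps)
qed

text \<open>The Fourier transform of the trapezoid that equals \<open>1\<close> on \<open>[-1, 1]\<close> and vanishes outside \<open>[-2, 2]\<close>.
  Its quadratic decay suffices for the modulation exponents below, so no smooth bump function is needed.\<close>

definition chi :: "real \<Rightarrow> real" where "chi y = 3 * snc (3 * y / 2) * snc (y / 2)"

lemma chi_measurable [measurable]: "chi \<in> borel_measurable borel" unfolding chi_def by measurable

lemma chi_minus [simp]: "chi (- y) = chi y" by (simp add: chi_def snc_def)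

lemma snc_bound2: "\<bar>snc (3 * y / 2)\<bar> \<le> 2 / (1 + \<bar>y\<bar>)" "\<bar>snc (y / 2)\<bar> \<le> 4 / (1 + \<bar>y\<bar>)"
  by (rule order_trans[OF snc_bound]; simp add: field_simps abs_mult)+

lemma chi_bound: "\<bar>chi y\<bar> \<le> 24 / (1 + \<bar>y\<bar>)\<^sup>2"
proof -
  have "\<bar>chi y\<bar> = 3 * (\<bar>snc (3 * y / 2)\<bar> * \<bar>snc (y / 2)\<bar>)" by (simp add: chi_def abs_mult)
  also have "\<dots> \<le> 3 * ((2 / (1 + \<bar>y\<bar>)) * (4 / (1 + \<bar>y\<bar>)))"
    by (intro mult_left_mono mult_mono snc_bound2) auto
  finally show ?thesis by (simp add: power2_eq_square)
qed

text \<open>The factor \<open>\<bar>x\<bar>\<close> will compensate the singular denominator of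
  \<open>kd\<close>. The condition on \<open>x\<close> keeps \<open>1 + \<bar>y - x\<bar>\<close>
  comparable with \<open>1 + \<bar>y\<bar>\<close>, so the quadratic decay survives.\<close>

lemma chi_diff_bound:
  assumes "\<bar>x\<bar> \<le> 1"
  shows "\<bar>chi (y - x) - chi y\<bar> \<le> 144 * \<bar>x\<bar> / (1 + \<bar>y\<bar>)\<^sup>2"
proof -
  let ?p = "1 + \<bar>y\<bar>"
  have p: "0 < ?p" by simp
  have 1: "\<bar>snc (3 * (y - x) / 2)\<bar> \<le> 4 / ?p"
  proof -
    have "?p \<le> 2 * (1 + \<bar>y - x\<bar>)" using assms by (smt (verit) abs_ge_zero)
    then have "2 / (1 + \<bar>y - x\<bar>) \<le> 4 / ?p" using p by (simp add: field_simps)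
    then show ?thesis using snc_bound2(1)[of "y - x"] by linarith
  qed
  have 2: "\<bar>snc ((y - x) / 2) - snc (y / 2)\<bar> \<le> 3 * \<bar>x\<bar> / ?p"
  proof -
    have "\<bar>snc ((y - x) / 2) - snc (y / 2)\<bar> \<le> 3 * \<bar>(y - x) / 2 - y / 2\<bar> / (1 + \<bar>y / 2\<bar>)" by (rule snc_diff_bound)
    also have "\<bar>(y - x) / 2 - y / 2\<bar> = \<bar>x\<bar> / 2" by (simp add: diff_divide_distrib)
    also have "3 * (\<bar>x\<bar> / 2) / (1 + \<bar>y / 2\<bar>) \<le> 3 * \<bar>x\<bar> / ?p"
      using p by (simp add: field_simps mult_left_mono)
    finally show ?thesis .
  qed
  have 3: "\<bar>snc (3 * (y - x) / 2) - snc (3 * y / 2)\<bar> \<le> 9 * \<bar>x\<bar> / ?p"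
  proof -
    have "\<bar>snc (3 * (y - x) / 2) - snc (3 * y / 2)\<bar> \<le> 3 * \<bar>3 * (y - x) / 2 - 3 * y / 2\<bar> / (1 + \<bar>3 * y / 2\<bar>)"
      by (rule snc_diff_bound)
    also have "\<bar>3 * (y - x) / 2 - 3 * y / 2\<bar> = 3 * \<bar>x\<bar> / 2" by (simp add: field_simps)
    also have "3 * (3 * \<bar>x\<bar> / 2) / (1 + \<bar>3 * y / 2\<bar>) \<le> 9 * \<bar>x\<bar> / ?p"
      using p by (intro frac_le) auto
    finally show ?thesis .
  qed
  have "chi (y - x) - chi y = 3 * (snc (3 * (y - x) / 2) * (snc ((y - x) / 2) - snc (y / 2)) + (snc (3 * (y - x) / 2) - snc (3
    * y / 2)) * snc (y / 2))"
    by (simp add: chi_def algebra_simps)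
  then have "\<bar>chi (y - x) - chi y\<bar> \<le> 3 * (\<bar>snc (3 * (y - x) / 2)\<bar> * \<bar>snc ((y - x) / 2) - snc (y / 2)\<bar> + \<bar>snc (3 * (y - x) / 2) - snc
    (3 * y / 2)\<bar> * \<bar>snc (y / 2)\<bar>)"
    by (simp add: abs_mult[symmetric])
  also have "\<dots> \<le> 3 * ((4 / ?p) * (3 * \<bar>x\<bar> / ?p) + (9 * \<bar>x\<bar> / ?p) * (4 / ?p))"
    by (intro mult_left_mono add_mono mult_mono 1 2 3 snc_bound2) auto
  also have "\<dots> = 144 * \<bar>x\<bar> / ?p\<^sup>2" by (simp add: power2_eq_square add_divide_distrib[symmetric])
  finally show ?thesis .
qed

section \<open>Fourier inversion of the cutoff by Fejer integrals\<close>

lemma exp_decay: "0 < (c::real) \<Longrightarrow> ((\<lambda>x. exp (- (c * x))) \<longlongrightarrow> 0) at_top"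
  by (intro filterlim_compose[OF exp_at_bot] filterlim_compose[OF filterlim_uminus_at_bot_at_top]
      filterlim_tendsto_pos_mult_at_top[OF tendsto_const] filterlim_ident) auto

lemma bounded_exp_decay:
  assumes "0 < (c::real)" and B: "\<And>x. \<bar>g x\<bar> \<le> B"
  shows "((\<lambda>x. exp (- (c * x)) * g x) \<longlongrightarrow> 0) at_top"
proof (rule Lim_null_comparison)
  show "\<forall>\<^sub>F x in at_top. norm (exp (- (c * x)) * g x) \<le> exp (- (c * x)) * B"
    using B by (intro always_eventually allI) (simp add: abs_mult mult_left_mono)
  show "((\<lambda>x. exp (- (c * x)) * B) \<longlongrightarrow> 0) at_top"
    using tendsto_mult[OF exp_decay[OF assms(1)] tendsto_const[of B]] by simp
qed

text \<open>Writes \<open>1 / y\<^sup>2\<close> as a Laplace integral. This turns the Fejer integral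
  into an iterated integral of nonnegative functions, in which Tonelli changes the order.\<close>

lemma nn_inverse_square:
  assumes y: "0 < (y::real)"
  shows "(\<integral>\<^sup>+x. ennreal (x * exp (- (y * x))) * indicator {0..} x \<partial>lborel) = ennreal (1 / y\<^sup>2)"
proof -
  have t1: "((\<lambda>x. x * exp (- (y * x))) \<longlongrightarrow> 0) at_top"
  proof -
    have "((\<lambda>x. (y * x) ^ 1 / exp (y * x)) \<longlongrightarrow> 0) at_top"
      by (rule filterlim_compose[OF tendsto_power_div_exp_0])
         (use y in \<open>auto intro: filterlim_tendsto_pos_mult_at_top[OF tendsto_const] filterlim_ident\<close>)
    moreover have "x * exp (- (y * x)) = (1 / y) * ((y * x) ^ 1 / exp (y * x))" for x
      using y by (simp add: exp_minus field_simps)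
    ultimately show ?thesis using tendsto_mult[OF tendsto_const[of "1 / y"]] by fastforce
  qed
  have "((\<lambda>x. - (x * exp (- (y * x)) / y) - exp (- (y * x)) / y\<^sup>2) \<longlongrightarrow> - (0 / y) - 0 / y\<^sup>2) at_top"
    using y by (intro tendsto_diff tendsto_minus tendsto_divide t1 exp_decay tendsto_const) auto
  then have "(\<integral>\<^sup>+x. ennreal (x * exp (- (y * x))) * indicator {0..} x \<partial>lborel) = ennreal ((- (0 / y) - 0 / y\<^sup>2) - (- (0 * exp (- (y
    * 0)) / y) - exp (- (y * 0)) / y\<^sup>2))"
    by (rule nn_integral_FTC_atLeast[rotated 3])
       (use y in \<open>auto intro!: derivative_eq_intros simp: field_simps power2_eq_square\<close>)
  then show ?thesis by simp
qed

lemma nn_one_minus_cos_exp: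
  assumes x: "0 < (x::real)"
  shows "(\<integral>\<^sup>+y. ennreal ((1 - cos (a * y)) * exp (- (x * y))) * indicator {0..} y \<partial>lborel) = ennreal (1 / x - x / (x\<^sup>2 + a\<^sup>2))"
proof -
  define q where "q = x\<^sup>2 + a\<^sup>2"
  have pos: "0 < q" using x by (simp add: q_def add_pos_nonneg)
  \<comment> \<open>An explicit antiderivative of the integrand; the exponential makes it vanish at
    infinity because the other factor is bounded.\<close>
  define F where "F y = exp (- (x * y)) * ((1 / q) * (x * cos (a * y) - a * sin (a * y)) - 1 / x)" for y
  have lim: "(F \<longlongrightarrow> 0) at_top"
    unfolding F_def
  proof (rule bounded_exp_decay[OF x])
    fix y
    have "\<bar>x * cos (a * y) - a * sin (a * y)\<bar> \<le> \<bar>x\<bar> * \<bar>cos (a * y)\<bar> + \<bar>a\<bar> * \<bar>sin (a * y)\<bar>" by (simp add: abs_mult[symmetric])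
    also have "\<dots> \<le> \<bar>x\<bar> * 1 + \<bar>a\<bar> * 1" by (intro add_mono mult_left_mono) auto
    finally have "\<bar>(1 / q) * (x * cos (a * y) - a * sin (a * y))\<bar> \<le> (\<bar>x\<bar> + \<bar>a\<bar>) / q"
      using pos by (simp add: divide_right_mono)
    then show "\<bar>(1 / q) * (x * cos (a * y) - a * sin (a * y)) - 1 / x\<bar> \<le> (\<bar>x\<bar> + \<bar>a\<bar>) / q + 1 / x"
      using x by (intro order_trans[OF abs_triangle_ineq4] add_mono) auto
  qed
  have der: "(F has_real_derivative (1 - cos (a * y)) * exp (- (x * y))) (at y)" for y
  proof -
    have gen: "((\<lambda>y. exp (- (x * y)) * (k * (x * cos (a * y) - a * sin (a * y)) - m)) has_real_derivative (- x) * exp (- (x * y))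
      * (k * (x * cos (a * y) - a * sin (a * y)) - m)
        + exp (- (x * y)) * (k * (- (x * a) * sin (a * y) - a * a * cos (a * y)))) (at y)" for k m
      by (auto intro!: derivative_eq_intros simp: algebra_simps)
    have "(F has_real_derivative (- x) * exp (- (x * y)) * ((1 / q) * (x * cos (a * y) - a * sin (a * y)) - 1 / x)
        + exp (- (x * y)) * ((1 / q) * (- (x * a) * sin (a * y) - a * a * cos (a * y)))) (at y)"
      unfolding F_def[abs_def] by (rule gen)
    also have "(- x) * E * ((1 / q) * (x * c - a * d) - 1 / x) + E * ((1 / q) * (- (x * a) * d - a * a * c))
      = E * (1 - c * ((x\<^sup>2 + a\<^sup>2) / q))" for E c d
      using x pos by (simp add: field_simps power2_eq_square)
    also have "(x\<^sup>2 + a\<^sup>2) / q = 1" using pos by (simp add: q_def[symmetric])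
    finally show ?thesis by (simp only: mult_1_left mult_1_right mult.commute)
  qed
  have "(\<integral>\<^sup>+y. ennreal ((1 - cos (a * y)) * exp (- (x * y))) * indicator {0..} y \<partial>lborel) = ennreal (0 - F 0)"
    by (rule nn_integral_FTC_atLeast[OF _ der _ lim]) auto
  then show ?thesis using pos by (simp add: F_def q_def)
qed

lemma nn_arctan:
  assumes a: "0 < (a::real)"
  shows "(\<integral>\<^sup>+x. ennreal (a\<^sup>2 / (x\<^sup>2 + a\<^sup>2)) * indicator {0..} x \<partial>lborel) = ennreal (a * pi / 2)"
proof -
  have lim: "((\<lambda>x. a * arctan (x / a)) \<longlongrightarrow> a * (pi / 2)) at_top"
  proof -
    have "filterlim (\<lambda>x. (1 / a) * x) at_top at_top"
      by (rule filterlim_tendsto_pos_mult_at_top[OF tendsto_const]) (use a in \<open>auto intro: filterlim_ident\<close>)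
    then show ?thesis by (intro tendsto_mult tendsto_const filterlim_compose[OF tendsto_arctan_at_top]) simp
  qed
  have "(\<integral>\<^sup>+x. ennreal (a\<^sup>2 / (x\<^sup>2 + a\<^sup>2)) * indicator {0..} x \<partial>lborel) = ennreal (a * (pi / 2) - a * arctan (0 / a))"
  proof (rule nn_integral_FTC_atLeast[OF _ _ _ lim])
    fix x :: real
    show "((\<lambda>x. a * arctan (x / a)) has_real_derivative a\<^sup>2 / (x\<^sup>2 + a\<^sup>2)) (at x)"
      using a by (auto intro!: derivative_eq_intros simp: field_simps power2_eq_square)
  qed auto
  then show ?thesis by simp
qed

lemma nn_fejer_half:
  assumes a: "0 < (a::real)"
  shows "(\<integral>\<^sup>+y. ennreal ((1 - cos (a * y)) / y\<^sup>2) * indicator {0<..} y \<partial>lborel) = ennreal (a * pi / 2)"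
proof -
  have "(\<integral>\<^sup>+y. ennreal ((1 - cos (a * y)) / y\<^sup>2) * indicator {0<..} y \<partial>lborel)
    = (\<integral>\<^sup>+y. \<integral>\<^sup>+x. ennreal ((1 - cos (a * y)) * indicator {0<..} y) * (ennreal (x * exp (-
      (y * x))) * indicator {0..} x) \<partial>lborel \<partial>lborel)"
  proof (rule nn_integral_cong)
    fix y :: real
    show "ennreal ((1 - cos (a * y)) / y\<^sup>2) * indicator {0<..} y = (\<integral>\<^sup>+x. ennreal ((1 - cos (a * y)) * indicator {0<..} y)
      * (ennreal (x * exp (- (y * x))) * indicator {0..} x) \<partial>lborel)"
    proof (cases "0 < y")
      case True
      have "(\<integral>\<^sup>+x. ennreal ((1 - cos (a * y)) * indicator {0<..} y) * (ennreal (x * exp (- (y * x))) * indicator {0..} x) \<partial>lborel)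
        = ennreal (1 - cos (a * y)) * ennreal (1 / y\<^sup>2)"
        using True by (subst nn_integral_cmult) (auto simp: nn_inverse_square)
      then show ?thesis using True by (simp add: ennreal_mult[symmetric])
    qed simp
  qed
  also have "\<dots> = (\<integral>\<^sup>+x. \<integral>\<^sup>+y. ennreal ((1 - cos (a * y)) * indicator {0<..} y) * (ennreal (x * exp (- (y * x))) * indicator {0..} x)
    \<partial>lborel \<partial>lborel)"
    by (rule nn_integral_lborel_swap) measurable
  also have "\<dots> = (\<integral>\<^sup>+x. ennreal (a\<^sup>2 / (x\<^sup>2 + a\<^sup>2)) * indicator {0..} x \<partial>lborel)"
  proof (rule nn_integral_cong_AE, rule AE_mp[OF AE_lborel_singleton[of 0]], rule AE_I2, rule impI)
    fix x :: real assume x0: "x \<noteq> 0"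
    show "(\<integral>\<^sup>+y. ennreal ((1 - cos (a * y)) * indicator {0<..} y) * (ennreal (x * exp (- (y * x))) * indicator {0..} x) \<partial>lborel)
      = ennreal (a\<^sup>2 / (x\<^sup>2 + a\<^sup>2)) * indicator {0..} x"
    proof (cases "0 \<le> x")
      case True
      then have x: "0 < x" using x0 by simp
      have pos: "0 < x\<^sup>2 + a\<^sup>2" using x by (simp add: add_pos_nonneg)
      have "(\<integral>\<^sup>+y. ennreal ((1 - cos (a * y)) * indicator {0<..} y) * (ennreal (x * exp (- (y * x))) * indicator {0..} x) \<partial>lborel)
         = (\<integral>\<^sup>+y. ennreal x * (ennreal ((1 - cos (a * y)) * exp (- (x * y))) * indicator {0..} y) \<partial>lborel)"
        using x by (intro nn_integral_cong) (auto simp: ennreal_mult[symmetric] mult_ac split: split_indicator)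
      also have "\<dots> = ennreal x * ennreal (1 / x - x / (x\<^sup>2 + a\<^sup>2))"
        by (subst nn_integral_cmult) (auto simp: nn_one_minus_cos_exp[OF x])
      also have "\<dots> = ennreal (x * (1 / x - x / (x\<^sup>2 + a\<^sup>2)))" using x by (simp add: ennreal_mult')
      also have "x * (1 / x - x / (x\<^sup>2 + a\<^sup>2)) = a\<^sup>2 / (x\<^sup>2 + a\<^sup>2)"
      proof -
        have "x * (1 / x - x / q) = (q - x\<^sup>2) / q" if "0 < q" for q
          using x that by (simp add: field_simps power2_eq_square)
        from this[OF pos] show ?thesis by simp
      qed
      finally show ?thesis using True by simp
    qed simp
  qed
  also have "\<dots> = ennreal (a * pi / 2)" by (rule nn_arctan[OF a])
  finally show ?thesis .
qed

text \<open>The absolute value of \<open>a\<close> is the point: linear combinations for shifted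
  parameters produce piecewise linear functions, among them the trapezoid.\<close>

lemma fejer_integral: "has_bochner_integral lborel (\<lambda>y. (1 - cos (a * y)) / y\<^sup>2) (pi * \<bar>a::real\<bar>)"
proof (cases "a = 0")
  case True then show ?thesis by (simp add: has_bochner_integral_zero)
next
  case False
  have eq: "1 - cos (a * y) = 1 - cos (\<bar>a\<bar> * y)" for y by (cases "0 \<le> a") auto
  let ?f = "\<lambda>y. ennreal ((1 - cos (\<bar>a\<bar> * y)) / y\<^sup>2) * indicator {0<..} y"
  have "(\<integral>\<^sup>+y. ennreal ((1 - cos (a * y)) / y\<^sup>2) \<partial>lborel) = (\<integral>\<^sup>+y. ?f y + ?f (- y) \<partial>lborel)"
    unfolding eq by (intro nn_integral_cong) (auto split: split_indicator)
  also have "\<dots> = (\<integral>\<^sup>+y. ?f y \<partial>lborel) + (\<integral>\<^sup>+y. ?f (- y) \<partial>lborel)" by (rule nn_integral_add) measurable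
  also have "(\<integral>\<^sup>+y. ?f (- y) \<partial>lborel) = (\<integral>\<^sup>+y. ?f y \<partial>lborel)"
    using nn_integral_lborel_reflect[of ?f 0] by simp
  also have "(\<integral>\<^sup>+y. ?f y \<partial>lborel) = ennreal (\<bar>a\<bar> * pi / 2)" using False by (intro nn_fejer_half) simp
  also have "ennreal (\<bar>a\<bar> * pi / 2) + ennreal (\<bar>a\<bar> * pi / 2) = ennreal (pi * \<bar>a\<bar>)"
    by (simp add: ennreal_plus[symmetric] del: ennreal_plus)
  finally show ?thesis
    by (intro has_bochner_integral_nn_integral) auto
qed

lemma chi_eq: "y \<noteq> 0 \<Longrightarrow> chi y = 2 * (cos y - cos (2 * y)) / y\<^sup>2"
proof -
  assume y: "y \<noteq> 0"
  have "cos y - cos (2 * y) = 2 * sin (3 * y / 2) * sin (y / 2)"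
    by (simp add: cos_diff_cos)
  then show ?thesis using y by (simp add: chi_def snc_def field_simps power2_eq_square)
qed

text \<open>\<open>cos (t * y) * chi y\<close> is a combination of four Fejer integrands with
  parameters \<open>t + 2\<close>, \<open>t - 2\<close>, \<open>t + 1\<close> and
  \<open>t - 1\<close>. Their absolute values combine to 2 for \<open>\<bar>t\<bar> \<le> 1\<close>,
  the plateau of the trapezoid.\<close>

lemma chi_inversion_cos:
  assumes "\<bar>t\<bar> \<le> 1"
  shows "has_bochner_integral lborel (\<lambda>y. cos (t * y) * chi y) (2 * pi)"
proof -
  let ?f = "\<lambda>a y. (1 - cos (a * y)) / y\<^sup>2 :: real"
  have "has_bochner_integral lborel (\<lambda>y. ?f (t + 2) y + ?f (t - 2) y - ?f (t + 1) y - ?f (t - 1) y)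
     (pi * \<bar>t + 2\<bar> + pi * \<bar>t - 2\<bar> - pi * \<bar>t + 1\<bar> - pi * \<bar>t - 1\<bar>)"
    by (intro has_bochner_integral_diff has_bochner_integral_add fejer_integral)
  also have "pi * \<bar>t + 2\<bar> + pi * \<bar>t - 2\<bar> - pi * \<bar>t + 1\<bar> - pi * \<bar>t - 1\<bar> = 2 * pi"
  proof -
    have "\<bar>t + 2\<bar> = t + 2" "\<bar>t - 2\<bar> = 2 - t" "\<bar>t + 1\<bar> = t + 1" "\<bar>t - 1\<bar> = 1 - t" using assms by auto
    then show ?thesis by (simp add: algebra_simps)
  qed
  finally have 1: "has_bochner_integral lborel (\<lambda>y. ?f (t + 2) y + ?f (t - 2) y - ?f (t + 1) y - ?f (t - 1) y) (2 * pi)" .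
  have eq: "?f (t + 2) y + ?f (t - 2) y - ?f (t + 1) y - ?f (t - 1) y = cos (t * y) * chi y" if "y \<noteq> 0" for y
  proof -
    have "cos ((t + c) * y) + cos ((t - c) * y) = 2 * (cos (t * y) * cos (c * y))" for c
      by (simp add: distrib_right left_diff_distrib cos_add cos_diff)
    from this[of 2] this[of 1] show ?thesis
      using that by (simp add: chi_eq add_divide_distrib[symmetric] diff_divide_distrib[symmetric] algebra_simps)
  qed
  have "AE y in lborel. ?f (t + 2) y + ?f (t - 2) y - ?f (t + 1) y - ?f (t - 1) y = cos (t * y) * chi y"
    by (rule AE_mp[OF AE_lborel_singleton[of 0]]) (use eq in auto)
  with 1 show ?thesis by (subst (asm) has_bochner_integral_cong_AE) auto
qed

section \<open>The Duhamel operator\<close>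

lemma nn_integral_scaled_decay:
  assumes "1 < a" "0 < \<delta>"
  shows "(\<integral>\<^sup>+x. ennreal ((1 + \<delta> * \<bar>x\<bar>) powr (- a)) \<partial>lborel) \<le> ennreal (2 / (a - 1) / \<delta>)"
proof -
  let ?k = "\<lambda>x. ennreal ((1 + x) powr (- a)) * indicator {0..} x"
  let ?h = "\<lambda>x. ennreal ((1 + \<bar>x\<bar>) powr (- a))"
  have "(\<integral>\<^sup>+x. ?h x \<partial>lborel) \<le> (\<integral>\<^sup>+x. ?k x + ?k (- x) \<partial>lborel)"
    by (intro nn_integral_mono) (auto split: split_indicator)
  also have "\<dots> = (\<integral>\<^sup>+x. ?k x \<partial>lborel) + (\<integral>\<^sup>+x. ?k (- x) \<partial>lborel)" by (rule nn_integral_add) measurable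
  also have "(\<integral>\<^sup>+x. ?k (- x) \<partial>lborel) = (\<integral>\<^sup>+x. ?k x \<partial>lborel)"
    using nn_integral_lborel_reflect[of ?k 0] by simp
  also have "(\<integral>\<^sup>+x. ?k x \<partial>lborel) = ennreal (1 / (a - 1))" by (rule nn_integral_affine_decay[OF assms(1)])
  also have "ennreal (1 / (a - 1)) + ennreal (1 / (a - 1)) = ennreal (2 / (a - 1))"
    using assms by (simp add: ennreal_plus[symmetric] del: ennreal_plus)
  finally have 1: "(\<integral>\<^sup>+x. ?h x \<partial>lborel) \<le> ennreal (2 / (a - 1))" .
  have "(\<integral>\<^sup>+x. ?h x \<partial>lborel) = ennreal \<delta> * (\<integral>\<^sup>+x. ?h (0 + \<delta> * x) \<partial>lborel)"
    using assms nn_integral_real_affine[of ?h \<delta> 0] by simp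
  also have "(\<integral>\<^sup>+x. ?h (0 + \<delta> * x) \<partial>lborel) = (\<integral>\<^sup>+x. ennreal ((1 + \<delta> * \<bar>x\<bar>) powr (- a)) \<partial>lborel)"
    using assms by (simp add: abs_mult)
  finally have "ennreal \<delta> * (\<integral>\<^sup>+x. ennreal ((1 + \<delta> * \<bar>x\<bar>) powr (- a)) \<partial>lborel) \<le> ennreal \<delta> * ennreal (2 / (a - 1) / \<delta>)"
    using 1 assms by (simp add: ennreal_mult[symmetric])
  then show ?thesis using assms by (subst (asm) ennreal_mult_le_mult_iff) auto
qed

lemma jbr_real_le: "jbr x \<le> 1 + \<bar>x::real\<bar>"
  unfolding jbr_def by (rule real_le_lsqrt) (auto simp: power2_sum)

lemma nn_integral_Young:
  fixes f :: "real \<Rightarrow> ennreal" and k :: "real \<Rightarrow> real"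
  assumes [measurable]: "f \<in> borel_measurable borel" "k \<in> borel_measurable borel" and k: "\<And>x. 0 \<le> k x"
  shows "(\<integral>\<^sup>+y. (\<integral>\<^sup>+x. f x * ennreal (k (y - x)) \<partial>lborel)\<^sup>2 \<partial>lborel) \<le> (\<integral>\<^sup>+x. ennreal (k x) \<partial>lborel)\<^sup>2 * (\<integral>\<^sup>+x. (f x)\<^sup>2 \<partial>lborel)"
proof -
  let ?K = "\<integral>\<^sup>+x. ennreal (k x) \<partial>lborel"
  have sq: "(ennreal (sqrt (k u)))\<^sup>2 = ennreal (k u)" for u
    using k by (simp add: ennreal_power)
  have "(\<integral>\<^sup>+y. (\<integral>\<^sup>+x. f x * ennreal (k (y - x)) \<partial>lborel)\<^sup>2 \<partial>lborel) \<le> (\<integral>\<^sup>+y. (\<integral>\<^sup>+x. (f x)\<^sup>2 * ennreal (k (y - x)) \<partial>lborel)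
    * ?K \<partial>lborel)"
  proof (rule nn_integral_mono)
    fix y
    have "(\<integral>\<^sup>+x. (f x * ennreal (sqrt (k (y - x)))) * ennreal (sqrt (k (y - x))) \<partial>lborel)\<^sup>2
       \<le> (\<integral>\<^sup>+x. (f x * ennreal (sqrt (k (y - x))))\<^sup>2 \<partial>lborel) * (\<integral>\<^sup>+x. (ennreal (sqrt (k (y - x))))\<^sup>2 \<partial>lborel)"
      by (rule Cauchy_Schwarz_nn_integral) measurable
    also have "(\<integral>\<^sup>+x. (ennreal (sqrt (k (y - x))))\<^sup>2 \<partial>lborel) = ?K"
      unfolding sq by (rule nn_integral_lborel_reflect) measurable
    also have "(\<integral>\<^sup>+x. (f x * ennreal (sqrt (k (y - x))))\<^sup>2 \<partial>lborel) = (\<integral>\<^sup>+x. (f x)\<^sup>2 * ennreal (k (y - x)) \<partial>lborel)"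
      unfolding power_mult_distrib sq ..
    also have "(\<integral>\<^sup>+x. (f x * ennreal (sqrt (k (y - x)))) * ennreal (sqrt (k (y - x))) \<partial>lborel)
      = (\<integral>\<^sup>+x. f x * ennreal (k (y - x)) \<partial>lborel)"
      unfolding mult.assoc power2_eq_square[symmetric] sq ..
    finally show "(\<integral>\<^sup>+x. f x * ennreal (k (y - x)) \<partial>lborel)\<^sup>2 \<le> (\<integral>\<^sup>+x. (f x)\<^sup>2 * ennreal (k (y - x)) \<partial>lborel) * ?K" .
  qed
  also have "\<dots> = (\<integral>\<^sup>+y. \<integral>\<^sup>+x. (f x)\<^sup>2 * ennreal (k (y - x)) \<partial>lborel \<partial>lborel) * ?K"
    by (rule nn_integral_multc) measurable
  also have "(\<integral>\<^sup>+y. \<integral>\<^sup>+x. (f x)\<^sup>2 * ennreal (k (y - x)) \<partial>lborel \<partial>lborel) = (\<integral>\<^sup>+x. \<integral>\<^sup>+y. (f x)\<^sup>2 * ennreal (k (y - x)) \<partial>lborel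
    \<partial>lborel)"
    by (rule nn_integral_lborel_swap) measurable
  also have "\<dots> = (\<integral>\<^sup>+x. (f x)\<^sup>2 * ?K \<partial>lborel)"
  proof (rule nn_integral_cong)
    fix x
    have "(\<integral>\<^sup>+y. (f x)\<^sup>2 * ennreal (k (y - x)) \<partial>lborel) = (f x)\<^sup>2 * (\<integral>\<^sup>+y. ennreal (k (- x + y)) \<partial>lborel)"
      by (subst nn_integral_cmult) auto
    also have "(\<integral>\<^sup>+y. ennreal (k (- x + y)) \<partial>lborel) = ?K" by (rule nn_integral_lborel_translate) measurable
    finally show "(\<integral>\<^sup>+y. (f x)\<^sup>2 * ennreal (k (y - x)) \<partial>lborel) = (f x)\<^sup>2 * ?K" .
  qed
  also have "\<dots> = (\<integral>\<^sup>+x. (f x)\<^sup>2 \<partial>lborel) * ?K" by (rule nn_integral_multc) measurable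
  finally show ?thesis by (simp add: power2_eq_square mult_ac)
qed

text \<open>Arguments are modulations, that is, frequencies relative to \<open>p = phi z\<close>. Both exponentials in the numerator of the
  Duhamel kernel are replaced by their products with the cutoff at time scale \<open>\<delta>\<close>, so for \<open>\<bar>t\<bar> \<le> \<delta>\<close> inverting
  the transform in the first argument gives back the Duhamel kernel (see \<open>kd_inversion\<close>).
  The value at \<open>x = 0\<close> is junk on a null set.\<close>

definition kd :: "real \<Rightarrow> real \<Rightarrow> real \<Rightarrow> complex"
  where "kd \<delta> y x = complex_of_real (\<delta> * (chi (\<delta> * (y - x)) - chi (\<delta> * y))) / (complex_of_real (2 * pi) * \<i> * complex_of_real x)"

lemma kd_measurable:
  assumes [measurable]: "u \<in> borel_measurable M" "v \<in> borel_measurable M"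
  shows "(\<lambda>x. kd \<delta> (u x) (v x)) \<in> borel_measurable M"
  unfolding kd_def by measurable

text \<open>For \<open>\<delta> * \<bar>x\<bar> \<le> 1\<close> the difference of the two cutoffs
  cancels the denominator. Otherwise the denominator itself gives the decay in \<open>x\<close>, and
  the two cutoffs are estimated separately.\<close>

lemma kd_bound:
  assumes \<delta>: "0 < \<delta>"
  shows "cmod (kd \<delta> y x) \<le> 48 * \<delta>\<^sup>2 * ((1 + \<delta> * \<bar>y - x\<bar>) powr (- 2) + (1 + \<delta> * \<bar>y\<bar>) powr (- 2)) * (1 + \<delta> * \<bar>x\<bar>) powr (- 1)"
proof (cases "x = 0")
  case True then show ?thesis by (simp add: kd_def)
next
  case False
  let ?E = "\<lambda>u. (1 + \<delta> * \<bar>u\<bar>) powr (- 2)"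
  have E: "?E u = 1 / (1 + \<bar>\<delta> * u\<bar>)\<^sup>2" for u
  proof -
    have "0 < 1 + \<delta> * \<bar>u\<bar>" using \<delta> by (simp add: add_pos_nonneg)
    then show ?thesis using \<delta> by (simp add: powr_minus abs_mult powr_numeral divide_inverse)
  qed
  have x: "0 < \<bar>x\<bar>" using False by simp
  have k: "cmod (kd \<delta> y x) = \<delta> * \<bar>chi (\<delta> * y - \<delta> * x) - chi (\<delta> * y)\<bar> / (2 * pi * \<bar>x\<bar>)"
  proof -
    have "\<delta> * (y - x) = \<delta> * y - \<delta> * x" by (simp add: right_diff_distrib)
    then show ?thesis unfolding kd_def norm_divide norm_mult norm_of_real using \<delta> by (simp add: abs_mult)
  qed
  have pi6: "6 \<le> 2 * pi" using pi_gt3 by simp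
  define S where "S = ?E (y - x) + ?E y"
  have S: "0 \<le> S" by (simp add: S_def)
  have le: "cmod (kd \<delta> y x) \<le> 48 * \<delta>\<^sup>2 * S / (1 + \<delta> * \<bar>x\<bar>)"
  proof (cases "\<delta> * \<bar>x\<bar> \<le> 1")
    case True
    have "\<bar>chi (\<delta> * y - \<delta> * x) - chi (\<delta> * y)\<bar> \<le> 144 * \<bar>\<delta> * x\<bar> / (1 + \<bar>\<delta> * y\<bar>)\<^sup>2"
      using True \<delta> by (intro chi_diff_bound) (simp add: abs_mult)
    also have "\<dots> = 144 * \<delta> * \<bar>x\<bar> * ?E y" using \<delta> by (simp add: E abs_mult)
    also have "\<dots> \<le> 144 * \<delta> * \<bar>x\<bar> * S" using \<delta> by (intro mult_left_mono) (auto simp: S_def)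
    finally have "cmod (kd \<delta> y x) \<le> \<delta> * (144 * \<delta> * \<bar>x\<bar> * S) / (6 * \<bar>x\<bar>)"
      unfolding k using \<delta> x S pi6 by (intro frac_le mult_left_mono mult_right_mono) auto
    also have "\<dots> = 24 * \<delta>\<^sup>2 * S" using x by (simp add: power2_eq_square)
    also have "\<dots> \<le> 48 * \<delta>\<^sup>2 * S / (1 + \<delta> * \<bar>x\<bar>)"
    proof -
      have "24 * \<delta>\<^sup>2 * S * (1 + \<delta> * \<bar>x\<bar>) \<le> 24 * \<delta>\<^sup>2 * S * 2"
        using True S by (intro mult_left_mono) auto
      then show ?thesis using \<delta> x by (simp add: pos_le_divide_eq add_pos_pos)
    qed
    finally show ?thesis .
  next
    case False
    have "\<bar>chi (\<delta> * y - \<delta> * x) - chi (\<delta> * y)\<bar> \<le> \<bar>chi (\<delta> * (y - x))\<bar> + \<bar>chi (\<delta> * y)\<bar>"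
      by (simp add: right_diff_distrib)
    also have "\<dots> \<le> 24 * S"
      using chi_bound[of "\<delta> * (y - x)"] chi_bound[of "\<delta> * y"] by (simp add: S_def E)
    finally have "cmod (kd \<delta> y x) \<le> \<delta> * (24 * S) / (6 * \<bar>x\<bar>)"
      unfolding k using \<delta> x S pi6 by (intro frac_le mult_left_mono mult_right_mono) auto
    also have "\<dots> = 4 * \<delta>\<^sup>2 * S / (\<delta> * \<bar>x\<bar>)" using x \<delta> by (simp add: power2_eq_square)
    also have "\<dots> \<le> 48 * \<delta>\<^sup>2 * S / (1 + \<delta> * \<bar>x\<bar>)"
    proof -
      have "4 * \<delta>\<^sup>2 * S * (1 + \<delta> * \<bar>x\<bar>) \<le> 4 * \<delta>\<^sup>2 * S * (2 * (\<delta> * \<bar>x\<bar>))"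
        using False S by (intro mult_left_mono) auto
      also have "\<dots> \<le> 48 * \<delta>\<^sup>2 * S * (\<delta> * \<bar>x\<bar>)" using \<delta> S by simp
      finally show ?thesis using \<delta> x by (simp add: divide_le_eq pos_le_divide_eq add_pos_pos)
    qed
    finally show ?thesis .
  qed
  moreover have "(1 + \<delta> * \<bar>x\<bar>) powr (- 1) = 1 / (1 + \<delta> * \<bar>x\<bar>)"
    using \<delta> by (simp add: powr_minus add_pos_nonneg inverse_eq_divide)
  ultimately show ?thesis by (simp add: S_def)
qed

text \<open>Since \<open>\<delta> \<le> 1\<close>, a bracket at unit scale is at most
  \<open>1 / \<delta>\<close> times the one at scale \<open>\<delta>\<close>; this costs
  \<open>\<delta> powr (- b - t)\<close> against the factor \<open>\<delta>\<^sup>2\<close> of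
  \<open>kd_bound\<close>. In the convolution term the weight in \<open>y\<close> is distributed
  over \<open>x\<close> and \<open>y - x\<close>, and \<open>b + t \<le> 1\<close> disposes of the
  part in \<open>x\<close>.\<close>

lemma kd_weighted_bound:
  assumes \<delta>: "0 < \<delta>" "\<delta> \<le> 1" and b: "0 \<le> b" and t: "0 \<le> t" and bt: "b + t \<le> 1"
  shows "jbr y powr b * cmod (kd \<delta> y x) * jbr x powr t
    \<le> 48 * \<delta> powr (2 - b - t) * ((1 + \<delta> * \<bar>y - x\<bar>) powr (b - 2) + (1 + \<delta> * \<bar>y\<bar>) powr (b - 2) * (1 + \<delta> * \<bar>x\<bar>) powr (t - 1))"
proof -
  define X where "X = 1 + \<delta> * \<bar>x\<bar>"
  define Y where "Y = 1 + \<delta> * \<bar>y\<bar>"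
  define Z where "Z = 1 + \<delta> * \<bar>y - x\<bar>"
  have pos: "1 \<le> X" "1 \<le> Y" "1 \<le> Z" using \<delta> by (auto simp: X_def Y_def Z_def)
  have jb: "jbr u powr c \<le> \<delta> powr (- c) * (1 + \<delta> * \<bar>u\<bar>) powr c" if "0 \<le> c" for u c :: real
  proof -
    have "jbr u \<le> (1 + \<delta> * \<bar>u\<bar>) / \<delta>"
    proof -
      have "\<delta> * jbr u \<le> \<delta> * (1 + \<bar>u\<bar>)" using \<delta> by (intro mult_left_mono jbr_real_le) auto
      also have "\<dots> \<le> 1 + \<delta> * \<bar>u\<bar>" using \<delta> by (simp add: distrib_left)
      finally show ?thesis using \<delta> by (simp add: pos_le_divide_eq mult.commute)
    qed
    then have "jbr u powr c \<le> ((1 + \<delta> * \<bar>u\<bar>) / \<delta>) powr c" using that jbr_pos[of u] by (intro powr_mono2) auto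
    also have "\<dots> = \<delta> powr (- c) * (1 + \<delta> * \<bar>u\<bar>) powr c"
      using \<delta> by (subst powr_divide) (auto simp: powr_minus divide_inverse mult.commute)
    finally show ?thesis .
  qed
  have YXZ: "Y powr b \<le> X powr b * Z powr b"
  proof -
    have "Y \<le> X + Z - 1" using abs_triangle_ineq[of x "y - x"] \<delta> mult_left_mono[of "\<bar>y\<bar>" "\<bar>x\<bar> + \<bar>y - x\<bar>" \<delta>]
      by (simp add: X_def Y_def Z_def distrib_left)
    also have "\<dots> \<le> X * Z" using pos mult_nonneg_nonneg[of "X - 1" "Z - 1"] by (simp add: algebra_simps)
    finally have "Y powr b \<le> (X * Z) powr b" using pos b by (intro powr_mono2) auto
    then show ?thesis using pos by (simp add: powr_mult)
  qed
  have "jbr y powr b * cmod (kd \<delta> y x) * jbr x powr t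
     \<le> (\<delta> powr (- b) * Y powr b) * (48 * \<delta>\<^sup>2 * (Z powr (- 2) + Y powr (- 2)) * X powr (- 1)) * (\<delta> powr (- t) * X powr t)"
    unfolding X_def Y_def Z_def using \<delta> b t
    by (intro mult_mono jb kd_bound) (auto intro!: mult_nonneg_nonneg add_nonneg_nonneg)
  also have "\<dots> = 48 * (\<delta> powr (- b) * \<delta>\<^sup>2 * \<delta> powr (- t)) * (Y powr b * Z powr (- 2) * (X powr (- 1) * X powr t) + (Y powr b
    * Y powr (- 2)) * (X powr (- 1) * X powr t))"
    by (simp add: algebra_simps)
  also have "\<delta> powr (- b) * \<delta>\<^sup>2 * \<delta> powr (- t) = \<delta> powr (2 - b - t)"
  proof -
    have d2: "\<delta>\<^sup>2 = \<delta> powr 2" using \<delta> by (simp add: powr_numeral)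
    show ?thesis unfolding d2 powr_add[symmetric] by (rule arg_cong[where f = "\<lambda>x. \<delta> powr x"]) simp
  qed
  also have "X powr (- 1) * X powr t = X powr (t - 1)" unfolding powr_add[symmetric] by simp
  also have "Y powr b * Y powr (- 2) = Y powr (b - 2)" by (simp add: powr_add[symmetric])
  also have "Y powr b * Z powr (- 2) * X powr (t - 1) \<le> Z powr (b - 2)"
  proof -
    have "Y powr b * Z powr (- 2) * X powr (t - 1) \<le> (X powr b * Z powr b) * Z powr (- 2) * X powr (t - 1)"
      by (intro mult_right_mono YXZ) auto
    also have "\<dots> = (X powr b * X powr (t - 1)) * (Z powr b * Z powr (- 2))" by (simp add: mult_ac)
    also have "\<dots> = X powr (b + t - 1) * Z powr (b - 2)" by (simp add: powr_add[symmetric] add_diff_eq)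
    also have "\<dots> \<le> X powr 0 * Z powr (b - 2)" using pos bt by (intro mult_right_mono powr_mono) auto
    finally show ?thesis using pos by simp
  qed
  finally show ?thesis by (simp add: X_def Y_def Z_def mult_left_mono)
qed

text \<open>The two terms of \<open>kd_weighted_bound\<close> are a convolution, handled by Young's
  inequality, and a rank-one kernel, handled by Cauchy-Schwarz. Each has operator norm of order
  \<open>1 / \<delta>\<close>, which leaves \<open>\<delta> powr (1 - b - t)\<close>. The condition
  \<open>t < 1 / 2\<close> makes the rank-one factor in \<open>x\<close> square integrable.\<close>

lemma kd_operator_bound:
  assumes b: "1 / 2 < b" "b < 1" and t: "0 \<le> t" "t < 1 / 2" and bt: "b + t \<le> 1"
  shows "\<exists>C\<ge>0. \<forall>\<delta> f. 0 < \<delta> \<longrightarrow> \<delta> \<le> 1 \<longrightarrow> f \<in> borel_measurable borel \<longrightarrow>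
    (\<integral>\<^sup>+y. ennreal (jbr y powr (2 * b)) * (\<integral>\<^sup>+x. f x * ennreal (cmod (kd \<delta> y x)) \<partial>lborel)\<^sup>2 \<partial>lborel)
      \<le> ennreal (C * \<delta> powr (2 * (1 - b - t))) * (\<integral>\<^sup>+x. ennreal (jbr x powr (2 * (- t))) * (f x)\<^sup>2 \<partial>lborel)"
proof -
  define c1 where "c1 = 2 / ((2 - b) - 1)"
  define c2 where "c2 = 2 / ((4 - 2 * b) - 1)"
  define c3 where "c3 = 2 / ((2 - 2 * t) - 1)"
  have c: "0 \<le> c1" "0 \<le> c2" "0 \<le> c3" using b t by (auto simp: c1_def c2_def c3_def)
  define C where "C = 48\<^sup>2 * (2 * c1\<^sup>2 + 2 * (c2 * c3))"
  show ?thesis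
  proof (intro exI[of _ C] conjI allI impI)
    show "0 \<le> C" using c by (simp add: C_def)
    fix \<delta> :: real and f :: "real \<Rightarrow> ennreal"
    assume \<delta>: "0 < \<delta>" "\<delta> \<le> 1" and [measurable]: "f \<in> borel_measurable borel"
    note [measurable] = kd_measurable
    define g where "g x = f x * ennreal (jbr x powr (- t))" for x
    have [measurable]: "g \<in> borel_measurable borel" unfolding g_def by measurable
    let ?g2 = "\<integral>\<^sup>+x. (g x)\<^sup>2 \<partial>lborel"
    have g2: "?g2 = (\<integral>\<^sup>+x. ennreal (jbr x powr (2 * (- t))) * (f x)\<^sup>2 \<partial>lborel)"
      by (simp add: g_def power_mult_distrib ennreal_power power2_powr mult.commute)
    define A where "A y = (\<integral>\<^sup>+x. g x * ennreal ((1 + \<delta> * \<bar>y - x\<bar>) powr (b - 2)) \<partial>lborel)" for y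
    define B where "B = (\<integral>\<^sup>+x. g x * ennreal ((1 + \<delta> * \<bar>x\<bar>) powr (t - 1)) \<partial>lborel)"
    define P where "P y = ennreal ((1 + \<delta> * \<bar>y\<bar>) powr (b - 2))" for y
    have [measurable]: "A \<in> borel_measurable borel" "P \<in> borel_measurable borel" unfolding A_def P_def by measurable
    define e where "e = 48 * \<delta> powr (2 - b - t)"
    have e: "0 \<le> e" by (simp add: e_def)
    have pt: "ennreal (jbr y powr b) * (\<integral>\<^sup>+x. f x * ennreal (cmod (kd \<delta> y x)) \<partial>lborel) \<le> ennreal e * (A y + P y * B)" for y
    proof -
      have "ennreal (jbr y powr b) * (\<integral>\<^sup>+x. f x * ennreal (cmod (kd \<delta> y x)) \<partial>lborel)
         = (\<integral>\<^sup>+x. ennreal (jbr y powr b) * (f x * ennreal (cmod (kd \<delta> y x))) \<partial>lborel)"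
        by (rule nn_integral_cmult[symmetric]) measurable
      also have "\<dots> = (\<integral>\<^sup>+x. g x * ennreal (jbr y powr b * cmod (kd \<delta> y x) * jbr x powr t) \<partial>lborel)"
      proof (rule nn_integral_cong)
        fix x
        have "jbr x powr (- t) * (jbr y powr b * cmod (kd \<delta> y x) * jbr x powr t) = (jbr x powr (- t) * jbr x powr t) * (jbr y powr b
          * cmod (kd \<delta> y x))" by (simp add: mult_ac)
        also have "jbr x powr (- t) * jbr x powr t = 1" using jbr_pos[of x] by (simp add: powr_add[symmetric])
        finally have eq: "jbr x powr (- t) * (jbr y powr b * cmod (kd \<delta> y x) * jbr x powr t) = jbr y powr b * cmod (kd \<delta> y x)"
          by simp
        have "g x * ennreal (jbr y powr b * cmod (kd \<delta> y x) * jbr x powr t) = f x * (ennreal (jbr x powr (- t)) * ennreal (jbr y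
          powr b * cmod (kd \<delta> y x) * jbr x powr t))"
          by (simp only: g_def mult.assoc)
        also have "\<dots> = f x * ennreal (jbr y powr b * cmod (kd \<delta> y x))"
          by (subst ennreal_mult[symmetric]) (auto simp only: eq powr_ge_zero norm_ge_zero intro!: mult_nonneg_nonneg)
        also have "ennreal (jbr y powr b * cmod (kd \<delta> y x)) = ennreal (jbr y powr b) * ennreal (cmod (kd \<delta> y x))"
          by (rule ennreal_mult) auto
        finally show "ennreal (jbr y powr b) * (f x * ennreal (cmod (kd \<delta> y x))) = g x * ennreal (jbr y powr b * cmod (kd \<delta> y x)
          * jbr x powr t)"
          by (simp only: mult_ac)
      qed
      also have "\<dots> \<le> (\<integral>\<^sup>+x. g x * ennreal (e * ((1 + \<delta> * \<bar>y - x\<bar>) powr (b - 2) + (1 + \<delta> * \<bar>y\<bar>) powr (b - 2) * (1 + \<delta> * \<bar>x\<bar>) powr (t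
        - 1))) \<partial>lborel)"
        unfolding e_def using \<delta> b t bt by (intro nn_integral_mono mult_left_mono ennreal_leI kd_weighted_bound) auto
      also have "\<dots> = (\<integral>\<^sup>+x. ennreal e * (g x * ennreal ((1 + \<delta> * \<bar>y - x\<bar>) powr (b - 2)) + P y * (g x * ennreal ((1 + \<delta>
        * \<bar>x\<bar>) powr (t - 1)))) \<partial>lborel)"
        using e by (intro nn_integral_cong) (simp add: P_def ennreal_mult ennreal_plus distrib_left mult_ac)
      also have "\<dots> = ennreal e * (A y + P y * B)"
        unfolding A_def B_def by (simp add: nn_integral_cmult nn_integral_add)
      finally show ?thesis .
    qed
    have IA: "(\<integral>\<^sup>+y. (A y)\<^sup>2 \<partial>lborel) \<le> (ennreal (c1 / \<delta>))\<^sup>2 * ?g2"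
    proof -
      have "(\<integral>\<^sup>+y. (A y)\<^sup>2 \<partial>lborel) \<le> (\<integral>\<^sup>+x. ennreal ((1 + \<delta> * \<bar>x\<bar>) powr (b - 2)) \<partial>lborel)\<^sup>2 * ?g2"
        unfolding A_def by (rule nn_integral_Young[where k = "\<lambda>x. (1 + \<delta> * \<bar>x\<bar>) powr (b - 2)"]) auto
      also have "\<dots> \<le> (ennreal (c1 / \<delta>))\<^sup>2 * ?g2"
        using nn_integral_scaled_decay[of "2 - b" \<delta>] b \<delta> by (intro mult_right_mono power_mono) (auto simp: c1_def)
      finally show ?thesis .
    qed
    have IP: "(\<integral>\<^sup>+y. (P y)\<^sup>2 \<partial>lborel) \<le> ennreal (c2 / \<delta>)"
      using nn_integral_scaled_decay[of "4 - 2 * b" \<delta>] b \<delta> by (simp add: P_def ennreal_power power2_powr c2_def)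
    have IB: "B\<^sup>2 \<le> ?g2 * ennreal (c3 / \<delta>)"
    proof -
      have "B\<^sup>2 \<le> ?g2 * (\<integral>\<^sup>+x. (ennreal ((1 + \<delta> * \<bar>x\<bar>) powr (t - 1)))\<^sup>2 \<partial>lborel)"
        unfolding B_def by (rule Cauchy_Schwarz_nn_integral) measurable
      also have "(\<integral>\<^sup>+x. (ennreal ((1 + \<delta> * \<bar>x\<bar>) powr (t - 1)))\<^sup>2 \<partial>lborel) \<le> ennreal (c3 / \<delta>)"
        using nn_integral_scaled_decay[of "2 - 2 * t" \<delta>] t \<delta> by (simp add: ennreal_power power2_powr c3_def)
      finally show ?thesis by (simp add: mult_left_mono)
    qed
    have "(\<integral>\<^sup>+y. ennreal (jbr y powr (2 * b)) * (\<integral>\<^sup>+x. f x * ennreal (cmod (kd \<delta> y x)) \<partial>lborel)\<^sup>2 \<partial>lborel)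
       = (\<integral>\<^sup>+y. (ennreal (jbr y powr b) * (\<integral>\<^sup>+x. f x * ennreal (cmod (kd \<delta> y x)) \<partial>lborel))\<^sup>2 \<partial>lborel)"
      by (simp add: power_mult_distrib ennreal_power power2_powr)
    also have "\<dots> \<le> (\<integral>\<^sup>+y. (ennreal e * (A y + P y * B))\<^sup>2 \<partial>lborel)"
      by (intro nn_integral_mono power_mono pt) auto
    also have "\<dots> \<le> (\<integral>\<^sup>+y. ennreal (e\<^sup>2) * (2 * (A y)\<^sup>2 + 2 * (B\<^sup>2 * (P y)\<^sup>2)) \<partial>lborel)"
    proof (rule nn_integral_mono)
      fix y
      have "(u + v)\<^sup>2 \<le> 2 * u\<^sup>2 + 2 * v\<^sup>2" for u v :: ennreal
      proof -
        have "(u + v)\<^sup>2 = u\<^sup>2 + v\<^sup>2 + 2 * (u * v)" unfolding power2_eq_square mult_2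
          by (simp add: distrib_left distrib_right mult_ac add_ac)
        also have "\<dots> \<le> u\<^sup>2 + v\<^sup>2 + (u\<^sup>2 + v\<^sup>2)" using ennreal_amgm[of u v 1] by (intro add_left_mono) simp
        also have "\<dots> = 2 * u\<^sup>2 + 2 * v\<^sup>2" by (simp add: mult_2 add_ac)
        finally show ?thesis .
      qed
      from this[of "A y" "P y * B"]
      show "(ennreal e * (A y + P y * B))\<^sup>2 \<le> ennreal (e\<^sup>2) * (2 * (A y)\<^sup>2 + 2 * (B\<^sup>2 * (P y)\<^sup>2))"
        using e by (simp add: power_mult_distrib ennreal_power mult_left_mono mult.commute)
    qed
    also have "\<dots> = ennreal (e\<^sup>2) * (2 * (\<integral>\<^sup>+y. (A y)\<^sup>2 \<partial>lborel) + 2 * (B\<^sup>2 * (\<integral>\<^sup>+y. (P y)\<^sup>2 \<partial>lborel)))"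
      by (simp add: nn_integral_cmult nn_integral_add)
    also have "\<dots> \<le> ennreal (e\<^sup>2) * (2 * ((ennreal (c1 / \<delta>))\<^sup>2 * ?g2) + 2 * ((?g2 * ennreal (c3 / \<delta>)) * ennreal (c2 / \<delta>)))"
      by (intro mult_left_mono add_mono IA IP IB mult_mono) auto
    also have "\<dots> = (ennreal (e\<^sup>2) * (ennreal 2 * (ennreal (c1 / \<delta>))\<^sup>2 + ennreal 2 * (ennreal (c3 / \<delta>) * ennreal (c2 / \<delta>)))) * ?g2"
      by (simp add: distrib_left distrib_right mult_ac)
    also have "ennreal (e\<^sup>2) * (ennreal 2 * (ennreal (c1 / \<delta>))\<^sup>2 + ennreal 2 * (ennreal (c3 / \<delta>) * ennreal (c2 / \<delta>)))
      = ennreal (e\<^sup>2 * (2 * (c1 / \<delta>)\<^sup>2 + 2 * ((c3 / \<delta>) * (c2 / \<delta>))))"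
    proof -
      have "ennreal p * (ennreal 2 * (ennreal u)\<^sup>2 + ennreal 2 * (ennreal v * ennreal w)) = ennreal (p * (2 * u\<^sup>2 + 2 * (v * w)))"
        if "0 \<le> p" "0 \<le> u" "0 \<le> v" "0 \<le> w" for p u v w
        using that by (simp add: ennreal_power ennreal_mult ennreal_plus del: ennreal_numeral)
      then show ?thesis using c \<delta> by simp
    qed
    also have "e\<^sup>2 * (2 * (c1 / \<delta>)\<^sup>2 + 2 * ((c3 / \<delta>) * (c2 / \<delta>))) = C * (\<delta> powr (2 * (2 - b - t)) / \<delta>\<^sup>2)"
    proof -
      have "e\<^sup>2 = 48\<^sup>2 * \<delta> powr (2 * (2 - b - t))" by (simp add: e_def power_mult_distrib power2_powr)
      moreover have "48\<^sup>2 * W * (2 * (c1 / \<delta>)\<^sup>2 + 2 * ((c3 / \<delta>) * (c2 / \<delta>))) = C * (W / \<delta>\<^sup>2)" for W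
        using \<delta> by (simp add: C_def field_simps power2_eq_square)
      ultimately show ?thesis by simp
    qed
    also have "\<delta> powr (2 * (2 - b - t)) / \<delta>\<^sup>2 = \<delta> powr (2 * (1 - b - t))"
    proof -
      have d2: "\<delta>\<^sup>2 = \<delta> powr 2" using \<delta> by (simp add: powr_numeral)
      show ?thesis unfolding d2 powr_diff[symmetric] by (rule arg_cong[where f = "\<lambda>x. \<delta> powr x"]) simp
    qed
    finally show "(\<integral>\<^sup>+y. ennreal (jbr y powr (2 * b)) * (\<integral>\<^sup>+x. f x * ennreal (cmod (kd \<delta> y x)) \<partial>lborel)\<^sup>2 \<partial>lborel)
      \<le> ennreal (C * \<delta> powr (2 * (1 - b - t))) * (\<integral>\<^sup>+x. ennreal (jbr x powr (2 * (- t))) * (f x)\<^sup>2 \<partial>lborel)"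
      unfolding g2 .
  qed
qed

lemma sp_tuple [simp]: "sp (fst z, snd z, \<tau>) = z" by (simp add: sp_def)
lemma md_tuple [simp]: "md (fst z, snd z, \<tau>) = \<tau> - phi z" by (simp add: md_def)

lemma nn_integral_shift:
  fixes f :: "real \<Rightarrow> ennreal"
  assumes [measurable]: "f \<in> borel_measurable borel"
  shows "(\<integral>\<^sup>+x. f (x - p) \<partial>lborel) = (\<integral>\<^sup>+x. f x \<partial>lborel)"
  using nn_integral_lborel_translate[of f "- p"] by simp

lemma AE_fiber_finite:
  fixes F :: "pt \<Rightarrow> ennreal"
  assumes [measurable]: "F \<in> borel_measurable borel" and "(\<integral>\<^sup>+\<zeta>. F \<zeta> \<partial>lborel) < \<infinity>"
  shows "AE z in lborel. (\<integral>\<^sup>+\<tau>. F (fst z, snd z, \<tau>) \<partial>lborel) < \<infinity>"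
proof -
  have "(\<integral>\<^sup>+z. \<integral>\<^sup>+\<tau>. F (fst z, snd z, \<tau>) \<partial>lborel \<partial>lborel) \<noteq> \<infinity>"
    using assms(2) by (simp add: nn_integral_pt)
  then have "AE z in lborel. (\<integral>\<^sup>+\<tau>. F (fst z, snd z, \<tau>) \<partial>lborel) \<noteq> \<infinity>"
    by (intro nn_integral_PInf_AE) auto
  then show ?thesis by (simp add: less_top)
qed

lemma chi_integrable: "integrable lborel chi"
proof (rule integrableI_bounded)
  have "(\<integral>\<^sup>+x. ennreal (norm (chi x)) \<partial>lborel) \<le> (\<integral>\<^sup>+x. ennreal 24 * ennreal ((1 + 1 * \<bar>x\<bar>) powr (- 2)) \<partial>lborel)"
  proof (rule nn_integral_mono)
    fix x
    have "norm (chi x) \<le> 24 * (1 + 1 * \<bar>x\<bar>) powr (- 2)"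
      using chi_bound[of x] by (simp add: powr_minus powr_numeral divide_inverse)
    then have "ennreal (norm (chi x)) \<le> ennreal (24 * (1 + 1 * \<bar>x\<bar>) powr (- 2))" by (rule ennreal_leI)
    also have "\<dots> = ennreal 24 * ennreal ((1 + 1 * \<bar>x\<bar>) powr (- 2))" by (rule ennreal_mult) auto
    finally show "ennreal (norm (chi x)) \<le> ennreal 24 * ennreal ((1 + 1 * \<bar>x\<bar>) powr (- 2))" .
  qed
  also have "\<dots> = ennreal 24 * (\<integral>\<^sup>+x. ennreal ((1 + 1 * \<bar>x\<bar>) powr (- 2)) \<partial>lborel)"
    by (rule nn_integral_cmult) measurable
  also have "\<dots> \<le> ennreal 24 * ennreal (2 / (2 - 1) / 1)"
    by (intro mult_left_mono nn_integral_scaled_decay) auto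
  also have "\<dots> < \<infinity>" by (simp add: ennreal_mult_less_top)
  finally show "(\<integral>\<^sup>+x. ennreal (norm (chi x)) \<partial>lborel) < \<infinity>" .
qed measurable

lemma chi_inversion:
  assumes "\<bar>t\<bar> \<le> 1"
  shows "has_bochner_integral lborel (\<lambda>y. exp (\<i> * complex_of_real (t * y)) * complex_of_real (chi y)) (complex_of_real (2 * pi))"
proof -
  have s: "integrable lborel (\<lambda>y. sin (t * y) * chi y)"
    by (rule Bochner_Integration.integrable_bound[OF chi_integrable]) (auto simp: abs_mult mult_left_le_one_le)
  have "(\<integral>y. sin (t * y) * chi y \<partial>lborel) = (\<integral>y. sin (t * (0 + - 1 * y)) * chi (0 + - 1 * y) \<partial>lborel)"
    using lborel_integral_real_affine[of "- 1" "\<lambda>y. sin (t * y) * chi y" 0] by simp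
  also have "\<dots> = - (\<integral>y. sin (t * y) * chi y \<partial>lborel)" by simp
  finally have "(\<integral>y. sin (t * y) * chi y \<partial>lborel) = 0" by simp
  with s have s': "has_bochner_integral lborel (\<lambda>y. sin (t * y) * chi y) 0" by (simp add: has_bochner_integral_iff)
  have "has_bochner_integral lborel (\<lambda>y. complex_of_real (cos (t * y) * chi y) + \<i> * complex_of_real (sin (t * y)
    * chi y)) (complex_of_real (2 * pi) + \<i> * complex_of_real 0)"
    by (intro has_bochner_integral_add has_bochner_integral_mult_right has_bochner_integral_of_real chi_inversion_cos[OF assms] s')
  moreover have "complex_of_real (cos (t * y) * chi y) + \<i> * complex_of_real (sin (t * y) * chi y)
    = exp (\<i> * complex_of_real (t * y)) * complex_of_real (chi y)" for y
    by (simp only: cis_conv_exp[symmetric]) (simp add: complex_eq_iff)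
  ultimately show ?thesis by simp
qed

lemma chi_inversion_scaled:
  assumes \<delta>: "0 < \<delta>" and t: "\<bar>t\<bar> \<le> \<delta>"
  shows "has_bochner_integral lborel (\<lambda>\<tau>. exp (\<i> * complex_of_real (t * \<tau>)) * complex_of_real (\<delta> * chi (\<delta>
    * (\<tau> - p)))) (complex_of_real (2 * pi) * exp (\<i> * complex_of_real (t * p)))"
proof -
  let ?f = "\<lambda>y. exp (\<i> * complex_of_real (t / \<delta> * y)) * complex_of_real (chi y)"
  have "\<bar>t / \<delta>\<bar> \<le> 1" using \<delta> t by (simp add: abs_divide)
  from chi_inversion[OF this]
  have h: "has_bochner_integral lborel (\<lambda>\<tau>. ?f (- (\<delta> * p) + \<delta> * \<tau>)) (complex_of_real (2 * pi) /\<^sub>R \<bar>\<delta>\<bar>)"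
    using \<delta> by (subst (asm) lborel_has_bochner_integral_real_affine_iff[of \<delta> _ _ "- (\<delta> * p)"]) auto
  have h2: "has_bochner_integral lborel (\<lambda>\<tau>. complex_of_real \<delta> * exp (\<i> * complex_of_real (t * p)) * ?f (- (\<delta> * p) + \<delta> * \<tau>))
    (complex_of_real \<delta> * exp (\<i> * complex_of_real (t * p)) * (complex_of_real (2 * pi) /\<^sub>R \<bar>\<delta>\<bar>))"
    by (intro has_bochner_integral_mult_right h)
  have h3: "complex_of_real \<delta> * exp (\<i> * complex_of_real (t * p)) * (complex_of_real (2 * pi) /\<^sub>R \<bar>\<delta>\<bar>)
    = complex_of_real (2 * pi) * exp (\<i> * complex_of_real (t * p))"
    using \<delta> by (simp add: scaleR_conv_of_real field_simps)
  have h4: "complex_of_real \<delta> * exp (\<i> * complex_of_real (t * p)) * ?f (- (\<delta> * p) + \<delta> * \<tau>) = exp (\<i> * complex_of_real (t * \<tau>))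
    * complex_of_real (\<delta> * chi (\<delta> * (\<tau> - p)))" for \<tau>
  proof -
    have "t * p + t / \<delta> * (- (\<delta> * p) + \<delta> * \<tau>) = t * \<tau>" using \<delta> by (simp add: field_simps)
    then have e: "exp (\<i> * complex_of_real (t * p)) * exp (\<i> * complex_of_real (t / \<delta> * (- (\<delta> * p) + \<delta> * \<tau>)))
      = exp (\<i> * complex_of_real (t * \<tau>))"
      by (simp only: exp_add[symmetric] distrib_left[symmetric] of_real_add[symmetric])
    have "- (\<delta> * p) + \<delta> * \<tau> = \<delta> * (\<tau> - p)" by (simp add: algebra_simps)
    then have "complex_of_real \<delta> * exp (\<i> * complex_of_real (t * p)) * ?f (- (\<delta> * p) + \<delta> * \<tau>)
      = (exp (\<i> * complex_of_real (t * p)) * exp (\<i> * complex_of_real (t / \<delta> * (- (\<delta> * p) + \<delta> * \<tau>)))) *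
        (complex_of_real \<delta> * complex_of_real (chi (\<delta> * (\<tau> - p))))"
      by (simp only: mult_ac)
    then show ?thesis unfolding e by simp
  qed
  show ?thesis using h2 unfolding h3 h4 .
qed

lemma kd_inversion:
  assumes \<delta>: "0 < \<delta>" and t: "\<bar>t\<bar> \<le> \<delta>" and x: "x \<noteq> p"
  shows "(\<integral>\<tau>. exp (\<i> * complex_of_real (t * \<tau>)) * kd \<delta> (\<tau> - p) (x - p) \<partial>lborel) = duh_kernel t x p"
proof -
  let ?e = "\<lambda>u. exp (\<i> * complex_of_real (t * u))"
  let ?c = "complex_of_real (2 * pi) * \<i> * complex_of_real (x - p)"
  have h: "has_bochner_integral lborel (\<lambda>\<tau>. (?e \<tau> * complex_of_real (\<delta> * chi (\<delta> * (\<tau> - x))) - ?e \<tau> * complex_of_real (\<delta> * chi (\<delta>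
    * (\<tau> - p)))) / ?c)
     ((complex_of_real (2 * pi) * ?e x - complex_of_real (2 * pi) * ?e p) / ?c)"
    by (intro has_bochner_integral_divide has_bochner_integral_diff chi_inversion_scaled assms)
  have e1: "(\<lambda>\<tau>. (?e \<tau> * complex_of_real (\<delta> * chi (\<delta> * (\<tau> - x))) - ?e \<tau> * complex_of_real (\<delta> * chi (\<delta> * (\<tau> - p)))) / ?c)
    = (\<lambda>\<tau>. ?e \<tau> * kd \<delta> (\<tau> - p) (x - p))"
    unfolding kd_def by (simp add: right_diff_distrib)
  have e2: "(complex_of_real (2 * pi) * ?e x - complex_of_real (2 * pi) * ?e p) / ?c = duh_kernel t x p"
    using x by (simp add: duh_kernel_def field_simps)
  show ?thesis using h unfolding e1 e2 by (rule has_bochner_integral_integral_eq)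
qed

text \<open>Transform of the free evolution cut off at time scale 1. In contrast to
  \<open>Dop\<close> it does not depend on \<open>\<delta>\<close>, hence neither does its
  norm.\<close>

definition Sop :: "(real \<times> real \<Rightarrow> complex) \<Rightarrow> pt \<Rightarrow> complex"
  where "Sop u0 \<zeta> = complex_of_real (chi (md \<zeta>)) * u0 (sp \<zeta>)"

text \<open>Transform of the cut-off Duhamel term of a general source \<open>F\<close>, defined for
  all times; \<open>Duh\<close> is the uncut value at a single time.\<close>

definition Dop :: "real \<Rightarrow> (pt \<Rightarrow> complex) \<Rightarrow> pt \<Rightarrow> complex"
  where "Dop \<delta> F \<zeta> = (\<integral>x. F (fst \<zeta>, fst (snd \<zeta>), x) * kd \<delta> (md \<zeta>) (x - phi (sp \<zeta>)) \<partial>lborel)"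

definition Duh :: "(pt \<Rightarrow> complex) \<Rightarrow> real \<times> real \<Rightarrow> real \<Rightarrow> complex"
  where "Duh F z t = (1 / (2 * pi)) * (\<integral>\<tau>. F (fst z, snd z, \<tau>) * duh_kernel t \<tau> (phi z) \<partial>lborel)"

lemma duhamel_Duh: "duhamel U = Duh (NL U)"
  by (simp add: duhamel_def[abs_def] Duh_def[abs_def])

lemma Sop_measurable [measurable]:
  assumes [measurable]: "u0 \<in> borel_measurable borel"
  shows "Sop u0 \<in> borel_measurable borel"
  unfolding Sop_def by measurable

lemma Dop_measurable [measurable]:
  assumes [measurable]: "F \<in> borel_measurable borel"
  shows "Dop \<delta> F \<in> borel_measurable borel"
proof -
  note [measurable] = kd_measurable
  show ?thesis unfolding Dop_def by measurable
qed

lemma time_rep_Sop: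
  assumes "\<bar>t\<bar> \<le> 1"
  shows "time_rep (Sop u0) z t = exp (\<i> * complex_of_real (t * phi z)) * u0 z"
proof -
  have "(\<integral>\<tau>. exp (\<i> * complex_of_real (t * \<tau>)) * Sop u0 (fst z, snd z, \<tau>) \<partial>lborel)
     = (\<integral>\<tau>. (exp (\<i> * complex_of_real (t * \<tau>)) * complex_of_real (1 * chi (1 * (\<tau> - phi z)))) * u0 z \<partial>lborel)"
    by (simp add: Sop_def mult.assoc)
  also have "\<dots> = (\<integral>\<tau>. (exp (\<i> * complex_of_real (t * \<tau>)) * complex_of_real (1 * chi (1 * (\<tau> - phi z)))) \<partial>lborel) * u0 z"
    by (rule integral_mult_left_zero)
  also have "\<dots> = complex_of_real (2 * pi) * exp (\<i> * complex_of_real (t * phi z)) * u0 z"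
    using chi_inversion_scaled[of 1 t "phi z"] assms by (simp add: has_bochner_integral_iff)
  finally show ?thesis by (simp add: time_rep_def)
qed

text \<open>True even where the integrand is not integrable, because the Bochner integral is then 0.
  No finiteness has to be known at this point.\<close>

lemma Dop_norm_le:
  assumes [measurable]: "F \<in> borel_measurable borel"
  shows "ennreal (cmod (Dop \<delta> F (fst z, snd z, \<tau>))) \<le> (\<integral>\<^sup>+x. ennreal (cmod (F (fst z, snd z, phi z + x))) * ennreal (cmod (kd \<delta> (\<tau> -
    phi z) x)) \<partial>lborel)"
proof -
  note [measurable] = kd_measurable
  let ?g = "\<lambda>x. F (fst z, snd z, x) * kd \<delta> (\<tau> - phi z) (x - phi z)"
  have "ennreal (cmod (Dop \<delta> F (fst z, snd z, \<tau>))) \<le> (\<integral>\<^sup>+x. ennreal (cmod (?g x)) \<partial>lborel)"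
  proof (cases "integrable lborel ?g")
    case True
    from integral_norm_bound_ennreal[OF this] show ?thesis by (simp add: Dop_def)
  next
    case False
    then show ?thesis by (simp add: Dop_def not_integrable_integral_eq)
  qed
  also have "\<dots> = (\<integral>\<^sup>+x. ennreal (cmod (?g (phi z + x))) \<partial>lborel)"
    by (rule nn_integral_lborel_translate[symmetric]) measurable
  finally show ?thesis by (simp add: norm_mult ennreal_mult)
qed

context nv
begin

text \<open>Weight and cutoff separate on the fibres over a spatial frequency, and the fibre
  integral converges because \<open>chi\<close> decays quadratically and
  \<open>2 * bb < 3\<close>.\<close>

lemma Sop_norm_aux: "\<exists>C\<ge>0. \<forall>u0. u0 \<in> borel_measurable borel \<longrightarrow> Xsb_norm2 s bb (Sop u0) \<le> ennreal C * Hs_norm2 s u0"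
proof -
  define C where "C = 24\<^sup>2 * (2 / ((4 - 2 * bb) - 1) / 1)"
  have bb: "1 / 2 < bb" "bb < 1" using eps by (auto simp: bb_def)
  have chi: "(\<integral>\<^sup>+x. ennreal (jbr x powr (2 * bb) * (chi x)\<^sup>2) \<partial>lborel) \<le> ennreal C"
  proof -
    have "(\<integral>\<^sup>+x. ennreal (jbr x powr (2 * bb) * (chi x)\<^sup>2) \<partial>lborel) \<le> (\<integral>\<^sup>+x. ennreal (24\<^sup>2) * ennreal ((1 + 1 * \<bar>x\<bar>) powr (- (4 - 2
      * bb))) \<partial>lborel)"
    proof (rule nn_integral_mono)
      fix x
      have "\<bar>chi x\<bar>\<^sup>2 \<le> (24 / (1 + \<bar>x\<bar>)\<^sup>2)\<^sup>2" by (intro power_mono chi_bound) simp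
      moreover have "jbr x powr (2 * bb) \<le> (1 + \<bar>x\<bar>) powr (2 * bb)" using bb jbr_pos[of x] by (intro powr_mono2 jbr_real_le) auto
      ultimately have "jbr x powr (2 * bb) * (chi x)\<^sup>2 \<le> (1 + \<bar>x\<bar>) powr (2 * bb) * (24 / (1 + \<bar>x\<bar>)\<^sup>2)\<^sup>2"
        by (intro mult_mono) auto
      also have "(24 / (1 + \<bar>x\<bar>)\<^sup>2)\<^sup>2 = 24\<^sup>2 * (1 + \<bar>x\<bar>) powr (- 4)"
        by (simp add: power_divide powr_minus powr_numeral divide_inverse power2_eq_square power4_eq_xxxx mult.assoc)
      also have "(1 + \<bar>x\<bar>) powr (2 * bb) * (24\<^sup>2 * (1 + \<bar>x\<bar>) powr (- 4)) = 24\<^sup>2 * (1 + 1 * \<bar>x\<bar>) powr (- (4 - 2 * bb))"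
        by (simp add: powr_add[symmetric])
      finally have "ennreal (jbr x powr (2 * bb) * (chi x)\<^sup>2) \<le> ennreal (24\<^sup>2 * (1 + 1 * \<bar>x\<bar>) powr (- (4 - 2 * bb)))"
        by (rule ennreal_leI)
      also have "\<dots> = ennreal (24\<^sup>2) * ennreal ((1 + 1 * \<bar>x\<bar>) powr (- (4 - 2 * bb)))" by (rule ennreal_mult) auto
      finally show "ennreal (jbr x powr (2 * bb) * (chi x)\<^sup>2) \<le> ennreal (24\<^sup>2) * ennreal ((1 + 1 * \<bar>x\<bar>) powr (- (4 - 2 * bb)))" .
    qed
    also have "\<dots> = ennreal (24\<^sup>2) * (\<integral>\<^sup>+x. ennreal ((1 + 1 * \<bar>x\<bar>) powr (- (4 - 2 * bb))) \<partial>lborel)"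
      by (rule nn_integral_cmult) measurable
    also have "\<dots> \<le> ennreal (24\<^sup>2) * ennreal (2 / ((4 - 2 * bb) - 1) / 1)"
      using bb by (intro mult_left_mono nn_integral_scaled_decay) auto
    also have "\<dots> = ennreal C" unfolding C_def using bb by (intro ennreal_mult[symmetric]) auto
    finally show ?thesis .
  qed
  show ?thesis
  proof (intro exI[of _ C] conjI allI impI)
    show "0 \<le> C" using bb by (simp add: C_def)
    fix u0 :: "real \<times> real \<Rightarrow> complex" assume [measurable]: "u0 \<in> borel_measurable borel"
    have "Xsb_norm2 s bb (Sop u0) = (\<integral>\<^sup>+z. \<integral>\<^sup>+\<tau>. ennreal (jbr z powr (2 * s) * (cmod (u0 z))\<^sup>2) * ennreal (jbr (\<tau> - phi z) powr (2
      * bb) * (chi (\<tau> - phi z))\<^sup>2) \<partial>lborel \<partial>lborel)"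
      unfolding Xsb_norm2_def
      by (subst nn_integral_pt) (auto intro!: nn_integral_cong simp: Xsb_weight_eq Sop_def norm_mult power_mult_distrib
        ennreal_mult[symmetric] mult_ac)
    also have "\<dots> = (\<integral>\<^sup>+z. ennreal (jbr z powr (2 * s) * (cmod (u0 z))\<^sup>2) * (\<integral>\<^sup>+x. ennreal (jbr x powr (2 * bb) * (chi x)\<^sup>2) \<partial>lborel)
      \<partial>lborel)"
      by (intro nn_integral_cong, subst nn_integral_cmult, measurable, subst nn_integral_shift[of "\<lambda>x. ennreal (jbr x powr (2 * bb)
        * (chi x)\<^sup>2)"], measurable)
    also have "\<dots> \<le> (\<integral>\<^sup>+z. ennreal (jbr z powr (2 * s) * (cmod (u0 z))\<^sup>2) * ennreal C \<partial>lborel)"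
      by (intro nn_integral_mono mult_left_mono chi) auto
    also have "\<dots> = ennreal C * Hs_norm2 s u0"
      unfolding Hs_norm2_def by (subst nn_integral_multc) (auto simp: mult.commute)
    finally show "Xsb_norm2 s bb (Sop u0) \<le> ennreal C * Hs_norm2 s u0" .
  qed
qed

definition CS :: real where "CS = (SOME C. C \<ge> 0 \<and> (\<forall>u0. u0 \<in> borel_measurable borel \<longrightarrow> Xsb_norm2 s bb (Sop u0)
  \<le> ennreal C * Hs_norm2 s u0))"

lemma CS_nonneg: "0 \<le> CS"
  and Sop_norm: "u0 \<in> borel_measurable borel \<Longrightarrow> Xsb_norm2 s bb (Sop u0) \<le> ennreal CS * Hs_norm2 s u0"
  using someI_ex[OF Sop_norm_aux] unfolding CS_def[symmetric] by auto

text \<open>Squared norm of the space that contains the nonlinearity, with modulation exponent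
  \<open>- th\<close>. The square is taken in the extended reals so that \<open>Babs\<close> can be
  compared under the integral.\<close>

definition X' :: "(pt \<Rightarrow> complex) \<Rightarrow> ennreal"
  where "X' F = (\<integral>\<^sup>+\<zeta>. ennreal (Xsb_weight s (- th) \<zeta>) * (ennreal (cmod (F \<zeta>)))\<^sup>2 \<partial>lborel)"

definition KC :: real where "KC = (SOME C. C \<ge> 0 \<and> (\<forall>\<delta> f. 0 < \<delta> \<longrightarrow> \<delta> \<le> 1 \<longrightarrow> f \<in> borel_measurable borel \<longrightarrow>
    (\<integral>\<^sup>+y. ennreal (jbr y powr (2 * bb)) * (\<integral>\<^sup>+x. f x * ennreal (cmod (kd \<delta> y x)) \<partial>lborel)\<^sup>2 \<partial>lborel)
      \<le> ennreal (C * \<delta> powr (2 * (1 - bb - th))) * (\<integral>\<^sup>+x. ennreal (jbr x powr (2 * (- th))) * (f x)\<^sup>2 \<partial>lborel)))"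

lemma KC_nonneg: "0 \<le> KC"
  and KC_bound: "\<lbrakk>0 < \<delta>; \<delta> \<le> 1; f \<in> borel_measurable borel\<rbrakk> \<Longrightarrow>
    (\<integral>\<^sup>+y. ennreal (jbr y powr (2 * bb)) * (\<integral>\<^sup>+x. f x * ennreal (cmod (kd \<delta> y x)) \<partial>lborel)\<^sup>2 \<partial>lborel)
      \<le> ennreal (KC * \<delta> powr (2 * \<epsilon>)) * (\<integral>\<^sup>+x. ennreal (jbr x powr (2 * (- th))) * (f x)\<^sup>2 \<partial>lborel)"
proof -
  have "1 - bb - th = \<epsilon>" by (simp add: bb_def th_def)
  then show "0 \<le> KC" "\<lbrakk>0 < \<delta>; \<delta> \<le> 1; f \<in> borel_measurable borel\<rbrakk> \<Longrightarrow>
    (\<integral>\<^sup>+y. ennreal (jbr y powr (2 * bb)) * (\<integral>\<^sup>+x. f x * ennreal (cmod (kd \<delta> y x)) \<partial>lborel)\<^sup>2 \<partial>lborel)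
      \<le> ennreal (KC * \<delta> powr (2 * \<epsilon>)) * (\<integral>\<^sup>+x. ennreal (jbr x powr (2 * (- th))) * (f x)\<^sup>2 \<partial>lborel)"
    using someI_ex[OF kd_operator_bound[of bb th]] eps unfolding KC_def[symmetric] by (auto simp: bb_def th_def)
qed

text \<open>The kernel acts on the modulation alone, so \<open>KC_bound\<close> is applied on each
  fibre and the spatial weight passes through.\<close>

lemma Dop_norm:
  assumes \<delta>: "0 < \<delta>" "\<delta> \<le> 1" and [measurable]: "F \<in> borel_measurable borel"
  shows "Xsb_norm2 s bb (Dop \<delta> F) \<le> ennreal (KC * \<delta> powr (2 * \<epsilon>)) * X' F"
proof -
  note [measurable] = kd_measurable
  let ?f = "\<lambda>z x. ennreal (cmod (F (fst z, snd z, phi z + x)))"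
  have "Xsb_norm2 s bb (Dop \<delta> F) = (\<integral>\<^sup>+z. \<integral>\<^sup>+\<tau>. ennreal (jbr z powr (2 * s)) * (ennreal (jbr (\<tau> - phi z) powr (2 * bb))
    * (ennreal (cmod (Dop \<delta> F (fst z, snd z, \<tau>))))\<^sup>2) \<partial>lborel \<partial>lborel)"
    unfolding Xsb_norm2_def
    by (subst nn_integral_pt) (auto intro!: nn_integral_cong simp: Xsb_weight_eq ennreal_power ennreal_mult[symmetric] mult_ac)
  also have "\<dots> \<le> (\<integral>\<^sup>+z. \<integral>\<^sup>+\<tau>. ennreal (jbr z powr (2 * s)) * (ennreal (jbr (\<tau> - phi z) powr (2 * bb)) * (\<integral>\<^sup>+x. ?f z x
    * ennreal (cmod (kd \<delta> (\<tau> - phi z) x)) \<partial>lborel)\<^sup>2) \<partial>lborel \<partial>lborel)"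
    by (intro nn_integral_mono mult_left_mono power_mono Dop_norm_le) auto
  also have "\<dots> = (\<integral>\<^sup>+z. ennreal (jbr z powr (2 * s)) * (\<integral>\<^sup>+y. ennreal (jbr y powr (2 * bb)) * (\<integral>\<^sup>+x. ?f z x * ennreal (cmod (kd \<delta> y
    x)) \<partial>lborel)\<^sup>2 \<partial>lborel) \<partial>lborel)"
    by (intro nn_integral_cong, subst nn_integral_cmult, measurable,
        subst nn_integral_shift[of "\<lambda>y. ennreal (jbr y powr (2 * bb)) * (\<integral>\<^sup>+x. ?f _ x * ennreal (cmod (kd \<delta> y x)) \<partial>lborel)\<^sup>2"],
          measurable)
  also have "\<dots> \<le> (\<integral>\<^sup>+z. ennreal (jbr z powr (2 * s)) * (ennreal (KC * \<delta> powr (2 * \<epsilon>)) * (\<integral>\<^sup>+x. ennreal (jbr x powr (2 * (- th)))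
    * (?f z x)\<^sup>2 \<partial>lborel)) \<partial>lborel)"
    using \<delta> by (intro nn_integral_mono mult_left_mono KC_bound) auto
  also have "\<dots> = ennreal (KC * \<delta> powr (2 * \<epsilon>)) * (\<integral>\<^sup>+z. ennreal (jbr z powr (2 * s)) * (\<integral>\<^sup>+x. ennreal (jbr x powr (2 * (- th)))
    * (?f z x)\<^sup>2 \<partial>lborel) \<partial>lborel)"
    by (subst nn_integral_cmult[symmetric]) (auto simp: mult_ac)
  also have "(\<integral>\<^sup>+z. ennreal (jbr z powr (2 * s)) * (\<integral>\<^sup>+x. ennreal (jbr x powr (2 * (- th))) * (?f z x)\<^sup>2 \<partial>lborel) \<partial>lborel) = X' F"
  proof -
    have "X' F = (\<integral>\<^sup>+z. \<integral>\<^sup>+\<tau>. ennreal (jbr z powr (2 * s)) * (ennreal (jbr (\<tau> - phi z) powr (2 * (- th))) * (ennreal (cmod (F (fst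
      z, snd z, \<tau>))))\<^sup>2) \<partial>lborel \<partial>lborel)"
      unfolding X'_def by (subst nn_integral_pt) (auto intro!: nn_integral_cong simp: Xsb_weight_eq ennreal_mult mult_ac)
    also have "\<dots> = (\<integral>\<^sup>+z. ennreal (jbr z powr (2 * s)) * (\<integral>\<^sup>+x. ennreal (jbr x powr (2 * (- th))) * (?f z x)\<^sup>2 \<partial>lborel) \<partial>lborel)"
    proof (rule nn_integral_cong)
      fix z
      have "(\<integral>\<^sup>+\<tau>. ennreal (jbr (\<tau> - phi z) powr (2 * (- th))) * (ennreal (cmod (F (fst z, snd z, \<tau>))))\<^sup>2 \<partial>lborel)
        = (\<integral>\<^sup>+x. ennreal (jbr ((phi z + x) - phi z) powr (2 * (- th))) * (ennreal (cmod (F (fst z, snd z, phi z + x))))\<^sup>2 \<partial>lborel)"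
        by (rule nn_integral_lborel_translate[symmetric]) measurable
      then show "(\<integral>\<^sup>+\<tau>. ennreal (jbr z powr (2 * s)) * (ennreal (jbr (\<tau> - phi z) powr (2 * (- th))) * (ennreal (cmod (F (fst z, snd
        z, \<tau>))))\<^sup>2) \<partial>lborel)
         = ennreal (jbr z powr (2 * s)) * (\<integral>\<^sup>+x. ennreal (jbr x powr (2 * (- th))) * (?f z x)\<^sup>2 \<partial>lborel)"
        by (subst nn_integral_cmult) auto
    qed
    finally show ?thesis by simp
  qed
  finally show ?thesis .
qed

text \<open>Fibrewise norm in which the Duhamel term converges absolutely: both
  \<open>duh_kernel\<close> and the integral of \<open>kd\<close> over its output frequency decay
  like the inverse modulation.\<close>

definition Aw :: "(pt \<Rightarrow> ennreal) \<Rightarrow> real \<times> real \<Rightarrow> ennreal"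
  where "Aw F z = (\<integral>\<^sup>+\<tau>. F (fst z, snd z, \<tau>) * ennreal (1 / (1 + \<bar>\<tau> - phi z\<bar>)) \<partial>lborel)"

text \<open>Cauchy-Schwarz on a fibre: once the weight with exponent \<open>- th\<close> is taken
  out, the remaining factor has exponent \<open>th - 1\<close>, which is square integrable because
  \<open>th < 1 / 2\<close>.\<close>

lemma AE_Aw_finite:
  assumes [measurable]: "F \<in> borel_measurable borel"
    and fin: "(\<integral>\<^sup>+\<zeta>. ennreal (Xsb_weight s (- th) \<zeta>) * (F \<zeta>)\<^sup>2 \<partial>lborel) < \<infinity>"
  shows "AE z in lborel. Aw F z < \<infinity>"
proof -
  have th2: "1 < 2 - 2 * th" using eps by (simp add: th_def)
  have "AE z in lborel. (\<integral>\<^sup>+\<tau>. ennreal (Xsb_weight s (- th) (fst z, snd z, \<tau>)) * (F (fst z, snd z, \<tau>))\<^sup>2 \<partial>lborel) < \<infinity>"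
    by (rule AE_fiber_finite[OF _ fin]) measurable
  then show ?thesis
  proof eventually_elim
    case (elim z)
    let ?j = "\<lambda>\<tau>. jbr (\<tau> - phi z) powr (- th)"
    have j: "0 < ?j \<tau>" for \<tau> using jbr_pos[of "\<tau> - phi z"] by simp
    have "(\<integral>\<^sup>+\<tau>. ennreal (Xsb_weight s (- th) (fst z, snd z, \<tau>)) * (F (fst z, snd z, \<tau>))\<^sup>2 \<partial>lborel)
      = (\<integral>\<^sup>+\<tau>. ennreal (jbr z powr (2 * s)) * (F (fst z, snd z, \<tau>) * ennreal (?j \<tau>))\<^sup>2 \<partial>lborel)"
    proof (rule nn_integral_cong)
      fix \<tau>
      have "Xsb_weight s (- th) (fst z, snd z, \<tau>) = jbr z powr (2 * s) * (?j \<tau>)\<^sup>2"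
        by (simp add: Xsb_weight_eq power2_powr mult.commute)
      then show "ennreal (Xsb_weight s (- th) (fst z, snd z, \<tau>)) * (F (fst z, snd z, \<tau>))\<^sup>2
        = ennreal (jbr z powr (2 * s)) * (F (fst z, snd z, \<tau>) * ennreal (?j \<tau>))\<^sup>2"
        by (simp add: ennreal_mult ennreal_power power_mult_distrib mult_ac)
    qed
    also have "\<dots> = ennreal (jbr z powr (2 * s)) * (\<integral>\<^sup>+\<tau>. (F (fst z, snd z, \<tau>) * ennreal (?j \<tau>))\<^sup>2 \<partial>lborel)"
      by (rule nn_integral_cmult) measurable
    finally have fin1: "(\<integral>\<^sup>+\<tau>. (F (fst z, snd z, \<tau>) * ennreal (?j \<tau>))\<^sup>2 \<partial>lborel) < \<infinity>"
      using elim jbr_pos[of z] by (auto simp: ennreal_mult_less_top)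
    let ?h = "\<lambda>\<tau>. ennreal ((1 + 1 * \<bar>\<tau> - phi z\<bar>) powr (th - 1))"
    have fin2: "(\<integral>\<^sup>+\<tau>. (?h \<tau>)\<^sup>2 \<partial>lborel) < \<infinity>"
    proof -
      have "(\<integral>\<^sup>+\<tau>. (?h \<tau>)\<^sup>2 \<partial>lborel) = (\<integral>\<^sup>+\<tau>. ennreal ((1 + 1 * \<bar>\<tau> - phi z\<bar>) powr (- (2 - 2 * th))) \<partial>lborel)"
        by (simp add: ennreal_power power2_powr)
      also have "\<dots> = (\<integral>\<^sup>+x. ennreal ((1 + 1 * \<bar>x\<bar>) powr (- (2 - 2 * th))) \<partial>lborel)"
        by (rule nn_integral_shift) measurable
      also have "\<dots> < \<infinity>" by (rule le_less_trans[OF nn_integral_scaled_decay]) (use th2 in auto)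
      finally show ?thesis .
    qed
    have "Aw F z \<le> (\<integral>\<^sup>+\<tau>. (F (fst z, snd z, \<tau>) * ennreal (?j \<tau>)) * ?h \<tau> \<partial>lborel)"
      unfolding Aw_def
    proof (rule nn_integral_mono)
      fix \<tau>
      have "1 / (1 + \<bar>\<tau> - phi z\<bar>) = (1 + \<bar>\<tau> - phi z\<bar>) powr (- th) * (1 + \<bar>\<tau> - phi z\<bar>) powr (th - 1)"
        unfolding powr_add[symmetric] by (simp add: powr_minus inverse_eq_divide)
      also have "\<dots> \<le> ?j \<tau> * (1 + 1 * \<bar>\<tau> - phi z\<bar>) powr (th - 1)"
        using th jbr_pos[of "\<tau> - phi z"] by (simp, intro mult_right_mono powr_mono2' jbr_real_le) auto
      finally have "ennreal (1 / (1 + \<bar>\<tau> - phi z\<bar>)) \<le> ennreal (?j \<tau>) * ?h \<tau>"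
        by (simp add: ennreal_mult[symmetric])
      from mult_left_mono[OF this, of "F (fst z, snd z, \<tau>)"]
      show "F (fst z, snd z, \<tau>) * ennreal (1 / (1 + \<bar>\<tau> - phi z\<bar>)) \<le> (F (fst z, snd z, \<tau>) * ennreal (?j \<tau>)) * ?h \<tau>"
        by (simp add: mult.assoc)
    qed
    then have "(Aw F z)\<^sup>2 \<le> (\<integral>\<^sup>+\<tau>. (F (fst z, snd z, \<tau>) * ennreal (?j \<tau>)) * ?h \<tau> \<partial>lborel)\<^sup>2" by (rule power_mono) simp
    also have "\<dots> \<le> (\<integral>\<^sup>+\<tau>. (F (fst z, snd z, \<tau>) * ennreal (?j \<tau>))\<^sup>2 \<partial>lborel) * (\<integral>\<^sup>+\<tau>. (?h \<tau>)\<^sup>2 \<partial>lborel)"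
      by (rule Cauchy_Schwarz_nn_integral) measurable
    also have "\<dots> < \<infinity>" using fin1 fin2 by (simp add: ennreal_mult_less_top)
    finally show "Aw F z < \<infinity>" by (auto simp: power2_eq_square ennreal_mult_less_top)
  qed
qed

lemma time_rep_Dop:
  assumes \<delta>: "0 < \<delta>" "\<delta> \<le> 1" and [measurable]: "F \<in> borel_measurable borel"
    and fin: "Aw (\<lambda>\<zeta>. ennreal (cmod (F \<zeta>))) z < \<infinity>" and t: "\<bar>t\<bar> \<le> \<delta>"
  shows "time_rep (Dop \<delta> F) z t = Duh F z t"
proof -
  note [measurable] = kd_measurable
  let ?p = "phi z" and ?f = "\<lambda>x. F (fst z, snd z, x)" and ?e = "\<lambda>u. exp (\<i> * complex_of_real (t * u))"
  let ?g = "\<lambda>\<tau> x. ?e \<tau> * (?f x * kd \<delta> (\<tau> - ?p) (x - ?p))"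
  \<comment> \<open>Prepares Fubini: after integration over the output frequency the kernel decays
    in \<open>x\<close> exactly like the weight in \<open>Aw\<close>.\<close>
  have kint: "(\<integral>\<^sup>+\<tau>. ennreal (cmod (kd \<delta> (\<tau> - ?p) (x - ?p))) \<partial>lborel) \<le> ennreal (192 * (1 / (1 + \<bar>x - ?p\<bar>)))" for x
  proof -
    define u where "u = x - ?p"
    let ?E = "\<lambda>v. ennreal ((1 + \<delta> * \<bar>v\<bar>) powr (- 2))"
    have "(\<integral>\<^sup>+\<tau>. ennreal (cmod (kd \<delta> (\<tau> - ?p) u)) \<partial>lborel) = (\<integral>\<^sup>+y. ennreal (cmod (kd \<delta> y u)) \<partial>lborel)"
      by (rule nn_integral_shift) measurable
    also have "\<dots> \<le> (\<integral>\<^sup>+y. ennreal (48 * \<delta>\<^sup>2 * (1 + \<delta> * \<bar>u\<bar>) powr (- 1)) * (?E (y - u) + ?E y) \<partial>lborel)"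
    proof (rule nn_integral_mono)
      fix y
      have "ennreal (cmod (kd \<delta> y u)) \<le> ennreal ((48 * \<delta>\<^sup>2 * (1 + \<delta> * \<bar>u\<bar>) powr (- 1)) * ((1 + \<delta> * \<bar>y - u\<bar>) powr (- 2) + (1 + \<delta>
        * \<bar>y\<bar>) powr (- 2)))"
        using kd_bound[OF \<delta>(1), of y u] by (intro ennreal_leI) (simp only: mult_ac)
      also have "\<dots> = ennreal (48 * \<delta>\<^sup>2 * (1 + \<delta> * \<bar>u\<bar>) powr (- 1)) * ennreal ((1 + \<delta> * \<bar>y - u\<bar>) powr (- 2) + (1 + \<delta> * \<bar>y\<bar>) powr (-
        2))"
        using \<delta> by (intro ennreal_mult) auto
      finally show "ennreal (cmod (kd \<delta> y u)) \<le> ennreal (48 * \<delta>\<^sup>2 * (1 + \<delta> * \<bar>u\<bar>) powr (- 1)) * (?E (y - u) + ?E y)" by simp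
    qed
    also have "\<dots> = ennreal (48 * \<delta>\<^sup>2 * (1 + \<delta> * \<bar>u\<bar>) powr (- 1)) * ((\<integral>\<^sup>+y. ?E (y - u) \<partial>lborel) + (\<integral>\<^sup>+y. ?E y \<partial>lborel))"
      by (simp add: nn_integral_cmult nn_integral_add)
    also have "(\<integral>\<^sup>+y. ?E (y - u) \<partial>lborel) = (\<integral>\<^sup>+y. ?E y \<partial>lborel)" by (rule nn_integral_shift) measurable
    also have "ennreal (48 * \<delta>\<^sup>2 * (1 + \<delta> * \<bar>u\<bar>) powr (- 1)) * ((\<integral>\<^sup>+y. ?E y \<partial>lborel) + (\<integral>\<^sup>+y. ?E y \<partial>lborel))
      \<le> ennreal (48 * \<delta>\<^sup>2 * (1 + \<delta> * \<bar>u\<bar>) powr (- 1)) * (ennreal (2 / (2 - 1) / \<delta>) + ennreal (2 / (2 - 1) / \<delta>))"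
      using \<delta> by (intro mult_left_mono add_mono nn_integral_scaled_decay) auto
    also have "\<dots> = ennreal ((48 * \<delta>\<^sup>2 * (1 + \<delta> * \<bar>u\<bar>) powr (- 1)) * (2 / (2 - 1) / \<delta> + 2 / (2 - 1) / \<delta>))"
    proof -
      have "ennreal a * (ennreal b + ennreal b) = ennreal (a * (b + b))" if "0 \<le> a" "0 \<le> b" for a b
        using that by (simp add: ennreal_mult flip: ennreal_plus)
      then show ?thesis using \<delta> by simp
    qed
    also have "\<dots> \<le> ennreal (192 * (1 / (1 + \<bar>u\<bar>)))"
    proof (rule ennreal_leI)
      have pos: "0 < 1 + \<delta> * \<bar>u\<bar>" using \<delta> by (simp add: add_pos_nonneg)
      have "(1 + \<delta> * \<bar>u\<bar>) powr (- 1) = 1 / (1 + \<delta> * \<bar>u\<bar>)" using pos by (simp add: powr_minus inverse_eq_divide)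
      then have "(48 * \<delta>\<^sup>2 * (1 + \<delta> * \<bar>u\<bar>) powr (- 1)) * (2 / (2 - 1) / \<delta> + 2 / (2 - 1) / \<delta>) = 192 * (\<delta> / (1 + \<delta> * \<bar>u\<bar>))"
        using \<delta> by (simp add: power2_eq_square)
      also have "\<delta> / (1 + \<delta> * \<bar>u\<bar>) \<le> 1 / (1 + \<bar>u\<bar>)"
      proof (rule mult_imp_div_pos_le[OF pos])
        have "\<delta> * (1 + \<bar>u\<bar>) \<le> 1 + \<delta> * \<bar>u\<bar>" using \<delta> by (simp add: distrib_left)
        then show "\<delta> \<le> 1 / (1 + \<bar>u\<bar>) * (1 + \<delta> * \<bar>u\<bar>)" by (simp add: pos_le_divide_eq)
      qed
      finally show "(48 * \<delta>\<^sup>2 * (1 + \<delta> * \<bar>u\<bar>) powr (- 1)) * (2 / (2 - 1) / \<delta> + 2 / (2 - 1) / \<delta>) \<le> 192 * (1 / (1 + \<bar>u\<bar>))" by simp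
    qed
    finally show ?thesis by (simp add: u_def)
  qed
  have "(\<integral>\<^sup>+x. \<integral>\<^sup>+\<tau>. ennreal (norm (?g \<tau> x)) \<partial>lborel \<partial>lborel) < \<infinity>"
  proof -
    have "(\<integral>\<^sup>+x. \<integral>\<^sup>+\<tau>. ennreal (norm (?g \<tau> x)) \<partial>lborel \<partial>lborel) = (\<integral>\<^sup>+x. ennreal (cmod (?f x)) * (\<integral>\<^sup>+\<tau>. ennreal (cmod (kd \<delta> (\<tau> - ?p)
      (x - ?p))) \<partial>lborel) \<partial>lborel)"
      by (intro nn_integral_cong, subst nn_integral_cmult[symmetric], measurable) (simp add: norm_mult ennreal_mult)
    also have "\<dots> \<le> (\<integral>\<^sup>+x. ennreal (cmod (?f x)) * ennreal (192 * (1 / (1 + \<bar>x - ?p\<bar>))) \<partial>lborel)"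
      by (intro nn_integral_mono mult_left_mono kint) auto
    also have "\<dots> = (\<integral>\<^sup>+x. ennreal 192 * (ennreal (cmod (?f x)) * ennreal (1 / (1 + \<bar>x - ?p\<bar>))) \<partial>lborel)"
      by (intro nn_integral_cong) (simp only: ennreal_mult'[of 192, simplified] mult_ac, simp)
    also have "\<dots> = ennreal 192 * Aw (\<lambda>\<zeta>. ennreal (cmod (F \<zeta>))) z"
      unfolding Aw_def by (rule nn_integral_cmult) measurable
    also have "\<dots> < \<infinity>" using fin by (simp add: ennreal_mult_less_top)
    finally show ?thesis .
  qed
  then have I: "integrable (lborel \<Otimes>\<^sub>M lborel) (\<lambda>(x, \<tau>). ?g \<tau> x)"
    unfolding integrable_iff_bounded by (simp add: lborel.nn_integral_fst[symmetric])
  have "(\<integral>\<tau>. ?e \<tau> * Dop \<delta> F (fst z, snd z, \<tau>) \<partial>lborel) = (\<integral>\<tau>. (\<integral>x. ?g \<tau> x \<partial>lborel) \<partial>lborel)"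
    by (simp add: Dop_def)
  also have "\<dots> = (\<integral>x. (\<integral>\<tau>. ?g \<tau> x \<partial>lborel) \<partial>lborel)"
    by (rule lborel_pair.Fubini_integral[OF I])
  also have "\<dots> = (\<integral>x. ?f x * duh_kernel t x ?p \<partial>lborel)"
  proof (rule integral_cong_AE)
    show "AE x in lborel. (\<integral>\<tau>. ?g \<tau> x \<partial>lborel) = ?f x * duh_kernel t x ?p"
    \<comment> \<open>The point where \<open>kd\<close> has a junk value is removed as a null
      set.\<close>
    proof (rule AE_mp[OF AE_lborel_singleton[of ?p]], rule AE_I2, rule impI)
      fix x assume x: "x \<noteq> ?p"
      have "(\<integral>\<tau>. ?g \<tau> x \<partial>lborel) = (\<integral>\<tau>. ?f x * (?e \<tau> * kd \<delta> (\<tau> - ?p) (x - ?p)) \<partial>lborel)"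
        by (simp only: mult_ac)
      also have "\<dots> = ?f x * (\<integral>\<tau>. ?e \<tau> * kd \<delta> (\<tau> - ?p) (x - ?p) \<partial>lborel)" by (rule integral_mult_right_zero)
      finally show "(\<integral>\<tau>. ?g \<tau> x \<partial>lborel) = ?f x * duh_kernel t x ?p"
        unfolding kd_inversion[OF \<delta>(1) t x] .
    qed
    show "(\<lambda>x. ?f x * duh_kernel t x ?p) \<in> borel_measurable lborel"
      unfolding duh_kernel_def by measurable
    show "(\<lambda>x. \<integral>\<tau>. ?g \<tau> x \<partial>lborel) \<in> borel_measurable lborel" by measurable
  qed
  finally show ?thesis by (simp add: time_rep_def Duh_def)
qed

end

section \<open>Differences of nonlinear terms\<close>

lemma Xsb_norm2_alt: "Xsb_norm2 s b F = (\<integral>\<^sup>+\<zeta>. ennreal (Xsb_weight s b \<zeta>) * (ennreal (cmod (F \<zeta>)))\<^sup>2 \<partial>lborel)"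
  unfolding Xsb_norm2_def
  by (intro nn_integral_cong) (simp add: ennreal_power ennreal_mult less_imp_le[OF Xsb_weight_pos])

lemma cmod_add_sq: "(ennreal (cmod (x + y)))\<^sup>2 \<le> 2 * (ennreal (cmod x))\<^sup>2 + 2 * (ennreal (cmod y))\<^sup>2"
proof -
  have "(cmod (x + y))\<^sup>2 \<le> (cmod x + cmod y)\<^sup>2" by (intro power_mono norm_triangle_ineq) simp
  also have "\<dots> \<le> 2 * (cmod x)\<^sup>2 + 2 * (cmod y)\<^sup>2"
    using sum_squares_bound[of "cmod x" "cmod y"] by (simp add: power2_sum)
  finally have "ennreal ((cmod (x + y))\<^sup>2) \<le> ennreal (2 * (cmod x)\<^sup>2 + 2 * (cmod y)\<^sup>2)" by (rule ennreal_leI)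
  then show ?thesis by (simp add: ennreal_power ennreal_mult)
qed

lemma weighted_sq_add:
  assumes [measurable]: "w \<in> borel_measurable M" "F \<in> borel_measurable M" "G \<in> borel_measurable M"
  shows "(\<integral>\<^sup>+x. w x * (ennreal (cmod (F x + G x)))\<^sup>2 \<partial>M) \<le> 2 * (\<integral>\<^sup>+x. w x * (ennreal (cmod (F x)))\<^sup>2 \<partial>M) + 2 * (\<integral>\<^sup>+x. w x
    * (ennreal (cmod (G x)))\<^sup>2 \<partial>M)"
proof -
  have "(\<integral>\<^sup>+x. w x * (ennreal (cmod (F x + G x)))\<^sup>2 \<partial>M) \<le> (\<integral>\<^sup>+x. 2 * (w x * (ennreal (cmod (F x)))\<^sup>2) + 2 * (w x * (ennreal (cmod (G
    x)))\<^sup>2) \<partial>M)"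
  proof (rule nn_integral_mono)
    fix x
    from mult_left_mono[OF cmod_add_sq[of "F x" "G x"], of "w x"]
    show "w x * (ennreal (cmod (F x + G x)))\<^sup>2 \<le> 2 * (w x * (ennreal (cmod (F x)))\<^sup>2) + 2 * (w x * (ennreal (cmod (G x)))\<^sup>2)"
      by (simp add: distrib_left mult_ac)
  qed
  also have "\<dots> = 2 * (\<integral>\<^sup>+x. w x * (ennreal (cmod (F x)))\<^sup>2 \<partial>M) + 2 * (\<integral>\<^sup>+x. w x * (ennreal (cmod (G x)))\<^sup>2 \<partial>M)"
    by (simp add: nn_integral_add nn_integral_cmult)
  finally show ?thesis .
qed

lemma Xsb_norm2_add:
  assumes [measurable]: "F \<in> borel_measurable borel" "G \<in> borel_measurable borel"
  shows "Xsb_norm2 s b (\<lambda>\<zeta>. F \<zeta> + G \<zeta>) \<le> 2 * Xsb_norm2 s b F + 2 * Xsb_norm2 s b G"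
  unfolding Xsb_norm2_alt by (intro weighted_sq_add) measurable

lemma Xsb_norm2_uminus: "Xsb_norm2 s b (\<lambda>\<zeta>. - F \<zeta>) = Xsb_norm2 s b F"
  by (simp add: Xsb_norm2_def)

lemma Xsb_norm2_diff:
  assumes [measurable]: "F \<in> borel_measurable borel" "G \<in> borel_measurable borel"
  shows "Xsb_norm2 s b (\<lambda>\<zeta>. F \<zeta> - G \<zeta>) \<le> 2 * Xsb_norm2 s b F + 2 * Xsb_norm2 s b G"
  using Xsb_norm2_add[of F "\<lambda>\<zeta>. - G \<zeta>" s b] by (simp add: Xsb_norm2_uminus)

lemma Xsb_norm2_diff_commute: "Xsb_norm2 s b (\<lambda>\<zeta>. F \<zeta> - G \<zeta>) = Xsb_norm2 s b (\<lambda>\<zeta>. G \<zeta> - F \<zeta>)"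
  by (simp add: Xsb_norm2_def norm_minus_commute)

lemma Xsb_norm2_cong_AE:
  assumes "AE \<zeta> in lborel. F \<zeta> = G \<zeta>"
  shows "Xsb_norm2 s b F = Xsb_norm2 s b G"
  unfolding Xsb_norm2_def using assms by (intro nn_integral_cong_AE) auto

lemma Xsb_meas: "U \<in> Xsb s b \<Longrightarrow> U \<in> borel_measurable borel" by (simp add: Xsb_def)
lemma Xsb_fin: "U \<in> Xsb s b \<Longrightarrow> Xsb_norm2 s b U < top" by (simp add: Xsb_def)
lemma XsbI: "U \<in> borel_measurable borel \<Longrightarrow> Xsb_norm2 s b U < top \<Longrightarrow> U \<in> Xsb s b" by (simp add: Xsb_def)

lemma Xsb_add: "U \<in> Xsb s b \<Longrightarrow> V \<in> Xsb s b \<Longrightarrow> (\<lambda>\<zeta>. U \<zeta> + V \<zeta>) \<in> Xsb s b"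
  by (intro XsbI le_less_trans[OF Xsb_norm2_add]) (auto simp: Xsb_def ennreal_mult_less_top)

lemma Xsb_diff: "U \<in> Xsb s b \<Longrightarrow> V \<in> Xsb s b \<Longrightarrow> (\<lambda>\<zeta>. U \<zeta> - V \<zeta>) \<in> Xsb s b"
  by (intro XsbI le_less_trans[OF Xsb_norm2_diff]) (auto simp: Xsb_def ennreal_mult_less_top)

text \<open>A cylinder over a null set of spatial frequencies is a null set in space-time.\<close>

lemma AE_sp:
  fixes P :: "real \<times> real \<Rightarrow> bool"
  assumes "AE z in lborel. P z"
  shows "AE \<zeta> in lborel. P (sp \<zeta>)"
proof -
  from assms obtain N where N: "{z. \<not> P z} \<subseteq> N" "N \<in> sets borel" "emeasure lborel N = 0"
    by (auto elim!: AE_E)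
  have [measurable]: "N \<in> sets borel" by fact
  have "(\<integral>\<^sup>+\<zeta>. indicator N (sp \<zeta>) \<partial>lborel) = (\<integral>\<^sup>+z. \<integral>\<^sup>+\<tau>. indicator N z \<partial>(lborel :: real measure) \<partial>lborel)"
    by (subst nn_integral_pt) auto
  also have "\<dots> = (\<integral>\<^sup>+z. 0 \<partial>(lborel :: (real \<times> real) measure))"
  proof (rule nn_integral_cong_AE)
    have "AE z in lborel. z \<notin> N" using N by (intro AE_not_in) (simp add: null_setsI)
    then show "AE z in lborel. (\<integral>\<^sup>+\<tau>. indicator N z \<partial>(lborel :: real measure)) = 0" by eventually_elim simp
  qed
  finally have "(\<integral>\<^sup>+\<zeta>. indicator N (sp \<zeta>) \<partial>lborel) = 0" by simp
  then have "AE \<zeta> in lborel. indicator N (sp \<zeta>) = (0::ennreal)" by (subst (asm) nn_integral_0_iff_AE) auto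
  then show ?thesis
  proof eventually_elim
    case (elim \<zeta>)
    then have "sp \<zeta> \<notin> N" by (simp split: split_indicator_asm)
    then show ?case using N(1) by auto
  qed
qed

lemma AE_fiber:
  fixes P :: "pt \<Rightarrow> bool"
  assumes "AE \<zeta> in lborel. P \<zeta>"
  shows "AE z in lborel. AE \<tau> in lborel. P (fst z, snd z, \<tau>)"
proof -
  from assms obtain N where N: "{\<zeta>. \<not> P \<zeta>} \<subseteq> N" "N \<in> sets borel" "emeasure lborel N = 0"
    by (auto elim!: AE_E)
  have [measurable]: "N \<in> sets borel" by fact
  have "(\<integral>\<^sup>+z. \<integral>\<^sup>+\<tau>. indicator N (fst z, snd z, \<tau>) \<partial>lborel \<partial>lborel) = (\<integral>\<^sup>+\<zeta>. indicator N \<zeta> \<partial>lborel)"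
    by (rule nn_integral_pt[of "indicator N", symmetric]) measurable
  also have "\<dots> = 0" using N by simp
  finally have "AE z in lborel. (\<integral>\<^sup>+\<tau>. indicator N (fst z, snd z, \<tau>) \<partial>lborel) = 0"
    by (subst (asm) nn_integral_0_iff_AE) auto
  then show ?thesis
  proof eventually_elim
    case (elim z)
    then have "AE \<tau> in lborel. indicator N (fst z, snd z, \<tau>) = (0::ennreal)" by (subst (asm) nn_integral_0_iff_AE) auto
    then show ?case
    proof eventually_elim
      case (elim \<tau>)
      then have "(fst z, snd z, \<tau>) \<notin> N" by (simp split: split_indicator_asm)
      then show ?case using N(1) by auto
    qed
  qed
qed

definition Bil :: "(pt \<Rightarrow> complex) \<Rightarrow> (pt \<Rightarrow> complex) \<Rightarrow> pt \<Rightarrow> complex"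
  where "Bil U V \<zeta> = (1 / (2 * pi)^3) * (\<integral>\<zeta>1. N_symb \<zeta> \<zeta>1 * U (\<zeta> - \<zeta>1) * V \<zeta>1 \<partial>lborel)"

lemma NL_Bil: "NL U = Bil U U" by (simp add: NL_def[abs_def] Bil_def[abs_def])

lemma Bil_measurable [measurable]:
  assumes [measurable]: "U \<in> borel_measurable borel" "V \<in> borel_measurable borel"
  shows "Bil U V \<in> borel_measurable borel"
proof -
  note [measurable] = N_symb_comp
  show ?thesis unfolding Bil_def by measurable
qed

lemma Bil_integrable:
  assumes [measurable]: "U \<in> borel_measurable borel" "V \<in> borel_measurable borel"
    and "Babs U V \<zeta> < \<infinity>"
  shows "integrable lborel (\<lambda>\<zeta>1. N_symb \<zeta> \<zeta>1 * U (\<zeta> - \<zeta>1) * V \<zeta>1)"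
proof (rule integrableI_bounded)
  note [measurable] = N_symb_comp
  show "(\<lambda>\<zeta>1. N_symb \<zeta> \<zeta>1 * U (\<zeta> - \<zeta>1) * V \<zeta>1) \<in> borel_measurable lborel" by measurable
  show "(\<integral>\<^sup>+\<zeta>1. ennreal (norm (N_symb \<zeta> \<zeta>1 * U (\<zeta> - \<zeta>1) * V \<zeta>1)) \<partial>lborel) < \<infinity>"
    using assms(3) by (simp add: Babs_def norm_mult)
qed

lemma two_pi_cube: "1 \<le> (2 * pi) ^ 3"
  using pi_gt3 by (intro one_le_power) simp

text \<open>The factor \<open>1 / (2 * pi)^3\<close> is at most 1 and is dropped; where
  \<open>Babs\<close> is infinite there is nothing to prove.\<close>

lemma Bil_le:
  assumes [measurable]: "U \<in> borel_measurable borel" "V \<in> borel_measurable borel"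
  shows "ennreal (cmod (Bil U V \<zeta>)) \<le> Babs U V \<zeta>"
proof (cases "Babs U V \<zeta> < \<infinity>")
  case True
  note I = Bil_integrable[OF assms True]
  have "cmod (Bil U V \<zeta>) = cmod (\<integral>\<zeta>1. N_symb \<zeta> \<zeta>1 * U (\<zeta> - \<zeta>1) * V \<zeta>1 \<partial>lborel) / (2 * pi) ^ 3"
    by (simp add: Bil_def norm_mult norm_divide norm_power)
  also have "\<dots> \<le> cmod (\<integral>\<zeta>1. N_symb \<zeta> \<zeta>1 * U (\<zeta> - \<zeta>1) * V \<zeta>1 \<partial>lborel) / 1"
    using two_pi_cube by (intro divide_left_mono) auto
  finally have "ennreal (cmod (Bil U V \<zeta>)) \<le> ennreal (cmod (\<integral>\<zeta>1. N_symb \<zeta> \<zeta>1 * U (\<zeta> - \<zeta>1) * V \<zeta>1 \<partial>lborel))"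
    by (intro ennreal_leI) simp
  also have "\<dots> \<le> Babs U V \<zeta>"
    using integral_norm_bound_ennreal[OF I] by (simp add: Babs_def norm_mult)
  finally show ?thesis .
next
  case False then show ?thesis by (simp add: less_top[symmetric])
qed

context nv
begin

lemma integrable_kd_fiber:
  assumes [measurable]: "F \<in> borel_measurable borel" and \<delta>: "0 < \<delta>" "\<delta> \<le> 1"
    and fin: "Aw (\<lambda>\<zeta>. ennreal (cmod (F \<zeta>))) z < \<infinity>"
  shows "integrable lborel (\<lambda>x. F (fst z, snd z, x) * kd \<delta> y (x - phi z))"
proof (rule integrableI_bounded)
  note [measurable] = kd_measurable
  show "(\<lambda>x. F (fst z, snd z, x) * kd \<delta> y (x - phi z)) \<in> borel_measurable lborel" by measurable
  have "(\<integral>\<^sup>+x. ennreal (norm (F (fst z, snd z, x) * kd \<delta> y (x - phi z))) \<partial>lborel)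
    \<le> (\<integral>\<^sup>+x. ennreal 96 * (ennreal (cmod (F (fst z, snd z, x))) * ennreal (1 / (1 + \<bar>x - phi z\<bar>))) \<partial>lborel)"
  proof (rule nn_integral_mono)
    fix x
    define u where "u = x - phi z"
    have pos: "0 < 1 + \<delta> * \<bar>u\<bar>" using \<delta> by (simp add: add_pos_nonneg)
    have E: "(1 + \<delta> * \<bar>v\<bar>) powr (- 2) \<le> 1" for v
      using powr_mono2'[of "- 2" 1 "1 + \<delta> * \<bar>v\<bar>"] \<delta> by simp
    have "cmod (kd \<delta> y u) \<le> 48 * \<delta>\<^sup>2 * ((1 + \<delta> * \<bar>y - u\<bar>) powr (- 2) + (1 + \<delta> * \<bar>y\<bar>) powr (- 2)) * (1 + \<delta> * \<bar>u\<bar>) powr (- 1)"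
      by (rule kd_bound[OF \<delta>(1)])
    also have "\<dots> \<le> 48 * \<delta>\<^sup>2 * (1 + 1) * (1 + \<delta> * \<bar>u\<bar>) powr (- 1)"
      by (intro mult_right_mono mult_left_mono add_mono E) auto
    also have "(1 + \<delta> * \<bar>u\<bar>) powr (- 1) = 1 / (1 + \<delta> * \<bar>u\<bar>)" using pos by (simp add: powr_minus inverse_eq_divide)
    also have "48 * \<delta>\<^sup>2 * (1 + 1) * (1 / (1 + \<delta> * \<bar>u\<bar>)) = 96 * (\<delta> * (\<delta> / (1 + \<delta> * \<bar>u\<bar>)))"
      by (simp add: power2_eq_square)
    also have "\<dots> \<le> 96 * (1 * (1 / (1 + \<bar>u\<bar>)))"
    proof (intro mult_left_mono mult_mono)
      show "\<delta> / (1 + \<delta> * \<bar>u\<bar>) \<le> 1 / (1 + \<bar>u\<bar>)"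
      proof (rule mult_imp_div_pos_le[OF pos])
        have "\<delta> * (1 + \<bar>u\<bar>) \<le> 1 + \<delta> * \<bar>u\<bar>" using \<delta> by (simp add: distrib_left)
        then show "\<delta> \<le> 1 / (1 + \<bar>u\<bar>) * (1 + \<delta> * \<bar>u\<bar>)" by (simp add: pos_le_divide_eq)
      qed
    qed (use \<delta> pos in auto)
    finally have "ennreal (cmod (kd \<delta> y u)) \<le> ennreal (96 * (1 / (1 + \<bar>u\<bar>)))" by (intro ennreal_leI) simp
    also have "\<dots> = ennreal 96 * ennreal (1 / (1 + \<bar>u\<bar>))" by (rule ennreal_mult) auto
    finally have "ennreal (cmod (kd \<delta> y u)) \<le> ennreal 96 * ennreal (1 / (1 + \<bar>u\<bar>))" .
    from mult_left_mono[OF this, of "ennreal (cmod (F (fst z, snd z, x)))"]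
    show "ennreal (norm (F (fst z, snd z, x) * kd \<delta> y (x - phi z))) \<le> ennreal 96 * (ennreal (cmod (F (fst z, snd z, x)))
      * ennreal (1 / (1 + \<bar>x - phi z\<bar>)))"
      by (simp add: norm_mult ennreal_mult'' u_def mult_ac)
  qed
  also have "\<dots> = ennreal 96 * Aw (\<lambda>\<zeta>. ennreal (cmod (F \<zeta>))) z"
    unfolding Aw_def by (rule nn_integral_cmult) measurable
  also have "\<dots> < \<infinity>" using fin by (simp add: ennreal_mult_less_top)
  finally show "(\<integral>\<^sup>+x. ennreal (norm (F (fst z, snd z, x) * kd \<delta> y (x - phi z))) \<partial>lborel) < \<infinity>" .
qed


abbreviation N2 :: "(pt \<Rightarrow> complex) \<Rightarrow> ennreal" where "N2 \<equiv> Xsb_norm2 s bb"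
abbreviation XX :: "(pt \<Rightarrow> complex) set" where "XX \<equiv> Xsb s bb"

lemma AE_Babs_finite:
  assumes U: "U \<in> XX" and V: "V \<in> XX"
  shows "AE \<zeta> in lborel. Babs U V \<zeta> < \<infinity>"
proof -
  have [measurable]: "U \<in> borel_measurable borel" "V \<in> borel_measurable borel" using assms by (auto simp: Xsb_meas)
  have "(\<integral>\<^sup>+\<zeta>. ennreal (Xsb_weight s (- th) \<zeta>) * (Babs U V \<zeta>)\<^sup>2 \<partial>lborel) < \<infinity>"
    using bilinear[OF U V] Xsb_fin[OF U] Xsb_fin[OF V] by (auto simp: ennreal_mult_less_top intro: le_less_trans)
  then have "AE \<zeta> in lborel. ennreal (Xsb_weight s (- th) \<zeta>) * (Babs U V \<zeta>)\<^sup>2 \<noteq> \<infinity>"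
    by (intro nn_integral_PInf_AE) auto
  then show ?thesis
  proof eventually_elim
    case (elim \<zeta>)
    then have "(Babs U V \<zeta>)\<^sup>2 < top" using Xsb_weight_pos[of s "- th" \<zeta>]
      by (auto simp: less_top[symmetric] ennreal_mult_eq_top_iff)
    then show ?case by (auto simp: power2_eq_square ennreal_mult_less_top)
  qed
qed

lemma AE_Aw_Babs:
  assumes U: "U \<in> XX" and V: "V \<in> XX"
  shows "AE z in lborel. Aw (Babs U V) z < \<infinity>"
proof -
  have [measurable]: "U \<in> borel_measurable borel" "V \<in> borel_measurable borel" using assms by (auto simp: Xsb_meas)
  show ?thesis
    using bilinear[OF U V] Xsb_fin[OF U] Xsb_fin[OF V]
      by (intro AE_Aw_finite) (auto simp: ennreal_mult_less_top intro: le_less_trans)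
qed

lemma X'_Bil:
  assumes U: "U \<in> XX" and V: "V \<in> XX"
  shows "X' (Bil U V) \<le> ennreal CB * N2 U * N2 V"
proof -
  have "X' (Bil U V) \<le> (\<integral>\<^sup>+\<zeta>. ennreal (Xsb_weight s (- th) \<zeta>) * (Babs U V \<zeta>)\<^sup>2 \<partial>lborel)"
    unfolding X'_def using U V by (intro nn_integral_mono mult_left_mono power_mono Bil_le) (auto simp: Xsb_meas)
  also have "\<dots> \<le> ennreal CB * N2 U * N2 V" by (rule bilinear[OF U V])
  finally show ?thesis .
qed

lemma X'_Bil_finite: "U \<in> XX \<Longrightarrow> V \<in> XX \<Longrightarrow> X' (Bil U V) < top"
  using X'_Bil[of U V] by (auto simp: Xsb_fin ennreal_mult_less_top intro: le_less_trans)

lemma X'_add: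
  assumes [measurable]: "F \<in> borel_measurable borel" "G \<in> borel_measurable borel"
  shows "X' (\<lambda>\<zeta>. F \<zeta> + G \<zeta>) \<le> 2 * X' F + 2 * X' G"
  unfolding X'_def by (intro weighted_sq_add) measurable

lemma X'_cong_AE: "AE \<zeta> in lborel. F \<zeta> = G \<zeta> \<Longrightarrow> X' F = X' G"
  unfolding X'_def by (intro nn_integral_cong_AE) auto

lemma AE_Aw_X':
  assumes [measurable]: "F \<in> borel_measurable borel" and "X' F < top"
  shows "AE z in lborel. Aw (\<lambda>\<zeta>. ennreal (cmod (F \<zeta>))) z < \<infinity>"
  using assms(2) unfolding X'_def by (intro AE_Aw_finite) auto

lemma AE_time_rep_Dop:
  assumes "0 < \<delta>" "\<delta> \<le> 1" and [measurable]: "F \<in> borel_measurable borel" and "X' F < top"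
  shows "AE z in lborel. \<forall>t. \<bar>t\<bar> \<le> \<delta> \<longrightarrow> time_rep (Dop \<delta> F) z t = Duh F z t"
  using AE_Aw_X'[OF assms(3,4)] by eventually_elim (use assms in \<open>auto intro: time_rep_Dop\<close>)

text \<open>Linearity is only claimed where both Bochner integrals converge; elsewhere the default
  value 0 could break it.\<close>

lemma AE_Dop_diff:
  assumes \<delta>: "0 < \<delta>" "\<delta> \<le> 1" and [measurable]: "F \<in> borel_measurable borel" "G \<in> borel_measurable borel"
    and fin: "X' F < top" "X' G < top"
  shows "AE \<zeta> in lborel. Dop \<delta> F \<zeta> - Dop \<delta> G \<zeta> = Dop \<delta> (\<lambda>\<zeta>. F \<zeta> - G \<zeta>) \<zeta>"
proof -
  have "AE \<zeta> in lborel. Aw (\<lambda>\<zeta>. ennreal (cmod (F \<zeta>))) (sp \<zeta>) < \<infinity> \<and> Aw (\<lambda>\<zeta>. ennreal (cmod (G \<zeta>))) (sp \<zeta>) < \<infinity>"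
    using AE_Aw_X'[OF _ fin(1)] AE_Aw_X'[OF _ fin(2)] by (intro AE_sp) auto
  then show ?thesis
  proof eventually_elim
    case (elim \<zeta>)
    have 1: "integrable lborel (\<lambda>x. F (fst (sp \<zeta>), snd (sp \<zeta>), x) * kd \<delta> (md \<zeta>) (x - phi (sp \<zeta>)))"
      "integrable lborel (\<lambda>x. G (fst (sp \<zeta>), snd (sp \<zeta>), x) * kd \<delta> (md \<zeta>) (x - phi (sp \<zeta>)))"
      using elim \<delta> by (auto intro!: integrable_kd_fiber simp: Aw_def)
    have "Dop \<delta> F \<zeta> - Dop \<delta> G \<zeta> = (\<integral>x. F (fst (sp \<zeta>), snd (sp \<zeta>), x) * kd \<delta> (md \<zeta>) (x - phi (sp \<zeta>)) - G (fst (sp \<zeta>), snd (sp \<zeta>), x)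
      * kd \<delta> (md \<zeta>) (x - phi (sp \<zeta>)) \<partial>lborel)"
      unfolding Bochner_Integration.integral_diff[OF 1] by (simp add: Dop_def sp_def)
    then show ?case by (simp add: Dop_def left_diff_distrib sp_def)
  qed
qed

lemma AE_Bil_diff_right:
  assumes "U \<in> XX" "V \<in> XX" "W \<in> XX"
  shows "AE \<zeta> in lborel. Bil U V \<zeta> - Bil U W \<zeta> = Bil U (\<lambda>\<zeta>. V \<zeta> - W \<zeta>) \<zeta>"
  using AE_Babs_finite[OF assms(1,2)] AE_Babs_finite[OF assms(1,3)]
proof eventually_elim
  case (elim \<zeta>)
  show ?case
    using Bil_integrable[OF _ _ elim(1)] Bil_integrable[OF _ _ elim(2)] assms
    by (simp add: Bil_def Xsb_meas right_diff_distrib diff_divide_distrib)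
qed

lemma AE_Bil_diff_left:
  assumes "U \<in> XX" "V \<in> XX" "W \<in> XX"
  shows "AE \<zeta> in lborel. Bil U W \<zeta> - Bil V W \<zeta> = Bil (\<lambda>\<zeta>. U \<zeta> - V \<zeta>) W \<zeta>"
  using AE_Babs_finite[OF assms(1,3)] AE_Babs_finite[OF assms(2,3)]
proof eventually_elim
  case (elim \<zeta>)
  show ?case
    using Bil_integrable[OF _ _ elim(1)] Bil_integrable[OF _ _ elim(2)] assms
    by (simp add: Bil_def Xsb_meas right_diff_distrib left_diff_distrib diff_divide_distrib)
qed

lemma AE_NL_diff:
  assumes "U \<in> XX" "V \<in> XX"
  shows "AE \<zeta> in lborel. NL U \<zeta> - NL V \<zeta> = Bil U (\<lambda>\<zeta>. U \<zeta> - V \<zeta>) \<zeta> + Bil (\<lambda>\<zeta>. U \<zeta> - V \<zeta>) V \<zeta>"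
  using AE_Bil_diff_right[OF assms(1,1,2)] AE_Bil_diff_left[OF assms(1,2,2)]
  by eventually_elim (simp add: NL_Bil, metis add.commute diff_add_cancel diff_add_eq)

lemma N2_two_Dop:
  assumes \<delta>: "0 < \<delta>" "\<delta> \<le> 1" and [measurable]: "F \<in> borel_measurable borel" "G \<in> borel_measurable borel"
  shows "N2 (Dop \<delta> (\<lambda>\<zeta>. F \<zeta> + G \<zeta>)) \<le> ennreal (KC * \<delta> powr (2 * \<epsilon>)) * (2 * X' F + 2 * X' G)"
  by (rule order_trans[OF Dop_norm[OF \<delta>]]) (measurable, intro mult_left_mono X'_add, auto)

lemma contraction:
  assumes \<delta>: "0 < \<delta>" "\<delta> \<le> 1" and U: "U \<in> XX" and V: "V \<in> XX"
  shows "N2 (\<lambda>\<zeta>. Dop \<delta> (NL U) \<zeta> - Dop \<delta> (NL V) \<zeta>)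
    \<le> ennreal (KC * \<delta> powr (2 * \<epsilon>)) * (2 * (ennreal CB * (N2 U + N2 V) * N2 (\<lambda>\<zeta>. U \<zeta> - V \<zeta>)))"
proof -
  let ?D = "\<lambda>\<zeta>. U \<zeta> - V \<zeta>"
  have D: "?D \<in> XX" by (rule Xsb_diff[OF U V])
  have [measurable]: "U \<in> borel_measurable borel" "V \<in> borel_measurable borel" "?D \<in> borel_measurable borel" using U V D
    by (auto simp: Xsb_meas)
  have "N2 (\<lambda>\<zeta>. Dop \<delta> (NL U) \<zeta> - Dop \<delta> (NL V) \<zeta>) = N2 (Dop \<delta> (\<lambda>\<zeta>. NL U \<zeta> - NL V \<zeta>))"
    using U V unfolding NL_Bil by (intro Xsb_norm2_cong_AE AE_Dop_diff \<delta> X'_Bil_finite) auto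
  also have "\<dots> \<le> ennreal (KC * \<delta> powr (2 * \<epsilon>)) * X' (\<lambda>\<zeta>. NL U \<zeta> - NL V \<zeta>)"
    unfolding NL_Bil by (intro Dop_norm \<delta>) measurable
  also have "X' (\<lambda>\<zeta>. NL U \<zeta> - NL V \<zeta>) = X' (\<lambda>\<zeta>. Bil U ?D \<zeta> + Bil ?D V \<zeta>)"
    by (rule X'_cong_AE[OF AE_NL_diff[OF U V]])
  also have "\<dots> \<le> 2 * X' (Bil U ?D) + 2 * X' (Bil ?D V)" by (rule X'_add) measurable
  also have "\<dots> \<le> 2 * (ennreal CB * N2 U * N2 ?D) + 2 * (ennreal CB * N2 ?D * N2 V)"
    by (intro add_mono mult_left_mono X'_Bil U V D) auto
  also have "\<dots> = 2 * (ennreal CB * (N2 U + N2 V) * N2 ?D)" by (simp add: distrib_left distrib_right mult_ac)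
  finally show ?thesis by (simp add: mult_left_mono)
qed

lemma Dop_XX:
  assumes "0 < \<delta>" "\<delta> \<le> 1" and [measurable]: "F \<in> borel_measurable borel" and "X' F < top"
  shows "Dop \<delta> F \<in> XX"
  using assms(4) by (intro XsbI le_less_trans[OF Dop_norm[OF assms(1,2,3)]]) (auto simp: ennreal_mult_less_top)

lemma Sop_XX:
  assumes "u0 \<in> Hs s"
  shows "Sop u0 \<in> XX"
  using assms by (intro XsbI le_less_trans[OF Sop_norm]) (auto simp: ennreal_mult_less_top Hs_def)

text \<open>The embedding into continuous functions of time, on a single fibre:
  \<open>2 * bb > 1\<close> makes the inverse squared weight integrable, so the fibre is in L^1 and
  has a value at every time.\<close>

lemma fiber_bound_aux:
  "\<exists>C\<ge>0. \<forall>U z. U \<in> borel_measurable borel \<longrightarrow>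
    (\<integral>\<^sup>+\<tau>. ennreal (cmod (U (fst z, snd z, \<tau>))) \<partial>lborel)\<^sup>2 \<le> ennreal C * (\<integral>\<^sup>+\<tau>. ennreal (jbr (\<tau> - phi z) powr (2 * bb)) * (ennreal
      (cmod (U (fst z, snd z, \<tau>))))\<^sup>2 \<partial>lborel)"
proof (intro exI[of _ cw] conjI allI impI)
  show "0 \<le> cw" by (rule cw)
  fix U :: "pt \<Rightarrow> complex" and z assume [measurable]: "U \<in> borel_measurable borel"
  let ?j = "\<lambda>\<tau>. jbr (\<tau> - phi z)"
  have e: "ennreal (?j \<tau> powr (- bb)) * ennreal (?j \<tau> powr bb) = 1" for \<tau>
    using jbr_pos[of "\<tau> - phi z"] by (simp add: ennreal_mult[symmetric] powr_add[symmetric])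
  have "(\<integral>\<^sup>+\<tau>. ennreal (cmod (U (fst z, snd z, \<tau>))) \<partial>lborel)\<^sup>2 = (\<integral>\<^sup>+\<tau>. ennreal (?j \<tau> powr (- bb)) * (ennreal (?j \<tau> powr bb)
    * ennreal (cmod (U (fst z, snd z, \<tau>)))) \<partial>lborel)\<^sup>2"
    unfolding mult.assoc[symmetric] e by simp
  also have "\<dots> \<le> (\<integral>\<^sup>+\<tau>. (ennreal (?j \<tau> powr (- bb)))\<^sup>2 \<partial>lborel) * (\<integral>\<^sup>+\<tau>. (ennreal (?j \<tau> powr bb) * ennreal (cmod (U (fst z, snd z,
    \<tau>))))\<^sup>2 \<partial>lborel)"
    by (rule Cauchy_Schwarz_nn_integral) measurable
  also have "(\<integral>\<^sup>+\<tau>. (ennreal (?j \<tau> powr (- bb)))\<^sup>2 \<partial>lborel) = (\<integral>\<^sup>+x. ennreal (wt x) \<partial>lborel)"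
    using nn_integral_shift[of "\<lambda>x. ennreal (wt x)" "phi z"] by (simp add: ennreal_power power2_powr wt_def)
  also have "\<dots> * (\<integral>\<^sup>+\<tau>. (ennreal (?j \<tau> powr bb) * ennreal (cmod (U (fst z, snd z, \<tau>))))\<^sup>2 \<partial>lborel)
     \<le> ennreal cw * (\<integral>\<^sup>+\<tau>. (ennreal (?j \<tau> powr bb) * ennreal (cmod (U (fst z, snd z, \<tau>))))\<^sup>2 \<partial>lborel)"
    by (intro mult_right_mono cw) auto
  finally show "(\<integral>\<^sup>+\<tau>. ennreal (cmod (U (fst z, snd z, \<tau>))) \<partial>lborel)\<^sup>2 \<le> ennreal cw * (\<integral>\<^sup>+\<tau>. ennreal (?j \<tau> powr (2 * bb))
    * (ennreal (cmod (U (fst z, snd z, \<tau>))))\<^sup>2 \<partial>lborel)"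
    by (simp add: power_mult_distrib ennreal_power power2_powr)
qed

lemma AE_fiber_L1:
  assumes U: "U \<in> XX"
  shows "AE z in lborel. integrable lborel (\<lambda>\<tau>. U (fst z, snd z, \<tau>))"
proof -
  have [measurable]: "U \<in> borel_measurable borel" using U by (auto simp: Xsb_meas)
  obtain C where C: "0 \<le> C" "\<And>z. (\<integral>\<^sup>+\<tau>. ennreal (cmod (U (fst z, snd z, \<tau>))) \<partial>lborel)\<^sup>2
    \<le> ennreal C * (\<integral>\<^sup>+\<tau>. ennreal (jbr (\<tau> - phi z) powr (2 * bb)) * (ennreal (cmod (U (fst z, snd z, \<tau>))))\<^sup>2 \<partial>lborel)"
    using fiber_bound_aux by (auto simp: Xsb_meas U)
  have "AE z in lborel. (\<integral>\<^sup>+\<tau>. ennreal (Xsb_weight s bb (fst z, snd z, \<tau>)) * (ennreal (cmod (U (fst z, snd z, \<tau>))))\<^sup>2 \<partial>lborel) < \<infinity>"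
    using Xsb_fin[OF U] unfolding Xsb_norm2_alt by (intro AE_fiber_finite) auto
  then show ?thesis
  proof eventually_elim
    case (elim z)
    have "(\<integral>\<^sup>+\<tau>. ennreal (Xsb_weight s bb (fst z, snd z, \<tau>)) * (ennreal (cmod (U (fst z, snd z, \<tau>))))\<^sup>2 \<partial>lborel)
      = ennreal (jbr z powr (2 * s)) * (\<integral>\<^sup>+\<tau>. ennreal (jbr (\<tau> - phi z) powr (2 * bb)) * (ennreal (cmod (U
        (fst z, snd z, \<tau>))))\<^sup>2 \<partial>lborel)"
      by (subst nn_integral_cmult[symmetric]) (auto simp: Xsb_weight_eq ennreal_mult mult_ac)
    then have "(\<integral>\<^sup>+\<tau>. ennreal (jbr (\<tau> - phi z) powr (2 * bb)) * (ennreal (cmod (U (fst z, snd z, \<tau>))))\<^sup>2 \<partial>lborel) < top"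
      using elim jbr_pos[of z] by (auto simp: ennreal_mult_less_top)
    then have "(\<integral>\<^sup>+\<tau>. ennreal (cmod (U (fst z, snd z, \<tau>))) \<partial>lborel)\<^sup>2 < top"
      using C(2)[of z] by (auto simp: ennreal_mult_less_top intro: le_less_trans)
    then have "(\<integral>\<^sup>+\<tau>. ennreal (cmod (U (fst z, snd z, \<tau>))) \<partial>lborel) < \<infinity>"
      by (auto simp: power2_eq_square ennreal_mult_less_top)
    then show ?case by (intro integrableI_bounded) auto
  qed
qed

lemma integrable_exp:
  assumes "integrable lborel (f :: real \<Rightarrow> complex)"
  shows "integrable lborel (\<lambda>\<tau>. exp (\<i> * complex_of_real (t * \<tau>)) * f \<tau>)"
  by (rule Bochner_Integration.integrable_bound[OF assms]) (use assms in \<open>auto simp: norm_mult\<close>)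

lemma AE_time_rep_add:
  assumes U: "U \<in> XX" and V: "V \<in> XX"
  shows "AE z in lborel. \<forall>t. time_rep (\<lambda>\<zeta>. U \<zeta> + V \<zeta>) z t = time_rep U z t + time_rep V z t"
  using AE_fiber_L1[OF U] AE_fiber_L1[OF V]
proof eventually_elim
  case (elim z)
  show ?case
    by (simp add: time_rep_def distrib_left add_divide_distrib Bochner_Integration.integral_add[OF integrable_exp[OF elim(1)]
      integrable_exp[OF elim(2)]] del: of_real_mult)
qed

lemma AE_time_rep_diff:
  assumes U: "U \<in> XX" and V: "V \<in> XX"
  shows "AE z in lborel. \<forall>t. time_rep (\<lambda>\<zeta>. U \<zeta> - V \<zeta>) z t = time_rep U z t - time_rep V z t"
  using AE_fiber_L1[OF U] AE_fiber_L1[OF V]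
proof eventually_elim
  case (elim z)
  show ?case
    by (simp add: time_rep_def right_diff_distrib diff_divide_distrib Bochner_Integration.integral_diff[OF integrable_exp[OF
      elim(1)] integrable_exp[OF elim(2)]] del: of_real_mult)
qed

text \<open>Controls the H^s norm at every single time. In \<open>vanishes_on_step\<close> it
  converts decay of the iterates into vanishing at that time.\<close>

lemma time_rep_bound_aux:
  "\<exists>C\<ge>0. \<forall>U t. U \<in> XX \<longrightarrow> (\<integral>\<^sup>+z. ennreal (jbr z powr (2 * s)) * (ennreal (cmod (time_rep U z t)))\<^sup>2 \<partial>lborel) \<le> ennreal C * N2 U"
proof -
  obtain C where C: "0 \<le> C" "\<And>U z. U \<in> borel_measurable borel \<Longrightarrow> (\<integral>\<^sup>+\<tau>. ennreal (cmod (U (fst z, snd z, \<tau>))) \<partial>lborel)\<^sup>2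
    \<le> ennreal C * (\<integral>\<^sup>+\<tau>. ennreal (jbr (\<tau> - phi z) powr (2 * bb)) * (ennreal (cmod (U (fst z, snd z, \<tau>))))\<^sup>2 \<partial>lborel)"
    using fiber_bound_aux by auto
  show ?thesis
  proof (intro exI[of _ C] conjI allI impI C(1))
    fix U t assume U: "U \<in> XX"
    then have [measurable]: "U \<in> borel_measurable borel" by (rule Xsb_meas)
    have tr: "ennreal (cmod (time_rep U z t)) \<le> (\<integral>\<^sup>+\<tau>. ennreal (cmod (U (fst z, snd z, \<tau>))) \<partial>lborel)" for z
    proof -
      let ?g = "\<lambda>\<tau>. exp (\<i> * complex_of_real (t * \<tau>)) * U (fst z, snd z, \<tau>)"
      have "cmod (time_rep U z t) \<le> cmod (\<integral>\<tau>. ?g \<tau> \<partial>lborel)"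
        using pi_gt3 by (simp add: time_rep_def norm_mult norm_divide divide_le_eq mult_le_cancel_left1)
      then have "ennreal (cmod (time_rep U z t)) \<le> ennreal (cmod (\<integral>\<tau>. ?g \<tau> \<partial>lborel))" by (rule ennreal_leI)
      also have "\<dots> \<le> (\<integral>\<^sup>+\<tau>. ennreal (cmod (?g \<tau>)) \<partial>lborel)"
        by (cases "integrable lborel ?g") (auto simp: not_integrable_integral_eq dest: integral_norm_bound_ennreal)
      finally show ?thesis by (simp add: norm_mult)
    qed
    have "(\<integral>\<^sup>+z. ennreal (jbr z powr (2 * s)) * (ennreal (cmod (time_rep U z t)))\<^sup>2 \<partial>lborel)
      \<le> (\<integral>\<^sup>+z. ennreal (jbr z powr (2 * s)) * (ennreal C * (\<integral>\<^sup>+\<tau>. ennreal (jbr (\<tau> - phi z) powr (2 * bb)) * (ennreal (cmod (U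
        (fst z, snd z, \<tau>))))\<^sup>2 \<partial>lborel)) \<partial>lborel)"
      by (intro nn_integral_mono mult_left_mono order_trans[OF power_mono[OF tr] C(2)]) auto
    also have "\<dots> = (\<integral>\<^sup>+z. ennreal C * (\<integral>\<^sup>+\<tau>. ennreal (Xsb_weight s bb (fst z, snd z, \<tau>)) * (ennreal (cmod (U (fst z, snd z, \<tau>))))\<^sup>2
      \<partial>lborel) \<partial>lborel)"
    proof (rule nn_integral_cong)
      fix z
      have "(\<integral>\<^sup>+\<tau>. ennreal (Xsb_weight s bb (fst z, snd z, \<tau>)) * (ennreal (cmod (U (fst z, snd z, \<tau>))))\<^sup>2 \<partial>lborel)
        = ennreal (jbr z powr (2 * s)) * (\<integral>\<^sup>+\<tau>. ennreal (jbr (\<tau> - phi z) powr (2 * bb)) * (ennreal (cmod (U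
          (fst z, snd z, \<tau>))))\<^sup>2 \<partial>lborel)"
        by (subst nn_integral_cmult[symmetric]) (auto simp: Xsb_weight_eq ennreal_mult mult_ac)
      then show "ennreal (jbr z powr (2 * s)) * (ennreal C * (\<integral>\<^sup>+\<tau>. ennreal (jbr (\<tau> - phi z) powr (2 * bb)) * (ennreal (cmod (U (fst
        z, snd z, \<tau>))))\<^sup>2 \<partial>lborel))
         = ennreal C * (\<integral>\<^sup>+\<tau>. ennreal (Xsb_weight s bb (fst z, snd z, \<tau>)) * (ennreal (cmod (U (fst z, snd z, \<tau>))))\<^sup>2 \<partial>lborel)"
        by (simp add: mult_ac)
    qed
    also have "\<dots> = ennreal C * (\<integral>\<^sup>+z. (\<integral>\<^sup>+\<tau>. ennreal (Xsb_weight s bb (fst z, snd z, \<tau>)) * (ennreal (cmod (U (fst z, snd z, \<tau>))))\<^sup>2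
      \<partial>lborel) \<partial>lborel)"
      by (rule nn_integral_cmult) measurable
    also have "\<dots> = ennreal C * N2 U"
      unfolding Xsb_norm2_alt by (subst nn_integral_pt) auto
    finally show "(\<integral>\<^sup>+z. ennreal (jbr z powr (2 * s)) * (ennreal (cmod (time_rep U z t)))\<^sup>2 \<partial>lborel) \<le> ennreal C * N2 U" .
  qed
qed

end

section \<open>Picard iteration\<close>

lemma suminf_geometric_ennreal:
  assumes "0 \<le> M" "0 \<le> q" "q < 1"
  shows "(\<Sum>k. ennreal (M * q ^ k)) = ennreal (M / (1 - q))"
proof (rule suminf_ennreal_eq)
  show "0 \<le> M * q ^ k" for k using assms by simp
  show "(\<lambda>k. M * q ^ k) sums (M / (1 - q))"
    using sums_mult[OF geometric_sums[of q], of M] assms by simp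
qed

lemma two_ennreal: "0 \<le> x \<Longrightarrow> 2 * ennreal x = ennreal (2 * x)"
  by (simp add: ennreal_mult)

lemma ennreal_eq_0I:
  assumes "\<And>n::nat. x \<le> ennreal (c / 4 ^ n)"
  shows "x = 0"
proof -
  have "(\<lambda>n. ennreal (c * (1 / 4) ^ n)) \<longlonglongrightarrow> ennreal (c * 0)"
    by (intro tendsto_ennrealI tendsto_mult tendsto_const LIMSEQ_realpow_zero) auto
  moreover have "\<exists>N. \<forall>n\<ge>N. x \<le> ennreal (c * (1 / 4) ^ n)" using assms by (simp add: power_one_over)
  ultimately have "x \<le> ennreal (c * 0)" by (rule LIMSEQ_le_const)
  then show ?thesis by simp
qed

context nv
begin

lemma N2_eq_0_AE:
  assumes [measurable]: "F \<in> borel_measurable borel" and "N2 F = 0"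
  shows "AE \<zeta> in lborel. F \<zeta> = 0"
proof -
  have "AE \<zeta> in lborel. ennreal (Xsb_weight s bb \<zeta> * (cmod (F \<zeta>))\<^sup>2) = 0"
    using assms(2) unfolding Xsb_norm2_def by (subst (asm) nn_integral_0_iff_AE) auto
  then show ?thesis
  proof eventually_elim
    case (elim \<zeta>)
    then have "Xsb_weight s bb \<zeta> * (cmod (F \<zeta>))\<^sup>2 \<le> 0" by (simp add: ennreal_eq_0_iff)
    then show ?case using Xsb_weight_pos[of s bb \<zeta>] by (simp add: mult_le_0_iff)
  qed
qed

text \<open>Completeness with an explicit tail. The series of norms still converges with the weights
  \<open>4 ^ k\<close>, so \<open>S\<close> is finite almost everywhere and bounds the term of index
  k by \<open>sqrt S\<close> times 2^(-k); pointwise convergence and the tail bound follow.\<close>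

lemma Riesz_Fischer:
  fixes d :: "nat \<Rightarrow> pt \<Rightarrow> complex"
  assumes dm: "\<And>n. d n \<in> borel_measurable borel" and M: "0 \<le> M"
    and N: "\<And>n. N2 (d n) \<le> ennreal (M / 16 ^ n)"
  shows "(\<lambda>\<zeta>. \<Sum>n. d n \<zeta>) \<in> borel_measurable borel"
    and "N2 (\<lambda>\<zeta>. (\<Sum>n. d n \<zeta>) - (\<Sum>k<n. d k \<zeta>)) \<le> ennreal (8 * M / 4 ^ n)"
proof -
  note [measurable] = dm
  show m[measurable]: "(\<lambda>\<zeta>. \<Sum>n. d n \<zeta>) \<in> borel_measurable borel" by measurable
  define S where "S \<zeta> = (\<Sum>k. ennreal (4 ^ k) * (ennreal (cmod (d k \<zeta>)))\<^sup>2)" for \<zeta>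
  have [measurable]: "S \<in> borel_measurable borel" unfolding S_def by measurable
  let ?w = "\<lambda>\<zeta>. ennreal (Xsb_weight s bb \<zeta>)"
  have IS: "(\<integral>\<^sup>+\<zeta>. ?w \<zeta> * S \<zeta> \<partial>lborel) \<le> ennreal (2 * M)"
  proof -
    have "(\<integral>\<^sup>+\<zeta>. ?w \<zeta> * S \<zeta> \<partial>lborel) = (\<integral>\<^sup>+\<zeta>. (\<Sum>k. ennreal (4 ^ k) * (?w \<zeta> * (ennreal (cmod (d k \<zeta>)))\<^sup>2)) \<partial>lborel)"
      unfolding S_def by (intro nn_integral_cong, subst ennreal_suminf_cmult[symmetric], intro arg_cong[where f = suminf] ext)
        (simp add: mult_ac)
    also have "\<dots> = (\<Sum>k. \<integral>\<^sup>+\<zeta>. ennreal (4 ^ k) * (?w \<zeta> * (ennreal (cmod (d k \<zeta>)))\<^sup>2) \<partial>lborel)"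
      by (rule nn_integral_suminf) measurable
    also have "\<dots> = (\<Sum>k. ennreal (4 ^ k) * N2 (d k))"
      unfolding Xsb_norm2_alt by (simp add: nn_integral_cmult)
    also have "\<dots> \<le> (\<Sum>k. ennreal (M * (1 / 4) ^ k))"
    proof (rule suminf_le)
      fix k
      have "ennreal (4 ^ k) * N2 (d k) \<le> ennreal (4 ^ k) * ennreal (M / 16 ^ k)" by (intro mult_left_mono N) auto
      also have "\<dots> = ennreal (4 ^ k * (M / 16 ^ k))" by (rule ennreal_mult[symmetric]) (use M in auto)
      also have "4 ^ k * (M / 16 ^ k) = M * (1 / 4) ^ k"
      proof -
        have "(16::real) ^ k = 4 ^ k * 4 ^ k" by (simp add: power_mult_distrib[symmetric])
        then show ?thesis by (simp add: power_one_over)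
      qed
      finally show "ennreal (4 ^ k) * N2 (d k) \<le> ennreal (M * (1 / 4) ^ k)" .
    qed auto
    also have "\<dots> = ennreal (M / (1 - 1 / 4))" by (rule suminf_geometric_ennreal) (use M in auto)
    also have "\<dots> \<le> ennreal (2 * M)" using M by (intro ennreal_leI) auto
    finally show ?thesis .
  qed
  have AES: "AE \<zeta> in lborel. S \<zeta> < top"
  proof -
    have "(\<integral>\<^sup>+\<zeta>. ?w \<zeta> * S \<zeta> \<partial>lborel) \<noteq> \<infinity>" using IS by (auto simp: top_unique)
    then have "AE \<zeta> in lborel. ?w \<zeta> * S \<zeta> \<noteq> \<infinity>" by (intro nn_integral_PInf_AE) auto
    then show ?thesis
    proof eventually_elim
      case (elim \<zeta>)
      then show ?case using Xsb_weight_pos[of s bb \<zeta>] by (auto simp: less_top[symmetric] ennreal_mult_eq_top_iff)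
    qed
  qed
  have pw: "(ennreal (cmod ((\<Sum>n. d n \<zeta>) - (\<Sum>k<n. d k \<zeta>))))\<^sup>2 \<le> ennreal (4 / 4 ^ n) * S \<zeta>" if fin: "S \<zeta> < top" for \<zeta>
  proof -
    obtain r where r: "S \<zeta> = ennreal r" "0 \<le> r" using fin by (cases "S \<zeta>") auto
    have dk: "cmod (d k \<zeta>) \<le> sqrt r * (1 / 2) ^ k" for k
    proof -
      have "ennreal (4 ^ k) * (ennreal (cmod (d k \<zeta>)))\<^sup>2 = (\<Sum>i\<in>{k}. ennreal (4 ^ i) * (ennreal (cmod (d i \<zeta>)))\<^sup>2)" by simp
      also have "\<dots> \<le> S \<zeta>" unfolding S_def by (rule sum_le_suminf) auto
      finally have "ennreal (4 ^ k * (cmod (d k \<zeta>))\<^sup>2) \<le> ennreal r"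
        by (simp add: r ennreal_mult ennreal_power)
      then have "4 ^ k * (cmod (d k \<zeta>))\<^sup>2 \<le> r" using r by (simp add: ennreal_le_iff)
      then have "(2 ^ k * cmod (d k \<zeta>))\<^sup>2 \<le> r"
      proof -
        have "(2 ^ k)\<^sup>2 = (4::real) ^ k" by (simp add: power2_eq_square power_mult_distrib[symmetric])
        then show ?thesis using \<open>4 ^ k * (cmod (d k \<zeta>))\<^sup>2 \<le> r\<close> by (simp add: power_mult_distrib)
      qed
      then have "2 ^ k * cmod (d k \<zeta>) \<le> sqrt r" by (rule real_le_rsqrt)
      then show ?thesis by (simp add: power_one_over field_simps)
    qed
    have gs: "summable (\<lambda>k. sqrt r * (1 / 2) ^ k)" by (intro summable_mult summable_geometric) simp
    have sm: "summable (\<lambda>k. d k \<zeta>)" by (rule summable_comparison_test'[OF gs]) (rule dk)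
    have "(\<Sum>n. d n \<zeta>) - (\<Sum>k<n. d k \<zeta>) = (\<Sum>k. d (k + n) \<zeta>)"
      using suminf_minus_initial_segment[OF sm, of n] by simp
    also have "cmod \<dots> \<le> (\<Sum>k. sqrt r * (1 / 2) ^ (k + n))"
    proof (rule norm_suminf_le)
      show "cmod (d (k + n) \<zeta>) \<le> sqrt r * (1 / 2) ^ (k + n)" for k by (rule dk)
      show "summable (\<lambda>k. sqrt r * (1 / 2) ^ (k + n))" by (rule summable_ignore_initial_segment[OF gs])
    qed
    also have "\<dots> = (sqrt r * (1 / 2) ^ n) * (\<Sum>k. (1 / 2) ^ k)"
      by (subst suminf_mult[symmetric]) (auto intro!: summable_geometric arg_cong[where f = suminf] simp: power_add mult_ac)
    also have "(\<Sum>k. (1 / 2 :: real) ^ k) = 2" by (subst suminf_geometric) auto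
    finally have "cmod ((\<Sum>n. d n \<zeta>) - (\<Sum>k<n. d k \<zeta>)) \<le> sqrt r * (1 / 2) ^ n * 2" .
    then have "(cmod ((\<Sum>n. d n \<zeta>) - (\<Sum>k<n. d k \<zeta>)))\<^sup>2 \<le> (sqrt r * (1 / 2) ^ n * 2)\<^sup>2"
      by (rule power_mono) simp
    also have "\<dots> = 4 / 4 ^ n * r"
    proof -
      have "((1 / 2 :: real) ^ n)\<^sup>2 = 1 / 4 ^ n" by (simp add: power2_eq_square power_mult_distrib[symmetric] power_one_over)
      then show ?thesis using r by (simp add: power_mult_distrib)
    qed
    finally have "ennreal ((cmod ((\<Sum>n. d n \<zeta>) - (\<Sum>k<n. d k \<zeta>)))\<^sup>2) \<le> ennreal (4 / 4 ^ n * r)" by (rule ennreal_leI)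
    also have "ennreal (4 / 4 ^ n * r) = ennreal (4 / 4 ^ n) * ennreal r" by (rule ennreal_mult) (use r in auto)
    finally show ?thesis by (simp only: r(1) ennreal_power norm_ge_zero)
  qed
  have "N2 (\<lambda>\<zeta>. (\<Sum>n. d n \<zeta>) - (\<Sum>k<n. d k \<zeta>)) \<le> (\<integral>\<^sup>+\<zeta>. ennreal (4 / 4 ^ n) * (?w \<zeta> * S \<zeta>) \<partial>lborel)"
    unfolding Xsb_norm2_alt
  proof (rule nn_integral_mono_AE)
    show "AE \<zeta> in lborel. ?w \<zeta> * (ennreal (cmod ((\<Sum>n. d n \<zeta>) - (\<Sum>k<n. d k \<zeta>))))\<^sup>2 \<le> ennreal (4 / 4 ^ n) * (?w \<zeta> * S \<zeta>)"
      using AES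
    proof eventually_elim
      case (elim \<zeta>)
      from mult_left_mono[OF pw[OF elim], of "?w \<zeta>"] show ?case by (simp add: mult_ac)
    qed
  qed
  also have "\<dots> = ennreal (4 / 4 ^ n) * (\<integral>\<^sup>+\<zeta>. ?w \<zeta> * S \<zeta> \<partial>lborel)" by (rule nn_integral_cmult) measurable
  also have "\<dots> \<le> ennreal (4 / 4 ^ n) * ennreal (2 * M)" by (intro mult_left_mono IS) auto
  also have "\<dots> = ennreal (8 * M / 4 ^ n)" using M by (simp add: ennreal_mult[symmetric])
  finally show "N2 (\<lambda>\<zeta>. (\<Sum>n. d n \<zeta>) - (\<Sum>k<n. d k \<zeta>)) \<le> ennreal (8 * M / 4 ^ n)" .
qed

text \<open>All norms are squared. The constant 128 lets successive differences shrink at least by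
  1/16 on the ball of size \<open>M\<close>, and lets half of the norm be absorbed on the ball of
  size \<open>8 * M\<close> in \<open>fix_Lipschitz\<close>.\<close>

definition small :: "real \<Rightarrow> real \<Rightarrow> bool"
  where "small \<delta> M \<longleftrightarrow> 0 < \<delta> \<and> \<delta> \<le> 1 \<and> 128 * (KC * \<delta> powr (2 * \<epsilon>) * CB * M) \<le> 1"

text \<open>The cut-off equation for the transforms themselves, hence global in time;
  \<open>fix_solves\<close> deduces \<open>solves_NV\<close>, which only concerns times up to
  \<open>\<delta>\<close>.\<close>

definition is_fix :: "real \<Rightarrow> (real \<times> real \<Rightarrow> complex) \<Rightarrow> (pt \<Rightarrow> complex) \<Rightarrow> bool"
  where "is_fix \<delta> u0 U \<longleftrightarrow> (AE \<zeta> in lborel. U \<zeta> = Sop u0 \<zeta> + Dop \<delta> (NL U) \<zeta>)"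

lemma contraction_real:
  assumes \<delta>: "0 < \<delta>" "\<delta> \<le> 1" and U: "U \<in> XX" and V: "V \<in> XX"
    and a: "N2 U \<le> ennreal a" "N2 V \<le> ennreal b" "N2 (\<lambda>\<zeta>. U \<zeta> - V \<zeta>) \<le> ennreal e" and pos: "0 \<le> a" "0 \<le> b" "0 \<le> e"
  shows "N2 (\<lambda>\<zeta>. Dop \<delta> (NL U) \<zeta> - Dop \<delta> (NL V) \<zeta>) \<le> ennreal (2 * (KC * \<delta> powr (2 * \<epsilon>) * CB) * (a + b) * e)"
proof -
  have "N2 (\<lambda>\<zeta>. Dop \<delta> (NL U) \<zeta> - Dop \<delta> (NL V) \<zeta>) \<le> ennreal (KC * \<delta> powr (2 * \<epsilon>)) * (2 * (ennreal CB * (N2 U + N2 V) * N2 (\<lambda>\<zeta>. U \<zeta> -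
    V \<zeta>)))"
    by (rule contraction[OF \<delta> U V])
  also have "\<dots> \<le> ennreal (KC * \<delta> powr (2 * \<epsilon>)) * (ennreal 2 * (ennreal CB * (ennreal a + ennreal b) * ennreal e))"
    using a by (intro mult_left_mono mult_mono add_mono) auto
  also have "\<dots> = ennreal (KC * \<delta> powr (2 * \<epsilon>) * (2 * (CB * (a + b) * e)))"
    using pos CB_nonneg KC_nonneg
      by (simp only: ennreal_plus[symmetric] ennreal_mult[symmetric] add_nonneg_nonneg mult_nonneg_nonneg powr_ge_zero
        zero_le_numeral)
  finally show ?thesis by (simp add: mult_ac)
qed

lemma NL_X'_finite: "U \<in> XX \<Longrightarrow> X' (NL U) < top"
  unfolding NL_Bil by (intro X'_Bil_finite)

lemma NL_meas: "U \<in> XX \<Longrightarrow> NL U \<in> borel_measurable borel"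
  unfolding NL_Bil by (intro Bil_measurable Xsb_meas)

text \<open>\<open>M\<close> is chosen such that the free part takes at most half of the ball, even
  after the factor 2 in \<open>Xsb_norm2_add\<close>; the summand 1 keeps \<open>M\<close> positive
  for zero data. The differences of iterates satisfy the hypothesis of \<open>Riesz_Fischer\<close>,
  whose tail at \<open>n = 0\<close> bounds the limit by \<open>8 * M\<close>.\<close>

lemma Picard_existence:
  assumes u0: "u0 \<in> Hs s" "Hs_norm2 s u0 \<le> ennreal r" and r: "0 \<le> r" and M: "M = 4 * CS * r + 1" and sm: "small \<delta> M"
  shows "\<exists>U\<in>XX. N2 U \<le> ennreal (8 * M) \<and> is_fix \<delta> u0 U"
proof -
  have \<delta>: "0 < \<delta>" "\<delta> \<le> 1" using sm by (auto simp: small_def)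
  define K where "K = KC * \<delta> powr (2 * \<epsilon>) * CB"
  have K: "0 \<le> K" using KC_nonneg CB_nonneg by (simp add: K_def)
  have KM: "128 * (K * M) \<le> 1" using sm by (simp add: small_def K_def mult.assoc)
  have M1: "1 \<le> M" using r CS_nonneg by (simp add: M)
  have [measurable]: "u0 \<in> borel_measurable borel" using u0 by (simp add: Hs_def)
  define Pm where "Pm U = (\<lambda>\<zeta>. Sop u0 \<zeta> + Dop \<delta> (NL U) \<zeta>)" for U
  have PmX: "Pm U \<in> XX" if "U \<in> XX" for U
    unfolding Pm_def using that u0(1) \<delta> by (intro Xsb_add Sop_XX Dop_XX NL_X'_finite NL_meas)
  have PmM: "N2 (Pm U) \<le> ennreal M" if U: "U \<in> XX" "N2 U \<le> ennreal M" for U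
  proof -
    have 1: "N2 (Sop u0) \<le> ennreal (CS * r)"
    proof -
      have "N2 (Sop u0) \<le> ennreal CS * Hs_norm2 s u0" by (rule Sop_norm) simp
      also have "\<dots> \<le> ennreal CS * ennreal r" by (intro mult_left_mono u0) auto
      finally show ?thesis using CS_nonneg by (simp add: ennreal_mult')
    qed
    have 2: "N2 (Dop \<delta> (NL U)) \<le> ennreal (K * M * M)"
    proof -
      have "N2 (Dop \<delta> (NL U)) \<le> ennreal (KC * \<delta> powr (2 * \<epsilon>)) * X' (NL U)" by (intro Dop_norm \<delta> NL_meas U)
      also have "\<dots> \<le> ennreal (KC * \<delta> powr (2 * \<epsilon>)) * (ennreal CB * N2 U * N2 U)"
        unfolding NL_Bil by (intro mult_left_mono X'_Bil U) auto
      also have "\<dots> \<le> ennreal (KC * \<delta> powr (2 * \<epsilon>)) * (ennreal CB * ennreal M * ennreal M)"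
        using U by (intro mult_left_mono mult_mono) auto
      also have "\<dots> = ennreal (KC * \<delta> powr (2 * \<epsilon>) * (CB * M * M))"
        using KC_nonneg CB_nonneg M1 by (simp add: ennreal_mult)
      finally show ?thesis by (simp add: K_def mult_ac)
    qed
    have Dm: "Dop \<delta> (NL U) \<in> borel_measurable borel" by (intro Dop_measurable NL_meas U)
    have "N2 (Pm U) \<le> 2 * N2 (Sop u0) + 2 * N2 (Dop \<delta> (NL U))"
      unfolding Pm_def by (intro Xsb_norm2_add Dm) measurable
    also have "\<dots> \<le> ennreal 2 * ennreal (CS * r) + ennreal 2 * ennreal (K * M * M)"
      using 1 2 by (intro add_mono mult_mono) auto
    also have "\<dots> = ennreal (2 * (CS * r) + 2 * (K * M * M))"
      using CS_nonneg r K M1 by (simp only: ennreal_plus[symmetric] ennreal_mult[symmetric] add_nonneg_nonneg mult_nonneg_nonneg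
        zero_le_numeral order_trans[OF zero_le_one])
    also have "\<dots> \<le> ennreal M"
    proof (rule ennreal_leI)
      have "(128 * (K * M)) * M \<le> 1 * M" using KM M1 by (intro mult_right_mono) auto
      moreover have "2 * (CS * r) \<le> M / 2" using M by simp
      moreover have "(128 * (K * M)) * M = 128 * (K * M * M)" by simp
      ultimately show "2 * (CS * r) + 2 * (K * M * M) \<le> M" using M1 by linarith
    qed
    finally show ?thesis .
  qed
  define u where "u n = (Pm ^^ n) (\<lambda>_. 0)" for n
  have uS: "u (Suc n) = Pm (u n)" for n by (simp add: u_def)
  have u0': "u 0 = (\<lambda>_. 0)" by (simp add: u_def)
  have uX: "u n \<in> XX \<and> N2 (u n) \<le> ennreal M" for n
  proof (induction n)
    case 0 show ?case by (auto simp: u0' Xsb_def Xsb_norm2_def)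
  next
    case (Suc n) then show ?case using PmX PmM by (auto simp: uS)
  qed
  have um: "u n \<in> borel_measurable borel" for n by (rule Xsb_meas[OF conjunct1[OF uX]])
  define d where "d n = (\<lambda>\<zeta>. u (Suc n) \<zeta> - u n \<zeta>)" for n
  have dm: "d n \<in> borel_measurable borel" for n unfolding d_def using um[of n] um[of "Suc n"] by measurable
  have dN: "N2 (d n) \<le> ennreal (M / 16 ^ n)" for n
  proof (induction n)
    case 0
    show ?case using uX[of 1] by (simp add: d_def u0')
  next
    case (Suc n)
    have "N2 (d (Suc n)) = N2 (\<lambda>\<zeta>. Dop \<delta> (NL (u (Suc n))) \<zeta> - Dop \<delta> (NL (u n)) \<zeta>)"
      by (simp add: d_def uS Pm_def)
    also have "\<dots> \<le> ennreal (2 * K * (M + M) * (M / 16 ^ n))"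
      unfolding K_def using uX Suc M1 by (intro contraction_real \<delta>) (auto simp: d_def)
    also have "\<dots> \<le> ennreal (M / 16 ^ Suc n)"
    proof (rule ennreal_leI)
      have "4 * (K * M) * (M / 16 ^ n) \<le> (1 / 16) * (M / 16 ^ n)" using KM M1 by (intro mult_right_mono) auto
      then show "2 * K * (M + M) * (M / 16 ^ n) \<le> M / 16 ^ Suc n" by (simp add: mult_ac)
    qed
    finally show ?case .
  qed
  have tele: "(\<Sum>k<n. d k \<zeta>) = u n \<zeta>" for n \<zeta>
    unfolding d_def by (simp add: sum_lessThan_telescope[of "\<lambda>k. u k \<zeta>"] u0')
  define U where "U = (\<lambda>\<zeta>. \<Sum>n. d n \<zeta>)"
  have Um: "U \<in> borel_measurable borel" unfolding U_def by (rule Riesz_Fischer(1)[OF dm _ dN]) (use M1 in simp)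
  have Ud: "N2 (\<lambda>\<zeta>. U \<zeta> - u n \<zeta>) \<le> ennreal (8 * M / 4 ^ n)" for n
    using Riesz_Fischer(2)[OF dm _ dN, of n] M1 by (simp add: U_def tele)
  have UN: "N2 U \<le> ennreal (8 * M)" using Ud[of 0] by (simp add: u0')
  have UX: "U \<in> XX" using UN by (intro XsbI Um) (auto intro: le_less_trans)
  have PmUm: "Pm U \<in> borel_measurable borel" using PmX[OF UX] by (rule Xsb_meas)
  \<comment> \<open>The iterate \<open>u (Suc n) = Pm (u n)\<close> is inserted between
    \<open>U\<close> and \<open>Pm U\<close>; the bound tends to zero, so the limit is a fixed
    point.\<close>
  have "N2 (\<lambda>\<zeta>. U \<zeta> - Pm U \<zeta>) \<le> ennreal (8 * M / 4 ^ n)" for n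
  proof -
    have "N2 (\<lambda>\<zeta>. U \<zeta> - Pm U \<zeta>) = N2 (\<lambda>\<zeta>. (U \<zeta> - u (Suc n) \<zeta>) + (u (Suc n) \<zeta> - Pm U \<zeta>))" by simp
    also have "\<dots> \<le> 2 * N2 (\<lambda>\<zeta>. U \<zeta> - u (Suc n) \<zeta>) + 2 * N2 (\<lambda>\<zeta>. u (Suc n) \<zeta> - Pm U \<zeta>)"
      using Um um PmUm by (intro Xsb_norm2_add borel_measurable_diff)
    also have "N2 (\<lambda>\<zeta>. u (Suc n) \<zeta> - Pm U \<zeta>) = N2 (\<lambda>\<zeta>. Dop \<delta> (NL (u n)) \<zeta> - Dop \<delta> (NL U) \<zeta>)"
      by (simp add: uS Pm_def)
    also have "\<dots> \<le> ennreal (2 * K * (M + 8 * M) * (8 * M / 4 ^ n))"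
      unfolding K_def using uX[of n] UX UN Ud[of n] M1 by (intro contraction_real \<delta>) (auto simp: Xsb_norm2_diff_commute[of _ _
        "u n"])
    also have "2 * N2 (\<lambda>\<zeta>. U \<zeta> - u (Suc n) \<zeta>) + 2 * ennreal (2 * K * (M + 8 * M) * (8 * M / 4 ^ n))
      \<le> ennreal 2 * ennreal (8 * M / 4 ^ Suc n) + ennreal 2 * ennreal (2 * K * (M + 8 * M) * (8 * M / 4 ^ n))"
      using Ud[of "Suc n"] by (intro add_mono mult_mono) auto
    also have "\<dots> = ennreal (2 * (8 * M / 4 ^ Suc n) + 2 * (2 * K * (M + 8 * M) * (8 * M / 4 ^ n)))"
    proof -
      have "ennreal 2 * ennreal x + ennreal 2 * ennreal y = ennreal (2 * x + 2 * y)" if "0 \<le> x" "0 \<le> y" for x y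
        using that by (simp add: ennreal_mult)
      then show ?thesis using K M1 by simp
    qed
    also have "\<dots> \<le> ennreal (8 * M / 4 ^ n)"
    proof (rule ennreal_leI)
      have "(K * M) * (288 * (M / 4 ^ n)) \<le> (1 / 128) * (288 * (M / 4 ^ n))" using KM M1 by (intro mult_right_mono) auto
      moreover have "0 \<le> M / 4 ^ n" using M1 by simp
      ultimately show "2 * (8 * M / 4 ^ Suc n) + 2 * (2 * K * (M + 8 * M) * (8 * M / 4 ^ n)) \<le> 8 * M / 4 ^ n"
        by (simp add: mult_ac)
    qed
    finally show ?thesis by (simp add: add_mono mult_left_mono)
  qed
  then have "N2 (\<lambda>\<zeta>. U \<zeta> - Pm U \<zeta>) = 0" by (rule ennreal_eq_0I)
  then have "AE \<zeta> in lborel. U \<zeta> - Pm U \<zeta> = 0" using Um PmUm by (intro N2_eq_0_AE borel_measurable_diff)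
  then have "is_fix \<delta> u0 U" unfolding is_fix_def Pm_def by simp
  then show ?thesis using UX UN by blast
qed

text \<open>The Duhamel terms contribute at most half of the squared norm of the difference. This
  half is absorbed, which is legitimate because that norm is finite.\<close>

lemma fix_Lipschitz:
  assumes u0: "u0 \<in> Hs s" and v0: "v0 \<in> Hs s" and sm: "small \<delta> M" and M: "0 \<le> M"
    and U: "U \<in> XX" "N2 U \<le> ennreal (8 * M)" "is_fix \<delta> u0 U" and V: "V \<in> XX" "N2 V \<le> ennreal (8 * M)" "is_fix \<delta> v0 V"
  shows "N2 (\<lambda>\<zeta>. U \<zeta> - V \<zeta>) \<le> ennreal (4 * CS) * Hs_norm2 s (\<lambda>z. u0 z - v0 z)"
proof -
  have \<delta>: "0 < \<delta>" "\<delta> \<le> 1" using sm by (auto simp: small_def)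
  define K where "K = KC * \<delta> powr (2 * \<epsilon>) * CB"
  have K: "0 \<le> K" using KC_nonneg CB_nonneg by (simp add: K_def)
  have KM: "128 * (K * M) \<le> 1" using sm by (simp add: small_def K_def mult.assoc)
  have [measurable]: "u0 \<in> borel_measurable borel" "v0 \<in> borel_measurable borel" using u0 v0 by (auto simp: Hs_def)
  let ?D = "\<lambda>\<zeta>. U \<zeta> - V \<zeta>" and ?w = "\<lambda>z. u0 z - v0 z"
  obtain e where e: "N2 ?D = ennreal e" "0 \<le> e"
    using Xsb_fin[OF Xsb_diff[OF U(1) V(1)]] by (cases "N2 ?D") auto
  have Dm: "Dop \<delta> (NL U) \<in> borel_measurable borel" "Dop \<delta> (NL V) \<in> borel_measurable borel" by (intro Dop_measurable NL_meas U V)+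
  have "AE \<zeta> in lborel. ?D \<zeta> = Sop ?w \<zeta> + (Dop \<delta> (NL U) \<zeta> - Dop \<delta> (NL V) \<zeta>)"
    using U(3) V(3) unfolding is_fix_def by eventually_elim (simp add: Sop_def algebra_simps)
  then have "N2 ?D = N2 (\<lambda>\<zeta>. Sop ?w \<zeta> + (Dop \<delta> (NL U) \<zeta> - Dop \<delta> (NL V) \<zeta>))" by (rule Xsb_norm2_cong_AE)
  also have "\<dots> \<le> 2 * N2 (Sop ?w) + 2 * N2 (\<lambda>\<zeta>. Dop \<delta> (NL U) \<zeta> - Dop \<delta> (NL V) \<zeta>)"
    by (intro Xsb_norm2_add borel_measurable_diff Dm Sop_measurable) measurable
  also have "\<dots> \<le> 2 * (ennreal CS * Hs_norm2 s ?w) + 2 * ennreal (2 * K * (8 * M + 8 * M) * e)"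
    unfolding K_def using U V M e by (intro add_mono mult_left_mono Sop_norm contraction_real \<delta>) auto
  also have "2 * ennreal (2 * K * (8 * M + 8 * M) * e) \<le> ennreal (e / 2)"
  proof -
    have "2 * ennreal (2 * K * (8 * M + 8 * M) * e) = ennreal (2 * (2 * K * (8 * M + 8 * M) * e))"
      using K M e by (intro two_ennreal) auto
    also have "\<dots> \<le> ennreal (e / 2)"
    proof (rule ennreal_leI)
      have "(64 * (K * M)) * e \<le> (1 / 2) * e" using KM e by (intro mult_right_mono) auto
      then show "2 * (2 * K * (8 * M + 8 * M) * e) \<le> e / 2" by (simp add: mult_ac)
    qed
    finally show ?thesis .
  qed
  finally have le: "ennreal e \<le> 2 * (ennreal CS * Hs_norm2 s ?w) + ennreal (e / 2)" by (simp add: e add_left_mono)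
  show ?thesis
  proof (cases "ennreal CS * Hs_norm2 s ?w")
    case (real q)
    then have "ennreal e \<le> ennreal (2 * q + e / 2)" using le e by (simp add: ennreal_mult)
    then have "e \<le> 2 * q + e / 2" using real e by (subst (asm) ennreal_le_iff) auto
    then have "ennreal e \<le> ennreal (4 * q)" by (intro ennreal_leI) simp
    also have "\<dots> = ennreal 4 * (ennreal CS * Hs_norm2 s ?w)" using real by (simp add: ennreal_mult)
    finally show ?thesis using e CS_nonneg by (simp add: ennreal_mult mult.assoc)
  next
    case top
    then have "ennreal (4 * CS) * Hs_norm2 s ?w = top" using CS_nonneg
      by (auto simp: ennreal_mult mult.assoc ennreal_mult_eq_top_iff)
    then show ?thesis by simp
  qed
qed

lemma time_rep_cong_AE:
  assumes "AE \<zeta> in lborel. U \<zeta> = V \<zeta>" and [measurable]: "U \<in> borel_measurable borel" "V \<in> borel_measurable borel"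
  shows "AE z in lborel. \<forall>t. time_rep U z t = time_rep V z t"
  using AE_fiber[OF assms(1)]
proof eventually_elim
  case (elim z)
  show ?case
  proof
    fix t
    have "(\<integral>\<tau>. exp (\<i> * complex_of_real (t * \<tau>)) * U (fst z, snd z, \<tau>) \<partial>lborel) = (\<integral>\<tau>. exp (\<i> * complex_of_real (t * \<tau>))
      * V (fst z, snd z, \<tau>) \<partial>lborel)"
    proof (rule integral_cong_AE)
      show "AE \<tau> in lborel. exp (\<i> * complex_of_real (t * \<tau>)) * U (fst z, snd z, \<tau>) = exp (\<i> * complex_of_real (t * \<tau>))
        * V (fst z, snd z, \<tau>)"
        using elim by eventually_elim simp
    qed measurable
    then show "time_rep U z t = time_rep V z t" by (simp add: time_rep_def)
  qed
qed

text \<open>Both cutoffs equal 1 for \<open>\<bar>t\<bar> \<le> \<delta> \<le> 1\<close>, so the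
  cut-off equation turns into the Duhamel equation there.\<close>

lemma fix_solves:
  assumes u0: "u0 \<in> Hs s" and \<delta>: "0 < \<delta>" "\<delta> \<le> 1" and U: "U \<in> XX" "is_fix \<delta> u0 U"
  shows "solves_NV s bb \<delta> u0 U"
proof -
  have S: "Sop u0 \<in> XX" by (rule Sop_XX[OF u0])
  have D: "Dop \<delta> (NL U) \<in> XX" by (intro Dop_XX \<delta> NL_meas NL_X'_finite U)
  have "AE z in lborel. time_rep U z t = exp (\<i> * complex_of_real (t * phi z)) * u0 z + duhamel U z t" if t: "t \<in> {-\<delta>..\<delta>}" for t
  proof -
    have "AE z in lborel. \<forall>t. time_rep U z t = time_rep (\<lambda>\<zeta>. Sop u0 \<zeta> + Dop \<delta> (NL U) \<zeta>) z t"
      using U S D unfolding is_fix_def by (intro time_rep_cong_AE) (auto intro: Xsb_meas Xsb_meas[OF Xsb_add])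
    then show ?thesis
      using AE_time_rep_add[OF S D] AE_time_rep_Dop[OF \<delta> NL_meas[OF U(1)] NL_X'_finite[OF U(1)]]
    proof eventually_elim
      case (elim z)
      have "\<bar>t\<bar> \<le> \<delta>" "\<bar>t\<bar> \<le> 1" using t \<delta> by auto
      then show ?case using elim time_rep_Sop[of t u0 z] by (simp add: duhamel_Duh)
    qed
  qed
  then show ?thesis using U(1) by (simp add: solves_NV_def)
qed

end

section \<open>Locality of the Duhamel term\<close>

lemma lborel_reflect_distr: "(lborel::'a::euclidean_space measure) = distr lborel borel (\<lambda>x. c - x)"
  using lborel_affine[of "-1" c] by (simp add: density_1)

lemma integral_lborel_reflect:
  fixes f :: "'a::euclidean_space \<Rightarrow> 'b::{banach, second_countable_topology}"
  assumes [measurable]: "f \<in> borel_measurable borel"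
  shows "(\<integral>x. f (c - x) \<partial>lborel) = (\<integral>x. f x \<partial>lborel)"
  by (subst (2) lborel_reflect_distr[of c], subst integral_distr) auto

lemma AE_lborel_reflect:
  fixes P :: "'a::euclidean_space \<Rightarrow> bool"
  assumes "AE x in lborel. P x"
  shows "AE x in lborel. P (c - x)"
proof -
  from assms obtain N where N: "{x. \<not> P x} \<subseteq> N" "N \<in> sets borel" "emeasure lborel N = 0"
    by (auto elim!: AE_E)
  have [measurable]: "N \<in> sets borel" by fact
  have "(\<integral>\<^sup>+x. indicator N (c - x) \<partial>lborel) = (\<integral>\<^sup>+x. indicator N x \<partial>lborel)"
    by (rule nn_integral_lborel_reflect) measurable
  then have "(\<integral>\<^sup>+x. indicator N (c - x) \<partial>lborel) = 0" using N by simp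
  then have "AE x in lborel. indicator N (c - x) = (0::ennreal)" by (subst (asm) nn_integral_0_iff_AE) auto
  then show ?thesis
  proof eventually_elim
    case (elim x)
    then have "c - x \<notin> N" by (simp split: split_indicator_asm)
    then show ?case using N(1) by auto
  qed
qed

lemma lborel_pt_distr: "(lborel :: pt measure) = distr (lborel \<Otimes>\<^sub>M lborel) borel (\<lambda>x. (fst (fst x), snd (fst x), snd x))"
proof (rule measure_eqI)
  fix A :: "pt set" assume "A \<in> sets lborel"
  then have [measurable]: "A \<in> sets borel" by simp
  have m[measurable]: "(\<lambda>x. (fst (fst x), snd (fst x), snd x)) \<in> (lborel \<Otimes>\<^sub>M lborel :: ((real \<times> real) \<times> real) measure) \<rightarrow>\<^sub>M borel"
    by measurable
  have "emeasure (distr (lborel \<Otimes>\<^sub>M lborel) borel (\<lambda>x. (fst (fst x), snd (fst x), snd x))) A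
    = (\<integral>\<^sup>+x. indicator A x \<partial>distr (lborel \<Otimes>\<^sub>M lborel) borel (\<lambda>x::((real \<times> real) \<times> real). (fst (fst x), snd (fst x), snd x)))"
    by simp
  also have "\<dots> = (\<integral>\<^sup>+x. indicator A (fst (fst x), snd (fst x), snd x) \<partial>(lborel \<Otimes>\<^sub>M lborel))"
    by (rule nn_integral_distr) measurable
  also have "\<dots> = (\<integral>\<^sup>+z. \<integral>\<^sup>+\<tau>. indicator A (fst z, snd z, \<tau>) \<partial>lborel \<partial>lborel)"
    by (subst lborel.nn_integral_fst[symmetric]) auto
  also have "\<dots> = emeasure lborel A" by (subst nn_integral_pt[symmetric]) auto
  finally show "emeasure lborel A = emeasure (distr (lborel \<Otimes>\<^sub>M lborel) borel (\<lambda>x. (fst (fst x), snd (fst x), snd x))) A" by simp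
qed simp

lemma integral_pt:
  fixes f :: "pt \<Rightarrow> complex"
  assumes f: "integrable lborel f"
  shows "(\<integral>\<zeta>. f \<zeta> \<partial>lborel) = (\<integral>z. (\<integral>\<tau>. f (fst z, snd z, \<tau>) \<partial>lborel) \<partial>lborel)"
proof -
  have [measurable]: "f \<in> borel_measurable borel" using f by auto
  have m[measurable]: "(\<lambda>x. (fst (fst x), snd (fst x), snd x)) \<in> (lborel \<Otimes>\<^sub>M lborel :: ((real \<times> real) \<times> real) measure) \<rightarrow>\<^sub>M borel"
    by measurable
  have i: "integrable (lborel \<Otimes>\<^sub>M lborel) (\<lambda>x::((real \<times> real) \<times> real). f (fst (fst x), snd (fst x), snd x))"
    using f by (subst (asm) lborel_pt_distr) (subst (asm) integrable_distr_eq, auto)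
  have "(\<integral>\<zeta>. f \<zeta> \<partial>lborel) = (\<integral>x. f (fst (fst x), snd (fst x), snd x) \<partial>(lborel \<Otimes>\<^sub>M lborel))"
    by (subst lborel_pt_distr, subst integral_distr) auto
  also have "\<dots> = (\<integral>z. (\<integral>\<tau>. f (fst z, snd z, \<tau>) \<partial>lborel) \<partial>lborel)"
    using lborel_pair.integral_fst'[OF i] by simp
  finally show ?thesis .
qed

lemma Bil_commute:
  assumes [measurable]: "U \<in> borel_measurable borel" "V \<in> borel_measurable borel"
  shows "Bil U V = Bil V U"
proof
  fix \<zeta>
  note [measurable] = N_symb_comp
  have "(\<integral>\<zeta>1. N_symb \<zeta> \<zeta>1 * U (\<zeta> - \<zeta>1) * V \<zeta>1 \<partial>lborel) = (\<integral>\<zeta>1. N_symb \<zeta> (\<zeta> - \<zeta>1) * U (\<zeta> - (\<zeta> - \<zeta>1)) * V (\<zeta> - \<zeta>1) \<partial>lborel)"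
    by (rule integral_lborel_reflect[symmetric]) measurable
  then show "Bil U V \<zeta> = Bil V U \<zeta>" by (simp add: Bil_def N_symb_refl mult_ac)
qed

lemma duh_kernel_measurable:
  assumes [measurable]: "u \<in> borel_measurable M"
  shows "(\<lambda>x. duh_kernel t (u x) p) \<in> borel_measurable M"
  unfolding duh_kernel_def by measurable

lemma exp_ii_FTC:
  assumes "a \<le> b"
  shows "(\<integral>x. indicator {a..b} x *\<^sub>R exp (\<i> * complex_of_real (x * c)) \<partial>lborel)
    = (if c = 0 then complex_of_real (b - a) else (exp (\<i> * complex_of_real (b * c)) - exp (\<i> * complex_of_real (a * c))) /
      (\<i> * complex_of_real c))"
proof (cases "c = 0")
  case True
  then have "(\<integral>x. indicator {a..b} x *\<^sub>R exp (\<i> * complex_of_real (x * c)) \<partial>lborel)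
    = (\<integral>x. indicator {a..b} x *\<^sub>R (1::complex) \<partial>lborel)" by simp
  also have "\<dots> = complex_of_real b - complex_of_real a"
    by (rule integral_FTC_Icc[OF assms]) (auto intro!: derivative_eq_intros simp: has_vector_derivative_of_real)
  finally show ?thesis using True by simp
next
  case False
  have "((\<lambda>x. exp (\<i> * complex_of_real (x * c)) / (\<i> * complex_of_real c)) has_vector_derivative exp (\<i> * complex_of_real (x
    * c))) (at x within {a..b})" for x
  proof -
    have "((\<lambda>z. exp (\<i> * (z * complex_of_real c)) / (\<i> * complex_of_real c)) has_field_derivative exp (\<i> * (complex_of_real x
      * complex_of_real c))) (at (complex_of_real x))"
      using False by (auto intro!: derivative_eq_intros simp: complex_eq_iff[of "- (\<i> * (_ * \<i>))"])
    from has_vector_derivative_real_field[OF this] show ?thesis by simp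
  qed
  then have "(\<integral>x. indicator {a..b} x *\<^sub>R exp (\<i> * complex_of_real (x * c)) \<partial>lborel) = exp (\<i> * complex_of_real (b * c)) / (\<i>
    * complex_of_real c) - exp (\<i> * complex_of_real (a * c)) / (\<i> * complex_of_real c)"
    by (intro integral_FTC_Icc[OF assms]) (auto intro!: continuous_intros)
  then show ?thesis using False by (simp add: diff_divide_distrib)
qed

abbreviation Jt :: "real \<Rightarrow> real set" where "Jt t \<equiv> {min 0 t..max 0 t}"

text \<open>The factor \<open>sgn t\<close> and the interval between 0 and \<open>t\<close> encode
  an oriented integral, so both signs of time are treated together.\<close>

lemma duh_kernel_rep:
  "duh_kernel t \<tau> p = (\<integral>x. indicator (Jt t) x *\<^sub>R (complex_of_real (sgn t) * exp (\<i> * complex_of_real ((t - x) * p)) * exp (\<i>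
    * complex_of_real (x * \<tau>))) \<partial>lborel)"
proof -
  have e: "exp (\<i> * complex_of_real ((t - x) * p)) * exp (\<i> * complex_of_real (x * \<tau>)) = exp (\<i> * complex_of_real (t * p)) * exp (\<i>
    * complex_of_real (x * (\<tau> - p)))" for x
    unfolding exp_add[symmetric] distrib_left[symmetric] of_real_add[symmetric] by (simp add: algebra_simps)
  have "(\<integral>x. indicator (Jt t) x *\<^sub>R (complex_of_real (sgn t) * exp (\<i> * complex_of_real ((t - x) * p)) * exp (\<i> * complex_of_real (x
    * \<tau>))) \<partial>lborel)
     = (\<integral>x. (complex_of_real (sgn t) * exp (\<i> * complex_of_real (t * p))) * (indicator (Jt t) x *\<^sub>R exp (\<i> * complex_of_real (x *
       (\<tau> - p)))) \<partial>lborel)"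
    unfolding mult.assoc e by (simp only: mult_scaleR_right)
  also have "\<dots> = (complex_of_real (sgn t) * exp (\<i> * complex_of_real (t * p))) * (\<integral>x. indicator (Jt t) x *\<^sub>R exp (\<i>
    * complex_of_real (x * (\<tau> - p))) \<partial>lborel)"
    by (rule integral_mult_right_zero)
  also have "\<dots> = duh_kernel t \<tau> p"
  proof (cases "\<tau> = p")
    case True
    have "(\<integral>x. indicator (Jt t) x *\<^sub>R exp (\<i> * complex_of_real (x * (\<tau> - p))) \<partial>lborel) = complex_of_real (max 0 t - min 0 t)"
      using True by (subst exp_ii_FTC) auto
    then show ?thesis using True by (auto simp: duh_kernel_def sgn_if)
  next
    case False
    have alg: "I = s * ((B - 1) / c) \<Longrightarrow> s * A * I = s * s * ((A * B - A) / c)" for I s A B c :: complex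
      by (simp add: right_diff_distrib mult_ac)
    have e2: "exp (\<i> * complex_of_real (t * p)) * exp (\<i> * complex_of_real (t * (\<tau> - p))) = exp (\<i> * complex_of_real (t * \<tau>))"
      unfolding exp_add[symmetric] distrib_left[symmetric] of_real_add[symmetric] by (simp add: algebra_simps)
    have "(\<integral>x. indicator (Jt t) x *\<^sub>R exp (\<i> * complex_of_real (x * (\<tau> - p))) \<partial>lborel)
      = (exp (\<i> * complex_of_real (max 0 t * (\<tau> - p))) - exp (\<i> * complex_of_real (min 0 t * (\<tau> - p)))) / (\<i> * complex_of_real
        (\<tau> - p))"
      using False by (subst exp_ii_FTC) auto
    also have "\<dots> = complex_of_real (sgn t) * ((exp (\<i> * complex_of_real (t * (\<tau> - p))) - 1) / (\<i> * complex_of_real (\<tau> - p)))"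
      by (cases "t = 0"; cases "0 < t") (auto simp: sgn_if max_def min_def minus_divide_left)
    finally have "complex_of_real (sgn t) * exp (\<i> * complex_of_real (t * p)) * (\<integral>x. indicator (Jt t) x *\<^sub>R exp (\<i> * complex_of_real
      (x * (\<tau> - p))) \<partial>lborel)
      = complex_of_real (sgn t * sgn t) * ((exp (\<i> * complex_of_real (t * p)) * exp (\<i> * complex_of_real (t * (\<tau> - p))) - exp
        (\<i> * complex_of_real (t * p))) / (\<i> * complex_of_real (\<tau> - p)))"
      unfolding of_real_mult by (rule alg)
    also have "\<dots> = duh_kernel t \<tau> p"
      unfolding e2 using False by (cases "t = 0") (auto simp: duh_kernel_def sgn_if)
    finally show ?thesis .
  qed
  finally show ?thesis by simp
qed

text \<open>Sum of two bounds: \<open>\<bar>t\<bar>\<close> from the integral representation, and 2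
  for the product with the frequency difference, from the closed form.\<close>

lemma duh_kernel_bound: "cmod (duh_kernel t \<tau> p) \<le> (\<bar>t\<bar> + 2) / (1 + \<bar>\<tau> - p\<bar>)"
proof -
  have 1: "cmod (duh_kernel t \<tau> p) \<le> \<bar>t\<bar>"
  proof -
    have "cmod (duh_kernel t \<tau> p) \<le> (\<integral>x. cmod (indicator (Jt t) x *\<^sub>R (complex_of_real (sgn t) * exp (\<i> * complex_of_real ((t - x)
      * p)) * exp (\<i> * complex_of_real (x * \<tau>)))) \<partial>lborel)"
      unfolding duh_kernel_rep by (rule integral_norm_bound)
    also have "\<dots> = (\<integral>x. \<bar>sgn t\<bar> * indicator (Jt t) x \<partial>lborel)"
      by (rule Bochner_Integration.integral_cong[OF refl]) (simp add: norm_mult)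
    also have "\<dots> = \<bar>sgn t\<bar> * (max 0 t - min 0 t)" by (subst integral_mult_right_zero) simp
    also have "\<dots> = \<bar>t\<bar>" by (auto simp: sgn_if)
    finally show ?thesis .
  qed
  have 2: "\<bar>\<tau> - p\<bar> * cmod (duh_kernel t \<tau> p) \<le> 2"
  proof (cases "\<tau> = p")
    case False
    have "cmod (exp (\<i> * complex_of_real (t * \<tau>)) - exp (\<i> * complex_of_real (t * p))) \<le> 1 + 1"
      by (rule order_trans[OF norm_triangle_ineq4]) simp
    then show ?thesis using False by (simp add: duh_kernel_def norm_divide norm_mult of_real_diff[symmetric] del: of_real_diff)
  qed simp
  from 1 2 have "(1 + \<bar>\<tau> - p\<bar>) * cmod (duh_kernel t \<tau> p) \<le> \<bar>t\<bar> + 2" by (simp add: distrib_right)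
  then show ?thesis by (simp add: pos_le_divide_eq mult.commute add_pos_nonneg)
qed

lemma integrable_pair_bound:
  fixes F :: "'a::euclidean_space \<Rightarrow> 'b::euclidean_space \<Rightarrow> complex" and f :: "'a \<Rightarrow> complex" and g :: "'b \<Rightarrow> real"
  assumes f: "integrable lborel f" and g: "integrable lborel g" and m: "case_prod F \<in> borel_measurable (borel \<Otimes>\<^sub>M borel)"
    and b: "\<And>x y. cmod (F x y) \<le> cmod (f x) * g y"
  shows "integrable (lborel \<Otimes>\<^sub>M lborel) (case_prod F)"
proof (rule integrableI_bounded)
  have [measurable]: "f \<in> borel_measurable borel" "g \<in> borel_measurable borel" using f g by auto
  have [measurable]: "case_prod F \<in> borel_measurable (lborel \<Otimes>\<^sub>M lborel)" using m by simp
  show "case_prod F \<in> borel_measurable (lborel \<Otimes>\<^sub>M lborel)" by measurable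
  have "(\<integral>\<^sup>+x. ennreal (norm (case_prod F x)) \<partial>(lborel \<Otimes>\<^sub>M lborel)) = (\<integral>\<^sup>+x. \<integral>\<^sup>+y. ennreal (cmod (F x y)) \<partial>lborel \<partial>lborel)"
    by (subst lborel.nn_integral_fst[symmetric]) auto
  also have "\<dots> \<le> (\<integral>\<^sup>+x. \<integral>\<^sup>+y. ennreal (cmod (f x)) * ennreal (norm (g y)) \<partial>lborel \<partial>lborel)"
  proof (intro nn_integral_mono)
    fix x y
    have "cmod (F x y) \<le> cmod (f x) * norm (g y)" using b[of x y] by (intro order_trans[OF b] mult_left_mono) auto
    then show "ennreal (cmod (F x y)) \<le> ennreal (cmod (f x)) * ennreal (norm (g y))"
      by (simp add: ennreal_mult[symmetric] ennreal_leI)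
  qed
  also have "\<dots> = (\<integral>\<^sup>+x. ennreal (cmod (f x)) \<partial>lborel) * (\<integral>\<^sup>+y. ennreal (norm (g y)) \<partial>lborel)"
    by (simp add: nn_integral_cmult nn_integral_multc)
  also have "\<dots> < \<infinity>" using f g by (simp add: integrable_iff_bounded ennreal_mult_less_top)
  finally show "(\<integral>\<^sup>+x. ennreal (norm (case_prod F x)) \<partial>(lborel \<Otimes>\<^sub>M lborel)) < \<infinity>" .
qed

text \<open>The Duhamel kernel is a superposition of the exponentials \<open>exp (\<i> x \<tau>)\<close> with \<open>x\<close> between \<open>0\<close> and \<open>t\<close>,
  so it only sees the product of the inverse transforms of \<open>f\<close> and \<open>g\<close> there.\<close>

lemma duh_conv_zero:
  fixes f g :: "real \<Rightarrow> complex"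
  assumes f: "integrable lborel f" and g: "integrable lborel g"
    and z: "AE x in lborel. \<bar>x\<bar> \<le> h \<longrightarrow> (\<integral>\<tau>. exp (\<i> * complex_of_real (x * \<tau>)) * g \<tau> \<partial>lborel) = 0"
    and t: "\<bar>t\<bar> \<le> h"
  shows "(\<integral>\<tau>1. (\<integral>\<tau>. f (\<tau> - \<tau>1) * g \<tau>1 * duh_kernel t \<tau> p \<partial>lborel) \<partial>lborel) = 0"
proof -
  have [measurable]: "f \<in> borel_measurable borel" "g \<in> borel_measurable borel" using f g by auto
  note [measurable] = duh_kernel_measurable
  define e where "e x = complex_of_real (sgn t) * exp (\<i> * complex_of_real ((t - x) * p))" for x
  have e1: "cmod (e x) \<le> 1" for x by (simp add: e_def norm_mult sgn_if)
  have [measurable]: "e \<in> borel_measurable borel" unfolding e_def by measurable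
  define I :: "real \<Rightarrow> real" where "I x = indicator (Jt t) x" for x
  have I_int: "integrable lborel I" unfolding I_def by (rule integrable_real_indicator) auto
  have [measurable]: "I \<in> borel_measurable borel" unfolding I_def by measurable
  define fh where "fh x = (\<integral>\<tau>. exp (\<i> * complex_of_real (x * \<tau>)) * f \<tau> \<partial>lborel)" for x
  have [measurable]: "fh \<in> borel_measurable borel" unfolding fh_def by measurable
  define F where "F = (\<integral>\<tau>. cmod (f \<tau>) \<partial>lborel)"
  have fh: "cmod (fh x) \<le> F" for x
  proof -
    have "cmod (fh x) \<le> (\<integral>\<tau>. cmod (exp (\<i> * complex_of_real (x * \<tau>)) * f \<tau>) \<partial>lborel)" unfolding fh_def by (rule integral_norm_bound)
    then show ?thesis by (simp add: F_def norm_mult)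
  qed
  let ?E = "\<lambda>x \<tau>. exp (\<i> * complex_of_real (x * \<tau>))"
  have inner: "(\<integral>\<tau>. f (\<tau> - \<tau>1) * g \<tau>1 * duh_kernel t \<tau> p \<partial>lborel) = (\<integral>x. g \<tau>1 * (I x *\<^sub>R (e x * ?E x \<tau>1 * fh x)) \<partial>lborel)" for \<tau>1
  proof -
    have "(\<integral>\<tau>. f (\<tau> - \<tau>1) * g \<tau>1 * duh_kernel t \<tau> p \<partial>lborel) = (\<integral>\<tau>. f \<tau> * g \<tau>1 * duh_kernel t (\<tau>1 + \<tau>) p \<partial>lborel)"
      using lborel_integral_real_affine[of 1 "\<lambda>\<tau>. f (\<tau> - \<tau>1) * g \<tau>1 * duh_kernel t \<tau> p" \<tau>1] by simp
    also have "\<dots> = (\<integral>\<tau>. (\<integral>x. g \<tau>1 * (I x *\<^sub>R (e x * ?E x \<tau>1 * (?E x \<tau> * f \<tau>))) \<partial>lborel) \<partial>lborel)"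
    proof (rule Bochner_Integration.integral_cong[OF refl])
      fix \<tau>
      have "f \<tau> * g \<tau>1 * duh_kernel t (\<tau>1 + \<tau>) p = (\<integral>x. (f \<tau> * g \<tau>1) * (I x *\<^sub>R (e x * ?E x (\<tau>1 + \<tau>))) \<partial>lborel)"
        unfolding duh_kernel_rep e_def I_def by (rule integral_mult_right_zero[symmetric])
      also have "\<dots> = (\<integral>x. g \<tau>1 * (I x *\<^sub>R (e x * ?E x \<tau>1 * (?E x \<tau> * f \<tau>))) \<partial>lborel)"
      proof (rule Bochner_Integration.integral_cong[OF refl])
        fix x
        have "?E x (\<tau>1 + \<tau>) = ?E x \<tau>1 * ?E x \<tau>" by (simp add: exp_add[symmetric] distrib_left)
        then show "(f \<tau> * g \<tau>1) * (I x *\<^sub>R (e x * ?E x (\<tau>1 + \<tau>))) = g \<tau>1 * (I x *\<^sub>R (e x * ?E x \<tau>1 * (?E x \<tau> * f \<tau>)))"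
          by (simp only: mult_scaleR_right mult_ac)
      qed
      finally show "f \<tau> * g \<tau>1 * duh_kernel t (\<tau>1 + \<tau>) p = (\<integral>x. g \<tau>1 * (I x *\<^sub>R (e x * ?E x \<tau>1 * (?E x \<tau> * f \<tau>))) \<partial>lborel)" .
    qed
    also have "\<dots> = (\<integral>x. (\<integral>\<tau>. g \<tau>1 * (I x *\<^sub>R (e x * ?E x \<tau>1 * (?E x \<tau> * f \<tau>))) \<partial>lborel) \<partial>lborel)"
    proof (rule lborel_pair.Fubini_integral[symmetric])
      show "integrable (lborel \<Otimes>\<^sub>M lborel) (\<lambda>(\<tau>, x). g \<tau>1 * (I x *\<^sub>R (e x * ?E x \<tau>1 * (?E x \<tau> * f \<tau>))))"
      proof (rule integrable_pair_bound[OF f, of "\<lambda>x. cmod (g \<tau>1) * I x"])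
        show "integrable lborel (\<lambda>x. cmod (g \<tau>1) * I x)" using I_int by simp
        fix \<tau> x
        have "cmod (g \<tau>1 * (I x *\<^sub>R (e x * ?E x \<tau>1 * (?E x \<tau> * f \<tau>)))) = cmod (g \<tau>1) * I x * cmod (e x) * cmod (f \<tau>)"
          by (simp add: norm_mult I_def)
        also have "\<dots> \<le> cmod (g \<tau>1) * I x * 1 * cmod (f \<tau>)"
          by (intro mult_right_mono mult_left_mono e1) (auto simp: I_def)
        finally show "cmod (g \<tau>1 * (I x *\<^sub>R (e x * ?E x \<tau>1 * (?E x \<tau> * f \<tau>)))) \<le> cmod (f \<tau>) * (cmod (g \<tau>1) * I x)"
          by (simp add: mult_ac)
      qed measurable
    qed
    also have "\<dots> = (\<integral>x. g \<tau>1 * (I x *\<^sub>R (e x * ?E x \<tau>1 * fh x)) \<partial>lborel)"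
      unfolding fh_def by (simp only: integral_mult_right_zero integral_scaleR_right)
    finally show ?thesis .
  qed
  have "(\<integral>\<tau>1. (\<integral>\<tau>. f (\<tau> - \<tau>1) * g \<tau>1 * duh_kernel t \<tau> p \<partial>lborel) \<partial>lborel) = (\<integral>\<tau>1. (\<integral>x. g \<tau>1 * (I x *\<^sub>R (e x * ?E x \<tau>1
    * fh x)) \<partial>lborel) \<partial>lborel)"
    unfolding inner ..
  also have "\<dots> = (\<integral>x. (\<integral>\<tau>1. g \<tau>1 * (I x *\<^sub>R (e x * ?E x \<tau>1 * fh x)) \<partial>lborel) \<partial>lborel)"
  proof (rule lborel_pair.Fubini_integral[symmetric])
    show "integrable (lborel \<Otimes>\<^sub>M lborel) (\<lambda>(\<tau>1, x). g \<tau>1 * (I x *\<^sub>R (e x * ?E x \<tau>1 * fh x)))"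
    proof (rule integrable_pair_bound[OF g, of "\<lambda>x. F * I x"])
      show "integrable lborel (\<lambda>x. F * I x)" using I_int by simp
      fix \<tau>1 x
      have "cmod (g \<tau>1 * (I x *\<^sub>R (e x * ?E x \<tau>1 * fh x))) = cmod (g \<tau>1) * (I x * (cmod (e x) * cmod (fh x)))"
        by (simp add: norm_mult I_def)
      also have "\<dots> \<le> cmod (g \<tau>1) * (I x * (1 * F))"
        by (intro mult_left_mono mult_mono e1 fh) (auto simp: I_def)
      finally show "cmod (g \<tau>1 * (I x *\<^sub>R (e x * ?E x \<tau>1 * fh x))) \<le> cmod (g \<tau>1) * (F * I x)"
        by (simp add: mult_ac)
    qed measurable
  qed
  \<comment> \<open>After both uses of Fubini the inverse transform of \<open>g\<close> at time
    \<open>x\<close> splits off. The indicator \<open>I\<close> confines \<open>x\<close> to the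
    interval between 0 and \<open>t\<close>, where that transform vanishes almost
    everywhere.\<close>
  also have "\<dots> = (\<integral>x. (I x *\<^sub>R (e x * fh x)) * (\<integral>\<tau>1. ?E x \<tau>1 * g \<tau>1 \<partial>lborel) \<partial>lborel)"
  proof (rule Bochner_Integration.integral_cong[OF refl])
    fix x
    have "(\<integral>\<tau>1. g \<tau>1 * (I x *\<^sub>R (e x * ?E x \<tau>1 * fh x)) \<partial>lborel) = (\<integral>\<tau>1. (I x *\<^sub>R (e x * fh x)) * (?E x \<tau>1 * g \<tau>1) \<partial>lborel)"
      by (rule Bochner_Integration.integral_cong[OF refl]) (simp only: mult_scaleR_right mult_scaleR_left mult_ac)
    then show "(\<integral>\<tau>1. g \<tau>1 * (I x *\<^sub>R (e x * ?E x \<tau>1 * fh x)) \<partial>lborel) = (I x *\<^sub>R (e x * fh x)) * (\<integral>\<tau>1. ?E x \<tau>1 * g \<tau>1 \<partial>lborel)"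
      by (simp only: integral_mult_right_zero)
  qed
  also have "\<dots> = 0"
  proof (rule integral_eq_zero_AE)
    show "AE x in lborel. (I x *\<^sub>R (e x * fh x)) * (\<integral>\<tau>1. ?E x \<tau>1 * g \<tau>1 \<partial>lborel) = 0"
      using z
    proof eventually_elim
      case (elim x)
      show ?case
      proof (cases "\<bar>x\<bar> \<le> h")
        case True then show ?thesis using elim by simp
      next
        case False
        then have "x \<notin> Jt t" using t by auto
        then show ?thesis by (simp add: I_def)
      qed
    qed
  qed
  finally show ?thesis .
qed

lemma N_symb_space: "N_symb (fst z, snd z, \<tau>) (fst y, snd y, \<tau>') = N_symb (fst z, snd z, 0) (fst y, snd y, 0)"
  by (simp add: N_symb_def Let_def)

context nv
begin

text \<open>Demanded at every time, with a null set of frequencies that may depend on the time, as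
  in \<open>solves_NV\<close>.\<close>

definition vanishes_on :: "real \<Rightarrow> (pt \<Rightarrow> complex) \<Rightarrow> bool"
  where "vanishes_on h W \<longleftrightarrow> (\<forall>t. \<bar>t\<bar> \<le> h \<longrightarrow> (AE z in lborel. time_rep W z t = 0))"

lemma time_rep_measurable:
  assumes [measurable]: "W \<in> borel_measurable borel" "u \<in> borel_measurable M" "v \<in> borel_measurable M"
  shows "(\<lambda>x. time_rep W (u x) (v x)) \<in> borel_measurable M"
  unfolding time_rep_def by measurable

text \<open>Exchanges the quantifiers over time and frequency, using joint measurability of
  \<open>time_rep\<close>; \<open>duh_conv_zero\<close> needs almost all times on one fixed
  fibre.\<close>

lemma vanishes_on_AE:
  assumes [measurable]: "W \<in> borel_measurable borel" and "vanishes_on h W"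
  shows "AE z in lborel. AE t in lborel. \<bar>t\<bar> \<le> h \<longrightarrow> time_rep W z t = 0"
proof -
  note [measurable] = time_rep_measurable
  have "AE t in lborel. AE z in lborel. \<bar>t\<bar> \<le> h \<longrightarrow> time_rep W z t = 0"
  proof (rule AE_I2)
    fix t show "AE z in lborel. \<bar>t\<bar> \<le> h \<longrightarrow> time_rep W z t = 0"
      using assms(2) by (cases "\<bar>t\<bar> \<le> h") (simp_all add: vanishes_on_def)
  qed
  moreover have "{x \<in> space (lborel \<Otimes>\<^sub>M lborel). \<bar>snd x\<bar> \<le> h \<longrightarrow> time_rep W (fst x) (snd x) = 0} \<in> sets (lborel \<Otimes>\<^sub>M lborel)"
    by measurable
  ultimately show ?thesis by (simp only: lborel_pair.AE_commute)
qed

text \<open>The symbol sees spatial frequencies only (\<open>N_symb_space\<close>), so for fixed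
  \<open>z\<close> and \<open>y\<close> the time frequencies form a one-dimensional convolution and
  \<open>duh_conv_zero\<close> applies. Absolute convergence from \<open>AE_Aw_Babs\<close> permits
  the reordering of the integrals.\<close>

lemma locality:
  assumes U: "U \<in> XX" and W: "W \<in> XX" and h: "vanishes_on h W" and t: "\<bar>t\<bar> \<le> h"
  shows "AE z in lborel. Duh (Bil U W) z t = 0"
proof -
  note [measurable] = duh_kernel_measurable N_symb_comp
  have [measurable]: "U \<in> borel_measurable borel" "W \<in> borel_measurable borel" using U W by (auto simp: Xsb_meas)
  show ?thesis
    using AE_Aw_Babs[OF U W]
  proof eventually_elim
    case (elim z)
    let ?p = "phi z"
    let ?a = "\<lambda>\<tau> \<zeta>1. N_symb (fst z, snd z, \<tau>) \<zeta>1 * U ((fst z, snd z, \<tau>) - \<zeta>1) * W \<zeta>1 * duh_kernel t \<tau> ?p"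
    have I: "integrable (lborel \<Otimes>\<^sub>M lborel) (\<lambda>(\<tau>, \<zeta>1). ?a \<tau> \<zeta>1)"
    proof (rule integrableI_bounded)
      show "(\<lambda>(\<tau>, \<zeta>1). ?a \<tau> \<zeta>1) \<in> borel_measurable (lborel \<Otimes>\<^sub>M lborel)" by measurable
      have "(\<integral>\<^sup>+x. ennreal (norm (case x of (\<tau>, \<zeta>1) \<Rightarrow> ?a \<tau> \<zeta>1)) \<partial>(lborel \<Otimes>\<^sub>M lborel))
        = (\<integral>\<^sup>+\<tau>. \<integral>\<^sup>+\<zeta>1. ennreal (cmod (?a \<tau> \<zeta>1)) \<partial>lborel \<partial>lborel)"
        by (subst lborel.nn_integral_fst[symmetric]) auto
      also have "\<dots> = (\<integral>\<^sup>+\<tau>. Babs U W (fst z, snd z, \<tau>) * ennreal (cmod (duh_kernel t \<tau> ?p)) \<partial>lborel)"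
        unfolding Babs_def by (intro nn_integral_cong, subst nn_integral_multc[symmetric])
          (auto simp: norm_mult ennreal_mult mult_ac)
      also have "\<dots> \<le> (\<integral>\<^sup>+\<tau>. ennreal (\<bar>t\<bar> + 2) * (Babs U W (fst z, snd z, \<tau>) * ennreal (1 / (1 + \<bar>\<tau> - ?p\<bar>))) \<partial>lborel)"
      proof (rule nn_integral_mono)
        fix \<tau>
        have "ennreal (cmod (duh_kernel t \<tau> ?p)) \<le> ennreal ((\<bar>t\<bar> + 2) * (1 / (1 + \<bar>\<tau> - ?p\<bar>)))"
          using duh_kernel_bound[of t \<tau> ?p] by (intro ennreal_leI) simp
        also have "\<dots> = ennreal (\<bar>t\<bar> + 2) * ennreal (1 / (1 + \<bar>\<tau> - ?p\<bar>))" by (rule ennreal_mult) auto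
        finally have "Babs U W (fst z, snd z, \<tau>) * ennreal (cmod (duh_kernel t \<tau> ?p)) \<le> Babs U W (fst z, snd z, \<tau>) * (ennreal (\<bar>t\<bar>
          + 2) * ennreal (1 / (1 + \<bar>\<tau> - ?p\<bar>)))"
          by (rule mult_left_mono) simp
        then show "Babs U W (fst z, snd z, \<tau>) * ennreal (cmod (duh_kernel t \<tau> ?p)) \<le> ennreal (\<bar>t\<bar> + 2) * (Babs U W (fst z, snd z, \<tau>)
          * ennreal (1 / (1 + \<bar>\<tau> - ?p\<bar>)))"
          by (simp only: mult_ac)
      qed
      also have "\<dots> = ennreal (\<bar>t\<bar> + 2) * Aw (Babs U W) z" unfolding Aw_def by (rule nn_integral_cmult) measurable
      also have "\<dots> < \<infinity>" using elim by (simp add: ennreal_mult_less_top)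
      finally show "(\<integral>\<^sup>+x. ennreal (norm (case x of (\<tau>, \<zeta>1) \<Rightarrow> ?a \<tau> \<zeta>1)) \<partial>(lborel \<Otimes>\<^sub>M lborel)) < \<infinity>" .
    qed
    have "(\<integral>\<tau>. (\<integral>\<zeta>1. ?a \<tau> \<zeta>1 \<partial>lborel) \<partial>lborel) = (\<integral>\<zeta>1. (\<integral>\<tau>. ?a \<tau> \<zeta>1 \<partial>lborel) \<partial>lborel)"
      by (rule lborel_pair.Fubini_integral[OF I, symmetric])
    also have "\<dots> = (\<integral>y. (\<integral>\<tau>1. (\<integral>\<tau>. ?a \<tau> (fst y, snd y, \<tau>1) \<partial>lborel) \<partial>lborel) \<partial>lborel)"
      by (rule integral_pt[OF lborel_pair.integrable_snd[OF I]])
    also have "\<dots> = 0"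
    proof (rule integral_eq_zero_AE)
      show "AE y in lborel. (\<integral>\<tau>1. (\<integral>\<tau>. ?a \<tau> (fst y, snd y, \<tau>1) \<partial>lborel) \<partial>lborel) = 0"
        using AE_lborel_reflect[OF AE_fiber_L1[OF U], of z] AE_fiber_L1[OF W] vanishes_on_AE[OF Xsb_meas[OF W] h]
      proof eventually_elim
        case (elim y)
        let ?f = "\<lambda>\<tau>. U (fst (z - y), snd (z - y), \<tau>)" and ?g = "\<lambda>\<tau>. W (fst y, snd y, \<tau>)"
        have z': "AE x in lborel. \<bar>x\<bar> \<le> h \<longrightarrow> (\<integral>\<tau>. exp (\<i> * complex_of_real (x * \<tau>)) * ?g \<tau> \<partial>lborel) = 0"
          using elim(3) by eventually_elim (simp add: time_rep_def)
        have "(\<integral>\<tau>1. (\<integral>\<tau>. ?a \<tau> (fst y, snd y, \<tau>1) \<partial>lborel) \<partial>lborel)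
          = (\<integral>\<tau>1. (\<integral>\<tau>. N_symb (fst z, snd z, 0) (fst y, snd y, 0) * (?f (\<tau> - \<tau>1) * ?g \<tau>1 * duh_kernel t \<tau> ?p) \<partial>lborel) \<partial>lborel)"
          by (subst N_symb_space) (simp add: mult.assoc)
        also have "\<dots> = N_symb (fst z, snd z, 0) (fst y, snd y, 0) * (\<integral>\<tau>1. (\<integral>\<tau>. ?f (\<tau> - \<tau>1) * ?g \<tau>1 * duh_kernel t \<tau> ?p \<partial>lborel)
          \<partial>lborel)"
          by (simp only: integral_mult_right_zero)
        also have "\<dots> = 0" using duh_conv_zero[OF elim(1,2) z' t] by simp
        finally show ?case .
      qed measurable
    qed
    finally have "(\<integral>\<tau>. (\<integral>\<zeta>1. ?a \<tau> \<zeta>1 \<partial>lborel) \<partial>lborel) = 0" .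
    moreover have "Duh (Bil U W) z t = (1 / (2 * pi)) * (1 / (2 * pi)^3) * (\<integral>\<tau>. (\<integral>\<zeta>1. ?a \<tau> \<zeta>1 \<partial>lborel) \<partial>lborel)"
      unfolding Duh_def Bil_def
      by (simp only: integral_mult_left_zero mult.assoc[of _ _ "duh_kernel t _ _", symmetric])
        (simp only: integral_mult_right_zero mult.assoc of_real_mult)
    ultimately show ?case by simp
  qed
qed

end

section \<open>Uniqueness\<close>

text \<open>On the frequency side, the integral from \<open>T\<close> to \<open>t + T\<close> is the
  one up to \<open>t + T\<close> minus the freely evolved one up to \<open>T\<close>.\<close>

lemma duh_kernel_shift:
  "exp (\<i> * complex_of_real (T * \<tau>)) * duh_kernel t \<tau> p
    = duh_kernel (t + T) \<tau> p - exp (\<i> * complex_of_real (t * p)) * duh_kernel T \<tau> p"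
proof -
  have e: "exp (\<i> * complex_of_real ((t + T) * x)) = exp (\<i> * complex_of_real (t * x)) * exp (\<i> * complex_of_real (T * x))" for x
    by (simp add: exp_add[symmetric] algebra_simps)
  show ?thesis
  proof (cases "\<tau> = p")
    case True then show ?thesis unfolding duh_kernel_def e by (simp add: algebra_simps)
  next
    case False
    have alg: "A * ((B - b) / c) = (B * A - b * a) / c - b * ((A - a) / c)" for A B a b c :: complex
      by (simp add: diff_divide_distrib[symmetric] algebra_simps)
    show ?thesis using False unfolding duh_kernel_def e by (simp only: if_False alg)
  qed
qed

lemma duh_kernel_0: "duh_kernel 0 \<tau> p = 0"
  by (simp add: duh_kernel_def)

definition time_shift :: "real \<Rightarrow> (pt \<Rightarrow> complex) \<Rightarrow> pt \<Rightarrow> complex"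
  where "time_shift T U \<zeta> = exp (\<i> * complex_of_real (T * snd (snd \<zeta>))) * U \<zeta>"

lemma time_shift_measurable: "U \<in> borel_measurable borel \<Longrightarrow> time_shift T U \<in> borel_measurable borel"
  unfolding time_shift_def by measurable

lemma time_shift_Xsb: "U \<in> Xsb s b \<Longrightarrow> time_shift T U \<in> Xsb s b"
  using time_shift_measurable[of U T] by (simp add: Xsb_def Xsb_norm2_def time_shift_def norm_mult)

lemma Xsb_norm2_time_shift: "Xsb_norm2 s b (time_shift T U) = Xsb_norm2 s b U"
  by (simp add: Xsb_norm2_def time_shift_def norm_mult)

lemma time_rep_time_shift: "time_rep (time_shift T U) z t = time_rep U z (t + T)"
proof -
  have e: "exp (\<i> * complex_of_real (t * \<tau>)) * (exp (\<i> * complex_of_real (T * \<tau>)) * x) = exp (\<i> * complex_of_real ((t + T) * \<tau>))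
    * x" for \<tau> x
    by (simp add: exp_add algebra_simps)
  show ?thesis by (simp only: time_rep_def time_shift_def snd_conv e)
qed

text \<open>Time frequencies add under convolution, so the exponential factors of the two inputs
  multiply to that of the output.\<close>

lemma NL_time_shift: "NL (time_shift T U) = time_shift T (NL U)"
proof
  fix \<zeta>
  have e: "N_symb \<zeta> \<zeta>1 * time_shift T U (\<zeta> - \<zeta>1) * time_shift T U \<zeta>1
    = exp (\<i> * complex_of_real (T * snd (snd \<zeta>))) * (N_symb \<zeta> \<zeta>1 * U (\<zeta> - \<zeta>1) * U \<zeta>1)" for \<zeta>1
  proof -
    have "exp (\<i> * complex_of_real (T * snd (snd (\<zeta> - \<zeta>1)))) * exp (\<i> * complex_of_real (T * snd (snd \<zeta>1)))
      = exp (\<i> * complex_of_real (T * snd (snd \<zeta>)))"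
      by (simp add: exp_add[symmetric] algebra_simps)
    moreover have "a * (e * u) * (f * v) = (e * f) * (a * u * v)" for a e f u v :: complex by (simp add: mult_ac)
    ultimately show ?thesis unfolding time_shift_def by metis
  qed
  have alg: "a * (b * c) = b * (a * c)" for a b c :: complex by (simp add: mult_ac)
  show "NL (time_shift T U) \<zeta> = time_shift T (NL U) \<zeta>"
    unfolding NL_def e integral_mult_right_zero alg[of "complex_of_real _"] by (simp add: time_shift_def)
qed

context nv
begin

lemma Duh_integrable:
  assumes [measurable]: "F \<in> borel_measurable borel" and fin: "Aw (\<lambda>\<zeta>. ennreal (cmod (F \<zeta>))) z < \<infinity>"
  shows "integrable lborel (\<lambda>\<tau>. F (fst z, snd z, \<tau>) * duh_kernel t \<tau> (phi z))"
proof (rule integrableI_bounded)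
  note [measurable] = duh_kernel_measurable
  show "(\<lambda>\<tau>. F (fst z, snd z, \<tau>) * duh_kernel t \<tau> (phi z)) \<in> borel_measurable lborel" by measurable
  have "(\<integral>\<^sup>+\<tau>. ennreal (norm (F (fst z, snd z, \<tau>) * duh_kernel t \<tau> (phi z))) \<partial>lborel)
    \<le> (\<integral>\<^sup>+\<tau>. ennreal (\<bar>t\<bar> + 2) * (ennreal (cmod (F (fst z, snd z, \<tau>))) * ennreal (1 / (1 + \<bar>\<tau> - phi z\<bar>))) \<partial>lborel)"
  proof (rule nn_integral_mono)
    fix \<tau>
    have "cmod (F (fst z, snd z, \<tau>)) * cmod (duh_kernel t \<tau> (phi z)) \<le> cmod (F (fst z, snd z, \<tau>)) * ((\<bar>t\<bar> + 2) / (1 + \<bar>\<tau> - phi z\<bar>))"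
      by (intro mult_left_mono duh_kernel_bound) auto
    then have "ennreal (norm (F (fst z, snd z, \<tau>) * duh_kernel t \<tau> (phi z))) \<le> ennreal ((\<bar>t\<bar> + 2) * (cmod (F (fst z, snd z, \<tau>))
      * (1 / (1 + \<bar>\<tau> - phi z\<bar>))))"
      by (intro ennreal_leI) (simp add: norm_mult mult_ac)
    then show "ennreal (norm (F (fst z, snd z, \<tau>) * duh_kernel t \<tau> (phi z))) \<le> ennreal (\<bar>t\<bar> + 2) * (ennreal (cmod (F (fst z, snd z,
      \<tau>))) * ennreal (1 / (1 + \<bar>\<tau> - phi z\<bar>)))"
      by (subst ennreal_mult[symmetric], simp, simp, subst ennreal_mult[symmetric], auto)
  qed
  also have "\<dots> = ennreal (\<bar>t\<bar> + 2) * Aw (\<lambda>\<zeta>. ennreal (cmod (F \<zeta>))) z" unfolding Aw_def by (rule nn_integral_cmult) measurable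
  also have "\<dots> < \<infinity>" using fin by (simp add: ennreal_mult_less_top)
  finally show "(\<integral>\<^sup>+\<tau>. ennreal (norm (F (fst z, snd z, \<tau>) * duh_kernel t \<tau> (phi z))) \<partial>lborel) < \<infinity>" .
qed

lemma AE_Duh_add:
  assumes F: "F \<in> borel_measurable borel" "X' F < top" and G: "G \<in> borel_measurable borel" "X' G < top"
  shows "AE z in lborel. \<forall>t. Duh (\<lambda>\<zeta>. F \<zeta> + G \<zeta>) z t = Duh F z t + Duh G z t"
  using AE_Aw_X'[OF F] AE_Aw_X'[OF G]
proof eventually_elim
  case (elim z)
  show ?case
    unfolding Duh_def distrib_right Bochner_Integration.integral_add[OF Duh_integrable[OF F(1) elim(1)] Duh_integrable[OF G(1)
      elim(2)]]
    by (simp add: distrib_left)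
qed

lemma AE_Duh_diff:
  assumes F: "F \<in> borel_measurable borel" "X' F < top" and G: "G \<in> borel_measurable borel" "X' G < top"
  shows "AE z in lborel. \<forall>t. Duh (\<lambda>\<zeta>. F \<zeta> - G \<zeta>) z t = Duh F z t - Duh G z t"
  using AE_Aw_X'[OF F] AE_Aw_X'[OF G]
proof eventually_elim
  case (elim z)
  show ?case
    unfolding Duh_def left_diff_distrib Bochner_Integration.integral_diff[OF Duh_integrable[OF F(1) elim(1)] Duh_integrable[OF G(1)
      elim(2)]]
    by (simp add: right_diff_distrib)
qed

lemma AE_Duh_cong:
  assumes "AE \<zeta> in lborel. F \<zeta> = G \<zeta>" and [measurable]: "F \<in> borel_measurable borel" "G \<in> borel_measurable borel"
  shows "AE z in lborel. \<forall>t. Duh F z t = Duh G z t"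
  using AE_fiber[OF assms(1)]
proof eventually_elim
  case (elim z)
  note [measurable] = duh_kernel_measurable
  show ?case
  proof
    fix t
    have "(\<integral>\<tau>. F (fst z, snd z, \<tau>) * duh_kernel t \<tau> (phi z) \<partial>lborel) = (\<integral>\<tau>. G (fst z, snd z, \<tau>) * duh_kernel t \<tau> (phi z) \<partial>lborel)"
    proof (rule integral_cong_AE)
      show "AE \<tau> in lborel. F (fst z, snd z, \<tau>) * duh_kernel t \<tau> (phi z) = G (fst z, snd z, \<tau>) * duh_kernel t \<tau> (phi z)"
        using elim by eventually_elim simp
    qed measurable
    then show "Duh F z t = Duh G z t" by (simp add: Duh_def)
  qed
qed

lemma AE_Duh_time_shift:
  assumes F: "F \<in> borel_measurable borel" "X' F < top"
  shows "AE z in lborel. \<forall>t. Duh (time_shift T F) z t = Duh F z (t + T) - exp (\<i> * complex_of_real (t * phi z)) * Duh F z T"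
  using AE_Aw_X'[OF F]
proof eventually_elim
  case (elim z)
  note I = Duh_integrable[OF F(1) elim]
  show ?case
  proof
    fix t
    let ?e = "exp (\<i> * complex_of_real (t * phi z))"
    have alg: "f * (a - e * b) = f * a - e * (f * b)" for f a e b :: complex by (simp add: algebra_simps)
    have "(\<integral>\<tau>. time_shift T F (fst z, snd z, \<tau>) * duh_kernel t \<tau> (phi z) \<partial>lborel)
      = (\<integral>\<tau>. F (fst z, snd z, \<tau>) * duh_kernel (t + T) \<tau> (phi z) - ?e * (F (fst z, snd z, \<tau>) * duh_kernel T \<tau> (phi z)) \<partial>lborel)"
    proof (rule Bochner_Integration.integral_cong[OF refl])
      fix \<tau>
      have "time_shift T F (fst z, snd z, \<tau>) * duh_kernel t \<tau> (phi z) = F (fst z, snd z, \<tau>) * (exp (\<i> * complex_of_real (T * \<tau>))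
        * duh_kernel t \<tau> (phi z))"
        by (simp add: time_shift_def mult_ac)
      then show "time_shift T F (fst z, snd z, \<tau>) * duh_kernel t \<tau> (phi z) = F (fst z, snd z, \<tau>) * duh_kernel (t + T) \<tau> (phi z) - ?e
        * (F (fst z, snd z, \<tau>) * duh_kernel T \<tau> (phi z))"
        by (simp only: duh_kernel_shift alg)
    qed
    also have "\<dots> = (\<integral>\<tau>. F (fst z, snd z, \<tau>) * duh_kernel (t + T) \<tau> (phi z) \<partial>lborel) - ?e * (\<integral>\<tau>. F (fst z, snd z, \<tau>) * duh_kernel T \<tau>
      (phi z) \<partial>lborel)"
      by (subst Bochner_Integration.integral_diff[OF I integrable_mult_right[OF I]]) simp
    finally show "Duh (time_shift T F) z t = Duh F z (t + T) - ?e * Duh F z T"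
      by (simp only: Duh_def right_diff_distrib mult_ac)
  qed
qed

lemma vanishes_on_step:
  assumes U: "U \<in> XX" "N2 U \<le> ennreal a" and V: "V \<in> XX" "N2 V \<le> ennreal a" and a: "0 \<le> a"
    and h: "0 < h" "h \<le> 1" and sm: "16 * CB * KC * a * h powr (2 * \<epsilon>) \<le> 1"
    and eq: "\<And>t. \<bar>t\<bar> \<le> h \<Longrightarrow> AE z in lborel. time_rep U z t - time_rep V z t = Duh (NL U) z t - Duh (NL V) z t"
  shows "vanishes_on h (\<lambda>\<zeta>. U \<zeta> - V \<zeta>)"
proof -
  define D where "D = (\<lambda>\<zeta>. U \<zeta> - V \<zeta>)"
  have D: "D \<in> XX" unfolding D_def by (rule Xsb_diff[OF U(1) V(1)])
  \<comment> \<open>With \<open>U\<close> and \<open>V\<close> frozen this is linear in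
    \<open>W\<close>, and \<open>L D\<close> is the difference of the two nonlinear terms.\<close>
  define L where "L W = (\<lambda>\<zeta>. Bil U W \<zeta> + Bil W V \<zeta>)" for W
  have Bm: "Bil A B \<in> borel_measurable borel" if "A \<in> XX" "B \<in> XX" for A B using that by (intro Bil_measurable Xsb_meas)
  have Lm: "L W \<in> borel_measurable borel" if "W \<in> XX" for W unfolding L_def using that U V by (intro borel_measurable_add Bm)
  have LX: "X' (L W) < top" if W: "W \<in> XX" for W
    unfolding L_def using W U V X'_Bil_finite
    by (intro le_less_trans[OF X'_add]) (auto intro: Bm simp: ennreal_mult_less_top)
  define K where "K = KC * h powr (2 * \<epsilon>)"
  have K: "0 \<le> K" using KC_nonneg by (simp add: K_def)
  \<comment> \<open>The constant 16 in the condition on \<open>h\<close> leaves the factor 1/4 per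
    application. The size \<open>a\<close> of the given extensions may be large; only
    \<open>h\<close> is adapted to it.\<close>
  have TN: "N2 (Dop h (L W)) \<le> ennreal (e / 4)" if W: "W \<in> XX" "N2 W \<le> ennreal e" "0 \<le> e" for W e
  proof -
    have "N2 (Dop h (L W)) \<le> ennreal K * (2 * X' (Bil U W) + 2 * X' (Bil W V))"
      unfolding L_def K_def using W U V by (intro N2_two_Dop h Bm)
    also have "\<dots> \<le> ennreal K * (2 * (ennreal CB * N2 U * N2 W) + 2 * (ennreal CB * N2 W * N2 V))"
      using W U V by (intro mult_left_mono add_mono X'_Bil) auto
    also have "\<dots> \<le> ennreal K * (ennreal 2 * (ennreal CB * ennreal a * ennreal e) + ennreal 2 * (ennreal CB * ennreal e
      * ennreal a))"
      using W U V by (intro mult_left_mono add_mono mult_mono) auto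
    also have "\<dots> = ennreal (K * (2 * (CB * a * e) + 2 * (CB * e * a)))"
      using K CB_nonneg a W by (simp only: ennreal_plus[symmetric] ennreal_mult[symmetric] add_nonneg_nonneg mult_nonneg_nonneg
        zero_le_numeral)
    also have "\<dots> \<le> ennreal (e / 4)"
    proof (rule ennreal_leI)
      have "(16 * CB * KC * a * h powr (2 * \<epsilon>)) * e \<le> 1 * e" using sm W by (intro mult_right_mono) auto
      then show "K * (2 * (CB * a * e) + 2 * (CB * e * a)) \<le> e / 4" by (simp add: K_def algebra_simps)
    qed
    finally show ?thesis .
  qed
  have TX: "Dop h (L W) \<in> XX" if "W \<in> XX" for W using that by (intro Dop_XX h Lm LX)
  \<comment> \<open>If \<open>D\<close> and \<open>W\<close> coincide up to time \<open>h\<close>,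
    locality makes the Duhamel terms of \<open>L D\<close> and \<open>L W\<close> coincide there.
    The former gives the values of \<open>D\<close> by the equation, the latter those of
    \<open>Dop h (L W)\<close>.\<close>
  have Ttz: "vanishes_on h (\<lambda>\<zeta>. D \<zeta> - Dop h (L W) \<zeta>)" if W: "W \<in> XX" and tz: "vanishes_on h (\<lambda>\<zeta>. D \<zeta> - W \<zeta>)" for W
    unfolding vanishes_on_def
  proof (intro allI impI)
    fix t :: real assume t: "\<bar>t\<bar> \<le> h"
    let ?E = "\<lambda>\<zeta>. D \<zeta> - W \<zeta>"
    have E: "?E \<in> XX" by (rule Xsb_diff[OF D W])
    have Em: "?E \<in> borel_measurable borel" "V \<in> borel_measurable borel" using E V by (auto intro: Xsb_meas)
    have l1: "AE z in lborel. Duh (Bil U ?E) z t = 0" by (rule locality[OF U(1) E tz t])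
    have l2: "AE z in lborel. Duh (Bil ?E V) z t = 0"
      unfolding Bil_commute[OF Em] by (rule locality[OF V(1) E tz t])
    have "AE \<zeta> in lborel. NL U \<zeta> - NL V \<zeta> = L D \<zeta>"
      using AE_NL_diff[OF U(1) V(1)] unfolding L_def D_def .
    then have c1: "AE z in lborel. \<forall>t. Duh (\<lambda>\<zeta>. NL U \<zeta> - NL V \<zeta>) z t = Duh (L D) z t"
      by (intro AE_Duh_cong Lm D borel_measurable_diff NL_meas U V)
    have "AE \<zeta> in lborel. L D \<zeta> - L W \<zeta> = Bil U ?E \<zeta> + Bil ?E V \<zeta>"
      using AE_Bil_diff_right[OF U(1) D W] AE_Bil_diff_left[OF D W V(1)]
      unfolding L_def by eventually_elim (simp add: algebra_simps)
    then have c2: "AE z in lborel. \<forall>t. Duh (\<lambda>\<zeta>. L D \<zeta> - L W \<zeta>) z t = Duh (\<lambda>\<zeta>. Bil U ?E \<zeta> + Bil ?E V \<zeta>) z t"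
      by (intro AE_Duh_cong Lm D W borel_measurable_diff borel_measurable_add Bm U V E)
    show "AE z in lborel. time_rep (\<lambda>\<zeta>. D \<zeta> - Dop h (L W) \<zeta>) z t = 0"
      using AE_time_rep_diff[OF D TX[OF W]] AE_time_rep_diff[OF U(1) V(1)] eq[OF t]
        AE_time_rep_Dop[OF h Lm[OF W] LX[OF W]] l1 l2 c1 c2
        AE_Duh_diff[OF NL_meas[OF U(1)] NL_X'_finite[OF U(1)] NL_meas[OF V(1)] NL_X'_finite[OF V(1)]]
        AE_Duh_diff[OF Lm[OF D] LX[OF D] Lm[OF W] LX[OF W]]
        AE_Duh_add[OF Bm[OF U(1) E] X'_Bil_finite[OF U(1) E] Bm[OF E V(1)] X'_Bil_finite[OF E V(1)]]
    proof eventually_elim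
      case (elim z)
      have 1: "time_rep D z t = Duh (L D) z t"
        using elim(2,3,7,9) unfolding D_def by simp
      have 2: "Duh (L D) z t - Duh (L W) z t = 0" using elim(5,6,8,10,11) by simp
      show ?case using elim(1,4) 1 2 t by simp
    qed
  qed
  obtain d where d: "N2 D = ennreal d" "0 \<le> d" using Xsb_fin[OF D] by (cases "N2 D") auto
  \<comment> \<open>Starting from \<open>D\<close> itself, coincidence with \<open>D\<close> is
    trivial at first and preserved by \<open>Ttz\<close>, while \<open>TN\<close> drives the norms
    to zero.\<close>
  define W where "W n = ((\<lambda>W. Dop h (L W)) ^^ n) D" for n
  have W: "W n \<in> XX \<and> vanishes_on h (\<lambda>\<zeta>. D \<zeta> - W n \<zeta>) \<and> N2 (W n) \<le> ennreal (d / 4 ^ n)" for n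
  proof (induction n)
    case 0 show ?case using D d by (simp add: W_def vanishes_on_def time_rep_def)
  next
    case (Suc n)
    have "N2 (Dop h (L (W n))) \<le> ennreal (d / 4 ^ n / 4)" using Suc d by (intro TN) auto
    then show ?case using Suc TX Ttz by (simp add: W_def mult.commute)
  qed
  obtain C where C: "0 \<le> C" "\<And>U t. U \<in> XX \<Longrightarrow> (\<integral>\<^sup>+z. ennreal (jbr z powr (2 * s)) * (ennreal (cmod (time_rep U z t)))\<^sup>2 \<partial>lborel)
    \<le> ennreal C * N2 U"
    using time_rep_bound_aux by blast
  show ?thesis unfolding vanishes_on_def D_def[symmetric]
  proof (intro allI impI)
    fix t :: real assume t: "\<bar>t\<bar> \<le> h"
    have [measurable]: "D \<in> borel_measurable borel" using D by (rule Xsb_meas)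
    note [measurable] = time_rep_measurable
    have "(\<integral>\<^sup>+z. ennreal (jbr z powr (2 * s)) * (ennreal (cmod (time_rep D z t)))\<^sup>2 \<partial>lborel) \<le> ennreal (C * d / 4 ^ n)" for n
    proof -
      have tzn: "AE z in lborel. time_rep (\<lambda>\<zeta>. D \<zeta> - W n \<zeta>) z t = 0" using W[of n] t by (simp add: vanishes_on_def)
      have WX: "W n \<in> XX" using W by blast
      have "AE z in lborel. time_rep D z t = time_rep (W n) z t"
        using AE_time_rep_diff[OF D WX] tzn by eventually_elim auto
      then have "(\<integral>\<^sup>+z. ennreal (jbr z powr (2 * s)) * (ennreal (cmod (time_rep D z t)))\<^sup>2 \<partial>lborel)
        = (\<integral>\<^sup>+z. ennreal (jbr z powr (2 * s)) * (ennreal (cmod (time_rep (W n) z t)))\<^sup>2 \<partial>lborel)"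
        by (intro nn_integral_cong_AE) auto
      also have "\<dots> \<le> ennreal C * N2 (W n)" by (rule C(2)[OF WX])
      also have "\<dots> \<le> ennreal C * ennreal (d / 4 ^ n)" using W by (intro mult_left_mono) auto
      finally show ?thesis using C(1) d by (simp add: ennreal_mult[symmetric])
    qed
    then have "(\<integral>\<^sup>+z. ennreal (jbr z powr (2 * s)) * (ennreal (cmod (time_rep D z t)))\<^sup>2 \<partial>lborel) = 0" by (rule ennreal_eq_0I)
    then have "AE z in lborel. ennreal (jbr z powr (2 * s)) * (ennreal (cmod (time_rep D z t)))\<^sup>2 = 0"
      by (subst (asm) nn_integral_0_iff_AE) measurable
    then show "AE z in lborel. time_rep D z t = 0"
    proof eventually_elim
      case (elim z)
      then show ?case using jbr_pos[of z] by auto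
    qed
  qed
qed

text \<open>The witness solves the equation with \<open>A + 1\<close> in place of \<open>A\<close>,
  which avoids division by zero and keeps it below 1.\<close>

lemma small_time:
  assumes "0 \<le> A"
  shows "\<exists>h0. 0 < h0 \<and> h0 \<le> 1 \<and> (\<forall>h. 0 < h \<longrightarrow> h \<le> h0 \<longrightarrow> A * h powr (2 * \<epsilon>) \<le> 1)"
proof (intro exI[of _ "(1 / (A + 1)) powr (1 / (2 * \<epsilon>))"] conjI allI impI)
  let ?h = "(1 / (A + 1)) powr (1 / (2 * \<epsilon>))"
  show "0 < ?h" using assms by simp
  have "?h \<le> 1 powr (1 / (2 * \<epsilon>))" using assms eps by (intro powr_mono2) auto
  then show "?h \<le> 1" by simp
  fix h :: real assume h: "0 < h" "h \<le> ?h"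
  have "h powr (2 * \<epsilon>) \<le> ?h powr (2 * \<epsilon>)" using h eps by (intro powr_mono2) auto
  also have "\<dots> = 1 / (A + 1)" using eps assms by (simp add: powr_powr)
  finally have "A * h powr (2 * \<epsilon>) \<le> A * (1 / (A + 1))" using assms by (intro mult_left_mono)
  also have "\<dots> \<le> 1" using assms by (simp add: divide_le_eq)
  finally show "A * h powr (2 * \<epsilon>) \<le> 1" .
qed

text \<open>The step length depends only on the norms of the two extensions, which time shifts
  preserve. Finitely many steps of equal length therefore reach both ends of the interval.\<close>

lemma uniqueness:
  assumes U: "solves_NV s bb \<delta> u0 U" and V: "solves_NV s bb \<delta> u0 V" and \<delta>: "0 < \<delta>"
  shows "vanishes_on \<delta> (\<lambda>\<zeta>. U \<zeta> - V \<zeta>)"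
proof -
  have UX: "U \<in> XX" and VX: "V \<in> XX" using U V by (auto simp: solves_NV_def)
  define D where "D = (\<lambda>\<zeta>. U \<zeta> - V \<zeta>)"
  have solve: "AE z in lborel. time_rep U z t - time_rep V z t = Duh (NL U) z t - Duh (NL V) z t" if "\<bar>t\<bar> \<le> \<delta>" for t
  proof -
    have "t \<in> {- \<delta>..\<delta>}" using that by auto
    then have "AE z in lborel. time_rep U z t = exp (\<i> * complex_of_real (t * phi z)) * u0 z + duhamel U z t"
      "AE z in lborel. time_rep V z t = exp (\<i> * complex_of_real (t * phi z)) * u0 z + duhamel V z t"
      using U V by (auto simp: solves_NV_def)
    then show ?thesis by eventually_elim (simp add: duhamel_Duh)
  qed
  obtain u v where uv: "N2 U = ennreal u" "0 \<le> u" "N2 V = ennreal v" "0 \<le> v"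
    using Xsb_fin[OF UX] Xsb_fin[OF VX] by (cases "N2 U"; cases "N2 V") auto
  define a where "a = u + v"
  have a: "0 \<le> a" "N2 U \<le> ennreal a" "N2 V \<le> ennreal a" using uv by (auto simp: a_def intro: ennreal_leI)
  have "0 \<le> 16 * CB * KC * a" using a CB_nonneg KC_nonneg by simp
  from small_time[OF this] obtain h0 where h0: "0 < h0" "h0 \<le> 1" "\<And>h. 0 < h \<Longrightarrow> h \<le> h0 \<Longrightarrow> 16 * CB * KC * a * h powr (2 * \<epsilon>) \<le> 1"
    by blast
  obtain m :: nat where m: "\<delta> / h0 < real m" using reals_Archimedean2 by blast
  have m0: "0 < real m" using \<delta> h0 m by (metis divide_pos_pos less_trans)
  define h where "h = \<delta> / real m"
  have h: "0 < h" "h \<le> h0" using m m0 \<delta> h0 by (auto simp: h_def field_simps)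
  \<comment> \<open>Restart at time \<open>T\<close>: where \<open>D\<close> vanishes, the two
    Duhamel terms at \<open>T\<close> agree as well (\<open>e\<close>), so the shifted functions
    satisfy an equation that starts at \<open>T\<close>. The margin
    \<open>\<bar>T\<bar> + h \<le> \<delta>\<close> keeps all times inside the given
    interval.\<close>
  have step: "AE z in lborel. time_rep D z (t + T) = 0"
    if T: "AE z in lborel. time_rep D z T = 0" "\<bar>T\<bar> + h \<le> \<delta>" and t: "\<bar>t\<bar> \<le> h" for T t
  proof -
    have T': "\<bar>T\<bar> \<le> \<delta>" using T h by auto
    have e: "AE z in lborel. Duh (NL U) z T - Duh (NL V) z T = 0"
      using T(1) solve[OF T'] AE_time_rep_diff[OF UX VX] unfolding D_def by eventually_elim auto
    have "vanishes_on h (\<lambda>\<zeta>. time_shift T U \<zeta> - time_shift T V \<zeta>)"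
    proof (rule vanishes_on_step[OF _ _ _ _ a(1) h(1) _ h0(3)[OF h]])
      show "time_shift T U \<in> XX" "time_shift T V \<in> XX" by (rule time_shift_Xsb[OF UX] time_shift_Xsb[OF VX])+
      show "N2 (time_shift T U) \<le> ennreal a" "N2 (time_shift T V) \<le> ennreal a" using a by (simp_all add: Xsb_norm2_time_shift)
      show "h \<le> 1" using h h0 by simp
      fix t assume t: "\<bar>t\<bar> \<le> h"
      have "\<bar>t + T\<bar> \<le> \<delta>" using T(2) t by auto
      note s = solve[OF this]
      show "AE z in lborel. time_rep (time_shift T U) z t - time_rep (time_shift T V) z t
        = Duh (NL (time_shift T U)) z t - Duh (NL (time_shift T V)) z t"
        unfolding NL_time_shift
        using s e AE_Duh_time_shift[OF NL_meas[OF UX] NL_X'_finite[OF UX], of T] AE_Duh_time_shift[OF NL_meas[OF VX] NL_X'_finite[OF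
          VX], of T]
        by eventually_elim (simp add: time_rep_time_shift)
    qed
    then have "AE z in lborel. time_rep (time_shift T D) z t = 0"
      using t unfolding vanishes_on_def D_def time_shift_def by (simp add: right_diff_distrib)
    then show ?thesis by (simp add: time_rep_time_shift)
  qed
  have "vanishes_on (real n * h) D" if "n \<le> m" for n
    using that
  proof (induction n)
    case 0
    have "\<bar>0\<bar> \<le> \<delta>" using \<delta> by simp
    from solve[OF this] AE_time_rep_diff[OF UX VX]
    have "AE z in lborel. time_rep D z 0 = 0"
      unfolding D_def by eventually_elim (simp add: Duh_def duh_kernel_0)
    then show ?case by (simp add: vanishes_on_def)
  next
    case (Suc n)
    have "real (Suc n) * h \<le> real m * h" using Suc h by (intro mult_right_mono) auto
    also have "\<dots> = \<delta>" using m0 by (simp add: h_def)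
    finally have le: "real n * h + h \<le> \<delta>" by (simp add: algebra_simps)
    have nn: "0 \<le> real n * h" using h by simp
    have IH: "vanishes_on (real n * h) D" using Suc by simp
    show ?case unfolding vanishes_on_def
    proof (intro allI impI)
      fix t :: real assume t: "\<bar>t\<bar> \<le> real (Suc n) * h"
      then have t': "\<bar>t\<bar> \<le> real n * h + h" by (simp add: algebra_simps)
      consider "\<bar>t\<bar> \<le> real n * h" | "t > real n * h" | "t < - (real n * h)" by linarith
      then show "AE z in lborel. time_rep D z t = 0"
      proof cases
        case 1 then show ?thesis using IH by (simp add: vanishes_on_def)
      next
        case 2
        then show ?thesis using step[of "real n * h" "t - real n * h"] IH nn le t' by (simp add: vanishes_on_def)
      next
        case 3
        then show ?thesis using step[of "- (real n * h)" "t + real n * h"] IH nn le t' by (simp add: vanishes_on_def)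
      qed
    qed
  qed
  from this[OF order_refl] show ?thesis using m0 by (simp add: h_def D_def)
qed

end

section \<open>Restriction to a time strip\<close>

lemma Hs_norm2_diff_finite:
  assumes "u0 \<in> Hs s" "v0 \<in> Hs s"
  shows "Hs_norm2 s (\<lambda>z. u0 z - v0 z) < top"
proof -
  have alt: "Hs_norm2 s f = (\<integral>\<^sup>+z. ennreal (jbr z powr (2 * s)) * (ennreal (cmod (f z)))\<^sup>2 \<partial>lborel)" for f
    unfolding Hs_norm2_def by (intro nn_integral_cong) (simp add: ennreal_power ennreal_mult)
  have [measurable]: "u0 \<in> borel_measurable borel" "v0 \<in> borel_measurable borel" using assms by (auto simp: Hs_def)
  have "Hs_norm2 s (\<lambda>z. u0 z + - v0 z) \<le> 2 * Hs_norm2 s u0 + 2 * Hs_norm2 s (\<lambda>z. - v0 z)"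
    unfolding alt by (rule weighted_sq_add) measurable
  also have "\<dots> < top" using assms by (simp add: Hs_def Hs_norm2_def ennreal_mult_less_top)
  finally show ?thesis by simp
qed

context nv
begin

text \<open>A Parseval argument: inserting the definition of \<open>FT3\<close> and using Fubini on
  each spatial fibre produces the difference at time \<open>t\<close> multiplied by the test
  function, whose support keeps \<open>t\<close> in the strip.\<close>

lemma vanishes_on_agree:
  assumes D: "(\<lambda>\<zeta>. U \<zeta> - V \<zeta>) \<in> XX" and tz: "vanishes_on \<delta> (\<lambda>\<zeta>. U \<zeta> - V \<zeta>)"
  shows "agree_on_strip \<delta> U V"
  unfolding agree_on_strip_def
proof (intro allI impI)
  fix \<psi> assume "test_fun_strip \<delta> \<psi>"
  then obtain K where K: "smooth_fun \<psi>" "compact K" "K \<subseteq> {z. - \<delta> < snd (snd z) \<and> snd (snd z) < \<delta>}" "\<And>z. z \<notin> K \<Longrightarrow> \<psi> z = 0"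
    unfolding test_fun_strip_def by blast
  have "\<psi> \<in> Ck 0" using K(1) unfolding smooth_fun_def by blast
  then have cont: "continuous_on UNIV \<psi>" by simp
  have "integrable lborel (\<lambda>x. indicator K x *\<^sub>R \<psi> x)"
    by (rule borel_integrable_compact[OF K(2) continuous_on_subset[OF cont]]) simp
  moreover have "indicator K x *\<^sub>R \<psi> x = \<psi> x" for x using K(4)[of x] by (cases "x \<in> K") auto
  ultimately have psi: "integrable lborel \<psi>" by simp
  then have [measurable]: "\<psi> \<in> borel_measurable borel" by simp
  define D where "D = (\<lambda>\<zeta>. U \<zeta> - V \<zeta>)"
  have DX: "D \<in> XX" and Dtz: "vanishes_on \<delta> D" using assms by (auto simp: D_def)
  have Dm [measurable]: "D \<in> borel_measurable borel" by (rule Xsb_meas[OF DX])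
  show "(\<integral>\<zeta>. (U \<zeta> - V \<zeta>) * FT3 \<psi> (- \<zeta>) \<partial>lborel) = 0"
  proof (cases "integrable lborel (\<lambda>\<zeta>. D \<zeta> * FT3 \<psi> (- \<zeta>))")
    \<comment> \<open>If the pairing does not converge absolutely, the Bochner integral is 0 by
      default, which is what is claimed.\<close>
    case False
    then show ?thesis by (simp add: D_def not_integrable_integral_eq)
  next
    case True
    have "(\<integral>z. (\<integral>\<tau>. D (fst z, snd z, \<tau>) * FT3 \<psi> (- (fst z, snd z, \<tau>)) \<partial>lborel) \<partial>lborel) = 0"
    proof (rule integral_eq_zero_AE)
      show "AE z in lborel. (\<integral>\<tau>. D (fst z, snd z, \<tau>) * FT3 \<psi> (- (fst z, snd z, \<tau>)) \<partial>lborel) = 0"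
        using AE_fiber_L1[OF DX] vanishes_on_AE[OF Dm Dtz]
      proof eventually_elim
        case (elim z)
        let ?f = "\<lambda>\<tau>. D (fst z, snd z, \<tau>)"
        let ?E = "\<lambda>x::pt. exp (\<i> * complex_of_real (x \<bullet> (fst z, snd z, 0)))"
        let ?e = "\<lambda>(x::pt) \<tau>. exp (\<i> * complex_of_real (snd (snd x) * \<tau>))"
        let ?F = "\<lambda>\<tau> x. ?f \<tau> * (?e x \<tau> * (?E x * \<psi> x))"
        have I: "integrable (lborel \<Otimes>\<^sub>M lborel) (\<lambda>(\<tau>, x). ?F \<tau> x)"
        proof (rule integrable_pair_bound[OF elim(1), of "\<lambda>x. cmod (\<psi> x)"])
          show "integrable lborel (\<lambda>x. cmod (\<psi> x))" using psi by simp
          show "cmod (?F \<tau> x) \<le> cmod (?f \<tau>) * cmod (\<psi> x)" for \<tau> x by (simp add: norm_mult)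
        qed measurable
        have "(\<integral>\<tau>. ?f \<tau> * FT3 \<psi> (- (fst z, snd z, \<tau>)) \<partial>lborel) = (\<integral>\<tau>. (\<integral>x. ?F \<tau> x \<partial>lborel) \<partial>lborel)"
        proof (rule Bochner_Integration.integral_cong[OF refl])
          fix \<tau>
          have "exp (- \<i> * complex_of_real (x \<bullet> - (fst z, snd z, \<tau>))) * \<psi> x = ?e x \<tau> * (?E x * \<psi> x)" for x
          proof -
            have "exp (- \<i> * complex_of_real (x \<bullet> - (fst z, snd z, \<tau>))) = ?e x \<tau> * ?E x"
              by (cases x) (simp add: exp_add[symmetric] algebra_simps)
            then show ?thesis by (simp only: mult.assoc)
          qed
          then have "FT3 \<psi> (- (fst z, snd z, \<tau>)) = (\<integral>x. ?e x \<tau> * (?E x * \<psi> x) \<partial>lborel)" unfolding FT3_def by (simp only:)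
          then show "?f \<tau> * FT3 \<psi> (- (fst z, snd z, \<tau>)) = (\<integral>x. ?F \<tau> x \<partial>lborel)" by (simp only: integral_mult_right_zero)
        qed
        also have "\<dots> = (\<integral>x. (\<integral>\<tau>. ?F \<tau> x \<partial>lborel) \<partial>lborel)" by (rule lborel_pair.Fubini_integral[OF I, symmetric])
        also have "\<dots> = (\<integral>y. (\<integral>t. (\<integral>\<tau>. ?F \<tau> (fst y, snd y, t) \<partial>lborel) \<partial>lborel) \<partial>lborel)"
          by (rule integral_pt[OF lborel_pair.integrable_snd[OF I]])
        also have "\<dots> = 0"
        proof (rule integral_eq_zero_AE, rule AE_I2, rule integral_eq_zero_AE)
          fix y :: "real \<times> real"
          show "AE t in lborel. (\<integral>\<tau>. ?F \<tau> (fst y, snd y, t) \<partial>lborel) = 0"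
            using elim(2)
          proof eventually_elim
            case (elim t)
            let ?x = "(fst y, snd y, t)"
            have "(\<integral>\<tau>. ?F \<tau> ?x \<partial>lborel) = (\<integral>\<tau>. (?E ?x * \<psi> ?x) * (exp (\<i> * complex_of_real (t * \<tau>)) * ?f \<tau>) \<partial>lborel)"
              by (rule Bochner_Integration.integral_cong[OF refl]) (simp only: snd_conv mult_ac)
            also have "\<dots> = (?E ?x * \<psi> ?x) * (\<integral>\<tau>. exp (\<i> * complex_of_real (t * \<tau>)) * ?f \<tau> \<partial>lborel)"
              by (rule integral_mult_right_zero)
            also have "\<dots> = 0"
            proof (cases "?x \<in> K")
              case True
              then have "\<bar>t\<bar> \<le> \<delta>" using K(3) by auto
              then show ?thesis using elim by (simp add: time_rep_def)
            next
              case False then show ?thesis by (simp add: K(4))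
            qed
            finally show ?case .
          qed
        qed
        finally show ?case .
      qed
    qed
    then show ?thesis using integral_pt[OF True] by (simp add: D_def)
  qed
qed

lemma agree_solutions:
  assumes "solves_NV s bb \<delta> u0 U" "solves_NV s bb \<delta> u0 V" "0 < \<delta>"
  shows "agree_on_strip \<delta> U V"
  using assms by (intro vanishes_on_agree uniqueness Xsb_diff) (auto simp: solves_NV_def)

lemma Hs_norm2_le:
  assumes "u0 \<in> Hs s" "Hs_norm s u0 \<le> r"
  shows "Hs_norm2 s u0 \<le> ennreal (r\<^sup>2)"
proof -
  obtain q where q: "Hs_norm2 s u0 = ennreal q" "0 \<le> q" using assms(1) by (cases "Hs_norm2 s u0") (auto simp: Hs_def)
  have "sqrt q \<le> r" using assms(2) q by (simp add: Hs_norm_def)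
  then have "(sqrt q)\<^sup>2 \<le> r\<^sup>2" using q by (intro power_mono) auto
  then show ?thesis using q by (simp add: ennreal_leI)
qed

lemma lifespan: "\<exists>d. \<forall>r\<ge>0. small (d r) (4 * CS * r\<^sup>2 + 1)"
proof -
  have "\<exists>\<delta>. 0 \<le> r \<longrightarrow> small \<delta> (4 * CS * r\<^sup>2 + 1)" for r
  proof -
    let ?M = "4 * CS * r\<^sup>2 + 1"
    have "0 \<le> 128 * KC * CB * ?M" using KC_nonneg CB_nonneg CS_nonneg by simp
    from small_time[OF this] obtain h where "0 < h" "h \<le> 1" "128 * KC * CB * ?M * h powr (2 * \<epsilon>) \<le> 1" by blast
    then show ?thesis by (intro exI[of _ h]) (simp add: small_def mult_ac)
  qed
  then show ?thesis by metis
qed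

lemma Picard_solution:
  assumes "u0 \<in> Hs s" "Hs_norm s u0 \<le> r" "0 \<le> r" "small \<delta> (4 * CS * r\<^sup>2 + 1)"
  obtains U where "U \<in> XX" "N2 U \<le> ennreal (8 * (4 * CS * r\<^sup>2 + 1))" "is_fix \<delta> u0 U" "solves_NV s bb \<delta> u0 U"
proof -
  from Picard_existence[OF assms(1) Hs_norm2_le[OF assms(1,2)] _ refl assms(4)]
  obtain U where U: "U \<in> XX" "N2 U \<le> ennreal (8 * (4 * CS * r\<^sup>2 + 1))" "is_fix \<delta> u0 U" by auto
  then show thesis using assms by (intro that[OF U] fix_solves) (auto simp: small_def)
qed

text \<open>Arbitrary solutions carry no size bound, since only their restriction is determined.
  They are replaced by Picard solutions \<open>U'\<close> and \<open>V'\<close>, which agree with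
  them on the strip; the difference of the latter is a competitor in the infimum defining
  \<open>Xdelta_norm\<close>.\<close>

lemma solution_Lipschitz:
  assumes u0: "u0 \<in> Hs s" "Hs_norm s u0 \<le> r" and v0: "v0 \<in> Hs s" "Hs_norm s v0 \<le> r" and r: "0 \<le> r"
    and sm: "small \<delta> (4 * CS * r\<^sup>2 + 1)"
    and U: "solves_NV s bb \<delta> u0 U" and V: "solves_NV s bb \<delta> v0 V"
  shows "Xdelta_norm s bb \<delta> (\<lambda>z. U z - V z) \<le> sqrt (4 * CS) * Hs_norm s (\<lambda>z. u0 z - v0 z)"
proof -
  have \<delta>: "0 < \<delta>" using sm by (simp add: small_def)
  let ?M = "4 * CS * r\<^sup>2 + 1" and ?w = "\<lambda>z. u0 z - v0 z"
  obtain U' where U': "U' \<in> XX" "N2 U' \<le> ennreal (8 * ?M)" "is_fix \<delta> u0 U'" "solves_NV s bb \<delta> u0 U'"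
    by (rule Picard_solution[OF u0 r sm])
  obtain V' where V': "V' \<in> XX" "N2 V' \<le> ennreal (8 * ?M)" "is_fix \<delta> v0 V'" "solves_NV s bb \<delta> v0 V'"
    by (rule Picard_solution[OF v0 r sm])
  have UX: "U \<in> XX" and VX: "V \<in> XX" using U V by (auto simp: solves_NV_def)
  let ?W = "\<lambda>\<zeta>. U' \<zeta> - V' \<zeta>"
  have W: "?W \<in> XX" by (rule Xsb_diff[OF U'(1) V'(1)])
  have L: "N2 ?W \<le> ennreal (4 * CS) * Hs_norm2 s ?w"
    using CS_nonneg by (intro fix_Lipschitz[OF u0(1) v0(1) sm _ U'(1-3) V'(1-3)]) simp
  have fin: "Hs_norm2 s ?w < top" by (rule Hs_norm2_diff_finite[OF u0(1) v0(1)])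
  have "enn2real (N2 ?W) \<le> 4 * CS * enn2real (Hs_norm2 s ?w)"
  proof -
    have "enn2real (N2 ?W) \<le> enn2real (ennreal (4 * CS) * Hs_norm2 s ?w)"
      using L fin by (intro enn2real_mono) (auto simp: ennreal_mult_less_top)
    then show ?thesis using CS_nonneg by (simp add: enn2real_mult)
  qed
  then have N: "Xsb_norm s bb ?W \<le> sqrt (4 * CS) * Hs_norm s ?w"
    unfolding Xsb_norm_def Hs_norm_def real_sqrt_mult[symmetric] by (rule real_sqrt_le_mono)
  have agree: "agree_on_strip \<delta> ?W (\<lambda>z. U z - V z)"
  proof (rule vanishes_on_agree)
    have e: "(\<lambda>\<zeta>. ?W \<zeta> - (U \<zeta> - V \<zeta>)) = (\<lambda>\<zeta>. (U' \<zeta> - U \<zeta>) - (V' \<zeta> - V \<zeta>))" by (auto simp: algebra_simps)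
    have A: "(\<lambda>\<zeta>. U' \<zeta> - U \<zeta>) \<in> XX" and B: "(\<lambda>\<zeta>. V' \<zeta> - V \<zeta>) \<in> XX" using U' V' UX VX by (auto intro: Xsb_diff)
    show "(\<lambda>\<zeta>. ?W \<zeta> - (U \<zeta> - V \<zeta>)) \<in> XX" unfolding e by (rule Xsb_diff[OF A B])
    show "vanishes_on \<delta> (\<lambda>\<zeta>. ?W \<zeta> - (U \<zeta> - V \<zeta>))"
      unfolding e vanishes_on_def
    proof (intro allI impI)
      fix t assume "\<bar>t\<bar> \<le> \<delta>"
      then have "AE z in lborel. time_rep (\<lambda>\<zeta>. U' \<zeta> - U \<zeta>) z t = 0" "AE z in lborel. time_rep (\<lambda>\<zeta>. V' \<zeta> - V \<zeta>) z t = 0"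
        using uniqueness[OF U'(4) U \<delta>] uniqueness[OF V'(4) V \<delta>] by (auto simp: vanishes_on_def)
      then show "AE z in lborel. time_rep (\<lambda>\<zeta>. (U' \<zeta> - U \<zeta>) - (V' \<zeta> - V \<zeta>)) z t = 0"
        using AE_time_rep_diff[OF A B] by eventually_elim simp
    qed
  qed
  have "Xdelta_norm s bb \<delta> (\<lambda>z. U z - V z) \<le> Xsb_norm s bb ?W"
    unfolding Xdelta_norm_def
  proof (rule cInf_lower)
    show "Xsb_norm s bb ?W \<in> {Xsb_norm s bb W |W. W \<in> XX \<and> agree_on_strip \<delta> W (\<lambda>z. U z - V z)}"
      using W agree by blast
    show "bdd_below {Xsb_norm s bb W |W. W \<in> XX \<and> agree_on_strip \<delta> W (\<lambda>z. U z - V z)}"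
      by (rule bdd_belowI[of _ 0]) (auto simp: Xsb_norm_def)
  qed
  then show ?thesis using N by simp
qed

end

theorem theorem1:
  fixes s :: real
  assumes "s > - 3 / 4"
  shows "\<exists>b > 1 / 2. \<exists>\<delta> :: real \<Rightarrow> real. (\<forall>r \<ge> 0. \<delta> r > 0) \<and>
    (\<forall>u0 \<in> Hs s.
       (\<exists>U. solves_NV s b (\<delta> (Hs_norm s u0)) u0 U) \<and>
       (\<forall>U V. solves_NV s b (\<delta> (Hs_norm s u0)) u0 U \<longrightarrow>
              solves_NV s b (\<delta> (Hs_norm s u0)) u0 V \<longrightarrow>
              agree_on_strip (\<delta> (Hs_norm s u0)) U V)) \<and>
    (\<forall>R > 0.
       (\<forall>u0 \<in> Hs s. Hs_norm s u0 < R \<longrightarrow>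
          (\<exists>U. solves_NV s b (\<delta> R) u0 U) \<and>
          (\<forall>U V. solves_NV s b (\<delta> R) u0 U \<longrightarrow> solves_NV s b (\<delta> R) u0 V \<longrightarrow>
                 agree_on_strip (\<delta> R) U V)) \<and>
       (\<exists>L. \<forall>u0 v0 U V. u0 \<in> Hs s \<longrightarrow> v0 \<in> Hs s \<longrightarrow>
             Hs_norm s u0 < R \<longrightarrow> Hs_norm s v0 < R \<longrightarrow>
             solves_NV s b (\<delta> R) u0 U \<longrightarrow> solves_NV s b (\<delta> R) v0 V \<longrightarrow>
             Xdelta_norm s b (\<delta> R) (\<lambda>z. U z - V z) \<le> L * Hs_norm s (\<lambda>z. u0 z - v0 z)))"
proof -
  \<comment> \<open>The larger of \<open>- s\<close> and 5/8, so that
    \<open>- \<rho> \<le> s\<close> holds and \<open>\<rho>\<close> lies in the range of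
    \<open>nv_params\<close>.\<close>
  define \<rho> where "\<rho> = - min s (- 5 / 8)"
  define \<epsilon> where "\<epsilon> = (3 / 4 - \<rho>) / 10"
  interpret nv \<rho> \<epsilon> s
    by unfold_locales (use assms in \<open>auto simp: \<rho>_def \<epsilon>_def\<close>)
  \<comment> \<open>One function of the radius serves both as the lifespan at the exact norm of the
    data and as the uniform lifespan on the ball of radius \<open>R\<close>, because
    \<open>small\<close> involves the data only through \<open>r\<close>.\<close>
  obtain d where d: "\<And>r. 0 \<le> r \<Longrightarrow> small (d r) (4 * CS * r\<^sup>2 + 1)" using lifespan by blast
  have pos: "0 < d r" if "0 \<le> r" for r using d[OF that] by (simp add: small_def)
  have ex: "\<exists>U. solves_NV s bb (d r) u0 U" if "u0 \<in> Hs s" "Hs_norm s u0 \<le> r" "0 \<le> r" for u0 r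
    by (rule Picard_solution[OF that d[OF that(3)]]) blast
  have nonneg: "0 \<le> Hs_norm s u0" for u0 by (simp add: Hs_norm_def)
  show ?thesis
  proof (rule exI[of _ bb], rule conjI, goal_cases)
    case 2
    show ?case
    proof (rule exI[of _ d], intro conjI allI impI ballI)
      show "0 < d r" if "0 \<le> r" for r by (rule pos[OF that])
      show "\<exists>U. solves_NV s bb (d (Hs_norm s u0)) u0 U" if "u0 \<in> Hs s" for u0
        using ex[OF that order_refl nonneg] .
      show "agree_on_strip (d (Hs_norm s u0)) U V"
        if "solves_NV s bb (d (Hs_norm s u0)) u0 U" "solves_NV s bb (d (Hs_norm s u0)) u0 V" for u0 U V
        using agree_solutions[OF that pos[OF nonneg]] .
      fix R :: real assume R: "0 < R"
      show "\<exists>U. solves_NV s bb (d R) u0 U" if "u0 \<in> Hs s" "Hs_norm s u0 < R" for u0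
        using that R by (intro ex) auto
      show "agree_on_strip (d R) U V" if "solves_NV s bb (d R) u0 U" "solves_NV s bb (d R) u0 V" for u0 U V
        using R by (intro agree_solutions[OF that] pos) simp
      show "\<exists>L. \<forall>u0 v0 U V. u0 \<in> Hs s \<longrightarrow> v0 \<in> Hs s \<longrightarrow> Hs_norm s u0 < R \<longrightarrow> Hs_norm s v0 < R \<longrightarrow>
          solves_NV s bb (d R) u0 U \<longrightarrow> solves_NV s bb (d R) v0 V \<longrightarrow>
          Xdelta_norm s bb (d R) (\<lambda>z. U z - V z) \<le> L * Hs_norm s (\<lambda>z. u0 z - v0 z)"
        using R by (intro exI[of _ "sqrt (4 * CS)"] allI impI solution_Lipschitz[where r = R] d) auto
    qed
  qed (use eps in \<open>simp add: bb_def\<close>)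
qed

end
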